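(* Consider the sequence of $M_t/G/n/n$ loss systems with initial conditions described in the context. Then: (i) For any $T>0$, there exists a real-valued continuous deterministic process $\rho$ such that, almost surely, $$\lim_{n\to\infty}\sup_{t\in[0,T]}|\bar N^n_t-\rho_t|=0 .$$ (ii) Moreover, there exists a bounded function $w$ such that, almost surely, $$\mathbb 1_{\{\bar N^n_{t-}<1\}}\stackrel{*}{\rightharpoonup}w(t)\quad\text{in }L^\infty[0,T],$$ $\lambda$-almost surely in $t$, where $w$ solves $$w(t)\lambda(t)=\begin{cases}\lambda(t), & \rho_t<1,\\ \rho_0 f(t)+\int_0^t w(u)\lambda(u)g(t-u)\,du, & \rho_t=1,\end{cases}\qquad \mathbb 1_{\{\rho_t<1\}}\le w(t)\le 1\ \text{ a.e. in }[0,T].$$ (iii) Furthermore, $\rho$ and $w$ satisfy $$\rho_t=\rho_0\bar F(t)+\int_0^t w(u)\bar G(t-u)\lambda(u)\,du,\quad t\in[0,T],\qquad \mathbb 1_{\{\rho_{u-}<1\}}\le w(u)\le 1\ \text{ a.e. in }[0,T].$$ That is, $(\rho,w)$ is a solution (in the sense defined in the context) of the non-linear discontinuous Volterra integral equation $$\rho_t=\rho_0\bar F(t)+\int_0^t\mathbb 1_{\{\rho_{u-}<1\}}\bar G(t-u)\lambda(u)\,du .$$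
   Context: Model. For each $n\ge1$ consider an $M_t/G/n/n$ loss queue: customers arrive according to a nonhomogeneous Poisson process $A^n$ with intensity function $n\lambda(\cdot)$, where $\lambda$ is locally integrable; service times are sampled independently from a distribution $G$ with density $g$; there are $n$ servers and no waiting space, so a customer arriving when all $n$ servers are busy is lost. $N^n_t$ is the number of busy servers at time $t$ and $\bar N^n_t=N^n_t/n$. Write $\bar G=1-G$, $\bar F=1-F$. Initial conditions. The number $N_0^n$ of customers in the system at time $0$ satisfies $N_0^n/n\to\rho_0$ almost surely, with $\rho_0\in[0,1]$. The remaining service times of each of the initially occupied servers follow the distribution $F^n$, where $\lim_{n\to\infty}\sup_t|F^n(t)-F(t)|=0$ for some limiting distribution $F$. The symbol $f$ denotes the density of $F$. Weak-star convergence. $h_n\stackrel{*}{\rightharpoonup}h$ in $L^\infty[0,T]$ means $\int_0^T\phi h_n\to\int_0^T\phi h$ for every $\phi\in L^1[0,T]$. "$\lambda$-almost surely in $t$" means almost everywhere with respect to the measure $\lambda(t)\,dt$. Solution concept. For bounded $p$, let $\underline p(x)=\lim_{\epsilon\to0}\operatorname{ess\,inf}_{|y-x|<\epsilon}p(y)$ and $\bar p(x)=\lim_{\epsilon\to0}\operatorname{ess\,sup}_{|y-x|<\epsilon}p(y)$. A pair $(\rho,w)$ of bounded functions solves the Volterra equation $\rho_t=q(t)+\int_0^t p(\rho_{u-})\bar G(t-u)\lambda(u)du$ on $[0,T]$ if $\underline p(\rho_t)\le w(t)\le\bar p(\rho_t)$ for a.e. $t$ and $\rho_t=q(t)+\int_0^t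 w(u)\bar G(t-u)\lambda(u)du$ for all $t\in[0,T]$. For $p(x)=\mathbb 1_{\{x<1\}}$ and $\rho\le1$ the constraint reads $\mathbb 1_{\{\rho_t<1\}}\le w(t)\le1$ a.e. *)

theory Defs
  imports "HOL-Probability.Probability"
begin

definition left_lim :: "(real \<Rightarrow> real) \<Rightarrow> real \<Rightarrow> real" where
  "left_lim x t = Lim (at_left t) x"

definition locally_integrable :: "(real \<Rightarrow> real) \<Rightarrow> bool" where
  "locally_integrable h \<longleftrightarrow> (\<forall>T\<ge>0. set_integrable lborel {0..T} h)"

(* The Poisson weights are written out because the library's poisson_pmf is only specified for a
   strictly positive rate, while the mean of an increment may vanish here. Simplicity of the jumps
   is not required separately: it holds almost surely, as the mean measure has no atoms. *)
definition nonhom_poisson_process ::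
    "'a measure \<Rightarrow> (real \<Rightarrow> real) \<Rightarrow> (real \<Rightarrow> 'a \<Rightarrow> nat) \<Rightarrow> bool" where
  "nonhom_poisson_process M intensity X \<longleftrightarrow>
     (\<forall>t\<ge>0. X t \<in> measurable M (count_space UNIV)) \<and>
     (AE \<omega> in M. X 0 \<omega> = 0 \<and> mono_on {0..} (\<lambda>t. X t \<omega>) \<and>
        (\<forall>t\<ge>0. ((\<lambda>s. X s \<omega>) \<longlongrightarrow> X t \<omega>) (at_right t))) \<and>
     (\<forall>(ts :: nat \<Rightarrow> real) m. 0 \<le> ts 0 \<and> mono ts \<longrightarrow>
        prob_space.indep_vars M (\<lambda>_. count_space UNIV)
          (\<lambda>i \<omega>. X (ts (Suc i)) \<omega> - X (ts i) \<omega>) {..<m}) \<and>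
     (\<forall>s t k. 0 \<le> s \<and> s \<le> t \<longrightarrow>
        measure M {\<omega> \<in> space M. X t \<omega> - X s \<omega> = k} =
          (LBINT u:{s..t}. intensity u) ^ k / fact k * exp (- (LBINT u:{s..t}. intensity u)))"

(* Epoch of arrival number k, counted from 0, of a counting path a. It is meaningful only if that
   arrival occurs, that is, if k < a t for some t; the definitions below use it only in that case. *)
definition arrival_time :: "(real \<Rightarrow> nat) \<Rightarrow> nat \<Rightarrow> real" where
  "arrival_time a k = Inf {t. 0 \<le> t \<and> k < a t}"

(* admitted n n0 r \<tau> s k is the set of those among the first k arriving customers that find a free
   server. Here n0 is the number of initially occupied servers, r j the remaining service time of the
   j-th of them, \<tau> i the arrival epoch and s i the service time of arriving customer i.
   A customer departing at time d is present just before time t iff t \<le> d. *)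
primrec admitted ::
    "nat \<Rightarrow> nat \<Rightarrow> (nat \<Rightarrow> real) \<Rightarrow> (nat \<Rightarrow> real) \<Rightarrow> (nat \<Rightarrow> real) \<Rightarrow> nat \<Rightarrow> nat set" where
  "admitted n n0 r \<tau> s 0 = {}"
| "admitted n n0 r \<tau> s (Suc k) =
     (if card {j. j < n0 \<and> \<tau> k \<le> r j}
           + card {i \<in> admitted n n0 r \<tau> s k. \<tau> k \<le> \<tau> i + s i} < n
      then insert k (admitted n n0 r \<tau> s k)
      else admitted n n0 r \<tau> s k)"

definition busy_servers ::
    "nat \<Rightarrow> (real \<Rightarrow> nat) \<Rightarrow> nat \<Rightarrow> (nat \<Rightarrow> real) \<Rightarrow> (nat \<Rightarrow> real) \<Rightarrow> real \<Rightarrow> nat" where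
  "busy_servers n a n0 r s t =
     card {j. j < n0 \<and> t < r j}
     + card {i \<in> admitted n n0 r (arrival_time a) s (a t). t < arrival_time a i + s i}"

datatype source = Arrivals | Initial_Number | Residual nat | Service nat

primrec source_sigma ::
    "'a measure \<Rightarrow> (real \<Rightarrow> 'a \<Rightarrow> nat) \<Rightarrow> ('a \<Rightarrow> nat) \<Rightarrow> (nat \<Rightarrow> 'a \<Rightarrow> real)
      \<Rightarrow> (nat \<Rightarrow> 'a \<Rightarrow> real) \<Rightarrow> source \<Rightarrow> 'a set set" where
  "source_sigma M A N0 R S Arrivals =
     sigma_sets (space M) {A t -` B \<inter> space M | t B. 0 \<le> t}"
| "source_sigma M A N0 R S Initial_Number = {N0 -` B \<inter> space M | B. True}"
| "source_sigma M A N0 R S (Residual j) = {R j -` B \<inter> space M | B. B \<in> sets borel}"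
| "source_sigma M A N0 R S (Service k) = {S k -` B \<inter> space M | B. B \<in> sets borel}"

(* Primitive data of the n-server system: arrivals A, initial number N0, remaining service times
   R j (only those with j < N0 matter) and service times S k of the arriving customers, all mutually
   independent. Nothing is assumed on the joint law of the data for different n. *)
definition loss_queue_data ::
    "'a measure \<Rightarrow> nat \<Rightarrow> (real \<Rightarrow> real) \<Rightarrow> real measure \<Rightarrow> real measure \<Rightarrow> (real \<Rightarrow> 'a \<Rightarrow> nat)
      \<Rightarrow> ('a \<Rightarrow> nat) \<Rightarrow> (nat \<Rightarrow> 'a \<Rightarrow> real) \<Rightarrow> (nat \<Rightarrow> 'a \<Rightarrow> real) \<Rightarrow> bool" where
  "loss_queue_data M n lam G Fn A N0 R S \<longleftrightarrow>
     nonhom_poisson_process M (\<lambda>t. real n * lam t) A \<and>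
     N0 \<in> measurable M (count_space UNIV) \<and> (AE \<omega> in M. N0 \<omega> \<le> n) \<and>
     (\<forall>j. R j \<in> borel_measurable M \<and> distr M borel (R j) = Fn) \<and>
     (\<forall>k. S k \<in> borel_measurable M \<and> distr M borel (S k) = G) \<and>
     prob_space.indep_sets M (source_sigma M A N0 R S) UNIV"

definition scaled_busy ::
    "nat \<Rightarrow> (real \<Rightarrow> 'a \<Rightarrow> nat) \<Rightarrow> ('a \<Rightarrow> nat) \<Rightarrow> (nat \<Rightarrow> 'a \<Rightarrow> real) \<Rightarrow> (nat \<Rightarrow> 'a \<Rightarrow> real)
      \<Rightarrow> 'a \<Rightarrow> real \<Rightarrow> real" where
  "scaled_busy n A N0 R S \<omega> t =
     real (busy_servers n (\<lambda>u. A u \<omega>) (N0 \<omega>) (\<lambda>j. R j \<omega>) (\<lambda>k. S k \<omega>) t) / real n"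

(* For E = {0..T} this is weak-star convergence in L-infinity of [0,T]. For
   E = {t \<in> {0..T}. 0 < lam t} it is weak-star convergence in L-infinity of [0,T] with respect to the
   measure lam t dt, since \<phi> is Lebesgue integrable on E iff \<phi> / lam is integrable on E for
   lam t dt. *)
definition weak_star_conv_on ::
    "real set \<Rightarrow> (nat \<Rightarrow> real \<Rightarrow> real) \<Rightarrow> (real \<Rightarrow> real) \<Rightarrow> bool" where
  "weak_star_conv_on E hn h \<longleftrightarrow>
     (\<forall>\<phi>. set_integrable lborel E \<phi> \<longrightarrow>
        (\<lambda>n. LBINT t:E. \<phi> t * hn n t) \<longlonglongrightarrow> (LBINT t:E. \<phi> t * h t))"

definition upper_env :: "(real \<Rightarrow> real) \<Rightarrow> real \<Rightarrow> ereal" where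
  "upper_env p x =
     Lim (at_right 0) (\<lambda>\<epsilon>. esssup (restrict_space lborel (ball x \<epsilon>)) (\<lambda>y. ereal (p y)))"

(* The essential infimum is expressed as minus the essential supremum of the negative. *)
definition lower_env :: "(real \<Rightarrow> real) \<Rightarrow> real \<Rightarrow> ereal" where
  "lower_env p x =
     Lim (at_right 0) (\<lambda>\<epsilon>. - esssup (restrict_space lborel (ball x \<epsilon>)) (\<lambda>y. - ereal (p y)))"

(* (\<rho>, w) solves  \<rho> t = q t + \<integral>_0^t p (\<rho> (u-)) * K (t - u) * lam u du  on [0,T]. *)
definition volterra_solution ::
    "real \<Rightarrow> (real \<Rightarrow> real) \<Rightarrow> (real \<Rightarrow> real) \<Rightarrow> (real \<Rightarrow> real) \<Rightarrow> (real \<Rightarrow> real)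
      \<Rightarrow> (real \<Rightarrow> real) \<Rightarrow> (real \<Rightarrow> real) \<Rightarrow> bool" where
  "volterra_solution T q p K lam \<rho> w \<longleftrightarrow>
     bounded (\<rho> ` {0..T}) \<and> bounded (w ` {0..T}) \<and> set_borel_measurable lborel {0..T} w \<and>
     (AE t in lborel. t \<in> {0..T} \<longrightarrow>
        lower_env p (\<rho> t) \<le> ereal (w t) \<and> ereal (w t) \<le> upper_env p (\<rho> t)) \<and>
     (\<forall>t\<in>{0..T}. \<rho> t = q t + (LBINT u:{0..t}. w u * K (t - u) * lam u))"

end

(* Along one path, the scaled occupancy is q + B - g * B up to a uniformly small error, where B is the
   scaled number of accepted arrivals and g * B the convolution with the service density. Writing
   B = Lam - L with L the scaled number of losses, L increases only when the occupancy is close to 1,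
   so the occupancies are approximately reflected at 1. A Skorokhod-type comparison bounds the
   distance of two approximately reflected paths; the convolution is absorbed by the weight exp (-t),
   for which g has total mass below 1. Hence L is Cauchy, with a deterministic limit.

   That almost every path is good follows from exponential bounds: sums of n centred predictable terms
   have exponential moments controlled by a product of conditional expectations, and Borel-Cantelli
   applies after division by n.

   The limit L is dominated by Lam, so L has a density k with 0 <= k <= lam, and w = 1 - k / lam. On
   {rho = 1} the derivative of rho vanishes almost everywhere, which is the equation for w there. *)

theory Submission
  imports Defs
begin

text \<open>The obstacle is that admission couples the service times with one another and with the
  arrivals, so the accepted customers are not an independent sample. What survives is
  predictability: the decision on customer \<open>k\<close> does not involve the service time of
  \<open>k\<close> or of anyone later, and the occupancy at a time does not involve later increments
  of the arrival process. Exponential bounds need no more, and being summable in \<open>n\<close>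
  they suit an arbitrary joint law over \<open>n\<close>.

  The good event consists of countably many limits, at rational times and thresholds; monotone paths
  and continuous limits make them uniform. After that the argument is deterministic. It compares two
  arbitrary families of good paths rather than two indices of one family, which is why the limit
  does not depend on the sample point.

  The losses are known only as a uniform limit of step functions, so no derivative is available
  beforehand. The density comes from comparing measures, and the statement on the level set is
  proved in integrated form, through powers of the limit occupancy.\<close>

section \<open>Exponential bounds and predictable products\<close>

text \<open>For \<open>x < 0\<close> put \<open>y = - x\<close>: since
  \<open>(1 + y) * (1 - y + y\<^sup>2) = 1 + y ^ 3\<close> and \<open>1 + y \<le> exp y\<close>, the
  factor \<open>1 - y + y\<^sup>2\<close> dominates \<open>exp (- y)\<close>. The quadratic
  remainder is the source of every term in \<open>\<theta>\<^sup>2\<close> below.\<close>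

lemma exp_le_quadratic:
  fixes x :: real
  assumes "\<bar>x\<bar> \<le> 1"
  shows "exp x \<le> 1 + x + x\<^sup>2"
proof (cases "x \<ge> 0")
  case True
  then show ?thesis using exp_bound[of x] assms by simp
next
  case False
  define y where "y = - x"
  have y: "0 < y" "y \<le> 1" using False assms by (auto simp: y_def)
  have "(1 + y) * (1 - y + y\<^sup>2) = 1 + y ^ 3"
    by (simp add: power2_eq_square power3_eq_cube algebra_simps)
  then have "1 \<le> (1 + y) * (1 - y + y\<^sup>2)" using y by simp
  also have "\<dots> \<le> exp y * (1 - y + y\<^sup>2)"
    using y by (intro mult_right_mono) (auto simp: exp_ge_add_one_self)
  finally have "exp (- y) \<le> 1 - y + y\<^sup>2"
    by (simp add: exp_minus field_simps)
  then show ?thesis by (simp add: y_def)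
qed

context prob_space
begin

text \<open>Independence enters as a product rule for events, because the sigma-algebras met later
  are shown independent through generating families. The proof recasts the rule as
  \<open>indep_vars\<close> for a family indexed by \<open>bool\<close> and applies the product
  formula for nonnegative integrals.\<close>

lemma indep_set_nn_integral_mult:
  fixes X Y :: "'a \<Rightarrow> real"
  assumes sub: "sets E \<subseteq> sets M" "space E = space M"
    and X: "X \<in> borel_measurable E" "\<And>\<omega>. 0 \<le> X \<omega>"
    and Y: "Y \<in> borel_measurable M" "\<And>\<omega>. 0 \<le> Y \<omega>"
    and ind: "\<And>a B. a \<in> sets E \<Longrightarrow> B \<in> sets borel \<Longrightarrow>
      prob (a \<inter> (Y -` B \<inter> space M)) = prob a * prob (Y -` B \<inter> space M)"
  shows "(\<integral>\<^sup>+\<omega>. ennreal (X \<omega> * Y \<omega>) \<partial>M) = (\<integral>\<^sup>+\<omega>. ennreal (X \<omega>) \<partial>M) * (\<integral>\<^sup>+\<omega>. ennreal (Y \<omega>) \<partial>M)"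
proof -
  have XM: "X \<in> borel_measurable M"
    using X sub by (auto simp: measurable_def)
  define X' Y' where "X' \<omega> = ennreal (X \<omega>)" and "Y' \<omega> = ennreal (Y \<omega>)" for \<omega>
  have X': "X' \<in> borel_measurable E" "X' \<in> borel_measurable M" and Y': "Y' \<in> borel_measurable M"
    using X XM Y unfolding X'_def[abs_def] Y'_def[abs_def] by measurable
  have "indep_vars (case_bool borel borel) (case_bool X' Y') UNIV"
    unfolding indep_vars_def2
  proof safe
    fix b show "random_variable (case b of True \<Rightarrow> borel | False \<Rightarrow> borel) (case b of True \<Rightarrow> X' | False \<Rightarrow> Y')"
      using X' Y' by (cases b) auto
  next
    have *: "indep_set {X' -` A \<inter> space M |A. A \<in> sets borel} {Y' -` A \<inter> space M |A. A \<in> sets borel}"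
      unfolding indep_sets2_eq
    proof safe
      fix A :: "ennreal set" assume A: "A \<in> sets borel"
      show "X' -` A \<inter> space M \<in> events" using A X' by measurable
      show "Y' -` A \<inter> space M \<in> events" using A Y' by measurable
    next
      fix A B :: "ennreal set" assume A: "A \<in> sets borel" "B \<in> sets borel"
      have "X' -` A \<inter> space M \<in> sets E" using A X' sub measurable_sets[of X' E borel A] by simp
      moreover have "ennreal -` B \<in> sets borel"
        using A(2) measurable_sets[of ennreal borel borel B] by simp
      moreover have "Y' -` B = Y -` (ennreal -` B)" by (auto simp: Y'_def)
      ultimately show "prob (X' -` A \<inter> space M \<inter> (Y' -` B \<inter> space M)) =
           prob (X' -` A \<inter> space M) * prob (Y' -` B \<inter> space M)"
        using ind by metis
    qed
    show "indep_sets (\<lambda>i. {(case i of True \<Rightarrow> X' | False \<Rightarrow> Y') -` A \<inter> space M |A.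
           A \<in> sets (case i of True \<Rightarrow> borel | False \<Rightarrow> borel)}) UNIV"
      using * unfolding indep_set_def by (rule iffD1[OF indep_sets_cong, rotated -1]) (auto split: bool.split)
  qed
  then have iv: "indep_vars (\<lambda>_. borel) (case_bool X' Y') UNIV"
    by (rule iffD1[OF indep_vars_cong, rotated -1]) (auto split: bool.split)
  have "(\<integral>\<^sup>+\<omega>. (\<Prod>i\<in>UNIV. case_bool X' Y' i \<omega>) \<partial>M) = (\<Prod>i\<in>UNIV. \<integral>\<^sup>+\<omega>. case_bool X' Y' i \<omega> \<partial>M)"
    by (rule indep_vars_nn_integral) (use iv in auto)
  then show ?thesis
    using X(2) Y(2) by (simp add: UNIV_bool mult.commute X'_def[abs_def] Y'_def[abs_def] ennreal_mult)
qed

text \<open>A supermartingale in product form. The partial product and the event \<open>D k\<close>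
  are measurable for \<open>E k\<close>, of which \<open>Y k\<close> is independent, so the factor
  with index \<open>k\<close> contributes at most its mean, hence at most 1. The index ranges in the
  assumptions on \<open>D\<close> and \<open>Y\<close>, \<open>i \<le> k\<close> and
  \<open>i < k\<close>, express this predictability.\<close>

lemma nn_integral_predictable_prod_le_1:
  fixes Y :: "nat \<Rightarrow> 'a \<Rightarrow> real" and D :: "nat \<Rightarrow> 'a \<Rightarrow> bool"
  assumes sub: "\<And>k. k < K \<Longrightarrow> sets (E k) \<subseteq> sets M" "\<And>k. k < K \<Longrightarrow> space (E k) = space M"
    and D: "\<And>i k. i \<le> k \<Longrightarrow> k < K \<Longrightarrow> {\<omega>\<in>space M. D i \<omega>} \<in> sets (E k)"
    and Y: "\<And>i k. i < k \<Longrightarrow> k < K \<Longrightarrow> Y i \<in> borel_measurable (E k)"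
    and YM: "\<And>k. k < K \<Longrightarrow> Y k \<in> borel_measurable M"
    and pos: "\<And>k \<omega>. 0 \<le> Y k \<omega>"
    and ind: "\<And>k a B. k < K \<Longrightarrow> a \<in> sets (E k) \<Longrightarrow> B \<in> sets borel \<Longrightarrow>
      prob (a \<inter> (Y k -` B \<inter> space M)) = prob a * prob (Y k -` B \<inter> space M)"
    and le: "\<And>k. k < K \<Longrightarrow> (\<integral>\<^sup>+\<omega>. ennreal (Y k \<omega>) \<partial>M) \<le> 1"
  shows "(\<integral>\<^sup>+\<omega>. ennreal (\<Prod>k<K. if D k \<omega> then Y k \<omega> else 1) \<partial>M) \<le> 1"
proof -
  define Z where "Z k \<omega> = (\<Prod>i<k. if D i \<omega> then Y i \<omega> else 1)" for k \<omega>
  have Zpos: "0 \<le> Z k \<omega>" for k \<omega> unfolding Z_def using pos by (auto intro!: prod_nonneg)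
  have "k \<le> K \<Longrightarrow> (\<integral>\<^sup>+\<omega>. ennreal (Z k \<omega>) \<partial>M) \<le> 1" for k
  proof (induction k)
    case 0
    then show ?case by (simp add: Z_def emeasure_space_1)
  next
    case (Suc k)
    then have k: "k < K" by simp
    have [measurable]: "Measurable.pred (E k) (D i)" if "i \<le> k" for i
      using D[OF that k] sub(2)[OF k] by (simp add: pred_def)
    have ZE: "Z k \<in> borel_measurable (E k)"
      unfolding Z_def using Y k by measurable
    have [measurable]: "Measurable.pred (E k) (D k)" by measurable
    \<comment> \<open>Splitting along \<open>D k\<close> leaves the fresh factor \<open>Y k\<close>
      on \<open>Z1\<close> alone; both pieces are measurable for \<open>E k\<close>.\<close>
    define Z1 where "Z1 \<omega> = Z k \<omega> * (if D k \<omega> then 1 else 0)" for \<omega>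
    define Z0 where "Z0 \<omega> = Z k \<omega> * (if D k \<omega> then 0 else 1)" for \<omega>
    have Z1E: "Z1 \<in> borel_measurable (E k)" and Z0E: "Z0 \<in> borel_measurable (E k)"
      unfolding Z1_def Z0_def using ZE by measurable
    have toM: "h \<in> borel_measurable M" if "h \<in> borel_measurable (E k)" for h :: "'a \<Rightarrow> real"
      using that sub[OF k] by (auto simp: measurable_def)
    note [measurable] = toM[OF Z1E] toM[OF Z0E] YM[OF k]
    have p: "0 \<le> Z1 \<omega>" "0 \<le> Z0 \<omega>" for \<omega> using Zpos by (auto simp: Z1_def Z0_def)
    have "(\<integral>\<^sup>+\<omega>. ennreal (Z (Suc k) \<omega>) \<partial>M) = (\<integral>\<^sup>+\<omega>. ennreal (Z0 \<omega>) + ennreal (Z1 \<omega> * Y k \<omega>) \<partial>M)"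
      using p pos by (intro nn_integral_cong) (auto simp: Z_def Z0_def Z1_def)
    also have "\<dots> = (\<integral>\<^sup>+\<omega>. ennreal (Z0 \<omega>) \<partial>M) + (\<integral>\<^sup>+\<omega>. ennreal (Z1 \<omega> * Y k \<omega>) \<partial>M)"
      by (rule nn_integral_add) measurable
    also have "(\<integral>\<^sup>+\<omega>. ennreal (Z1 \<omega> * Y k \<omega>) \<partial>M) = (\<integral>\<^sup>+\<omega>. ennreal (Z1 \<omega>) \<partial>M) * (\<integral>\<^sup>+\<omega>. ennreal (Y k \<omega>) \<partial>M)"
      by (rule indep_set_nn_integral_mult[OF sub[OF k] Z1E p(1) YM[OF k] pos ind[OF k]])
    also have "\<dots> \<le> (\<integral>\<^sup>+\<omega>. ennreal (Z1 \<omega>) \<partial>M) * 1"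
      by (intro mult_left_mono le[OF k]) auto
    also have "(\<integral>\<^sup>+\<omega>. ennreal (Z0 \<omega>) \<partial>M) + (\<integral>\<^sup>+\<omega>. ennreal (Z1 \<omega>) \<partial>M) * 1 = (\<integral>\<^sup>+\<omega>. ennreal (Z0 \<omega>) + ennreal (Z1 \<omega>) \<partial>M)"
      by (simp add: nn_integral_add)
    also have "\<dots> = (\<integral>\<^sup>+\<omega>. ennreal (Z k \<omega>) \<partial>M)"
      using Zpos by (intro nn_integral_cong) (auto simp: Z0_def Z1_def)
    finally show ?case using Suc by (auto intro: order_trans add_left_mono)
  qed
  then show ?thesis unfolding Z_def by auto
qed

text \<open>Markov's inequality bounds the probability of the exceptional event by
  \<open>exp (- c) ^ n\<close>, which is summable. Only the law of each single \<open>Z n\<close>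
  enters.\<close>

lemma AE_eventually_le_exp:
  fixes Z :: "nat \<Rightarrow> 'a \<Rightarrow> ennreal"
  assumes Z: "\<And>n. n \<ge> 1 \<Longrightarrow> Z n \<in> borel_measurable M"
    and le: "\<And>n. n \<ge> 1 \<Longrightarrow> (\<integral>\<^sup>+\<omega>. Z n \<omega> \<partial>M) \<le> 1"
    and c: "c > 0"
  shows "AE \<omega> in M. \<forall>\<^sub>F n in sequentially. Z n \<omega> < ennreal (exp (c * real n))"
proof -
  \<comment> \<open>The index 0 is neutralised by the empty set, as the assumptions start at
    1.\<close>
  define A where "A n = (if n \<ge> 1 then {\<omega>\<in>space M. ennreal (exp (c * real n)) \<le> Z n \<omega>} else {})" for n
  have Am: "A n \<in> events" for n using Z[of n] by (auto simp: A_def)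
  have eA: "emeasure M (A n) \<le> ennreal (exp (-c) ^ n)" for n
  proof (cases "n \<ge> 1")
    case True
    have [measurable]: "Z n \<in> borel_measurable M" by (rule Z[OF True])
    have "A n = {\<omega>\<in>space M. 1 \<le> ennreal (exp (- (c * real n))) * Z n \<omega>}"
    proof -
      have "ennreal (exp (c * real n)) \<le> z \<longleftrightarrow> 1 \<le> ennreal (exp (- (c * real n))) * z" for z
      proof
        assume "ennreal (exp (c * real n)) \<le> z"
        then have "ennreal (exp (- (c * real n))) * ennreal (exp (c * real n)) \<le> ennreal (exp (- (c * real n))) * z"
          by (rule mult_left_mono) simp
        then show "1 \<le> ennreal (exp (- (c * real n))) * z"
          by (simp add: ennreal_mult[symmetric] exp_minus)
      next
        assume "1 \<le> ennreal (exp (- (c * real n))) * z"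
        then have "ennreal (exp (c * real n)) * 1 \<le> ennreal (exp (c * real n)) * (ennreal (exp (- (c * real n))) * z)"
          by (rule mult_left_mono) simp
        also have "\<dots> = z" by (simp add: ennreal_mult[symmetric] exp_minus mult.assoc[symmetric])
        finally show "ennreal (exp (c * real n)) \<le> z" by simp
      qed
      then show ?thesis using True by (simp add: A_def)
    qed
    also have "emeasure M \<dots> \<le> ennreal (exp (- (c * real n))) * (\<integral>\<^sup>+\<omega>. Z n \<omega> * indicator (space M) \<omega> \<partial>M)"
      using nn_integral_Markov_inequality[of "Z n" "space M" M "ennreal (exp (- (c * real n)))"] by simp
    also have "(\<integral>\<^sup>+\<omega>. Z n \<omega> * indicator (space M) \<omega> \<partial>M) = (\<integral>\<^sup>+\<omega>. Z n \<omega> \<partial>M)"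
      by (intro nn_integral_cong) auto
    also have "ennreal (exp (- (c * real n))) * \<dots> \<le> ennreal (exp (- (c * real n))) * 1"
      by (intro mult_left_mono le[OF True]) simp
    finally show ?thesis by (simp add: exp_of_nat_mult[symmetric] mult.commute)
  next
    case False
    then show ?thesis by (auto simp: A_def)
  qed
  have "summable (\<lambda>n. exp (-c) ^ n)" using c by (intro summable_geometric) simp
  then have "summable (\<lambda>n. prob (A n))"
    by (rule summable_comparison_test') (use eA in \<open>simp add: emeasure_eq_measure\<close>)
  then have "AE \<omega> in M. \<forall>\<^sub>F n in sequentially. \<omega> \<in> space M - A n"
    by (intro borel_cantelli_AE1) (use Am in \<open>auto simp: emeasure_eq_measure\<close>)
  then show ?thesis
  proof eventually_elim
    case (elim \<omega>)
    with eventually_ge_at_top[of 1] show ?case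
      by eventually_elim (auto simp: A_def not_le)
  qed
qed

text \<open>Every law of large numbers below is obtained through this criterion. Dominating the
  exponential by a measurable \<open>Z\<close> avoids a measurability proof for \<open>x n\<close>,
  which will be a functional of whole paths. A fixed \<open>\<theta>\<close> eventually gives
  \<open>\<theta> * x n \<omega> \<le> (\<kappa> + 1) * \<theta>\<^sup>2\<close>; taking
  \<open>\<theta>\<close> of size \<open>1 / (k + 1)\<close> with both signs and dividing bounds
  \<open>x n \<omega>\<close> by a multiple of \<open>1 / (k + 1)\<close>.\<close>

lemma AE_tendsto_zero_of_exp_bounds:
  fixes x :: "nat \<Rightarrow> 'a \<Rightarrow> real"
  assumes bnd: "\<And>n \<theta>. n \<ge> 1 \<Longrightarrow> \<bar>\<theta>\<bar> \<le> 1 \<Longrightarrow> \<exists>Z\<in>borel_measurable M. (\<integral>\<^sup>+\<omega>. Z \<omega> \<partial>M) \<le> 1 \<and>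
      (AE \<omega> in M. ennreal (exp (real n * (\<theta> * x n \<omega> - \<kappa> * \<theta>\<^sup>2))) \<le> Z \<omega>)"
  shows "AE \<omega> in M. (\<lambda>n. x n \<omega>) \<longlonglongrightarrow> 0"
proof -
  have one: "AE \<omega> in M. \<forall>\<^sub>F n in sequentially. \<theta> * x n \<omega> \<le> (\<kappa> + 1) * \<theta>\<^sup>2"
    if \<theta>: "\<bar>\<theta>\<bar> \<le> 1" "\<theta> \<noteq> 0" for \<theta> :: real
  proof -
    have "\<forall>n. \<exists>Z. n \<ge> 1 \<longrightarrow> Z\<in>borel_measurable M \<and> (\<integral>\<^sup>+\<omega>. Z \<omega> \<partial>M) \<le> 1 \<and>
      (AE \<omega> in M. ennreal (exp (real n * (\<theta> * x n \<omega> - \<kappa> * \<theta>\<^sup>2))) \<le> Z \<omega>)"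
      using bnd[OF _ \<theta>(1)] by blast
    from choice[OF this] obtain Z where "\<forall>n. n \<ge> 1 \<longrightarrow> Z n \<in>borel_measurable M \<and> (\<integral>\<^sup>+\<omega>. Z n \<omega> \<partial>M) \<le> 1 \<and>
      (AE \<omega> in M. ennreal (exp (real n * (\<theta> * x n \<omega> - \<kappa> * \<theta>\<^sup>2))) \<le> Z n \<omega>)" ..
    then have Z: "\<And>n. n \<ge> 1 \<Longrightarrow> Z n \<in>borel_measurable M" "\<And>n. n \<ge> 1 \<Longrightarrow> (\<integral>\<^sup>+\<omega>. Z n \<omega> \<partial>M) \<le> 1"
      "\<And>n. n \<ge> 1 \<Longrightarrow> AE \<omega> in M. ennreal (exp (real n * (\<theta> * x n \<omega> - \<kappa> * \<theta>\<^sup>2))) \<le> Z n \<omega>"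
      by auto
    have "AE \<omega> in M. \<forall>n\<in>{1..}. ennreal (exp (real n * (\<theta> * x n \<omega> - \<kappa> * \<theta>\<^sup>2))) \<le> Z n \<omega>"
      using Z(3) by (intro AE_ball_countable') auto
    \<comment> \<open>The threshold has the same order as the cost
      \<open>\<kappa> * \<theta>\<^sup>2\<close>, which turns \<open>\<kappa>\<close> into
      \<open>\<kappa> + 1\<close>.\<close>
    moreover have "AE \<omega> in M. \<forall>\<^sub>F n in sequentially. Z n \<omega> < ennreal (exp (\<theta>\<^sup>2 * real n))"
      using \<theta> by (intro AE_eventually_le_exp Z) auto
    ultimately show ?thesis
    proof eventually_elim
      case (elim \<omega>)
      from elim(2) eventually_ge_at_top[of 1] show ?case
      proof eventually_elim
        case (elim n)
        with \<open>\<forall>n\<in>_. _\<close> have "ennreal (exp (real n * (\<theta> * x n \<omega> - \<kappa> * \<theta>\<^sup>2))) < ennreal (exp (\<theta>\<^sup>2 * real n))"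
          by (auto intro: le_less_trans)
        then have "\<theta> * x n \<omega> - \<kappa> * \<theta>\<^sup>2 < \<theta>\<^sup>2"
          using elim by (simp add: ennreal_less_iff mult.commute)
        then show ?case using elim by (simp add: mult_less_cancel_left algebra_simps)
      qed
    qed
  qed
  have "AE \<omega> in M. \<forall>k. \<forall>\<^sub>F n in sequentially. inverse (real (Suc k)) * x n \<omega> \<le> (\<kappa> + 1) * (inverse (real (Suc k)))\<^sup>2"
    unfolding AE_all_countable by (intro allI one) (auto simp: field_simps)
  moreover have "AE \<omega> in M. \<forall>k. \<forall>\<^sub>F n in sequentially. - inverse (real (Suc k)) * x n \<omega> \<le> (\<kappa> + 1) * (- inverse (real (Suc k)))\<^sup>2"
    unfolding AE_all_countable by (intro allI one) (auto simp: field_simps)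
  ultimately show ?thesis
  proof eventually_elim
    case (elim \<omega>)
    have ev: "\<forall>\<^sub>F n in sequentially. \<bar>x n \<omega>\<bar> \<le> (\<kappa> + 1) * inverse (real (Suc k))" for k
      using elim(1)[rule_format, of k] elim(2)[rule_format, of k]
    proof eventually_elim
      case (elim n)
      have *: "y \<le> c * d" if "d * y \<le> c * d\<^sup>2" "d > 0" for c d y :: real
        using that by (simp add: power2_eq_square)
      have "x n \<omega> \<le> (\<kappa> + 1) * inverse (real (Suc k))"
        using elim(1) by (rule *) simp
      moreover have "- x n \<omega> \<le> (\<kappa> + 1) * inverse (real (Suc k))"
        by (rule *) (use elim(2) in simp_all)
      ultimately show ?case by (rule abs_leI)
    qed
    show ?case
    proof (rule LIMSEQ_I)
      fix r :: real assume "r > 0"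
      have "(\<lambda>k. (\<kappa> + 1) * inverse (real (Suc k))) \<longlonglongrightarrow> (\<kappa> + 1) * 0"
        by (intro tendsto_mult tendsto_const LIMSEQ_inverse_real_of_nat)
      then have "\<forall>\<^sub>F k in sequentially. (\<kappa> + 1) * inverse (real (Suc k)) < r"
        using \<open>r > 0\<close> by (intro order_tendstoD) auto
      then obtain k where k: "(\<kappa> + 1) * inverse (real (Suc k)) < r"
        by (auto simp: eventually_sequentially)
      from ev[of k] have "\<forall>\<^sub>F n in sequentially. norm (x n \<omega> - 0) < r"
        by eventually_elim (use k in auto)
      then show "\<exists>no. \<forall>n\<ge>no. norm (x n \<omega> - 0) < r" by (auto simp: eventually_sequentially)
    qed
  qed
qed

text \<open>The Poisson moment generating function, normalised to integral one. Expanding over the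
  values of \<open>X\<close> and summing the exponential series of
  \<open>exp \<theta> * \<mu>\<close> includes \<open>\<mu> = 0\<close>, which occurs where the
  intensity vanishes.\<close>

lemma nn_integral_exp_poisson:
  fixes X :: "'a \<Rightarrow> nat"
  assumes X: "X \<in> measurable M (count_space UNIV)" and \<mu>: "\<mu> \<ge> 0"
    and p: "\<And>k. prob {\<omega>\<in>space M. X \<omega> = k} = \<mu> ^ k / fact k * exp (-\<mu>)"
  shows "(\<integral>\<^sup>+\<omega>. ennreal (exp (\<theta> * real (X \<omega>) - (exp \<theta> - 1) * \<mu>)) \<partial>M) = 1"
proof -
  let ?c = "\<lambda>k. exp (\<theta> * real k - (exp \<theta> - 1) * \<mu>)"
  have meas: "{\<omega>\<in>space M. X \<omega> = k} \<in> events" for k using X by measurable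
  have "ennreal (?c (X \<omega>)) = (\<Sum>k. ennreal (?c k) * indicator {\<omega>\<in>space M. X \<omega> = k} \<omega>)" if "\<omega> \<in> space M" for \<omega>
    using that by (subst suminf_finite[of "{X \<omega>}"]) (auto simp: indicator_def)
  then have "(\<integral>\<^sup>+\<omega>. ennreal (?c (X \<omega>)) \<partial>M) = (\<integral>\<^sup>+\<omega>. (\<Sum>k. ennreal (?c k) * indicator {\<omega>\<in>space M. X \<omega> = k} \<omega>) \<partial>M)"
    by (intro nn_integral_cong) auto
  also have "\<dots> = (\<Sum>k. \<integral>\<^sup>+\<omega>. ennreal (?c k) * indicator {\<omega>\<in>space M. X \<omega> = k} \<omega> \<partial>M)"
    using meas by (intro nn_integral_suminf) auto
  also have "\<dots> = (\<Sum>k. ennreal (?c k * (\<mu> ^ k / fact k * exp (-\<mu>))))"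
    using meas \<mu> by (intro suminf_cong, subst ennreal_mult) (simp_all add: nn_integral_cmult_indicator emeasure_eq_measure p)
  also have "\<dots> = 1"
  proof (subst ennreal_1[symmetric], rule sums_unique[symmetric], subst sums_ennreal)
    have "(\<lambda>k. ((exp \<theta> * \<mu>) ^ k /\<^sub>R fact k) * exp (- (exp \<theta> * \<mu>))) sums (exp (exp \<theta> * \<mu>) * exp (- (exp \<theta> * \<mu>)))"
      by (intro sums_mult2 exp_converges)
    then show "(\<lambda>k. ?c k * (\<mu> ^ k / fact k * exp (-\<mu>))) sums 1"
    proof (rule iffD1[OF arg_cong2[where f="(sums)"], rotated -1])
      show "exp (exp \<theta> * \<mu>) * exp (- (exp \<theta> * \<mu>)) = 1" by (simp add: exp_minus)
      show "(\<lambda>k. ((exp \<theta> * \<mu>) ^ k /\<^sub>R fact k) * exp (- (exp \<theta> * \<mu>))) = (\<lambda>k. ?c k * (\<mu> ^ k / fact k * exp (-\<mu>)))"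
      proof
        fix k
        have "?c k * exp (-\<mu>) = exp \<theta> ^ k * exp (- (exp \<theta> * \<mu>))"
          by (simp add: exp_of_nat_mult[symmetric] exp_add[symmetric] algebra_simps)
        then show "((exp \<theta> * \<mu>) ^ k /\<^sub>R fact k) * exp (- (exp \<theta> * \<mu>)) = ?c k * (\<mu> ^ k / fact k * exp (-\<mu>))"
          by (simp add: power_mult_distrib divide_inverse mult_ac)
      qed
    qed
  qed (use \<mu> in auto)
  finally show ?thesis .
qed

text \<open>From \<open>exp (- \<mu>) \<ge> 1 - \<mu>\<close> follows \<open>1 - (1 + \<mu>) * exp
  (- \<mu>) \<le> 1 - (1 + \<mu>) * (1 - \<mu>)\<close>. The square serves to exclude simultaneous
  arrivals: summed over a fine mesh, second-order terms become small.\<close>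

lemma prob_poisson_ge_2:
  fixes X :: "'a \<Rightarrow> nat"
  assumes X: "X \<in> measurable M (count_space UNIV)" and \<mu>: "\<mu> \<ge> 0"
    and p: "\<And>k. prob {\<omega>\<in>space M. X \<omega> = k} = \<mu> ^ k / fact k * exp (-\<mu>)"
  shows "prob {\<omega>\<in>space M. 2 \<le> X \<omega>} \<le> \<mu>\<^sup>2"
proof -
  have meas: "{\<omega>\<in>space M. X \<omega> = k} \<in> events" for k using X by measurable
  have "{\<omega>\<in>space M. 2 \<le> X \<omega>} = space M - ({\<omega>\<in>space M. X \<omega> = 0} \<union> {\<omega>\<in>space M. X \<omega> = 1})" by auto
  also have "prob \<dots> = 1 - prob ({\<omega>\<in>space M. X \<omega> = 0} \<union> {\<omega>\<in>space M. X \<omega> = 1})"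
    using meas by (intro prob_compl) auto
  also have "prob ({\<omega>\<in>space M. X \<omega> = 0} \<union> {\<omega>\<in>space M. X \<omega> = 1}) = prob {\<omega>\<in>space M. X \<omega> = 0} + prob {\<omega>\<in>space M. X \<omega> = 1}"
    using meas by (intro finite_measure_Union) auto
  also have "1 - \<dots> = 1 - (1 + \<mu>) * exp (-\<mu>)" by (simp only: p) (simp add: algebra_simps)
  also have "\<dots> \<le> 1 - (1 + \<mu>) * (1 - \<mu>)"
    using exp_ge_add_one_self[of "-\<mu>"] \<mu> by (intro diff_left_mono mult_left_mono) auto
  finally show ?thesis by (simp add: power2_eq_square algebra_simps)
qed

text \<open>By the quadratic bound \<open>exp (\<theta> * D \<omega>) \<le> 1 + \<theta> * D
  \<omega> + \<theta>\<^sup>2\<close>; the linear term integrates to 0, and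
  \<open>1 + \<theta>\<^sup>2 \<le> exp (\<theta>\<^sup>2)\<close> is compensated by the subtracted
  \<open>\<theta>\<^sup>2\<close>.\<close>

lemma nn_integral_exp_centered_le_1:
  fixes D :: "'a \<Rightarrow> real"
  assumes [measurable]: "D \<in> borel_measurable M" and b: "\<And>\<omega>. \<bar>D \<omega>\<bar> \<le> 1" and e: "expectation D = 0" and \<theta>: "\<bar>\<theta>\<bar> \<le> 1"
  shows "(\<integral>\<^sup>+\<omega>. ennreal (exp (\<theta> * D \<omega> - \<theta>\<^sup>2)) \<partial>M) \<le> 1" (is "?L \<le> 1")
proof -
  have i: "integrable M D" by (rule integrable_const_bound[of _ 1]) (use b in auto)
  have *: "exp (\<theta> * D \<omega> - \<theta>\<^sup>2) \<le> exp (-\<theta>\<^sup>2) * (1 + \<theta> * D \<omega> + \<theta>\<^sup>2)" for \<omega>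
  proof -
    have "\<bar>\<theta> * D \<omega>\<bar> \<le> 1" using \<theta> b[of \<omega>] by (simp add: abs_mult mult_le_one)
    from exp_le_quadratic[OF this] have "exp (\<theta> * D \<omega>) \<le> 1 + \<theta> * D \<omega> + (\<theta> * D \<omega>)\<^sup>2" .
    also have "(\<theta> * D \<omega>)\<^sup>2 \<le> \<theta>\<^sup>2" using b[of \<omega>] by (simp add: power_mult_distrib mult_left_le abs_square_le_1)
    finally show ?thesis by (simp add: exp_diff exp_minus field_simps)
  qed
  have i2: "integrable M (\<lambda>\<omega>. exp (-\<theta>\<^sup>2) * (1 + \<theta> * D \<omega> + \<theta>\<^sup>2))" using i by simp
  have pos: "0 \<le> exp (-\<theta>\<^sup>2) * (1 + \<theta> * D \<omega> + \<theta>\<^sup>2)" for \<omega> using order_trans[OF _ *[of \<omega>], of 0] by simp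
  have "?L \<le> (\<integral>\<^sup>+\<omega>. ennreal (exp (-\<theta>\<^sup>2) * (1 + \<theta> * D \<omega> + \<theta>\<^sup>2)) \<partial>M)"
    by (intro nn_integral_mono ennreal_leI *)
  also have "\<dots> = ennreal (\<integral>\<omega>. exp (-\<theta>\<^sup>2) * (1 + \<theta> * D \<omega> + \<theta>\<^sup>2) \<partial>M)"
    by (rule nn_integral_eq_integral[OF i2]) (use pos in auto)
  also have "(\<integral>\<omega>. exp (-\<theta>\<^sup>2) * (1 + \<theta> * D \<omega> + \<theta>\<^sup>2) \<partial>M) = exp (-\<theta>\<^sup>2) * (1 + \<theta>\<^sup>2)"
    using i e by (simp add: prob_space)
  also have "\<dots> \<le> exp (-\<theta>\<^sup>2) * exp (\<theta>\<^sup>2)" by (intro mult_left_mono exp_ge_add_one_self) simp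
  finally have "?L \<le> ennreal (exp (-\<theta>\<^sup>2) * exp (\<theta>\<^sup>2))" by (simp add: ennreal_leI)
  then show ?thesis by (simp add: exp_minus)
qed

end

section \<open>Loss queues along a fixed path\<close>

definition counting_path :: "(real \<Rightarrow> nat) \<Rightarrow> bool" where
  "counting_path a \<longleftrightarrow> a 0 = 0 \<and> mono_on {0..} a \<and> (\<forall>t\<ge>0. (a \<longlongrightarrow> a t) (at_right t))"

lemma counting_path_mono: "counting_path a \<Longrightarrow> 0 \<le> s \<Longrightarrow> s \<le> t \<Longrightarrow> a s \<le> a t"
  by (auto simp: counting_path_def mono_on_def)

text \<open>The infimum defining the epoch is attained: \<open>nat\<close> is discrete, so
  right-continuity makes the path constant on an interval to the right of the infimum, and this
  interval contains a time at which arrival \<open>i\<close> has occurred. The assumption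
  \<open>i < a u\<close> ensures that the arrival occurs at all.\<close>

lemma arrival_time_le_iff:
  assumes a: "counting_path a" and u: "i < a u" "0 \<le> u" and t: "0 \<le> t"
  shows "arrival_time a i \<le> t \<longleftrightarrow> i < a t"
proof
  assume "i < a t"
  then show "arrival_time a i \<le> t"
    unfolding arrival_time_def using t by (intro cInf_lower) (auto intro!: bdd_belowI[of _ 0])
next
  define S where "S = {t. 0 \<le> t \<and> i < a t}"
  have S: "S \<noteq> {}" "bdd_below S" using u by (auto simp: S_def intro!: bdd_belowI[of _ 0])
  have pos: "0 \<le> Inf S" using S by (intro cInf_greatest) (auto simp: S_def)
  have "\<forall>\<^sub>F s in at_right (Inf S). a s = a (Inf S)"
    using a pos by (auto simp: counting_path_def tendsto_discrete)
  then obtain b where b: "b > Inf S" "\<And>s. Inf S < s \<Longrightarrow> s < b \<Longrightarrow> a s = a (Inf S)"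
    by (auto simp: eventually_at_right_field)
  have "Inf S < b" by fact
  then obtain s where s: "s \<in> S" "s < b" using S cInf_lessD by metis
  have "Inf S \<le> s" using s S by (intro cInf_lower) auto
  then have "a s = a (Inf S)" using b(2)[of s] s by (cases "s = Inf S") auto
  then have inf: "i < a (Inf S)" using s by (simp add: S_def)
  assume "arrival_time a i \<le> t"
  then have "Inf S \<le> t" by (simp add: arrival_time_def S_def)
  then show "i < a t" using inf counting_path_mono[OF a pos] by (auto intro: less_le_trans)
qed

lemma arrival_time_nonneg: "i < a u \<Longrightarrow> 0 \<le> u \<Longrightarrow> 0 \<le> arrival_time a i"
  unfolding arrival_time_def by (intro cInf_greatest) auto

lemma arrival_time_pos:
  assumes a: "counting_path a" and u: "i < a u" "0 \<le> u"
  shows "0 < arrival_time a i"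
proof (rule ccontr)
  assume "\<not> 0 < arrival_time a i"
  then have "i < a 0" using arrival_time_le_iff[OF a u, of 0] by simp
  then show False using a by (simp add: counting_path_def)
qed

section \<open>The admission recursion\<close>

lemma admitted_subset: "admitted n n0 r \<tau> s k \<subseteq> {..<k}"
proof (induction k)
  case (Suc k)
  have "admitted n n0 r \<tau> s (Suc k) \<subseteq> insert k (admitted n n0 r \<tau> s k)"
    unfolding admitted.simps by (split if_split) blast
  also have "\<dots> \<subseteq> insert k {..<k}" using Suc by blast
  finally show ?case by (simp add: lessThan_Suc)
qed simp

lemma finite_admitted [simp]: "finite (admitted n n0 r \<tau> s k)"
  by (rule finite_subset[OF admitted_subset]) simp

declare admitted.simps(2) [simp del]

lemma admitted_Int_lessThan: "k \<le> K \<Longrightarrow> admitted n n0 r \<tau> s K \<inter> {..<k} = admitted n n0 r \<tau> s k"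
proof (induction K)
  case 0
  then show ?case by simp
next
  case (Suc K)
  show ?case
  proof (cases "k = Suc K")
    case True
    then show ?thesis using admitted_subset[of n n0 r \<tau> s k] by auto
  next
    case False
    then have "k \<le> K" using Suc by simp
    then have "admitted n n0 r \<tau> s (Suc K) \<inter> {..<k} = admitted n n0 r \<tau> s K \<inter> {..<k}"
      unfolding admitted.simps by (split if_split) auto
    then show ?thesis using Suc.IH[OF \<open>k \<le> K\<close>] by simp
  qed
qed

lemma in_admitted_iff: "i < K \<Longrightarrow> i \<in> admitted n n0 r \<tau> s K \<longleftrightarrow> i \<in> admitted n n0 r \<tau> s (Suc i)"
  using admitted_Int_lessThan[of "Suc i" K n n0 r \<tau> s] by auto

text \<open>Used to exchange the true epochs for a measurable substitute that agrees with them for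
  the customers concerned.\<close>

lemma admitted_cong:
  "(\<And>i. i < k \<Longrightarrow> \<tau> i = \<tau>' i) \<Longrightarrow> admitted n n0 r \<tau> s k = admitted n n0 r \<tau>' s k"
proof (induction k)
  case 0
  then show ?case by simp
next
  case (Suc k)
  have IH: "admitted n n0 r \<tau> s k = admitted n n0 r \<tau>' s k" using Suc by simp
  have e: "\<tau> k = \<tau>' k" using Suc by simp
  have "{i \<in> admitted n n0 r \<tau>' s k. \<tau> k \<le> \<tau> i + s i} = {i \<in> admitted n n0 r \<tau>' s k. \<tau>' k \<le> \<tau>' i + s i}"
    using admitted_subset[of n n0 r \<tau>' s k] Suc.prems by (auto simp: e)
  then show ?case by (simp add: IH e admitted.simps(2))
qed

text \<open>The count that the recursion compares with \<open>n\<close>, at a general time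
  \<open>t\<close>. The non-strict inequalities make it the left limit of the occupancy at
  \<open>t\<close> when \<open>k\<close> customers have arrived before \<open>t\<close>.\<close>

definition present_before where
  "present_before n n0 r \<tau> s k t = card {j. j < n0 \<and> t \<le> r j} + card {i \<in> admitted n n0 r \<tau> s k. t \<le> \<tau> i + s i}"

lemma Suc_in_admitted_iff: "k \<in> admitted n n0 r \<tau> s (Suc k) \<longleftrightarrow> present_before n n0 r \<tau> s k (\<tau> k) < n"
  using admitted_subset[of n n0 r \<tau> s k] by (auto simp: present_before_def admitted.simps(2))

lemma present_after_le:
  assumes "n0 \<le> n" "\<And>i. i < k \<Longrightarrow> \<tau> i \<le> t"
  shows "card {j. j < n0 \<and> t < r j} + card {i \<in> admitted n n0 r \<tau> s k. t < \<tau> i + s i} \<le> n"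
  using assms(2)
proof (induction k)
  case 0
  have "card {j. j < n0 \<and> t < r j} \<le> card {..<n0}" by (intro card_mono) auto
  then show ?case using assms by simp
next
  case (Suc k)
  show ?case
  proof (cases "k \<in> admitted n n0 r \<tau> s (Suc k)")
    case True
    then have p: "present_before n n0 r \<tau> s k (\<tau> k) < n" by (simp only: Suc_in_admitted_iff)
    have le: "\<tau> k \<le> t" using Suc.prems by simp
    have 1: "card {j. j < n0 \<and> t < r j} \<le> card {j. j < n0 \<and> \<tau> k \<le> r j}"
      using le by (intro card_mono) auto
    have "{i \<in> admitted n n0 r \<tau> s (Suc k). t < \<tau> i + s i} \<subseteq> insert k {i \<in> admitted n n0 r \<tau> s k. \<tau> k \<le> \<tau> i + s i}"
      using le by (auto simp: admitted.simps(2) split: if_splits)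
    then have "card {i \<in> admitted n n0 r \<tau> s (Suc k). t < \<tau> i + s i} \<le> card (insert k {i \<in> admitted n n0 r \<tau> s k. \<tau> k \<le> \<tau> i + s i})"
      by (intro card_mono) auto
    also have "\<dots> \<le> Suc (card {i \<in> admitted n n0 r \<tau> s k. \<tau> k \<le> \<tau> i + s i})" by (rule card_insert_le_m1) auto
    finally show ?thesis using 1 p by (simp add: present_before_def)
  next
    case False
    then have "admitted n n0 r \<tau> s (Suc k) = admitted n n0 r \<tau> s k"
      by (auto simp: admitted.simps(2) split: if_splits)
    then show ?thesis using Suc by simp
  qed
qed

lemma busy_servers_le:
  assumes a: "counting_path a" and "n0 \<le> n" "0 \<le> t"
  shows "busy_servers n a n0 r s t \<le> n"
  unfolding busy_servers_def
  using assms arrival_time_le_iff[OF a _ \<open>0 \<le> t\<close> \<open>0 \<le> t\<close>] by (intro present_after_le) blast+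

text \<open>A customer found by the lost arrival \<open>k\<close> was either present at the earlier
  time \<open>u\<close> or has an index from \<open>a u\<close> up to \<open>k\<close>. Hence the
  occupancy at \<open>u\<close> falls short of \<open>n\<close> by at most \<open>k - a u\<close>,
  which is small relative to \<open>n\<close> if \<open>u\<close> is close to the epoch.\<close>

lemma busy_before_lost_arrival:
  assumes a: "counting_path a" and k: "k < a t" "0 \<le> t"
    and lost: "k \<notin> admitted n n0 r (arrival_time a) s (Suc k)" and u: "0 \<le> u" "u < arrival_time a k"
  shows "a u \<le> k" "n + a u \<le> busy_servers n a n0 r s u + k"
proof -
  let ?\<tau> = "arrival_time a"
  show au: "a u \<le> k" using arrival_time_le_iff[OF a k u(1)] u(2) by simp
  have "n \<le> present_before n n0 r ?\<tau> s k (?\<tau> k)"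
    using lost by (simp only: Suc_in_admitted_iff not_less)
  also have "\<dots> \<le> card {j. j < n0 \<and> u < r j} + (card {i \<in> admitted n n0 r ?\<tau> s (a u). u < ?\<tau> i + s i} + (k - a u))"
    unfolding present_before_def
  proof (intro add_mono)
    show "card {j. j < n0 \<and> ?\<tau> k \<le> r j} \<le> card {j. j < n0 \<and> u < r j}"
      using u by (intro card_mono) auto
    have "{i \<in> admitted n n0 r ?\<tau> s k. ?\<tau> k \<le> ?\<tau> i + s i} \<subseteq> {i \<in> admitted n n0 r ?\<tau> s (a u). u < ?\<tau> i + s i} \<union> {a u..<k}"
      using u admitted_Int_lessThan[OF au, of n n0 r ?\<tau> s] admitted_subset[of n n0 r ?\<tau> s k] by force
    then have "card {i \<in> admitted n n0 r ?\<tau> s k. ?\<tau> k \<le> ?\<tau> i + s i} \<le> card ({i \<in> admitted n n0 r ?\<tau> s (a u). u < ?\<tau> i + s i} \<union> {a u..<k})"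
      by (intro card_mono) auto
    also have "\<dots> \<le> card {i \<in> admitted n n0 r ?\<tau> s (a u). u < ?\<tau> i + s i} + card {a u..<k}"
      by (rule card_Un_le)
    finally show "card {i \<in> admitted n n0 r ?\<tau> s k. ?\<tau> k \<le> ?\<tau> i + s i} \<le> card {i \<in> admitted n n0 r ?\<tau> s (a u). u < ?\<tau> i + s i} + (k - a u)"
      by simp
  qed
  finally show "n + a u \<le> busy_servers n a n0 r s u + k"
    using au by (simp add: busy_servers_def)
qed

lemma card_lost_split:
  assumes "k \<le> K"
  shows "card ({..<K} - admitted n n0 r \<tau> s K) = card ({..<k} - admitted n n0 r \<tau> s k) + card ({k..<K} - admitted n n0 r \<tau> s K)"
proof -
  have "{..<K} - admitted n n0 r \<tau> s K = ({..<k} - admitted n n0 r \<tau> s k) \<union> ({k..<K} - admitted n n0 r \<tau> s K)"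
    using assms admitted_Int_lessThan[OF assms, of n n0 r \<tau> s] admitted_subset[of n n0 r \<tau> s k] by auto
  then show ?thesis by (simp add: card_Un_disjoint disjoint_iff)
qed

text \<open>The witness is the largest lost index \<open>k\<close>. Nothing after it is lost, so for
  \<open>m \<le> k\<close> the losses not yet counted at stage \<open>m\<close> lie in
  \<open>{m..<Suc k}\<close>. This relates the losses up to a time to those up to a freely chosen
  earlier stage.\<close>

lemma last_lost:
  fixes a :: "real \<Rightarrow> nat"
  assumes "{..<K} - admitted n n0 r \<tau> s K \<noteq> {}"
  obtains k where "k < K" "k \<notin> admitted n n0 r \<tau> s (Suc k)"
    "\<And>m. m \<le> k \<Longrightarrow> card ({..<K} - admitted n n0 r \<tau> s K) \<le> card ({..<m} - admitted n n0 r \<tau> s m) + (Suc k - m)"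
proof -
  let ?S = "{..<K} - admitted n n0 r \<tau> s K"
  define k where "k = Max ?S"
  have k: "k \<in> ?S" unfolding k_def by (rule Max_in) (use assms in auto)
  have kK: "k < K" using k by auto
  have mx: "i \<le> k" if "i \<in> ?S" for i unfolding k_def using that by (intro Max_ge) auto
  show thesis
  proof
    show "k < K" by fact
    show "k \<notin> admitted n n0 r \<tau> s (Suc k)" using k in_admitted_iff[OF kK] by auto
    fix m assume m: "m \<le> k"
    then have mK: "m \<le> K" using kK by simp
    have "card ({m..<K} - admitted n n0 r \<tau> s K) \<le> card {m..<Suc k}"
    proof (intro card_mono subsetI)
      fix x assume "x \<in> {m..<K} - admitted n n0 r \<tau> s K"
      then show "x \<in> {m..<Suc k}" using mx[of x] by simp
    qed simp
    then show "card ?S \<le> card ({..<m} - admitted n n0 r \<tau> s m) + (Suc k - m)"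
      by (simp add: card_lost_split[OF mK])
  qed
qed

section \<open>Left limits of the occupancy and admission decisions\<close>

lemma eventually_less_iff_at_left:
  fixes c t :: real
  shows "\<forall>\<^sub>F q in at_left t. q < c \<longleftrightarrow> t \<le> c"
proof (cases "t \<le> c")
  case True
  have "\<forall>\<^sub>F q in at_left t. q \<in> {t - 1<..<t}" by (rule eventually_at_left_real) simp
  then show ?thesis by eventually_elim (use True in auto)
next
  case False
  then have "c < t" by simp
  from eventually_at_left_real[OF this] show ?thesis by eventually_elim (use False in auto)
qed

text \<open>Before \<open>t\<close> the path takes finitely many values, being bounded by
  \<open>a t\<close>; once the largest of them is reached, monotonicity keeps it there.\<close>

lemma counting_path_eventually_const_at_left:
  assumes a: "counting_path a" and t: "0 < t"
  shows "\<exists>k. \<forall>\<^sub>F q in at_left t. a q = k"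
proof -
  define k where "k = Max (a ` {0..<t})"
  have fin: "finite (a ` {0..<t})"
    by (rule finite_subset[of _ "{..a t}"]) (use counting_path_mono[OF a, of _ t] in auto)
  have "k \<in> a ` {0..<t}" unfolding k_def using fin t by (intro Max_in) auto
  then obtain b where b: "0 \<le> b" "b < t" "a b = k" by auto
  from eventually_at_left_real[OF b(2)] have "\<forall>\<^sub>F q in at_left t. a q = k"
  proof eventually_elim
    case (elim q)
    then have "a q \<le> k" unfolding k_def using fin b by (intro Max_ge) auto
    moreover have "k \<le> a q" using counting_path_mono[OF a b(1), of q] elim b by auto
    ultimately show ?case by simp
  qed
  then show ?thesis by blast
qed

text \<open>For \<open>q\<close> just before \<open>t\<close>, comparing \<open>q\<close> strictly
  with a departure time amounts to comparing \<open>t\<close> non-strictly. This identifies the left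
  limit of the occupancy with the count tested in the recursion.\<close>

lemma busy_servers_eventually_at_left:
  assumes k: "\<forall>\<^sub>F q in at_left t. a q = k"
  shows "\<forall>\<^sub>F q in at_left t. busy_servers n a n0 r s q = present_before n n0 r (arrival_time a) s k t"
proof -
  have "\<forall>\<^sub>F q in at_left t. \<forall>j\<in>{..<n0}. q < r j \<longleftrightarrow> t \<le> r j"
    by (intro eventually_ball_finite) (auto intro: eventually_less_iff_at_left)
  moreover have "\<forall>\<^sub>F q in at_left t. \<forall>i\<in>{..<k}. q < arrival_time a i + s i \<longleftrightarrow> t \<le> arrival_time a i + s i"
    by (intro eventually_ball_finite) (auto intro: eventually_less_iff_at_left)
  ultimately show ?thesis using k
  proof eventually_elim
    case (elim q)
    have "{j. j < n0 \<and> q < r j} = {j. j < n0 \<and> t \<le> r j}" using elim by auto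
    moreover have "{i \<in> admitted n n0 r (arrival_time a) s k. q < arrival_time a i + s i} = {i \<in> admitted n n0 r (arrival_time a) s k. t \<le> arrival_time a i + s i}"
      using elim admitted_subset[of n n0 r "arrival_time a" s k] by auto
    ultimately show ?case using elim by (simp add: busy_servers_def present_before_def)
  qed
qed

lemma left_lim_eventually_const:
  assumes "\<forall>\<^sub>F q in at_left t. f q = c"
  shows "left_lim f t = c"
  unfolding left_lim_def using assms by (intro tendsto_Lim tendsto_eventually) auto

text \<open>If two customers share an epoch, the second may find the first present although the left
  limit does not show it. Distinct epochs make the admission of a customer equivalent to a free
  server in the left limit.\<close>

definition simple_arrivals :: "(real \<Rightarrow> nat) \<Rightarrow> real \<Rightarrow> bool" where
  "simple_arrivals a t \<longleftrightarrow> (\<forall>i. Suc i < a t \<longrightarrow> arrival_time a i < arrival_time a (Suc i))"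

lemma simple_arrivals_eventually_at_left_arrival:
  assumes a: "counting_path a" and t: "0 \<le> t" and sp: "simple_arrivals a t" and i: "i < a t"
  shows "\<forall>\<^sub>F q in at_left (arrival_time a i). a q = i"
proof -
  let ?\<tau> = "arrival_time a"
  \<comment> \<open>The preceding epoch, or time 0 for the first customer; strictly between
    \<open>b\<close> and the epoch of \<open>i\<close> exactly \<open>i\<close> arrivals have
    occurred.\<close>
  define b where "b = (if i = 0 then 0 else ?\<tau> (i - 1))"
  have b: "0 \<le> b" "b < ?\<tau> i"
    using arrival_time_pos[OF a i t] arrival_time_nonneg[of "i - 1" a t] i t sp
    by (auto simp: b_def simple_arrivals_def dest: spec[of _ "i - 1"])
  from eventually_at_left_real[OF b(2)] show ?thesis
  proof eventually_elim
    case (elim q)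
    then have q: "0 \<le> q" using b by auto
    have 1: "\<not> i < a q" using arrival_time_le_iff[OF a i t q] elim by auto
    have "i - 1 < a q" if "i > 0"
    proof -
      have "i - 1 < a t" using i by simp
      from arrival_time_le_iff[OF a this t q] show ?thesis using elim that by (auto simp: b_def)
    qed
    with 1 show ?case by (cases i) auto
  qed
qed

lemma eventually_busy_less_iff_admitted:
  assumes a: "counting_path a" and t: "0 \<le> t" and sp: "simple_arrivals a t" and i: "i < a t"
  shows "\<forall>\<^sub>F q in at_left (arrival_time a i). busy_servers n a n0 r s q < n \<longleftrightarrow> i \<in> admitted n n0 r (arrival_time a) s (Suc i)"
  using busy_servers_eventually_at_left[OF simple_arrivals_eventually_at_left_arrival[OF assms], of n n0 r s]
  unfolding Suc_in_admitted_iff by eventually_elim simp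

text \<open>The infimum over the rational times up to \<open>t\<close> agrees with the arrival epoch on counting paths,
  and unlike the latter it is a measurable function of the path on \<open>{0..t}\<close> for arbitrary paths.\<close>

definition arrival_before :: "(real \<Rightarrow> nat) \<Rightarrow> real \<Rightarrow> nat \<Rightarrow> real" where
  "arrival_before a t i = (INF q\<in>insert t ({0..t} \<inter> \<rat>). if i < a q then q else t)"

text \<open>Rational times just after the epoch approach it from above, since from the epoch on the
  path exceeds \<open>i\<close>. The time \<open>t\<close> is in the index set to cover an epoch
  equal to \<open>t\<close>, and it is the default value at times before the epoch.\<close>

lemma arrival_before_eq:
  assumes a: "counting_path a" and t: "0 \<le> t" and i: "i < a t"
  shows "arrival_before a t i = arrival_time a i"
proof (rule antisym)
  let ?\<tau> = "arrival_time a i" and ?f = "\<lambda>q. if i < a q then q else t"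
  let ?Q = "insert t ({0..t} \<inter> \<rat>)"
  have bdd: "bdd_below (?f ` ?Q)" using t by (auto intro!: bdd_belowI[of _ 0])
  have le: "?\<tau> \<le> t" using arrival_time_le_iff[OF a i t t] i by simp
  show "?\<tau> \<le> arrival_before a t i"
    unfolding arrival_before_def
  proof (rule cINF_greatest)
    fix q assume "q \<in> ?Q"
    then have "0 \<le> q" using t by auto
    then show "?\<tau> \<le> ?f q" using arrival_time_le_iff[OF a i t, of q] le by auto
  qed auto
  show "arrival_before a t i \<le> ?\<tau>"
  proof (cases "?\<tau> = t")
    case True
    have "arrival_before a t i \<le> ?f t" unfolding arrival_before_def by (intro cINF_lower bdd) auto
    then show ?thesis using True by (simp split: if_splits)
  next
    case False
    show ?thesis
    proof (rule dense_ge)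
      fix y assume "?\<tau> < y"
      then have "?\<tau> < min y t" using False le by auto
      then obtain q where q: "q \<in> \<rat>" "?\<tau> < q" "q < min y t" using Rats_dense_in_real by blast
      have "0 \<le> ?\<tau>" using i t by (rule arrival_time_nonneg)
      then have "0 \<le> q" using q by linarith
      then have "arrival_before a t i \<le> ?f q" unfolding arrival_before_def using q by (intro cINF_lower bdd) auto
      also have "\<dots> = q" using arrival_time_le_iff[OF a i t \<open>0 \<le> q\<close>] q by auto
      finally show "arrival_before a t i \<le> y" using q by simp
    qed
  qed
qed

text \<open>Both the range and the condition of the count are random; fixing each of the countably
  many values of \<open>N\<close> reduces the claim to finite sums.\<close>

lemma measurable_card_initial:
  fixes P :: "nat \<Rightarrow> 'a \<Rightarrow> bool"
  assumes N[measurable]: "N \<in> measurable E (count_space UNIV)" and P[measurable]: "\<And>j. Measurable.pred E (P j)"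
  shows "(\<lambda>\<omega>. card {j. j < (N \<omega> :: nat) \<and> P j \<omega>}) \<in> measurable E (count_space UNIV)"
proof -
  have "(\<lambda>\<omega>. (\<lambda>m \<omega>. \<Sum>j<m. if P j \<omega> then 1 else 0 :: nat) (N \<omega>) \<omega>) \<in> measurable E (count_space UNIV)"
    by (rule measurable_compose_countable[OF _ N]) measurable
  moreover have "card {j. j < m \<and> P j \<omega>} = (\<Sum>j<m. if P j \<omega> then 1 else 0)" for m \<omega>
  proof -
    have "{j. j < m \<and> P j \<omega>} = {j\<in>{..<m}. P j \<omega>}" by auto
    then show ?thesis by (simp add: sum.If_cases Int_def)
  qed
  ultimately show ?thesis by simp
qed

text \<open>Predictability in the form of measurability: the decision on a customer uses the
  services of strictly earlier customers, so after \<open>k\<close> stages only the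
  \<open>S i\<close> with \<open>Suc i < k\<close> have entered, whereas the epochs have entered up
  to index \<open>k - 1\<close>.\<close>

lemma pred_admitted:
  assumes N[measurable]: "N \<in> measurable E (count_space UNIV)"
    and R[measurable]: "\<And>j. R j \<in> borel_measurable E"
    and \<tau>: "\<And>i. i < k \<Longrightarrow> \<tau> i \<in> borel_measurable E"
    and S: "\<And>i. Suc i < k \<Longrightarrow> S i \<in> borel_measurable E"
  shows "Measurable.pred E (\<lambda>\<omega>. i \<in> admitted n (N \<omega>) (\<lambda>j. R j \<omega>) (\<lambda>j. \<tau> j \<omega>) (\<lambda>j. S j \<omega>) k)"
  using \<tau> S
proof (induction k arbitrary: i)
  case 0
  then show ?case by simp
next
  case (Suc k)
  have IH[measurable]: "Measurable.pred E (\<lambda>\<omega>. i \<in> admitted n (N \<omega>) (\<lambda>j. R j \<omega>) (\<lambda>j. \<tau> j \<omega>) (\<lambda>j. S j \<omega>) k)" for i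
    by (rule Suc.IH; rule Suc.prems) simp_all
  have [measurable]: "\<tau> k \<in> borel_measurable E" by (rule Suc.prems) simp
  let ?P = "\<lambda>i \<omega>. i < k \<and> i \<in> admitted n (N \<omega>) (\<lambda>j. R j \<omega>) (\<lambda>j. \<tau> j \<omega>) (\<lambda>j. S j \<omega>) k \<and> \<tau> k \<omega> \<le> \<tau> i \<omega> + S i \<omega>"
  have P: "Measurable.pred E (?P i)" for i
  proof (cases "i < k")
    case True
    then have [measurable]: "\<tau> i \<in> borel_measurable E" "S i \<in> borel_measurable E" by (auto intro!: Suc.prems)
    show ?thesis by measurable
  qed simp
  have eq: "{i \<in> admitted n (N \<omega>) (\<lambda>j. R j \<omega>) (\<lambda>j. \<tau> j \<omega>) (\<lambda>j. S j \<omega>) k. \<tau> k \<omega> \<le> \<tau> i \<omega> + S i \<omega>} = {i. i < k \<and> ?P i \<omega>}" for \<omega>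
    using admitted_subset[of n "N \<omega>" "\<lambda>j. R j \<omega>" "\<lambda>j. \<tau> j \<omega>" "\<lambda>j. S j \<omega>" k] by auto
  define c1 where "c1 \<omega> = card {j. j < N \<omega> \<and> \<tau> k \<omega> \<le> R j \<omega>}" for \<omega>
  define c2 where "c2 \<omega> = card {i \<in> admitted n (N \<omega>) (\<lambda>j. R j \<omega>) (\<lambda>j. \<tau> j \<omega>) (\<lambda>j. S j \<omega>) k. \<tau> k \<omega> \<le> \<tau> i \<omega> + S i \<omega>}" for \<omega>
  define Q where "Q \<omega> \<longleftrightarrow> i \<in> admitted n (N \<omega>) (\<lambda>j. R j \<omega>) (\<lambda>j. \<tau> j \<omega>) (\<lambda>j. S j \<omega>) k" for \<omega>
  have [measurable]: "c1 \<in> measurable E (count_space UNIV)"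
    unfolding c1_def[abs_def] by (rule measurable_card_initial) measurable
  have [measurable]: "c2 \<in> measurable E (count_space UNIV)"
    unfolding c2_def[abs_def] eq by (rule measurable_card_initial[OF measurable_const P]) simp
  have [measurable]: "Measurable.pred E Q" unfolding Q_def[abs_def] by (rule IH)
  have "(\<lambda>\<omega>. c1 \<omega> + c2 \<omega>) \<in> measurable E (count_space UNIV)"
    by measurable
  then have "Measurable.pred E (\<lambda>\<omega>. c1 \<omega> + c2 \<omega> < n)"
    using measurable_compose[of "\<lambda>\<omega>. c1 \<omega> + c2 \<omega>" E "count_space UNIV" "\<lambda>x. x < n" "count_space UNIV"] by simp
  then have "Measurable.pred E (\<lambda>\<omega>. c1 \<omega> + c2 \<omega> < n \<and> i = k)"
    by (cases "i = k") simp_all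
  then have "Measurable.pred E (\<lambda>\<omega>. (c1 \<omega> + c2 \<omega> < n \<and> i = k) \<or> Q \<omega>)"
    using \<open>Measurable.pred E Q\<close> by (rule pred_intros_logic(5))
  also have "?this \<longleftrightarrow> ?case"
    unfolding c1_def c2_def Q_def
    by (intro arg_cong[where f="Measurable.pred E"] ext) (auto simp: admitted.simps(2))
  finally show ?case .
qed

section \<open>The reflected convolution equation\<close>

definition conv_upto :: "(real \<Rightarrow> real) \<Rightarrow> (real \<Rightarrow> real) \<Rightarrow> real \<Rightarrow> real" where
  "conv_upto g h t = (LBINT v:{0..t}. g v * h (t - v))"

text \<open>Instantiated both for the service density and for the density of the limiting residual
  law. The normalisation is on the half-line because both laws charge no negative times.\<close>

locale service_density =
  fixes g :: "real \<Rightarrow> real"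
  assumes g_measurable [measurable]: "g \<in> borel_measurable borel"
    and g_nonneg: "\<And>x. 0 \<le> g x"
    and g_integrable: "set_integrable lborel {0..} g"
    and g_total: "(LBINT x:{0..}. g x) = 1"
begin

text \<open>The Laplace transform of the service law at 1. It bounds convolution by \<open>g\<close>
  in the supremum norm weighted by \<open>exp (- t)\<close> and is the contraction constant below;
  without the weight the bound is merely 1.\<close>

definition laplace_one :: real where
  "laplace_one = (LBINT v:{0..}. exp (- v) * g v)"

lemma exp_g_integrable: "set_integrable lborel {0..} (\<lambda>v. exp (- v) * g v)"
  by (rule set_integrable_bound[OF g_integrable])
     (auto simp: set_borel_measurable_def g_nonneg abs_mult mult_left_le_one_le)

lemma g_integrable_upto: "set_integrable lborel {0..t} g"
  by (rule set_integrable_subset[OF g_integrable]) auto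

lemma g_integral_upto_le: "(LBINT v:{0..t}. g v) \<le> 1"
proof -
  have "(LBINT v:{0..t}. g v) \<le> (LBINT v:{0..}. g v)"
    unfolding set_lebesgue_integral_def
    using g_integrable g_integrable_upto[of t] g_nonneg
    by (intro integral_mono) (auto simp: set_integrable_def indicator_def)
  then show ?thesis by (simp add: g_total)
qed

lemma exp_g_integral_upto_le: "(LBINT v:{0..t}. exp (- v) * g v) \<le> laplace_one"
proof -
  have "set_integrable lborel {0..t} (\<lambda>v. exp (- v) * g v)"
    by (rule set_integrable_subset[OF exp_g_integrable]) auto
  then show ?thesis unfolding laplace_one_def set_lebesgue_integral_def
    using exp_g_integrable g_nonneg
    by (intro integral_mono) (auto simp: set_integrable_def indicator_def)
qed

text \<open>Otherwise the nonnegative function \<open>(1 - exp (- v)) * g v\<close> would integrate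
  to 0 over \<open>{0..}\<close>, so \<open>g\<close> would vanish almost everywhere there, against
  total mass one.\<close>

lemma laplace_one_less_1: "laplace_one < 1"
proof (rule ccontr)
  assume "\<not> laplace_one < 1"
  let ?h = "\<lambda>v. (1 - exp (- v)) * g v"
  have i: "set_integrable lborel {0..} ?h"
    using set_integral_diff(1)[OF g_integrable exp_g_integrable] by (simp add: algebra_simps)
  have "(LBINT v:{0..}. ?h v) = 1 - laplace_one"
    using set_integral_diff(2)[OF g_integrable exp_g_integrable]
    by (simp add: g_total laplace_one_def algebra_simps)
  then have "(LBINT v:{0..}. ?h v) \<le> 0" using \<open>\<not> _\<close> by simp
  moreover have nn: "0 \<le> indicator {0..} v *\<^sub>R ?h v" for v
    using g_nonneg[of v] by (auto simp: indicator_def)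
  ultimately have "(LBINT v:{0..}. ?h v) = 0"
    unfolding set_lebesgue_integral_def by (intro antisym Bochner_Integration.integral_nonneg)
  then have "AE v in lborel. indicator {0..} v *\<^sub>R ?h v = 0"
    using i nn unfolding set_integrable_def set_lebesgue_integral_def
    by (subst (asm) integral_nonneg_eq_0_iff_AE) auto
  then have "AE v in lborel. indicator {0..} v *\<^sub>R g v = 0"
    using AE_lborel_singleton[of 0] by eventually_elim (auto simp: indicator_def split: if_splits)
  then have "(LBINT v:{0..}. g v) = (\<integral>v. 0 \<partial>(lborel :: real measure))"
    unfolding set_lebesgue_integral_def by (intro integral_cong_AE) auto
  then show False by (simp add: g_total)
qed

lemma laplace_one_nonneg: "0 \<le> laplace_one"
  unfolding laplace_one_def set_lebesgue_integral_def
  by (intro Bochner_Integration.integral_nonneg) (auto simp: g_nonneg)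

lemma conv_integrable:
  assumes [measurable]: "h \<in> borel_measurable borel" and b: "\<And>s. s \<in> {0..t} \<Longrightarrow> \<bar>h s\<bar> \<le> C"
  shows "set_integrable lborel {0..t} (\<lambda>v. g v * h (t - v))"
proof (rule set_integrable_bound)
  show "set_integrable lborel {0..t} (\<lambda>v. C * g v)" using g_integrable_upto by (rule set_integrable_mult_right)
  show "AE v in lborel. v \<in> {0..t} \<longrightarrow> norm (g v * h (t - v)) \<le> norm (C * g v)"
  proof (intro AE_I2 impI)
    fix v assume "v \<in> {0..t}"
    then have "\<bar>h (t - v)\<bar> \<le> C" by (intro b) auto
    then show "norm (g v * h (t - v)) \<le> norm (C * g v)"
      using g_nonneg[of v] mult_left_mono[of "\<bar>h (t - v)\<bar>" C "g v"] by (simp add: abs_mult mult.commute)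
  qed
qed (auto simp: set_borel_measurable_def)

lemma conv_diff:
  assumes "h \<in> borel_measurable borel" "\<And>s. s \<in> {0..t} \<Longrightarrow> \<bar>h s\<bar> \<le> C"
    and "k \<in> borel_measurable borel" "\<And>s. s \<in> {0..t} \<Longrightarrow> \<bar>k s\<bar> \<le> D"
  shows "conv_upto g (\<lambda>s. h s - k s) t = conv_upto g h t - conv_upto g k t"
proof -
  have "set_integrable lborel {0..t} (\<lambda>v. g v * h (t - v))" "set_integrable lborel {0..t} (\<lambda>v. g v * k (t - v))"
    using conv_integrable assms by blast+
  from set_integral_diff(2)[OF this] show ?thesis
    by (simp add: conv_upto_def right_diff_distrib)
qed

lemma conv_abs_le:
  assumes "h \<in> borel_measurable borel" "\<And>s. s \<in> {0..t} \<Longrightarrow> \<bar>h s\<bar> \<le> C" "0 \<le> C"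
  shows "\<bar>conv_upto g h t\<bar> \<le> C"
proof -
  have i: "set_integrable lborel {0..t} (\<lambda>v. g v * h (t - v))"
    using conv_integrable assms by blast
  have "\<bar>conv_upto g h t\<bar> \<le> (LBINT v:{0..t}. \<bar>g v * h (t - v)\<bar>)"
    using set_integral_norm_bound[OF i] by (simp add: conv_upto_def)
  also have "\<dots> \<le> (LBINT v:{0..t}. C * g v)"
  proof (rule set_integral_mono)
    show "set_integrable lborel {0..t} (\<lambda>v. \<bar>g v * h (t - v)\<bar>)" using i by (rule set_integrable_abs)
    show "set_integrable lborel {0..t} (\<lambda>v. C * g v)" using g_integrable_upto by (rule set_integrable_mult_right)
    fix v assume "v \<in> {0..t}"
    then have "\<bar>h (t - v)\<bar> \<le> C" by (intro assms) auto
    then show "\<bar>g v * h (t - v)\<bar> \<le> C * g v"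
      using g_nonneg[of v] mult_left_mono[of "\<bar>h (t - v)\<bar>" C "g v"] by (simp add: abs_mult mult.commute)
  qed
  also have "\<dots> = C * (LBINT v:{0..t}. g v)" by simp
  also have "\<dots> \<le> C * 1" by (intro mult_left_mono g_integral_upto_le assms)
  finally show ?thesis by simp
qed

text \<open>Writing \<open>exp (t - v) = exp t * exp (- v)\<close> moves the decay onto
  \<open>g\<close>, whose damped integral is at most \<open>laplace_one\<close> on every
  horizon.\<close>

lemma conv_le_exp:
  assumes h: "h \<in> borel_measurable borel" and b: "\<And>s. s \<in> {0..t} \<Longrightarrow> \<bar>h s\<bar> \<le> W * exp s" and W: "0 \<le> W"
  shows "conv_upto g h t \<le> laplace_one * W * exp t"
proof -
  have "\<bar>h s\<bar> \<le> W * exp t" if "s \<in> {0..t}" for s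
    using b[OF that] that W by (auto intro: order_trans mult_left_mono)
  from conv_integrable[OF h this] have i: "set_integrable lborel {0..t} (\<lambda>v. g v * h (t - v))" .
  have "conv_upto g h t \<le> (LBINT v:{0..t}. (W * exp t) * (exp (- v) * g v))"
    unfolding conv_upto_def
  proof (rule set_integral_mono[OF i])
    show "set_integrable lborel {0..t} (\<lambda>v. (W * exp t) * (exp (- v) * g v))"
      by (intro set_integrable_mult_right set_integrable_subset[OF exp_g_integrable]) auto
    fix v assume "v \<in> {0..t}"
    then have "h (t - v) \<le> W * exp (t - v)" using b[of "t - v"] by auto
    then have "g v * h (t - v) \<le> g v * (W * exp (t - v))" by (intro mult_left_mono g_nonneg)
    then show "g v * h (t - v) \<le> (W * exp t) * (exp (- v) * g v)"
      by (simp add: exp_diff exp_minus field_simps)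
  qed
  also have "\<dots> = (W * exp t) * (LBINT v:{0..t}. exp (- v) * g v)" by simp
  also have "\<dots> \<le> (W * exp t) * laplace_one" by (intro mult_left_mono exp_g_integral_upto_le) (use W in auto)
  finally show ?thesis by (simp add: mult_ac)
qed

text \<open>Here \<open>x\<close> is the path before reflection and
  \<open>x - L + conv_upto g L\<close> the occupancy. The third clause keeps the occupancy below 1.
  The last says that, up to \<open>d\<close>, the value \<open>L t\<close> is zero or forced by some
  time up to \<open>t\<close>. So \<open>L\<close> is nearly the running supremum of the positive
  part of \<open>x + conv_upto g L - 1\<close>: a Skorokhod map with feedback. Monotonicity on all
  of \<open>real\<close> secures measurability of \<open>L\<close>.\<close>

definition almost_reflected :: "real \<Rightarrow> real \<Rightarrow> (real \<Rightarrow> real) \<Rightarrow> (real \<Rightarrow> real) \<Rightarrow> bool" where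
  "almost_reflected T d x L \<longleftrightarrow> mono L \<and> (\<forall>t\<in>{0..T}. 0 \<le> L t) \<and>
     (\<forall>t\<in>{0..T}. x t + conv_upto g L t - 1 \<le> L t) \<and>
     (\<forall>t\<in>{0..T}. L t \<le> d \<or> (\<exists>u\<in>{0..t}. L t \<le> x u + conv_upto g L u - 1 + d))"

text \<open>At a time \<open>u\<close> that forces \<open>L1 t\<close>, the other path satisfies
  \<open>L2 t \<ge> L2 u \<ge> x2 u + conv_upto g L2 u - 1\<close>. After subtraction there remain
  the difference of \<open>x1\<close> and \<open>x2\<close> and a convolution of
  \<open>L1 - L2\<close>, to which the weighted bound applies at \<open>u \<le> t\<close>.\<close>

lemma almost_reflected_one_sided:
  assumes 1: "almost_reflected T d x1 L1" and 2: "almost_reflected T d x2 L2"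
    and x: "\<And>t. t \<in> {0..T} \<Longrightarrow> \<bar>x1 t - x2 t\<bar> \<le> \<eta>"
    and W: "0 \<le> W" "\<And>t. t \<in> {0..T} \<Longrightarrow> \<bar>L1 t - L2 t\<bar> \<le> W * exp t"
    and t: "t \<in> {0..T}" and d: "0 \<le> d" and \<eta>: "0 \<le> \<eta>"
  shows "L1 t - L2 t \<le> d + \<eta> + laplace_one * W * exp t"
proof -
  have m: "mono L1" "mono L2" using 1 2 by (auto simp: almost_reflected_def)
  have [measurable]: "L1 \<in> borel_measurable borel" "L2 \<in> borel_measurable borel"
    using m borel_measurable_mono by blast+
  have p: "0 \<le> laplace_one * W * exp t" using laplace_one_nonneg W by simp
  have "L1 t \<le> d \<or> (\<exists>u\<in>{0..t}. L1 t \<le> x1 u + conv_upto g L1 u - 1 + d)"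
    using 1 t by (auto simp: almost_reflected_def)
  then show ?thesis
  proof
    assume "L1 t \<le> d"
    moreover have "0 \<le> L2 t" using 2 t by (auto simp: almost_reflected_def)
    ultimately show ?thesis using p \<eta> by linarith
  next
    assume "\<exists>u\<in>{0..t}. L1 t \<le> x1 u + conv_upto g L1 u - 1 + d"
    then obtain u where u: "u \<in> {0..t}" "L1 t \<le> x1 u + conv_upto g L1 u - 1 + d" by blast
    have uT: "u \<in> {0..T}" using u t by auto
    have "L2 u \<le> L2 t" using m u by (auto dest: monoD)
    moreover have "x2 u + conv_upto g L2 u - 1 \<le> L2 u" using 2 uT by (auto simp: almost_reflected_def)
    moreover have "conv_upto g L1 u - conv_upto g L2 u \<le> laplace_one * W * exp u"
    proof -
      have b: "\<bar>L s\<bar> \<le> \<bar>L 0\<bar> + \<bar>L u\<bar>" if "mono L" "s \<in> {0..u}" for L :: "real \<Rightarrow> real" and s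
        using monoD[OF that(1), of 0 s] monoD[OF that(1), of s u] that(2) unfolding abs_le_iff atLeastAtMost_iff by linarith
      have "conv_upto g L1 u - conv_upto g L2 u = conv_upto g (\<lambda>s. L1 s - L2 s) u"
        by (rule conv_diff[symmetric]) (auto intro!: b m)
      also have "\<dots> \<le> laplace_one * W * exp u"
        using W uT by (intro conv_le_exp) auto
      finally show ?thesis .
    qed
    moreover have "laplace_one * W * exp u \<le> laplace_one * W * exp t"
      using laplace_one_nonneg W u by (intro mult_left_mono) auto
    moreover have "x1 u - x2 u \<le> \<eta>" using x[OF uT] by simp
    ultimately show ?thesis using u(2) by linarith
  qed
qed

text \<open>With \<open>W\<close> the weighted supremum of the difference, the one-sided estimate in
  both directions yields \<open>W \<le> d + \<eta> + laplace_one * W\<close>, to be solved for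
  \<open>W\<close> as \<open>laplace_one < 1\<close>. Undoing the weight costs
  \<open>exp T\<close>.\<close>

lemma almost_reflected_stability:
  assumes 1: "almost_reflected T d x1 L1" and 2: "almost_reflected T d x2 L2"
    and x: "\<And>t. t \<in> {0..T} \<Longrightarrow> \<bar>x1 t - x2 t\<bar> \<le> \<eta>"
    and t: "t \<in> {0..T}" and d: "0 \<le> d" and \<eta>: "0 \<le> \<eta>"
  shows "\<bar>L1 t - L2 t\<bar> \<le> exp T * (d + \<eta>) / (1 - laplace_one)"
proof -
  define W where "W = (SUP s\<in>{0..T}. exp (- s) * \<bar>L1 s - L2 s\<bar>)"
  have m: "mono L1" "mono L2" using 1 2 by (auto simp: almost_reflected_def)
  \<comment> \<open>Monotone functions are bounded on \<open>{0..T}\<close> by their end values;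
    this makes the supremum \<open>W\<close> finite.\<close>
  have b: "\<bar>L1 s - L2 s\<bar> \<le> \<bar>L1 0\<bar> + \<bar>L1 T\<bar> + \<bar>L2 0\<bar> + \<bar>L2 T\<bar>" if "s \<in> {0..T}" for s
    using monoD[OF m(1), of 0 s] monoD[OF m(1), of s T] monoD[OF m(2), of 0 s] monoD[OF m(2), of s T] that by auto
  have bdd: "bdd_above ((\<lambda>s. exp (- s) * \<bar>L1 s - L2 s\<bar>) ` {0..T})"
  proof (rule bdd_aboveI2)
    fix s assume s: "s \<in> {0..T}"
    have "exp (- s) * \<bar>L1 s - L2 s\<bar> \<le> 1 * (\<bar>L1 0\<bar> + \<bar>L1 T\<bar> + \<bar>L2 0\<bar> + \<bar>L2 T\<bar>)"
      by (intro mult_mono b s) (use s in auto)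
    then show "exp (- s) * \<bar>L1 s - L2 s\<bar> \<le> \<bar>L1 0\<bar> + \<bar>L1 T\<bar> + \<bar>L2 0\<bar> + \<bar>L2 T\<bar>" by simp
  qed
  have ub: "exp (- s) * \<bar>L1 s - L2 s\<bar> \<le> W" if "s \<in> {0..T}" for s
    unfolding W_def using that by (intro cSUP_upper bdd) auto
  have W0: "0 \<le> W" using ub[OF t] by (rule order_trans[rotated]) simp
  have ub': "\<bar>L1 s - L2 s\<bar> \<le> W * exp s" if "s \<in> {0..T}" for s
    using ub[OF that] by (simp add: exp_minus field_simps)
  have "W \<le> d + \<eta> + laplace_one * W"
    unfolding W_def
  proof (rule cSUP_least)
    show "{0..T} \<noteq> {}" using t by auto
    fix s assume s: "s \<in> {0..T}"
    have "L1 s - L2 s \<le> d + \<eta> + laplace_one * W * exp s"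
      by (rule almost_reflected_one_sided[OF 1 2 x W0 ub' s d \<eta>])
    moreover have "L2 s - L1 s \<le> d + \<eta> + laplace_one * W * exp s"
      by (rule almost_reflected_one_sided[OF 2 1 _ W0 _ s d \<eta>]) (use x ub' in \<open>auto simp: abs_minus_commute\<close>)
    ultimately have "\<bar>L1 s - L2 s\<bar> \<le> d + \<eta> + laplace_one * W * exp s" by simp
    also have "\<dots> \<le> (d + \<eta>) * exp s + laplace_one * W * exp s"
      using s d \<eta> mult_left_mono[of 1 "exp s" "d + \<eta>"] by simp
    finally have "exp (- s) * \<bar>L1 s - L2 s\<bar> \<le> exp (- s) * (((d + \<eta>) + laplace_one * W) * exp s)"
      by (intro mult_left_mono) (simp_all add: algebra_simps)
    also have "\<dots> = d + \<eta> + laplace_one * W" by (simp add: exp_minus field_simps)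
    finally show "exp (- s) * \<bar>L1 s - L2 s\<bar> \<le> d + \<eta> + laplace_one * (SUP s\<in>{0..T}. exp (- s) * \<bar>L1 s - L2 s\<bar>)"
      by (simp add: W_def)
  qed
  then have "W * (1 - laplace_one) \<le> d + \<eta>" by (simp add: algebra_simps)
  then have "W \<le> (d + \<eta>) / (1 - laplace_one)" using laplace_one_less_1 by (simp add: field_simps)
  then have "W * exp t \<le> (d + \<eta>) / (1 - laplace_one) * exp T"
    using t d \<eta> laplace_one_less_1 by (intro mult_mono) auto
  with ub'[OF t] show ?thesis by (simp add: mult.commute)
qed

end

text \<open>A monotone path is squeezed between its values at neighbouring grid points, so
  convergence at finitely many rational points and uniform continuity of the limit suffice.\<close>

lemma mono_imp_uniform_convergence:
  fixes X :: "nat \<Rightarrow> real \<Rightarrow> real"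
  assumes mono: "\<And>n s t. 0 \<le> s \<Longrightarrow> s \<le> t \<Longrightarrow> X n s \<le> X n t"
    and cont: "continuous_on {0..} x"
    and conv: "\<And>q. q \<in> \<rat> \<Longrightarrow> 0 \<le> q \<Longrightarrow> (\<lambda>n. X n q) \<longlonglongrightarrow> x q"
    and e: "0 < e"
  shows "\<forall>\<^sub>F n in sequentially. \<forall>t\<in>{0..T}. \<bar>X n t - x t\<bar> < e"
proof -
  \<comment> \<open>The interval is enlarged by 1 because the right-hand grid neighbour of
    \<open>t\<close> may lie beyond \<open>T\<close>.\<close>
  have "uniformly_continuous_on {0..T + 1} x"
    by (rule compact_uniformly_continuous[OF continuous_on_subset[OF cont]]) auto
  then obtain \<delta> where \<delta>: "\<delta> > 0" "\<And>s t. s \<in> {0..T+1} \<Longrightarrow> t \<in> {0..T+1} \<Longrightarrow> dist t s < \<delta> \<Longrightarrow> dist (x t) (x s) < e / 2"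
    unfolding uniformly_continuous_on_def using e by (metis half_gt_zero)
  obtain N :: nat where N: "N > 0" "inverse (real N) < min \<delta> 1"
    using \<delta>(1) ex_inverse_of_nat_less[of "min \<delta> 1"] by auto
  define J where "J = {..nat \<lfloor>T * N\<rfloor> + 1}"
  have "\<forall>\<^sub>F n in sequentially. \<forall>j\<in>J. \<bar>X n (real j / N) - x (real j / N)\<bar> < e / 2"
  proof (rule eventually_ball_finite)
    show "finite J" by (simp add: J_def)
    show "\<forall>j\<in>J. \<forall>\<^sub>F n in sequentially. \<bar>X n (real j / N) - x (real j / N)\<bar> < e / 2"
    proof
      fix j assume "j \<in> J"
      have "(\<lambda>n. X n (real j / N)) \<longlonglongrightarrow> x (real j / N)" by (rule conv) auto
      from tendstoD[OF this, of "e / 2"] show "\<forall>\<^sub>F n in sequentially. \<bar>X n (real j / N) - x (real j / N)\<bar> < e / 2"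
        using e by (simp add: dist_real_def)
    qed
  qed
  then show ?thesis
  proof eventually_elim
    case (elim n)
    show ?case
    proof
      fix t assume t: "t \<in> {0..T}"
      define j where "j = nat \<lfloor>t * N\<rfloor>"
      have j: "real j \<le> t * N" "t * N < real j + 1" using t by (auto simp: j_def)
      have a: "real j / N \<le> t" "t \<le> real (Suc j) / N" using j N by (auto simp: field_simps)
      have "j \<le> nat \<lfloor>T * N\<rfloor>" unfolding j_def using t by (intro nat_mono floor_mono mult_right_mono) auto
      then have J: "j \<in> J" "Suc j \<in> J" by (auto simp: J_def)
      have d: "real (Suc j) / N - real j / N = inverse (real N)" using N by (simp add: field_simps)
      have r: "real j / N \<in> {0..T+1}" "real (Suc j) / N \<in> {0..T+1}" "t \<in> {0..T+1}" using a d N t by auto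
      have "dist t (real j / N) < \<delta>" "dist t (real (Suc j) / N) < \<delta>" using a d N by (auto simp: dist_real_def)
      then have "\<bar>x t - x (real j / N)\<bar> < e / 2" "\<bar>x t - x (real (Suc j) / N)\<bar> < e / 2"
        using \<delta>(2) r by (auto simp: dist_real_def)
      moreover have "X n (real j / N) \<le> X n t" "X n t \<le> X n (real (Suc j) / N)" using a t by (auto intro!: mono)
      moreover note elim[rule_format, OF J(1)] elim[rule_format, OF J(2)]
      ultimately show "\<bar>X n t - x t\<bar> < e" unfolding abs_less_iff by linarith
    qed
  qed
qed

section \<open>Fluid limit along good paths\<close>

lemma continuous_on_LBINT_upto:
  fixes f :: "real \<Rightarrow> real"
  assumes "set_integrable lborel {0..T} f"
  shows "continuous_on {0..T} (\<lambda>t. LBINT u:{0..t}. f u)"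
proof -
  have i: "set_integrable lborel {0..t} f" if "t \<le> T" for t
    by (rule set_integrable_subset[OF assms]) (use that in auto)
  have "f integrable_on {0..T}" using set_borel_integral_eq_integral(1)[OF assms] .
  then have "continuous_on {0..T} (\<lambda>t. integral {0..t} f)" by (rule indefinite_integral_continuous_1)
  then show ?thesis
    by (rule continuous_on_eq) (simp add: set_borel_integral_eq_integral(2)[OF i])
qed

lemma continuous_on_atLeast_LBINT_upto:
  fixes f :: "real \<Rightarrow> real"
  assumes "\<And>T. 0 \<le> T \<Longrightarrow> set_integrable lborel {0..T} f"
  shows "continuous_on {0..} (\<lambda>t. LBINT u:{0..t}. f u)"
  unfolding continuous_on_eq_continuous_within
proof
  fix t :: real assume t: "t \<in> {0..}"
  have "continuous (at t within {0..t+1}) (\<lambda>t. LBINT u:{0..t}. f u)"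
    using continuous_on_LBINT_upto[OF assms, of "t + 1"] t by (auto simp: continuous_on_eq_continuous_within)
  moreover have "at t within {0..t+1} = at t within {0..}"
    by (rule at_within_nhd[of _ "{..<t+1}"]) auto
  ultimately show "continuous (at t within {0..}) (\<lambda>t. LBINT u:{0..t}. f u)" by simp
qed

text \<open>The value 0 at negative times, here and for the losses, makes the function monotone on
  the whole line whatever \<open>a\<close> does there; this gives Borel measurability for the
  convolutions.\<close>

definition accepted_upto where
  "accepted_upto n a n0 r s t =
     (if t < 0 then 0 else real (card (admitted n n0 r (arrival_time a) s (a t))))"

definition lost_upto where
  "lost_upto n a n0 r s t =
     (if t < 0 then 0 else real (card ({..<a t} - admitted n n0 r (arrival_time a) s (a t))))"

lemma accepted_plus_lost:
  assumes "0 \<le> t" shows "accepted_upto n a n0 r s t + lost_upto n a n0 r s t = real (a t)"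
proof -
  have "card (admitted n n0 r (arrival_time a) s (a t)) + card ({..<a t} - admitted n n0 r (arrival_time a) s (a t)) = card {..<a t}"
    using admitted_subset[of n n0 r "arrival_time a" s "a t"] by (subst card_Un_disjoint[symmetric]) (auto simp: Un_absorb1)
  then show ?thesis using assms by (simp add: accepted_upto_def lost_upto_def flip: of_nat_add)
qed

lemma mono_lost_upto:
  assumes a: "counting_path a" shows "mono (lost_upto n a n0 r s)"
proof (rule monoI)
  fix t u :: real assume "t \<le> u"
  show "lost_upto n a n0 r s t \<le> lost_upto n a n0 r s u"
    using card_lost_split[OF counting_path_mono[OF a _ \<open>t \<le> u\<close>], of n n0 r "arrival_time a" s] \<open>t \<le> u\<close>
    by (auto simp: lost_upto_def)
qed

lemma mono_accepted_upto:
  assumes a: "counting_path a" shows "mono (accepted_upto n a n0 r s)"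
proof (rule monoI)
  fix t u :: real assume tu: "t \<le> u"
  show "accepted_upto n a n0 r s t \<le> accepted_upto n a n0 r s u"
  proof (cases "t < 0")
    case False
    then have "admitted n n0 r (arrival_time a) s (a t) \<subseteq> admitted n n0 r (arrival_time a) s (a u)"
      using admitted_Int_lessThan[OF counting_path_mono[OF a _ tu], of n n0 r "arrival_time a" s] by auto
    then have "card (admitted n n0 r (arrival_time a) s (a t)) \<le> card (admitted n n0 r (arrival_time a) s (a u))"
      by (intro card_mono) auto
    then show ?thesis using False tu by (simp add: accepted_upto_def)
  qed (simp add: accepted_upto_def)
qed

lemma lost_upto_increment_le:
  assumes a: "counting_path a" and t: "0 \<le> t" "t \<le> u"
  shows "lost_upto n a n0 r s u - lost_upto n a n0 r s t \<le> real (a u) - real (a t)"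
  using accepted_plus_lost[of t n a n0 r s] accepted_plus_lost[of u n a n0 r s] monoD[OF mono_accepted_upto[OF a] t(2), of n n0 r s] t
  by linarith

lemma counting_path_0: "counting_path a \<Longrightarrow> a 0 = 0"
  by (simp add: counting_path_def)

section \<open>The occupancy as accepted arrivals minus a convolution\<close>

context service_density
begin

text \<open>The survival function of the law with density \<open>g\<close>; at a negative argument
  the integral is empty and the value is 1.\<close>

definition tail :: "real \<Rightarrow> real" where "tail c = 1 - (LBINT v:{0..c}. g v)"

lemma continuous_on_tail: "continuous_on A tail"
proof -
  have 1: "continuous_on {0..} (\<lambda>t. LBINT u:{0..t}. g u)"
    by (intro continuous_on_atLeast_LBINT_upto g_integrable_upto)
  have "continuous_on UNIV (\<lambda>c. 1 - (LBINT u:{0..max 0 c}. g u))"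
    by (intro continuous_intros continuous_on_compose2[OF 1]) auto
  moreover have "tail c = 1 - (LBINT u:{0..max 0 c}. g u)" for c
  proof (cases "c \<ge> 0")
    case True then show ?thesis by (simp add: tail_def max_def)
  next
    case False
    have "(LBINT u:{0}. g u) = 0"
      unfolding set_lebesgue_integral_def
      by (rule integral_eq_zero_AE, rule AE_mp[OF AE_lborel_singleton[of 0]]) (auto simp: indicator_def)
    then show ?thesis using False by (simp add: tail_def max_def set_lebesgue_integral_def)
  qed
  ultimately have "continuous_on UNIV tail" by (simp add: fun_eq_iff[symmetric])
  then show ?thesis by (rule continuous_on_subset) simp
qed

lemma tail_antimono: "c \<le> d \<Longrightarrow> tail d \<le> tail c"
  unfolding tail_def set_lebesgue_integral_def
  using g_integrable_upto g_nonneg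
  by (intro diff_left_mono integral_mono) (auto simp: set_integrable_def indicator_def)

lemma tail_bounds: "0 \<le> tail c" "tail c \<le> 1"
  using g_integral_upto_le[of c] g_nonneg
  by (auto simp: tail_def set_lebesgue_integral_def intro!: Bochner_Integration.integral_nonneg)

text \<open>Integration by parts for a step function: \<open>1 - tail (t - arrival_time a i)\<close>
  is the integral of \<open>g v\<close> over \<open>v \<le> t - arrival_time a i\<close>, and the
  customers satisfying this inequality for a given \<open>v\<close> are those accepted up to
  \<open>t - v\<close>. Exchanging sum and integral produces the convolution.\<close>

lemma sum_tail_admitted:
  assumes a: "counting_path a" and t: "0 \<le> t"
  shows "(\<Sum>i\<in>admitted n n0 r (arrival_time a) s (a t). tail (t - arrival_time a i))
    = accepted_upto n a n0 r s t - conv_upto g (accepted_upto n a n0 r s) t"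
proof -
  let ?A = "admitted n n0 r (arrival_time a) s (a t)" and ?\<tau> = "arrival_time a"
  have iA: "i < a t" if "i \<in> ?A" for i using that admitted_subset[of n n0 r "arrival_time a" s "a t"] by auto
  have acc: "accepted_upto n a n0 r s (t - v) = (\<Sum>i\<in>?A. of_bool (v \<le> t - ?\<tau> i))" if "v \<in> {0..t}" for v
  proof -
    have v: "0 \<le> t - v" "t - v \<le> t" using that by auto
    have "admitted n n0 r ?\<tau> s (a (t - v)) = ?A \<inter> {..<a (t - v)}"
      using admitted_Int_lessThan[OF counting_path_mono[OF a v], of n n0 r ?\<tau> s] by simp
    also have "\<dots> = {i\<in>?A. v \<le> t - ?\<tau> i}"
      using arrival_time_le_iff[OF a iA t v(1)] by (auto simp: le_diff_eq add.commute)
    finally show ?thesis using v by (simp add: accepted_upto_def sum.If_cases Int_def of_bool_def)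
  qed
  have "conv_upto g (accepted_upto n a n0 r s) t = (LBINT v:{0..t}. (\<Sum>i\<in>?A. g v * of_bool (v \<le> t - ?\<tau> i)))"
    unfolding conv_upto_def by (intro set_lebesgue_integral_cong) (auto simp: acc sum_distrib_left)
  also have "\<dots> = (\<Sum>i\<in>?A. (LBINT v:{0..t}. g v * of_bool (v \<le> t - ?\<tau> i)))"
    unfolding set_lebesgue_integral_def scaleR_sum_right
  proof (rule Bochner_Integration.integral_sum)
    fix i
    have "set_integrable lborel {0..t} (\<lambda>v. g v * of_bool (v \<le> t - ?\<tau> i))"
      by (rule set_integrable_bound[OF g_integrable_upto[of t]]) (auto simp: set_borel_measurable_def g_nonneg)
    then show "integrable lborel (\<lambda>v. indicator {0..t} v *\<^sub>R (g v * of_bool (v \<le> t - ?\<tau> i)))"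
      by (simp add: set_integrable_def)
  qed
  also have "\<dots> = (\<Sum>i\<in>?A. 1 - tail (t - ?\<tau> i))"
  proof (intro sum.cong refl)
    fix i assume "i \<in> ?A"
    then have "0 \<le> ?\<tau> i" by (intro arrival_time_nonneg[where a=a, OF iA t])
    then show "(LBINT v:{0..t}. g v * of_bool (v \<le> t - ?\<tau> i)) = 1 - tail (t - ?\<tau> i)"
      unfolding tail_def set_lebesgue_integral_def
      by (simp, intro Bochner_Integration.integral_cong) (auto simp: indicator_def)
  qed
  finally show ?thesis using t by (simp add: sum_subtractf accepted_upto_def)
qed

text \<open>Each accepted customer still present is replaced by the survival probability at its age,
  which leads to the convolution term; the last sum is the centred fluctuation, to be shown small
  relative to \<open>n\<close>.\<close>

lemma busy_servers_decomposition:
  assumes a: "counting_path a" and t: "0 \<le> t"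
  shows "real (busy_servers n a n0 r s t) = real (card {j. j < n0 \<and> t < r j})
     + (accepted_upto n a n0 r s t - conv_upto g (accepted_upto n a n0 r s) t)
     + (\<Sum>i\<in>admitted n n0 r (arrival_time a) s (a t). of_bool (t < arrival_time a i + s i) - tail (t - arrival_time a i))"
  by (simp add: sum_subtractf sum_tail_admitted[OF assms] busy_servers_def of_bool_def sum.If_cases Int_def)

end

text \<open>A loss needs \<open>n\<close> customers present, some of whom may have arrived at the
  very same epoch. Stepping back slightly from the epoch costs at most the arrivals in between: two
  errors of approximating \<open>a\<close> by \<open>Lam\<close> and one oscillation of the
  continuous \<open>Lam\<close>, hence \<open>3 * d\<close>. The second conclusion finds such a
  nearly full time after \<open>p\<close> if a loss occurs after \<open>p\<close>.\<close>

lemma almost_reflected_losses: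
  fixes Lam :: "real \<Rightarrow> real"
  assumes a: "counting_path a" and n: "n \<ge> 1" and n0: "n0 \<le> n" and d: "0 < d"
    and Lam: "continuous_on {0..} Lam"
    and close: "\<And>t. t \<in> {0..T} \<Longrightarrow> \<bar>real (a t) / n - Lam t\<bar> \<le> d"
    and t: "t \<in> {0..T}" and lost: "lost_upto n a n0 r s t \<noteq> 0"
  shows "\<exists>u\<in>{0..t}. real (busy_servers n a n0 r s u) / n \<ge> 1 - 3 * d \<and> lost_upto n a n0 r s t / n \<le> lost_upto n a n0 r s u / n + 3 * d"
    and "\<And>p. p \<in> {0..t} \<Longrightarrow> lost_upto n a n0 r s p < lost_upto n a n0 r s t \<Longrightarrow>
        \<exists>u\<in>{p..t}. real (busy_servers n a n0 r s u) / n \<ge> 1 - 3 * d"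
proof -
  let ?\<tau> = "arrival_time a" and ?L = "\<lambda>K. card ({..<K} - admitted n n0 r (arrival_time a) s K)"
  have t0: "0 \<le> t" "t \<le> T" using t by auto
  \<comment> \<open>The time is taken just before the epoch, not earlier than \<open>p\<close> and
    within the continuity radius of \<open>Lam\<close>.\<close>
  have near: "\<exists>u. p \<le> u \<and> u < ?\<tau> k \<and> real (a (?\<tau> k)) / n - real (a u) / n \<le> 3 * d"
    if k: "k < a t" and p: "0 \<le> p" "p < ?\<tau> k" for k p
  proof -
    have \<tau>t: "?\<tau> k \<le> t" using arrival_time_le_iff[OF a k t0(1) t0(1)] k by simp
    have "continuous (at (?\<tau> k) within {0..}) Lam"
      using Lam p by (auto simp: continuous_on_eq_continuous_within)
    then obtain \<delta> where \<delta>: "\<delta> > 0" "\<And>u. u \<in> {0..} \<Longrightarrow> dist u (?\<tau> k) < \<delta> \<Longrightarrow> dist (Lam u) (Lam (?\<tau> k)) < d"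
      using d unfolding continuous_within_eps_delta by blast
    define u where "u = max p (?\<tau> k - \<delta> / 2)"
    have u: "p \<le> u" "u < ?\<tau> k" "0 \<le> u" "dist u (?\<tau> k) < \<delta>" using p \<delta>(1) by (auto simp: u_def dist_real_def)
    have "Lam (?\<tau> k) - Lam u < d" using \<delta>(2)[of u] u by (auto simp: dist_real_def)
    moreover have "\<bar>real (a u) / n - Lam u\<bar> \<le> d" using u \<tau>t t0 by (intro close) auto
    moreover have "\<bar>real (a (?\<tau> k)) / n - Lam (?\<tau> k)\<bar> \<le> d" using p \<tau>t t0 by (intro close) auto
    ultimately have "real (a (?\<tau> k)) / n - real (a u) / n \<le> 3 * d" by linarith
    then show ?thesis using u by blast
  qed
  have full: "real (busy_servers n a n0 r s u) / n \<ge> 1 - 3 * d"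
    if k: "k < a t" "k \<notin> admitted n n0 r ?\<tau> s (Suc k)" and u: "0 \<le> u" "u < ?\<tau> k" "real (a (?\<tau> k)) / n - real (a u) / n \<le> 3 * d" for k u
  proof -
    have "n + a u \<le> busy_servers n a n0 r s u + k"
      by (rule busy_before_lost_arrival(2)[OF a k(1) t0(1) k(2) u(1,2)])
    moreover have "k < a (?\<tau> k)" using arrival_time_le_iff[OF a k(1) t0(1), of "?\<tau> k"] arrival_time_nonneg[where a=a, OF k(1) t0(1)] by simp
    ultimately have "n + a u \<le> busy_servers n a n0 r s u + a (?\<tau> k)" by simp
    then have "real n + real (a u) \<le> real (busy_servers n a n0 r s u) + real (a (?\<tau> k))"
      by (simp flip: of_nat_add)
    then have "(real n + real (a u)) / n \<le> (real (busy_servers n a n0 r s u) + real (a (?\<tau> k))) / n"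
      by (rule divide_right_mono) simp
    then show ?thesis using u(3) n by (simp add: add_divide_distrib)
  qed
  \<comment> \<open>From here on \<open>k\<close> plays the role of the last customer lost up to
    time \<open>t\<close>.\<close>
  have "{..<a t} - admitted n n0 r ?\<tau> s (a t) \<noteq> {}"
    using lost t0 unfolding lost_upto_def by (metis card.empty of_nat_0)
  then obtain k where k: "k < a t" "k \<notin> admitted n n0 r ?\<tau> s (Suc k)"
    "\<And>m. m \<le> k \<Longrightarrow> ?L (a t) \<le> ?L m + (Suc k - m)" by (rule last_lost) (rule that; assumption)
  have ka: "k < a (?\<tau> k)" using arrival_time_le_iff[OF a k(1) t0(1), of "?\<tau> k"] arrival_time_nonneg[where a=a, OF k(1) t0(1)] by simp
  have \<tau>t: "?\<tau> k \<le> t" using arrival_time_le_iff[OF a k(1) t0(1) t0(1)] k by simp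
  {
    obtain u where u: "0 \<le> u" "u < ?\<tau> k" "real (a (?\<tau> k)) / n - real (a u) / n \<le> 3 * d"
      using near[OF k(1), of 0] arrival_time_pos[OF a k(1) t0(1)] by auto
    have au: "a u \<le> k" by (rule busy_before_lost_arrival(1)[OF a k(1) t0(1) k(2) u(1,2)])
    have "?L (a t) + a u \<le> ?L (a u) + a (?\<tau> k)" using k(3)[OF au] ka au by simp
    then have "real (?L (a t)) + real (a u) \<le> real (?L (a u)) + real (a (?\<tau> k))" by (simp flip: of_nat_add)
    then have "(real (?L (a t)) + real (a u)) / n \<le> (real (?L (a u)) + real (a (?\<tau> k))) / n"
      by (rule divide_right_mono) simp
    then have "lost_upto n a n0 r s t / n \<le> lost_upto n a n0 r s u / n + 3 * d"
      using u t0 by (simp add: lost_upto_def add_divide_distrib)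
    with full[OF k(1,2) u] show "\<exists>u\<in>{0..t}. real (busy_servers n a n0 r s u) / n \<ge> 1 - 3 * d \<and> lost_upto n a n0 r s t / n \<le> lost_upto n a n0 r s u / n + 3 * d"
      using u \<tau>t by (intro bexI[of _ u]) auto
  }
  {
    fix p assume p: "p \<in> {0..t}" and lt: "lost_upto n a n0 r s p < lost_upto n a n0 r s t"
    \<comment> \<open>If customer \<open>k\<close> had arrived by \<open>p\<close>, all losses up to
      \<open>t\<close> would already be counted at \<open>p\<close>.\<close>
    have "p < ?\<tau> k"
    proof (rule ccontr)
      assume "\<not> p < ?\<tau> k"
      then have "k < a p" using arrival_time_le_iff[OF a k(1) t0(1), of p] p by auto
      have "?L (a t) \<le> ?L k + 1" using k(3)[of k] by simp
      also have "?L k + 1 \<le> ?L (a p)"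
      proof -
        have "k \<in> {k..<a p} - admitted n n0 r ?\<tau> s (a p)" using \<open>k < a p\<close> k(2) by (simp add: in_admitted_iff[of k "a p"])
        then have "card ({k..<a p} - admitted n n0 r ?\<tau> s (a p)) > 0" by (subst card_gt_0_iff) auto
        then show ?thesis using card_lost_split[of k "a p" n n0 r ?\<tau> s] \<open>k < a p\<close> by simp
      qed
      finally show False using lt p t0 by (simp add: lost_upto_def)
    qed
    with near[OF k(1), of p] p obtain u where u: "p \<le> u" "u < ?\<tau> k" "real (a (?\<tau> k)) / n - real (a u) / n \<le> 3 * d" by auto
    show "\<exists>u\<in>{p..t}. real (busy_servers n a n0 r s u) / n \<ge> 1 - 3 * d"
      using full[OF k(1,2) _ u(2,3)] u \<tau>t p by (intro bexI[of _ u]) auto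
  }
qed

section \<open>Convergence along good paths\<close>

locale reflected_limit = service_density +
  fixes Lam q :: "real \<Rightarrow> real" and T :: real
  assumes Lam_mono: "mono Lam" and Lam_0: "\<And>t. t \<le> 0 \<Longrightarrow> Lam t = 0" and Lam_cont: "continuous_on {0..} Lam"
    and q_cont: "continuous_on {0..} q" and T: "0 < T"
begin

definition good_paths ::
    "(nat \<Rightarrow> real \<Rightarrow> nat) \<Rightarrow> (nat \<Rightarrow> nat) \<Rightarrow> (nat \<Rightarrow> nat \<Rightarrow> real) \<Rightarrow> (nat \<Rightarrow> nat \<Rightarrow> real) \<Rightarrow> bool" where
  "good_paths a n0 r s \<longleftrightarrow>
    (\<forall>n\<ge>1. counting_path (a n) \<and> n0 n \<le> n) \<and>
    (\<forall>p\<in>\<rat>. 0 \<le> p \<longrightarrow> (\<lambda>n. real (a n p) / n) \<longlonglongrightarrow> Lam p) \<and>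
    (\<forall>p\<in>\<rat>. 0 \<le> p \<longrightarrow> (\<lambda>n. real (card {j. j < n0 n \<and> p < r n j}) / n) \<longlonglongrightarrow> q p) \<and>
    (\<forall>p\<in>\<rat>. \<forall>p'\<in>\<rat>. \<forall>c\<in>\<rat>. 0 \<le> p \<longrightarrow> p \<le> p' \<longrightarrow>
      (\<lambda>n. (\<Sum>i\<in>{i\<in>admitted n (n0 n) (r n) (arrival_time (a n)) (s n) (a n p'). a n p \<le> i}.
          of_bool (c < s n i) - tail c) / n) \<longlonglongrightarrow> 0)"

lemma good_paths_uniform:
  fixes e :: real
  assumes "good_paths a n0 r s" "0 < e"
  shows "\<forall>\<^sub>F n in sequentially. \<forall>t\<in>{0..S}. \<bar>real (a n t) / n - Lam t\<bar> < e"
    and "\<forall>\<^sub>F n in sequentially. \<forall>t\<in>{0..S}. \<bar>real (card {j. j < n0 n \<and> t < r n j}) / n - q t\<bar> < e"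
proof -
  \<comment> \<open>Index 0 is replaced by the zero function, because counting paths are guaranteed
    from index 1 on.\<close>
  let ?X = "\<lambda>n t. if n = 0 then 0 else real (a n t) / n"
  have "\<forall>\<^sub>F n in sequentially. \<forall>t\<in>{0..S}. \<bar>?X n t - Lam t\<bar> < e"
  proof (rule mono_imp_uniform_convergence[OF _ Lam_cont _ \<open>0 < e\<close>])
    fix n and u t :: real assume "0 \<le> u" "u \<le> t"
    then show "?X n u \<le> ?X n t" using assms(1) counting_path_mono[of "a n" u t]
      by (auto simp: good_paths_def divide_right_mono)
  next
    fix p :: real assume "p \<in> \<rat>" "0 \<le> p"
    then have "(\<lambda>n. real (a n p) / n) \<longlonglongrightarrow> Lam p" using assms by (auto simp: good_paths_def)
    then show "(\<lambda>n. ?X n p) \<longlonglongrightarrow> Lam p"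
      by (rule Lim_transform_eventually) (auto intro: eventually_mono[OF eventually_gt_at_top[of 0]])
  qed
  with eventually_gt_at_top[of 0] show "\<forall>\<^sub>F n in sequentially. \<forall>t\<in>{0..S}. \<bar>real (a n t) / n - Lam t\<bar> < e"
    by eventually_elim simp
  \<comment> \<open>The number of remaining initial customers decreases in time, so the criterion
    for monotone paths is applied to its negative.\<close>
  let ?Q = "\<lambda>n t. real (card {j. j < n0 n \<and> t < r n j}) / n"
  have "\<forall>\<^sub>F n in sequentially. \<forall>t\<in>{0..S}. \<bar>- ?Q n t - - q t\<bar> < e"
  proof (rule mono_imp_uniform_convergence[OF _ _ _ \<open>0 < e\<close>])
    fix n and u t :: real assume "0 \<le> u" "u \<le> t"
    then have "card {j. j < n0 n \<and> t < r n j} \<le> card {j. j < n0 n \<and> u < r n j}"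
      by (intro card_mono) auto
    then show "- ?Q n u \<le> - ?Q n t" by (simp add: divide_right_mono)
  next
    show "continuous_on {0..} (\<lambda>x. - q x)" by (intro continuous_intros q_cont)
    fix p :: real assume "p \<in> \<rat>" "0 \<le> p"
    then have "(\<lambda>n. ?Q n p) \<longlonglongrightarrow> q p" using assms by (auto simp: good_paths_def)
    then show "(\<lambda>n. - ?Q n p) \<longlonglongrightarrow> - q p" by (intro tendsto_minus) auto
  qed
  then show "\<forall>\<^sub>F n in sequentially. \<forall>t\<in>{0..S}. \<bar>?Q n t - q t\<bar> < e"
    by eventually_elim (auto simp: abs_minus_commute)
qed

text \<open>The threshold \<open>t - arrival_time (a n) i\<close> varies with the customer, whereas
  good paths control fixed rational thresholds. Arrivals are therefore grouped into cells of length
  \<open>h\<close>: within a cell the age varies by at most \<open>2 * h\<close>, so the centred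
  indicator is squeezed between those at two grid thresholds, up to the oscillation of
  \<open>tail\<close>. The incomplete last cell is bounded by the number of its arrivals.\<close>

lemma good_paths_residual:
  fixes e :: real
  assumes gp: "good_paths a n0 r s" and e: "0 < e"
  shows "\<forall>\<^sub>F n in sequentially. \<forall>t\<in>{0..T}.
    \<bar>\<Sum>i\<in>admitted n (n0 n) (r n) (arrival_time (a n)) (s n) (a n t).
       of_bool (t < arrival_time (a n) i + s n i) - tail (t - arrival_time (a n) i)\<bar> \<le> e * n"
proof -
  let ?A = "\<lambda>n t. admitted n (n0 n) (r n) (arrival_time (a n)) (s n) (a n t)"
  \<comment> \<open>The final estimate is \<open>b * (Lam (T + 1) + b + 4) * n\<close>: one
    \<open>b\<close> from the fluctuations of all cells together, \<open>Lam (T + 1) + b\<close>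
    from the number of customers, 3 from the last cell. As \<open>b \<le> 1\<close>, it stays below
    \<open>e * n\<close>.\<close>
  define b where "b = min 1 (e / (Lam (T + 1) + 6))"
  have LT: "0 \<le> Lam (T + 1)" using monoD[OF Lam_mono, of 0 "T+1"] T by (simp add: Lam_0)
  have "b \<le> e / (Lam (T + 1) + 6)" by (simp add: b_def)
  then have b: "b * (Lam (T + 1) + 6) \<le> e" "0 < b" "b \<le> 1"
    using LT by (simp add: pos_le_divide_eq) (use e LT in \<open>simp_all add: b_def\<close>)
  note b = b(2,3,1)
  have "uniformly_continuous_on {-3..T+3} tail" "uniformly_continuous_on {0..T+1} Lam"
    by (rule compact_uniformly_continuous continuous_on_tail continuous_on_subset[OF Lam_cont]; auto)+
  then obtain \<delta> \<delta>' where \<delta>: "\<delta> > 0" "\<And>x y. x \<in> {-3..T+3} \<Longrightarrow> y \<in> {-3..T+3} \<Longrightarrow> dist y x < \<delta> \<Longrightarrow> dist (tail y) (tail x) < b"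
    and \<delta>': "\<delta>' > 0" "\<And>x y. x \<in> {0..T+1} \<Longrightarrow> y \<in> {0..T+1} \<Longrightarrow> dist y x < \<delta>' \<Longrightarrow> dist (Lam y) (Lam x) < b"
    unfolding uniformly_continuous_on_def using b(1) by (elim allE[of _ b]) blast
  obtain N :: nat where N: "N > 0" "inverse (real N) < min (min (\<delta> / 3) \<delta>') 1"
    using ex_inverse_of_nat_less[of "min (min (\<delta> / 3) \<delta>') 1"] \<delta>(1) \<delta>'(1) by auto
  define h where "h = inverse (real N)"
  have h: "0 < h" "h < \<delta> / 3" "h < \<delta>'" "h < 1" "h \<in> \<rat>" using N by (auto simp: h_def)
  define m where "m = nat \<lceil>T / h\<rceil>"
  have m: "m > 0" using T h by (simp add: m_def)
  \<comment> \<open>The grid thresholds, as multiples of \<open>h\<close>, that can arise from cells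
    before the one containing \<open>t\<close>.\<close>
  define J where "J = {-1..int m + 1}"
  define C where "C n j = {i \<in> ?A n (real (Suc j) * h). a n (real j * h) \<le> i}" for n j
  have "\<forall>\<^sub>F n in sequentially. \<forall>j\<in>{..<m}. \<forall>c\<in>J.
      \<bar>(\<Sum>i\<in>C n j. of_bool (of_int c * h < s n i) - tail (of_int c * h)) / n\<bar> < b / m"
  proof (intro eventually_ball_finite ballI)
    fix j and c :: int
    have "(\<lambda>n. (\<Sum>i\<in>C n j. of_bool (of_int c * h < s n i) - tail (of_int c * h)) / n) \<longlonglongrightarrow> 0"
      using gp h unfolding good_paths_def C_def by (elim conjE) (auto intro!: Rats_mult mult_right_mono)
    from tendstoD[OF this, of "b / m"] b m show "\<forall>\<^sub>F n in sequentially. \<bar>(\<Sum>i\<in>C n j. of_bool (of_int c * h < s n i) - tail (of_int c * h)) / n\<bar> < b / m"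
      by (simp add: dist_real_def)
  qed (auto simp: J_def)
  with good_paths_uniform(1)[OF gp b(1), of "T + 1"] eventually_ge_at_top[of 1] show ?thesis
  proof eventually_elim
    case (elim n)
    have cp: "counting_path (a n)" using gp elim(2) by (auto simp: good_paths_def)
    have n: "real n > 0" using elim(2) by simp
    let ?\<tau> = "arrival_time (a n)"
    show ?case
    proof
      fix t assume t: "t \<in> {0..T}"
      show "\<bar>\<Sum>i\<in>?A n t. of_bool (t < ?\<tau> i + s n i) - tail (t - ?\<tau> i)\<bar> \<le> e * n"
      proof (cases "t = 0")
        case True
        then show ?thesis using counting_path_0[OF cp] e by simp
      next
        case False
        then have t0: "0 < t" "0 \<le> t" "t \<le> T" using t by auto
        \<comment> \<open>The cell with \<open>l * h < t \<le> (l + 1) * h\<close>. Cells are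
          left-open, because customers counted at the right end but not at the left end have their
          epochs in such a cell.\<close>
        define l where "l = nat (\<lceil>t / h\<rceil> - 1)"
        have "0 < \<lceil>t / h\<rceil>" using t0 h by simp
        then have lr: "real l = of_int \<lceil>t / h\<rceil> - 1" by (simp add: l_def)
        have "of_int \<lceil>t / h\<rceil> - 1 < t / h" "t / h \<le> of_int \<lceil>t / h\<rceil>" by linarith+
        then have "(of_int \<lceil>t / h\<rceil> - 1) * h < t" "t \<le> of_int \<lceil>t / h\<rceil> * h"
          using h by (simp_all only: pos_less_divide_eq pos_divide_le_eq)
        then have l: "real l * h < t" "t \<le> real (Suc l) * h" by (simp_all add: lr)
        have "t / h \<le> T / h" using t0 h by (simp add: divide_right_mono)
        then have "\<lceil>t / h\<rceil> \<le> \<lceil>T / h\<rceil>" by (rule ceiling_mono)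
        then have lm: "l < m" using \<open>0 < \<lceil>t / h\<rceil>\<close> unfolding l_def m_def by linarith
        have le_t: "real j * h \<le> t" if "j \<le> l" for j
        proof -
          have "real j * h \<le> real l * h" using that h by (intro mult_right_mono) auto
          then show ?thesis using l by simp
        qed
        define D where "D = {i \<in> ?A n t. a n (real l * h) \<le> i}"
        have sub: "?A n (real j * h) = ?A n t \<inter> {..<a n (real j * h)}" if "j \<le> l" for j
          by (rule admitted_Int_lessThan[symmetric]) (use counting_path_mono[OF cp _ le_t[OF that]] h in auto)
        have Cj: "C n j = {i \<in> ?A n t. a n (real j * h) \<le> i \<and> i < a n (real (Suc j) * h)}" if "j < l" for j
          unfolding C_def using sub[of "Suc j"] that by auto
        let ?f = "\<lambda>i. of_bool (t < ?\<tau> i + s n i) - tail (t - ?\<tau> i)"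
        have split: "sum ?f {i \<in> ?A n t. i < a n (real k * h)} = (\<Sum>j<k. sum ?f (C n j))" if "k \<le> l" for k
          using that
        proof (induction k)
          case 0
          then show ?case using counting_path_0[OF cp] by simp
        next
          case (Suc k)
          have mk: "a n (real k * h) \<le> a n (real (Suc k) * h)"
            using h by (intro counting_path_mono[OF cp]) (auto intro: mult_right_mono)
          have "{i \<in> ?A n t. i < a n (real (Suc k) * h)} = {i \<in> ?A n t. i < a n (real k * h)} \<union> C n k"
            unfolding Cj[OF Suc_le_lessD[OF Suc.prems]] using mk by (auto simp del: of_nat_Suc)
          moreover have "{i \<in> ?A n t. i < a n (real k * h)} \<inter> C n k = {}"
            unfolding Cj[OF Suc_le_lessD[OF Suc.prems]] by auto
          moreover have "finite (C n k)" by (simp add: C_def)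
          ultimately show ?case using Suc by (simp add: sum.union_disjoint del: of_nat_Suc)
        qed
        have "?A n t = {i \<in> ?A n t. i < a n (real l * h)} \<union> D" by (auto simp: D_def)
        then have "sum ?f (?A n t) = sum ?f ({i \<in> ?A n t. i < a n (real l * h)} \<union> D)" by simp
        also have "\<dots> = sum ?f {i \<in> ?A n t. i < a n (real l * h)} + sum ?f D"
          by (rule sum.union_disjoint) (auto simp: D_def)
        finally have decomp: "sum ?f (?A n t) = (\<Sum>j<l. sum ?f (C n j)) + sum ?f D" using split[of l] by simp
        have tail01: "0 \<le> tail x" "tail x \<le> 1" for x
          by (rule tail_bounds)+
        have f1: "\<bar>?f i\<bar> \<le> 1" for i using tail01[of "t - ?\<tau> i"] by (auto simp: of_bool_def)
        have cell: "\<bar>sum ?f (C n j)\<bar> \<le> b / m * n + b * card (C n j)" if j: "j < l" for j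
        proof -
          have \<tau>: "real j * h < ?\<tau> i" "?\<tau> i \<le> real (Suc j) * h" if "i \<in> C n j" for i
          proof -
            have i: "i < a n (real (Suc j) * h)" "\<not> i < a n (real j * h)" using that Cj[OF j] by auto
            have p: "0 \<le> real (Suc j) * h" "0 \<le> real j * h" using h by auto
            show "?\<tau> i \<le> real (Suc j) * h" using arrival_time_le_iff[OF cp i(1) p(1) p(1)] i by simp
            show "real j * h < ?\<tau> i" using arrival_time_le_iff[OF cp i(1) p(1) p(2)] i by simp
          qed
          \<comment> \<open>From \<open>l * h < t \<le> (l + 1) * h\<close> and an epoch in the cell
            from \<open>j * h\<close> to \<open>(j + 1) * h\<close>, the age lies between
            \<open>c * h\<close> and \<open>(c + 2) * h\<close>.\<close>
          define c where "c = int l - int j - 1"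
          have c: "c \<in> J" "c + 2 \<in> J" using j lm by (auto simp: c_def J_def)
          have ch: "of_int c * h = real l * h - real (Suc j) * h" "of_int (c + 2) * h = real (Suc l) * h - real j * h"
            using j by (simp_all add: c_def algebra_simps)
          have lT: "real l * h \<le> T" using l t0 by simp
          have rng: "of_int c * h \<in> {-3..T+3}" "of_int (c+2) * h \<in> {-3..T+3}"
          proof -
            have "real (Suc j) * h \<le> real l * h" using j h by (intro mult_right_mono) auto
            moreover have "real (Suc l) * h = real l * h + h" "real (Suc j) * h = real j * h + h" by (simp_all add: algebra_simps)
            moreover have "0 \<le> real j * h" "0 \<le> real (Suc j) * h" using h by auto
            ultimately show "of_int c * h \<in> {-3..T+3}" "of_int (c+2) * h \<in> {-3..T+3}"
              using h lT T unfolding ch atLeastAtMost_iff by linarith+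
          qed
          have "dist (of_int c * h) (of_int (c+2) * h) < \<delta>" using h by (simp add: dist_real_def algebra_simps)
          then have tc: "\<bar>tail (of_int c * h) - tail (of_int (c+2) * h)\<bar> < b"
            using \<delta>(2)[OF rng(2,1)] by (simp add: dist_real_def)
          have up: "?f i \<le> (of_bool (of_int c * h < s n i) - tail (of_int c * h)) + b" if "i \<in> C n j" for i
          proof -
            have "t - ?\<tau> i < of_int (c+2) * h \<or> t - ?\<tau> i = of_int (c+2) * h" using \<tau>[OF that] l unfolding ch by linarith
            then have "tail (of_int (c+2) * h) \<le> tail (t - ?\<tau> i)" by (intro tail_antimono) auto
            moreover have "of_int c * h < t - ?\<tau> i" using \<tau>[OF that] l unfolding ch by linarith
            ultimately show ?thesis using tc by (auto simp: of_bool_def)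
          qed
          have lo: "(of_bool (of_int (c+2) * h < s n i) - tail (of_int (c+2) * h)) - b \<le> ?f i" if "i \<in> C n j" for i
          proof -
            have "t - ?\<tau> i \<le> of_int (c+2) * h" using \<tau>[OF that] l unfolding ch by linarith
            moreover have "of_int c * h \<le> t - ?\<tau> i" using \<tau>[OF that] l unfolding ch by linarith
            then have "tail (t - ?\<tau> i) \<le> tail (of_int c * h)" by (rule tail_antimono)
            ultimately show ?thesis using tc by (auto simp: of_bool_def)
          qed
          have jm: "j \<in> {..<m}" using j lm by simp
          have bd: "\<bar>\<Sum>i\<in>C n j. of_bool (of_int c * h < s n i) - tail (of_int c * h)\<bar> \<le> b / m * n" if "c \<in> J" for c
          proof -
            have "\<bar>\<Sum>i\<in>C n j. of_bool (of_int c * h < s n i) - tail (of_int c * h)\<bar> / n \<le> b / m"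
              using elim(3)[rule_format, OF jm that] n by (simp only: abs_divide abs_of_nat less_imp_le)
            then show ?thesis using n by (simp only: pos_divide_le_eq)
          qed
          have "sum ?f (C n j) \<le> (\<Sum>i\<in>C n j. (of_bool (of_int c * h < s n i) - tail (of_int c * h)) + b)"
            by (intro sum_mono up)
          also have "\<dots> = (\<Sum>i\<in>C n j. of_bool (of_int c * h < s n i) - tail (of_int c * h)) + b * card (C n j)"
            by (simp add: sum.distrib)
          finally have 1: "sum ?f (C n j) \<le> b / m * n + b * card (C n j)" using bd[OF c(1)] by linarith
          have "(\<Sum>i\<in>C n j. of_bool (of_int (c+2) * h < s n i) - tail (of_int (c+2) * h)) - b * card (C n j)
              = (\<Sum>i\<in>C n j. (of_bool (of_int (c+2) * h < s n i) - tail (of_int (c+2) * h)) - b)"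
            by (simp add: sum_subtractf)
          also have "\<dots> \<le> sum ?f (C n j)" by (intro sum_mono lo)
          finally have 2: "- (b / m * n + b * card (C n j)) \<le> sum ?f (C n j)" using bd[OF c(2)] by linarith
          show ?thesis using 1 2 by linarith
        qed
        have cards: "(\<Sum>j<l. card (C n j)) \<le> a n t"
        proof -
          have "(\<Sum>j<l. card (C n j)) = card (\<Union>j<l. C n j)"
          proof (rule card_UN_disjoint[symmetric])
            have *: "C n i \<inter> C n j = {}" if "i < j" "j < l" for i j
            proof -
              have "a n (real (Suc i) * h) \<le> a n (real j * h)" using that h by (intro counting_path_mono[OF cp] mult_right_mono) auto
              then show ?thesis using that by (subst (1 2) Cj) (auto simp del: of_nat_Suc)
            qed
            then show "\<forall>i\<in>{..<l}. \<forall>j\<in>{..<l}. i \<noteq> j \<longrightarrow> C n i \<inter> C n j = {}"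
            proof (intro ballI impI)
              fix i j assume "i \<in> {..<l}" "j \<in> {..<l}" "i \<noteq> j"
              then show "C n i \<inter> C n j = {}" using *[of i j] *[of j i] by (cases "i < j") (simp_all add: Int_commute)
            qed
          qed (auto simp: C_def)
          also have "\<dots> \<le> card {..<a n t}"
            using admitted_subset[of n "n0 n" "r n" ?\<tau> "s n" "a n t"] by (intro card_mono UN_least) (auto simp: Cj simp del: of_nat_Suc)
          finally show ?thesis by simp
        qed
        have tT: "t \<in> {0..T+1}" "real l * h \<in> {0..T+1}" using t0 l h by auto
        have aLam: "real (a n t) \<le> (Lam (T+1) + b) * n"
        proof -
          have "real (a n t) / n \<le> Lam t + b" using elim(1)[rule_format, OF tT(1)] by linarith
          also have "\<dots> \<le> Lam (T+1) + b" using monoD[OF Lam_mono, of t "T+1"] t0 by simp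
          finally show ?thesis using n by (simp add: field_simps)
        qed
        \<comment> \<open>The customers of the last cell are among the arrivals since
          \<open>l * h\<close>: two approximation errors and one oscillation of
          \<open>Lam\<close>.\<close>
        have cD: "real (card D) \<le> 3 * b * n"
        proof -
          have ml: "a n (real l * h) \<le> a n t" using l h by (intro counting_path_mono[OF cp]) auto
          have "D \<subseteq> {a n (real l * h)..<a n t}"
            using admitted_subset[of n "n0 n" "r n" ?\<tau> "s n" "a n t"] by (auto simp: D_def)
          then have "card D \<le> card {a n (real l * h)..<a n t}" by (intro card_mono) auto
          then have "real (card D) \<le> real (a n t) - real (a n (real l * h))" using ml by (simp add: of_nat_diff)
          also have "\<dots> = (real (a n t) / n - real (a n (real l * h)) / n) * n" using n by (simp add: field_simps)
          also have "\<dots> \<le> 3 * b * n"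
          proof (rule mult_right_mono)
            have "dist t (real l * h) < \<delta>'" using l h by (simp add: dist_real_def algebra_simps)
            then have "\<bar>Lam t - Lam (real l * h)\<bar> < b" using \<delta>'(2)[OF tT(2,1)] by (simp add: dist_real_def)
            then show "real (a n t) / n - real (a n (real l * h)) / n \<le> 3 * b"
              using elim(1)[rule_format, OF tT(1)] elim(1)[rule_format, OF tT(2)] by linarith
          qed simp
          finally show ?thesis .
        qed
        have cc: "real (\<Sum>j<l. card (C n j)) \<le> (Lam (T+1) + b) * n"
          using cards aLam by linarith
        have "\<bar>sum ?f (?A n t)\<bar> \<le> (\<Sum>j<l. \<bar>sum ?f (C n j)\<bar>) + (\<Sum>i\<in>D. \<bar>?f i\<bar>)"
          unfolding decomp by (intro order_trans[OF abs_triangle_ineq] add_mono sum_abs)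
        also have "\<dots> \<le> (\<Sum>j<l. b / m * n + b * card (C n j)) + (\<Sum>i\<in>D. 1)"
          by (intro add_mono sum_mono cell f1) auto
        also have "\<dots> = real l * (b / m * n) + b * real (\<Sum>j<l. card (C n j)) + card D"
          by (simp add: sum.distrib sum_distrib_left)
        also have "\<dots> \<le> real m * (b / m * n) + b * ((Lam (T+1) + b) * n) + 3 * b * n"
          using lm b n cc cD by (intro add_mono mult_right_mono mult_left_mono) (auto simp del: of_nat_sum)
        also have "\<dots> = b * (Lam (T+1) + b + 4) * n" using m by (simp add: field_simps)
        also have "\<dots> \<le> b * (Lam (T+1) + 6) * n"
          using b n by (intro mult_right_mono mult_left_mono) auto
        also have "\<dots> \<le> e * n" using b n by (intro mult_right_mono) auto
        finally show ?thesis .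
      qed
    qed
  qed
qed

text \<open>The limit occupancy in the absence of blocking, that is, with infinitely many
  servers.\<close>

definition drift :: "real \<Rightarrow> real" where
  "drift t = q t + Lam t - conv_upto g Lam t"

lemma Lam_measurable [measurable]: "Lam \<in> borel_measurable borel"
  by (rule borel_measurable_mono[OF Lam_mono])

lemma mono_abs_le:
  fixes h :: "real \<Rightarrow> real"
  assumes "mono h" "u \<in> {0..t}"
  shows "\<bar>h u\<bar> \<le> \<bar>h 0\<bar> + \<bar>h t\<bar>"
  using monoD[OF assms(1), of 0 u] monoD[OF assms(1), of u t] assms(2)
  unfolding abs_le_iff atLeastAtMost_iff by linarith

text \<open>The path \<open>x\<close> is obtained by solving the occupancy identity for it, so that
  identity is exact and only the distance from \<open>drift\<close> and the last reflection clause
  need estimates. In units of \<open>d / 6\<close>, the reflection clause spends 3 on fullness and 3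
  on the losses, while the distance spends 4.\<close>

lemma good_paths_almost_reflected:
  fixes d :: real
  assumes gp: "good_paths a n0 r s" and d: "0 < d"
  shows "\<forall>\<^sub>F n in sequentially. \<exists>x. almost_reflected T d x (\<lambda>t. lost_upto n (a n) (n0 n) (r n) (s n) t / n) \<and>
    (\<forall>t\<in>{0..T}. \<bar>x t - drift t\<bar> \<le> d \<and>
      real (busy_servers n (a n) (n0 n) (r n) (s n) t) / n =
        x t - lost_upto n (a n) (n0 n) (r n) (s n) t / n + conv_upto g (\<lambda>t. lost_upto n (a n) (n0 n) (r n) (s n) t / n) t)"
proof -
  have d6: "0 < d / 6" using d by simp
  from good_paths_uniform(1)[OF gp d6, of T] good_paths_uniform(2)[OF gp d6, of T] good_paths_residual[OF gp d6] eventually_ge_at_top[of 1]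
  show ?thesis
  proof eventually_elim
    case (elim n)
    define L where "L t = lost_upto n (a n) (n0 n) (r n) (s n) t / n" for t
    define B where "B t = accepted_upto n (a n) (n0 n) (r n) (s n) t" for t
    define N where "N t = real (busy_servers n (a n) (n0 n) (r n) (s n) t) / n" for t
    define x where "x t = N t + L t - conv_upto g L t" for t
    have cp: "counting_path (a n)" and n0: "n0 n \<le> n" using gp elim(4) by (auto simp: good_paths_def)
    have n: "real n > 0" "n \<ge> 1" using elim(4) by auto
    have Lm: "mono L" using mono_lost_upto[OF cp] by (auto simp: L_def mono_def divide_right_mono)
    have Bm: "mono B" using mono_accepted_upto[OF cp] by (auto simp: B_def mono_def)
    have [measurable]: "L \<in> borel_measurable borel" "B \<in> borel_measurable borel" using Lm Bm borel_measurable_mono by blast+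
    have ar: "almost_reflected T d x L"
      unfolding almost_reflected_def
    proof (intro conjI ballI)
      show "mono L" by fact
      fix t assume t: "t \<in> {0..T}"
      show "0 \<le> L t" by (simp add: L_def lost_upto_def)
      have "N t \<le> 1" using busy_servers_le[OF cp n0, of t "r n" "s n"] t n by (simp add: N_def)
      then show "x t + conv_upto g L t - 1 \<le> L t" by (simp add: x_def)
      show "L t \<le> d \<or> (\<exists>u\<in>{0..t}. L t \<le> x u + conv_upto g L u - 1 + d)"
      proof (cases "lost_upto n (a n) (n0 n) (r n) (s n) t = 0")
        case True
        then show ?thesis using d by (simp add: L_def)
      next
        case False
        have "\<exists>u\<in>{0..t}. N u \<ge> 1 - 3 * (d / 6) \<and> L t \<le> L u + 3 * (d / 6)"
          unfolding N_def L_def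
          by (rule almost_reflected_losses(1)[OF cp n(2) n0 d6 Lam_cont _ t False]) (use elim(1) in \<open>auto intro: less_imp_le\<close>)
        then obtain u where "u \<in> {0..t}" "N u \<ge> 1 - 3 * (d / 6)" "L t \<le> L u + 3 * (d / 6)" by blast
        then show ?thesis by (intro disjI2 bexI[of _ u]) (auto simp: x_def)
      qed
    qed
    have close: "\<bar>x t - drift t\<bar> \<le> d" if t: "t \<in> {0..T}" for t
    proof -
      \<comment> \<open>\<open>A\<close> coincides with the scaled arrivals at nonnegative times and
        is Borel on the whole line.\<close>
      define A where "A u = B u / n + L u" for u
      have [measurable]: "A \<in> borel_measurable borel" unfolding A_def[abs_def] by measurable
      have A: "A u = real (a n u) / n" if "0 \<le> u" for u
        using accepted_plus_lost[OF that, of n "a n" "n0 n" "r n" "s n"]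
        by (simp add: A_def B_def L_def add_divide_distrib[symmetric])
      have AL: "\<bar>A u - Lam u\<bar> \<le> d / 6" if "u \<in> {0..t}" for u
        using elim(1) that t A[of u] by (auto intro: less_imp_le)
      have Ab: "\<bar>A u\<bar> \<le> \<bar>Lam 0\<bar> + \<bar>Lam t\<bar> + d / 6" if "u \<in> {0..t}" for u
        using AL[OF that] mono_abs_le[OF Lam_mono that] by linarith
      have "conv_upto g (\<lambda>u. A u - L u) t = conv_upto g A t - conv_upto g L t"
        by (rule conv_diff) (auto intro!: Ab mono_abs_le[OF Lm])
      moreover have "conv_upto g (\<lambda>u. A u - L u) t = conv_upto g B t / n"
        unfolding conv_upto_def by (simp add: A_def)
      moreover have "conv_upto g (\<lambda>u. A u - Lam u) t = conv_upto g A t - conv_upto g Lam t"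
        by (rule conv_diff) (auto intro!: Ab mono_abs_le[OF Lam_mono])
      moreover have "\<bar>conv_upto g (\<lambda>u. A u - Lam u) t\<bar> \<le> d / 6"
        by (rule conv_abs_le) (use AL d in auto)
      moreover define E where "E = (\<Sum>i\<in>admitted n (n0 n) (r n) (arrival_time (a n)) (s n) (a n t).
          of_bool (t < arrival_time (a n) i + s n i) - tail (t - arrival_time (a n) i))"
      moreover define Q where "Q = real (card {j. j < n0 n \<and> t < r n j})"
      have "N t = Q / n + (B t / n - conv_upto g B t / n) + E / n"
        using busy_servers_decomposition[OF cp, of t n "n0 n" "r n" "s n"] t
        by (simp add: N_def Q_def E_def B_def[abs_def] add_divide_distrib diff_divide_distrib)
      moreover have "\<bar>E / n\<bar> \<le> d / 6" using elim(3) t n by (auto simp: E_def field_simps)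
      moreover have "\<bar>Q / n - q t\<bar> < d / 6" using elim(2) t by (auto simp: Q_def)
      moreover have "\<bar>A t - Lam t\<bar> \<le> d / 6" using AL[of t] t by auto
      moreover have "A t = B t / n + L t" by (simp add: A_def)
      ultimately show ?thesis unfolding x_def drift_def abs_le_iff abs_less_iff by linarith
    qed
    show ?case
      unfolding L_def[symmetric] N_def[symmetric]
    proof (intro exI[of _ x] conjI ballI ar)
      fix t assume t: "t \<in> {0..T}"
      show "\<bar>x t - drift t\<bar> \<le> d" by (rule close[OF t])
      show "N t = x t - L t + conv_upto g L t" by (simp add: x_def)
    qed
  qed
qed

text \<open>Two unrelated good families are compared at different indices. One family in both roles
  gives the Cauchy property; two families show that all of them share one limit.\<close>

lemma good_paths_Cauchy:
  fixes e :: real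
  assumes gp: "good_paths a n0 r s" and gp': "good_paths a' n0' r' s'" and e: "0 < e"
  shows "\<exists>M. \<forall>n\<ge>M. \<forall>m\<ge>M. \<forall>t\<in>{0..T}.
    \<bar>lost_upto n (a n) (n0 n) (r n) (s n) t / n - lost_upto m (a' m) (n0' m) (r' m) (s' m) t / m\<bar> \<le> e"
proof -
  \<comment> \<open>The paths before reflection are \<open>2 * d\<close> apart and the reflection
    error is \<open>d\<close>; this \<open>d\<close> makes the stability bound equal to
    \<open>e\<close>.\<close>
  define d where "d = e * (1 - laplace_one) / (3 * exp T)"
  have d: "0 < d" using e laplace_one_less_1 by (simp add: d_def)
  have de: "exp T * (d + 2 * d) / (1 - laplace_one) = e" using laplace_one_less_1 by (simp add: d_def)
  obtain M where M: "\<And>n. n \<ge> M \<Longrightarrow> \<exists>x. almost_reflected T d x (\<lambda>t. lost_upto n (a n) (n0 n) (r n) (s n) t / n) \<and>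
    (\<forall>t\<in>{0..T}. \<bar>x t - drift t\<bar> \<le> d)"
    using eventually_mono[OF good_paths_almost_reflected[OF gp d], of "\<lambda>n. \<exists>x. almost_reflected T d x (\<lambda>t. lost_upto n (a n) (n0 n) (r n) (s n) t / n) \<and>
    (\<forall>t\<in>{0..T}. \<bar>x t - drift t\<bar> \<le> d)"] unfolding eventually_sequentially by blast
  obtain M' where M': "\<And>n. n \<ge> M' \<Longrightarrow> \<exists>x. almost_reflected T d x (\<lambda>t. lost_upto n (a' n) (n0' n) (r' n) (s' n) t / n) \<and>
    (\<forall>t\<in>{0..T}. \<bar>x t - drift t\<bar> \<le> d)"
    using eventually_mono[OF good_paths_almost_reflected[OF gp' d], of "\<lambda>n. \<exists>x. almost_reflected T d x (\<lambda>t. lost_upto n (a' n) (n0' n) (r' n) (s' n) t / n) \<and>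
    (\<forall>t\<in>{0..T}. \<bar>x t - drift t\<bar> \<le> d)"] unfolding eventually_sequentially by blast
  show ?thesis
  proof (intro exI[of _ "max M M'"] allI impI ballI)
    fix n m t assume n: "max M M' \<le> n" and m: "max M M' \<le> m" and t: "t \<in> {0..T}"
    obtain x where x: "almost_reflected T d x (\<lambda>t. lost_upto n (a n) (n0 n) (r n) (s n) t / n)" "\<And>t. t \<in> {0..T} \<Longrightarrow> \<bar>x t - drift t\<bar> \<le> d"
      using M[of n] n by auto
    obtain y where y: "almost_reflected T d y (\<lambda>t. lost_upto m (a' m) (n0' m) (r' m) (s' m) t / m)" "\<And>t. t \<in> {0..T} \<Longrightarrow> \<bar>y t - drift t\<bar> \<le> d"
      using M'[of m] m by auto
    have xy: "\<bar>x t - y t\<bar> \<le> 2 * d" if "t \<in> {0..T}" for t using x(2)[OF that] y(2)[OF that] by linarith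
    show "\<bar>lost_upto n (a n) (n0 n) (r n) (s n) t / n - lost_upto m (a' m) (n0' m) (r' m) (s' m) t / m\<bar> \<le> e"
      using almost_reflected_stability[OF x(1) y(1) xy t] d unfolding de by auto
  qed
qed

text \<open>As \<open>h\<close> vanishes at negative arguments, the integral may be taken over the
  fixed half-line \<open>{0..}\<close>; its integrand is continuous in the time and dominated by
  \<open>g v * h S\<close>.\<close>

lemma continuous_on_conv:
  assumes h: "continuous_on UNIV h" and h0: "\<And>u. u \<le> 0 \<Longrightarrow> h u = 0" and m: "mono h"
  shows "continuous_on {0..S} (conv_upto g h)"
  unfolding continuous_on_sequentially
proof (intro allI ballI impI, elim conjE)
  fix x t assume t: "t \<in> {0..S}" and x: "\<forall>n. x n \<in> {0..S}" "x \<longlonglongrightarrow> t"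
  have [measurable]: "h \<in> borel_measurable borel" using m by (rule borel_measurable_mono)
  have eq: "conv_upto g h u = (LBINT v. indicator {0..} v * (g v * h (u - v)))" for u
    unfolding conv_upto_def set_lebesgue_integral_def
    by (rule Bochner_Integration.integral_cong) (auto simp: indicator_def h0)
  have hb: "\<bar>h u\<bar> \<le> h S" if "u \<le> S" for u
    using monoD[OF m, of "min 0 u" u] monoD[OF m that] h0[of "min 0 u"] by auto
  have "(\<lambda>n. LBINT v. indicator {0..} v * (g v * h (x n - v))) \<longlonglongrightarrow> (LBINT v. indicator {0..} v * (g v * h (t - v)))"
  proof (rule integral_dominated_convergence[where w="\<lambda>v. indicator {0..} v * (g v * h S)"])
    show "integrable lborel (\<lambda>v. indicator {0..} v * (g v * h S))"
      using set_integrable_mult_left[of "h S" lborel "{0..}" g] g_integrable by (simp add: set_integrable_def mult_ac)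
    show "AE v in lborel. (\<lambda>n. indicator {0..} v * (g v * h (x n - v))) \<longlonglongrightarrow> indicator {0..} v * (g v * h (t - v))"
      by (intro AE_I2 tendsto_intros continuous_on_tendsto_compose[OF h] x) auto
    show "AE v in lborel. norm (indicator {0..} v * (g v * h (x n - v))) \<le> indicator {0..} v * (g v * h S)" for n
    proof (intro AE_I2)
      fix v :: real
      have "x n \<le> S" using x(1) by auto
      then have "0 \<le> v \<Longrightarrow> \<bar>h (x n - v)\<bar> \<le> h S" by (intro hb) auto
      then show "norm (indicator {0..} v * (g v * h (x n - v))) \<le> indicator {0..} v * (g v * h S)"
        using g_nonneg[of v] by (auto simp: indicator_def abs_mult intro: mult_left_mono)
    qed
  qed measurable
  then show "(conv_upto g h \<circ> x) \<longlonglongrightarrow> conv_upto g h t" by (simp add: eq comp_def)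
qed

definition rho_of :: "(real \<Rightarrow> real) \<Rightarrow> real \<Rightarrow> real" where
  "rho_of L t = drift t - L t + conv_upto g L t"

text \<open>\<open>L\<close> is extracted from one good family, while the last two clauses concern
  every good family: this is the determinism of the limit. Constancy of \<open>L\<close> where
  \<open>rho_of L\<close> is below 1 expresses complementarity, and the bound on increments yields
  continuity here and a density later.\<close>

lemma reflected_limit:
  assumes gp: "good_paths a n0 r s"
  obtains L where "mono L" "\<And>t. t \<le> 0 \<Longrightarrow> L t = 0" "\<And>t. T \<le> t \<Longrightarrow> L t = L T"
    "\<And>u t. 0 \<le> u \<Longrightarrow> u \<le> t \<Longrightarrow> t \<le> T \<Longrightarrow> L t - L u \<le> Lam t - Lam u"
    "continuous_on {0..T} (rho_of L)" "\<And>t. t \<in> {0..T} \<Longrightarrow> 0 \<le> rho_of L t \<and> rho_of L t \<le> 1"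
    "\<And>u t. 0 \<le> u \<Longrightarrow> u \<le> t \<Longrightarrow> t \<le> T \<Longrightarrow> (\<And>v. v \<in> {u..t} \<Longrightarrow> rho_of L v < 1) \<Longrightarrow> L t = L u"
    "\<And>a n0 r s e. good_paths a n0 r s \<Longrightarrow> 0 < e \<Longrightarrow> \<forall>\<^sub>F n in sequentially. \<forall>t\<in>{0..T}.
        \<bar>real (busy_servers n (a n) (n0 n) (r n) (s n) t) / n - rho_of L t\<bar> \<le> e"
    "\<And>a n0 r s p. good_paths a n0 r s \<Longrightarrow> p \<in> \<rat> \<Longrightarrow> p \<in> {0..T} \<Longrightarrow>
        (\<lambda>n. accepted_upto n (a n) (n0 n) (r n) (s n) p / n) \<longlonglongrightarrow> Lam p - L p"
proof -
  define \<Lambda>l where "\<Lambda>l n t = lost_upto n (a n) (n0 n) (r n) (s n) t / n" for n t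
  \<comment> \<open>Clamping times to \<open>{0..T}\<close> makes \<open>L\<close> monotone on all
    of \<open>real\<close> and constant beyond \<open>T\<close>.\<close>
  define c where "c t = max 0 (min t T)" for t :: real
  have c: "c t \<in> {0..T}" "t \<in> {0..T} \<Longrightarrow> c t = t" for t using T by (auto simp: c_def)
  have cm: "u \<le> t \<Longrightarrow> c u \<le> c t" for u t by (auto simp: c_def)
  have "convergent (\<lambda>n. \<Lambda>l n (c t))" for t
  proof (rule Cauchy_convergent, rule metric_CauchyI)
    fix e :: real assume "0 < e"
    then have "0 < e / 2" by simp
    from good_paths_Cauchy[OF gp gp this] obtain M where M: "\<And>n m. n \<ge> M \<Longrightarrow> m \<ge> M \<Longrightarrow> \<bar>\<Lambda>l n (c t) - \<Lambda>l m (c t)\<bar> \<le> e / 2"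
      using c(1)[of t] unfolding \<Lambda>l_def by blast
    show "\<exists>M. \<forall>m\<ge>M. \<forall>n\<ge>M. dist (\<Lambda>l m (c t)) (\<Lambda>l n (c t)) < e"
    proof (intro exI[of _ M] allI impI)
      fix m n assume "M \<le> m" "M \<le> n"
      then have "\<bar>\<Lambda>l m (c t) - \<Lambda>l n (c t)\<bar> \<le> e / 2" by (rule M)
      then show "dist (\<Lambda>l m (c t)) (\<Lambda>l n (c t)) < e" using \<open>0 < e\<close> by (simp add: dist_real_def)
    qed
  qed
  define L where "L t = lim (\<lambda>n. \<Lambda>l n (c t))" for t
  have limL: "(\<lambda>n. \<Lambda>l n (c t)) \<longlonglongrightarrow> L t" for t
    using \<open>convergent (\<lambda>n. \<Lambda>l n (c t))\<close> by (simp add: L_def convergent_LIMSEQ_iff)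
  have ev1: "\<forall>\<^sub>F n in sequentially. n \<ge> 1 \<and> counting_path (a n)"
    using eventually_ge_at_top[of 1] by eventually_elim (use gp in \<open>auto simp: good_paths_def\<close>)
  have mono: "mono L"
  proof (rule monoI)
    fix u t :: real assume "u \<le> t"
    from ev1 have "\<forall>\<^sub>F n in sequentially. \<Lambda>l n (c u) \<le> \<Lambda>l n (c t)"
      by eventually_elim (use cm[OF \<open>u \<le> t\<close>] in \<open>auto simp: \<Lambda>l_def intro!: divide_right_mono monoD[OF mono_lost_upto]\<close>)
    then show "L u \<le> L t" by (intro tendsto_le[OF _ limL limL]) auto
  qed
  have L0: "L t = 0" if "t \<le> 0" for t
  proof -
    from ev1 have "\<forall>\<^sub>F n in sequentially. \<Lambda>l n (c t) = 0"
      by eventually_elim (use that T in \<open>auto simp: \<Lambda>l_def c_def lost_upto_def counting_path_0\<close>)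
    then have "(\<lambda>n. \<Lambda>l n (c t)) \<longlonglongrightarrow> 0" by (rule tendsto_eventually)
    then show ?thesis using limL LIMSEQ_unique by blast
  qed
  have LT: "L t = L T" if "T \<le> t" for t using that T by (simp add: L_def c_def)
  have unif: "\<forall>\<^sub>F n in sequentially. \<forall>t\<in>{0..T}. \<bar>lost_upto n (a' n) (n0' n) (r' n) (s' n) t / n - L t\<bar> \<le> e"
    if gp': "good_paths a' n0' r' s'" and e: "0 < e" for a' n0' r' s' and e :: real
  proof -
    from good_paths_Cauchy[OF gp' gp e] obtain M where M: "\<And>n m t. n \<ge> M \<Longrightarrow> m \<ge> M \<Longrightarrow> t \<in> {0..T} \<Longrightarrow>
        \<bar>lost_upto n (a' n) (n0' n) (r' n) (s' n) t / n - \<Lambda>l m t\<bar> \<le> e" unfolding \<Lambda>l_def by blast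
    show ?thesis
      unfolding eventually_sequentially
    proof (intro exI[of _ M] allI impI ballI)
      fix n t assume n: "M \<le> n" and t: "t \<in> {0..T}"
      have "(\<lambda>m. \<bar>lost_upto n (a' n) (n0' n) (r' n) (s' n) t / n - \<Lambda>l m t\<bar>) \<longlonglongrightarrow> \<bar>lost_upto n (a' n) (n0' n) (r' n) (s' n) t / n - L t\<bar>"
        using limL[of t] c(2)[OF t] by (intro tendsto_intros) simp
      then show "\<bar>lost_upto n (a' n) (n0' n) (r' n) (s' n) t / n - L t\<bar> \<le> e"
        by (rule tendsto_upperbound) (auto simp: eventually_sequentially intro!: exI[of _ M] M n t)
    qed
  qed
  have ratconv: "(\<lambda>n. lost_upto n (a' n) (n0' n) (r' n) (s' n) t / n) \<longlonglongrightarrow> L t"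
    if gp': "good_paths a' n0' r' s'" and t: "t \<in> {0..T}" for a' n0' r' s' t
  proof (rule tendstoI)
    fix e :: real assume "0 < e"
    then have "0 < e / 2" by simp
    from unif[OF gp' this] show "\<forall>\<^sub>F n in sequentially. dist (lost_upto n (a' n) (n0' n) (r' n) (s' n) t / n) (L t) < e"
    proof eventually_elim
      case (elim n)
      from elim t have "\<bar>lost_upto n (a' n) (n0' n) (r' n) (s' n) t / n - L t\<bar> \<le> e / 2" by blast
      then show ?case using \<open>0 < e\<close> by (simp add: dist_real_def)
    qed
  qed
  have inc: "L t - L u \<le> Lam t - Lam u" if "0 \<le> u" "u \<le> t" "t \<le> T" for u t
  proof -
    have ac: "(\<lambda>n. real (a n v) / n) \<longlonglongrightarrow> Lam v" if "v \<in> {0..T}" for v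
    proof (rule tendstoI)
      fix e :: real assume "0 < e"
      from good_paths_uniform(1)[OF gp this, of T] show "\<forall>\<^sub>F n in sequentially. dist (real (a n v) / n) (Lam v) < e"
        by eventually_elim (use that in \<open>auto simp: dist_real_def\<close>)
    qed
    from ev1 have "\<forall>\<^sub>F n in sequentially. \<Lambda>l n (c t) - \<Lambda>l n (c u) \<le> real (a n t) / n - real (a n u) / n"
    proof eventually_elim
      case (elim n)
      have "lost_upto n (a n) (n0 n) (r n) (s n) t - lost_upto n (a n) (n0 n) (r n) (s n) u \<le> real (a n t) - real (a n u)"
        using elim that by (intro lost_upto_increment_le) auto
      then have "(lost_upto n (a n) (n0 n) (r n) (s n) t - lost_upto n (a n) (n0 n) (r n) (s n) u) / n \<le> (real (a n t) - real (a n u)) / n"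
        by (rule divide_right_mono) simp
      then show ?case using that c(2)[of t] c(2)[of u] by (simp add: \<Lambda>l_def diff_divide_distrib)
    qed
    then show ?thesis
      by (intro tendsto_le[OF _ tendsto_diff[OF ac ac] tendsto_diff[OF limL limL]]) (use that in auto)
  qed
  \<comment> \<open>Increments of \<open>L\<close> are dominated by those of the continuous function
    \<open>Lam\<close> at clamped times.\<close>
  have LcU: "continuous_on UNIV L"
  proof -
    have Lam_cont': "continuous_on UNIV (\<lambda>t. Lam (c t))"
      unfolding c_def by (intro continuous_on_compose2[OF Lam_cont] continuous_intros) auto
    have le: "\<bar>L t - L u\<bar> \<le> \<bar>Lam (c t) - Lam (c u)\<bar>" for t u
    proof -
      have L: "L v = L (c v)" for v using T by (simp add: L_def c_def)
      have *: "\<bar>L t - L u\<bar> \<le> \<bar>Lam (c t) - Lam (c u)\<bar>" if "u \<le> t" for t u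
        using inc[of "c u" "c t"] monoD[OF mono that] L[of t] L[of u] cm[OF that] c(1)[of u] c(1)[of t] by auto
      show ?thesis using *[of u t] *[of t u] by (cases "u \<le> t") (auto simp: abs_minus_commute)
    qed
    show ?thesis
      unfolding continuous_on_def
    proof
      fix t :: real
      have "((\<lambda>u. Lam (c u) - Lam (c t)) \<longlongrightarrow> Lam (c t) - Lam (c t)) (at t)"
        using Lam_cont' unfolding continuous_on_def by (intro tendsto_intros) auto
      then have "((\<lambda>u. \<bar>Lam (c u) - Lam (c t)\<bar>) \<longlongrightarrow> 0) (at t)" using tendsto_rabs_zero_iff by force
      then have "((\<lambda>u. L u - L t) \<longlongrightarrow> 0) (at t)"
        by (rule Lim_null_comparison[rotated]) (use le in auto)
      then show "(L \<longlongrightarrow> L t) (at t)" by (simp add: Lim_null[symmetric])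
    qed
  qed
  have LamU: "continuous_on UNIV Lam"
  proof -
    have "continuous_on UNIV (\<lambda>t. Lam (max 0 t))"
      by (intro continuous_on_compose2[OF Lam_cont] continuous_intros) auto
    moreover have "Lam (max 0 t) = Lam t" for t using Lam_0[of t] Lam_0[of 0] by (simp add: max_def)
    ultimately show ?thesis by simp
  qed
  have rho_cont: "continuous_on {0..T} (rho_of L)"
    unfolding rho_of_def[abs_def] drift_def
    by (intro continuous_intros continuous_on_conv LcU LamU Lam_0 L0 mono Lam_mono continuous_on_subset[OF q_cont]
        continuous_on_subset[OF LcU] continuous_on_subset[OF LamU]) auto
  have busy: "\<forall>\<^sub>F n in sequentially. \<forall>t\<in>{0..T}. \<bar>real (busy_servers n (a' n) (n0' n) (r' n) (s' n) t) / n - rho_of L t\<bar> \<le> e"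
    if gp': "good_paths a' n0' r' s'" and e: "0 < e" for a' n0' r' s' and e :: real
  proof -
    have e3: "0 < e / 3" using e by simp
    from good_paths_almost_reflected[OF gp' e3] unif[OF gp' e3] show ?thesis
    proof eventually_elim
      case (elim n)
      define l where "l t = lost_upto n (a' n) (n0' n) (r' n) (s' n) t / n" for t
      obtain x where x: "almost_reflected T (e / 3) x l"
        "\<And>t. t \<in> {0..T} \<Longrightarrow> \<bar>x t - drift t\<bar> \<le> e / 3"
        "\<And>t. t \<in> {0..T} \<Longrightarrow> real (busy_servers n (a' n) (n0' n) (r' n) (s' n) t) / n = x t - l t + conv_upto g l t"
        using elim(1) unfolding l_def by blast
      have lm: "mono l" using x(1) by (simp add: almost_reflected_def)
      have [measurable]: "l \<in> borel_measurable borel" "L \<in> borel_measurable borel"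
        using lm mono borel_measurable_mono by blast+
      show ?case
      proof
        fix t assume t: "t \<in> {0..T}"
        have lL: "\<bar>l u - L u\<bar> \<le> e / 3" if "u \<in> {0..T}" for u
          using elim(2) that unfolding l_def by blast
        have "conv_upto g (\<lambda>u. l u - L u) t = conv_upto g l t - conv_upto g L t"
          by (rule conv_diff) (auto intro!: mono_abs_le[OF lm] mono_abs_le[OF mono])
        moreover have "\<bar>conv_upto g (\<lambda>u. l u - L u) t\<bar> \<le> e / 3"
          by (rule conv_abs_le) (use lL t e in auto)
        moreover note lL[OF t]
        ultimately show "\<bar>real (busy_servers n (a' n) (n0' n) (r' n) (s' n) t) / n - rho_of L t\<bar> \<le> e"
          using x(2)[OF t] x(3)[OF t] unfolding rho_of_def abs_le_iff by linarith
      qed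
    qed
  qed
  have bt: "(\<lambda>n. real (busy_servers n (a n) (n0 n) (r n) (s n) t) / n) \<longlonglongrightarrow> rho_of L t" if "t \<in> {0..T}" for t
  proof (rule tendstoI)
    fix e :: real assume "0 < e"
    then have "0 < e / 2" by simp
    from busy[OF gp this] show "\<forall>\<^sub>F n in sequentially. dist (real (busy_servers n (a n) (n0 n) (r n) (s n) t) / n) (rho_of L t) < e"
    proof eventually_elim
      case (elim n)
      from elim that have "\<bar>real (busy_servers n (a n) (n0 n) (r n) (s n) t) / n - rho_of L t\<bar> \<le> e / 2" by blast
      then show ?case using \<open>0 < e\<close> by (simp add: dist_real_def)
    qed
  qed
  have rho01: "0 \<le> rho_of L t \<and> rho_of L t \<le> 1" if t: "t \<in> {0..T}" for t
  proof
    show "0 \<le> rho_of L t" by (rule tendsto_lowerbound[OF bt[OF t]]) auto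
    have "\<forall>\<^sub>F n in sequentially. real (busy_servers n (a n) (n0 n) (r n) (s n) t) / n \<le> 1"
      using eventually_ge_at_top[of 1]
    proof eventually_elim
      case (elim n)
      then have "busy_servers n (a n) (n0 n) (r n) (s n) t \<le> n"
        using gp t by (intro busy_servers_le) (auto simp: good_paths_def)
      then show ?case using elim by simp
    qed
    then show "rho_of L t \<le> 1" by (rule tendsto_upperbound[OF bt[OF t]]) auto
  qed
  have flat: "L t = L u" if ut: "0 \<le> u" "u \<le> t" "t \<le> T" and lt: "\<And>v. v \<in> {u..t} \<Longrightarrow> rho_of L v < 1" for u t
  proof (rule ccontr)
    assume "L t \<noteq> L u"
    then have Lut: "L u < L t" using monoD[OF mono ut(2)] by simp
    have "continuous_on {u..t} (rho_of L)" by (rule continuous_on_subset[OF rho_cont]) (use ut in auto)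
    from continuous_attains_sup[OF _ _ this] ut obtain w where w: "w \<in> {u..t}" "\<And>v. v \<in> {u..t} \<Longrightarrow> rho_of L v \<le> rho_of L w"
      by auto
    \<comment> \<open>On \<open>{u..t}\<close> the limit is at most \<open>1 - 5 * d\<close>, so the
      occupancies are eventually at most \<open>1 - 4 * d\<close>; a loss in between would force the
      level \<open>1 - 3 * d\<close> somewhere.\<close>
    define d where "d = (1 - rho_of L w) / 5"
    have d: "0 < d" using lt[OF w(1)] by (simp add: d_def)
    have tT: "t \<in> {0..T}" "u \<in> {0..T}" using ut by auto
    have "\<forall>\<^sub>F n in sequentially. 0 < \<Lambda>l n t - \<Lambda>l n u"
    proof (rule order_tendstoD)
      show "(\<lambda>n. \<Lambda>l n t - \<Lambda>l n u) \<longlonglongrightarrow> L t - L u"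
        using limL[of t] limL[of u] c(2)[OF tT(1)] c(2)[OF tT(2)] by (intro tendsto_diff) auto
    qed (use Lut in simp)
    with busy[OF gp d] good_paths_uniform(1)[OF gp d, of T] eventually_ge_at_top[of 1]
    have "\<forall>\<^sub>F n in sequentially. False"
    proof eventually_elim
      case (elim n)
      have cp: "counting_path (a n)" and n0: "n0 n \<le> n" using gp elim(3) by (auto simp: good_paths_def)
      have l: "lost_upto n (a n) (n0 n) (r n) (s n) u < lost_upto n (a n) (n0 n) (r n) (s n) t"
        using elim(3,4) by (simp add: \<Lambda>l_def divide_less_cancel)
      have "0 \<le> lost_upto n (a n) (n0 n) (r n) (s n) u" by (simp add: lost_upto_def)
      with l have l0: "lost_upto n (a n) (n0 n) (r n) (s n) t \<noteq> 0" by linarith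
      have "\<exists>v\<in>{u..t}. real (busy_servers n (a n) (n0 n) (r n) (s n) v) / n \<ge> 1 - 3 * d"
        by (rule almost_reflected_losses(2)[OF cp elim(3) n0 d Lam_cont _ tT(1) l0 _ l]) (use elim(2) ut in \<open>auto intro: less_imp_le\<close>)
      then obtain v where v: "v \<in> {u..t}" "real (busy_servers n (a n) (n0 n) (r n) (s n) v) / n \<ge> 1 - 3 * d" by blast
      have "\<bar>real (busy_servers n (a n) (n0 n) (r n) (s n) v) / n - rho_of L v\<bar> \<le> d" using elim(1) v ut by auto
      moreover have "rho_of L v \<le> 1 - 5 * d" using w(2)[OF v(1)] by (simp add: d_def field_simps)
      ultimately show False using v(2) d by linarith
    qed
    then show False by simp
  qed
  have acc: "(\<lambda>n. accepted_upto n (a' n) (n0' n) (r' n) (s' n) p / n) \<longlonglongrightarrow> Lam p - L p"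
    if gp': "good_paths a' n0' r' s'" and p: "p \<in> \<rat>" "p \<in> {0..T}" for a' n0' r' s' p
  proof -
    have "(\<lambda>n. real (a' n p) / n) \<longlonglongrightarrow> Lam p" using gp' p by (auto simp: good_paths_def)
    from tendsto_diff[OF this ratconv[OF gp' p(2)]]
    have "(\<lambda>n. real (a' n p) / n - lost_upto n (a' n) (n0' n) (r' n) (s' n) p / n) \<longlonglongrightarrow> Lam p - L p" .
    moreover have "real (a' n p) / n - lost_upto n (a' n) (n0' n) (r' n) (s' n) p / n = accepted_upto n (a' n) (n0' n) (r' n) (s' n) p / n" for n
      using accepted_plus_lost[of p n "a' n" "n0' n" "r' n" "s' n"] p by (simp add: diff_divide_distrib[symmetric])
    ultimately show ?thesis by simp
  qed
  show thesis
    by (rule that[of L]) (fact mono L0 LT inc rho_cont rho01 flat busy acc)+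
qed

end

section \<open>Densities and level sets\<close>

lemma measure_eqI_Ioc:
  fixes M N :: "real measure"
  assumes sets: "sets M = sets borel" "sets N = sets borel"
    and eq: "\<And>a b. a \<le> b \<Longrightarrow> emeasure M {a<..b} = emeasure N {a<..b}"
    and fin: "\<And>a b. a \<le> b \<Longrightarrow> emeasure M {a<..b} \<noteq> \<infinity>"
  shows "M = N"
proof (rule measure_eqI_generator_eq[where E="range (\<lambda>(a, b). {a<..b})" and \<Omega>=UNIV and A="\<lambda>i. {- real i<..real i}"])
  show "Int_stable (range (\<lambda>(a, b). {a<..b::real}))"
    unfolding Int_stable_def
  proof safe
    fix a b c d :: real
    have "{a<..b} \<inter> {c<..d} = (\<lambda>(a, b). {a<..b}) (max a c, min b d)" by auto
    then show "{a<..b} \<inter> {c<..d} \<in> range (\<lambda>(a, b). {a<..b})" by blast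
  qed
  show "sets M = sigma_sets UNIV (range (\<lambda>(a, b). {a<..b}))" "sets N = sigma_sets UNIV (range (\<lambda>(a, b). {a<..b}))"
    using sets by (simp_all add: borel_sigma_sets_Ioc)
  show "(\<Union>i. {- real i<..real i}) = UNIV"
  proof (intro equalityI subsetI UNIV_I)
    fix x :: real
    obtain i :: nat where "\<bar>x\<bar> < real i" using reals_Archimedean2 by blast
    then show "x \<in> (\<Union>i. {- real i<..real i})" by (intro UN_I[of i]) auto
  qed
  fix X assume "X \<in> range (\<lambda>(a, b). {a<..b::real})"
  then obtain a b where X: "X = {a<..b}" by auto
  show "emeasure M X = emeasure N X" by (cases "a \<le> b") (use eq X in auto)
qed (use fin in auto)

text \<open>Clamped arguments make the identity available for every half-open interval of the line;
  the two integrands differ at most at the point 0.\<close>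

lemma LBINT_Ioc_clamped:
  fixes h :: "real \<Rightarrow> real"
  assumes T: "0 < T" and h: "set_integrable lborel {0..T} h" and ab: "a \<le> b"
  shows "(LBINT x:{a<..b}. indicator {0..T} x * h x)
    = (LBINT x:{0..max 0 (min b T)}. h x) - (LBINT x:{0..max 0 (min a T)}. h x)"
proof -
  define c where "c t = max 0 (min t T)" for t :: real
  have i: "set_integrable lborel {0..c t} h" for t by (rule set_integrable_subset[OF h]) (use T in \<open>auto simp: c_def\<close>)
  have "(LBINT x:{0..c b}. h x) - (LBINT x:{0..c a}. h x)
    = (\<integral>x. indicator {0..c b} x *\<^sub>R h x - indicator {0..c a} x *\<^sub>R h x \<partial>lborel)"
    unfolding set_lebesgue_integral_def using i by (intro Bochner_Integration.integral_diff[symmetric]) (auto simp: set_integrable_def)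
  also have "\<dots> = (LBINT x:{a<..b}. indicator {0..T} x * h x)"
    unfolding set_lebesgue_integral_def
  proof (rule integral_cong_AE)
    show "AE x in lborel. indicator {0..c b} x *\<^sub>R h x - indicator {0..c a} x *\<^sub>R h x = indicator {a<..b} x *\<^sub>R (indicator {0..T} x * h x)"
      using AE_lborel_singleton[of 0]
    proof eventually_elim
      case (elim x)
      have "indicator {0..c b} x - indicator {0..c a} x = (indicator {a<..b} x * indicator {0..T} x :: real)"
        using elim ab T by (auto simp: indicator_def c_def min_def max_def split: if_splits)
      then have "(indicator {0..c b} x - indicator {0..c a} x) * h x = (indicator {a<..b} x * indicator {0..T} x) * h x"
        by (rule arg_cong)
      then show ?case by (simp add: algebra_simps)
    qed
    have [measurable]: "(\<lambda>x. indicator {0..T} x * h x) \<in> borel_measurable borel"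
      using h by (auto simp: set_integrable_def dest!: borel_measurable_integrable)
    show "(\<lambda>x. indicator {a<..b} x *\<^sub>R (indicator {0..T} x * h x)) \<in> borel_measurable lborel" by measurable
  qed (use i in \<open>auto simp: set_integrable_def dest!: borel_measurable_integrable\<close>)
  finally show ?thesis by (simp add: c_def)
qed

text \<open>The Stieltjes measures of \<open>L\<close> and of its complement \<open>B\<close> add up
  to the measure with density \<open>lam\<close> on \<open>{0..T}\<close>. Both are therefore
  absolutely continuous, and their Radon-Nikodym densities sum to \<open>lam\<close> there, whence
  \<open>k \<le> lam\<close> almost everywhere without differentiating \<open>L\<close>.\<close>

lemma dominated_increments_density:
  fixes lam L :: "real \<Rightarrow> real"
  assumes T: "0 < T" and lam: "set_integrable lborel {0..T} lam" and lam_nn: "\<And>x. 0 \<le> x \<Longrightarrow> 0 \<le> lam x"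
    and L: "mono L" "\<And>t. t \<le> 0 \<Longrightarrow> L t = 0" "\<And>t. T \<le> t \<Longrightarrow> L t = L T"
    and inc: "\<And>u t. 0 \<le> u \<Longrightarrow> u \<le> t \<Longrightarrow> t \<le> T \<Longrightarrow> L t - L u \<le> (LBINT x:{0..t}. lam x) - (LBINT x:{0..u}. lam x)"
  obtains k where "k \<in> borel_measurable borel" "\<And>x. 0 \<le> k x" "AE x in lborel. x \<in> {0..T} \<longrightarrow> k x \<le> lam x"
    "set_integrable lborel {0..T} k" "\<And>t. t \<in> {0..T} \<Longrightarrow> L t = (LBINT x:{0..t}. k x)"
proof -
  define l where "l x = indicator {0..T} x * lam x" for x
  have l_int: "integrable lborel l" using lam by (simp add: l_def[abs_def] set_integrable_def)
  have [measurable]: "l \<in> borel_measurable borel" using l_int by (auto dest: borel_measurable_integrable)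
  have l_nn: "0 \<le> l x" for x using lam_nn by (auto simp: l_def indicator_def)
  define c where "c t = max 0 (min t T)" for t :: real
  \<comment> \<open>The accepted part; its monotonicity is the bound on the increments of
    \<open>L\<close>.\<close>
  define B where "B t = (LBINT x:{0..c t}. lam x) - L t" for t
  have c: "0 \<le> c t" "c t \<le> T" "u \<le> t \<Longrightarrow> c u \<le> c t" for u t using T by (auto simp: c_def)
  have Lc: "L t = L (c t)" for t using T L(2)[of t] L(2)[of 0] L(3)[of t] by (auto simp: c_def min_def max_def)
  have Bm: "mono B"
  proof (rule monoI)
    fix u t :: real assume "u \<le> t"
    from inc[OF c(1) c(3)[OF this] c(2)] show "B u \<le> B t" using Lc[of u] Lc[of t] by (simp add: B_def)
  qed
  have Lam_cont: "continuous_on UNIV (\<lambda>t. LBINT x:{0..c t}. lam x)"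
    by (rule continuous_on_compose2[OF continuous_on_LBINT_upto[OF lam], of UNIV c])
       (use c in \<open>auto simp: c_def intro!: continuous_intros\<close>)
  have L_cont: "continuous_on UNIV L"
    unfolding continuous_on_def
  proof
    fix t :: real
    have le: "\<bar>L u - L t\<bar> \<le> \<bar>(LBINT x:{0..c u}. lam x) - (LBINT x:{0..c t}. lam x)\<bar>" for u
      using monoD[OF L(1), of u t] monoD[OF L(1), of t u] monoD[OF Bm, of u t] monoD[OF Bm, of t u]
      by (cases "u \<le> t") (auto simp: B_def)
    have "((\<lambda>u. (LBINT x:{0..c u}. lam x) - (LBINT x:{0..c t}. lam x)) \<longlongrightarrow> (LBINT x:{0..c t}. lam x) - (LBINT x:{0..c t}. lam x)) (at t)"
      using Lam_cont unfolding continuous_on_def by (intro tendsto_intros) auto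
    then have "((\<lambda>u. (LBINT x:{0..c u}. lam x) - (LBINT x:{0..c t}. lam x)) \<longlongrightarrow> 0) (at t)" by simp
    then have "((\<lambda>u. \<bar>(LBINT x:{0..c u}. lam x) - (LBINT x:{0..c t}. lam x)\<bar>) \<longlongrightarrow> 0) (at t)"
      by (rule tendsto_rabs_zero)
    then have "((\<lambda>u. L u - L t) \<longlongrightarrow> 0) (at t)"
      by (rule Lim_null_comparison[rotated]) (use le in auto)
    then show "(L \<longlongrightarrow> L t) (at t)" by (simp add: Lim_null[symmetric])
  qed
  have B_cont: "continuous_on UNIV B"
    unfolding B_def by (intro continuous_intros Lam_cont L_cont)
  have rc: "continuous (at_right a) F" if "continuous_on UNIV F" for F :: "real \<Rightarrow> real" and a
    using that by (simp add: continuous_on_eq_continuous_at continuous_at_imp_continuous_at_within)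
  have eL: "emeasure (interval_measure L) {a<..b} = L b - L a" if "a \<le> b" for a b
    by (rule emeasure_interval_measure_Ioc[OF that]) (use L_cont rc monoD[OF L(1)] in auto)
  have eB: "emeasure (interval_measure B) {a<..b} = B b - B a" if "a \<le> b" for a b
    by (rule emeasure_interval_measure_Ioc[OF that]) (use B_cont rc monoD[OF Bm] in auto)
  \<comment> \<open>The sum of the two Stieltjes measures.\<close>
  define N where "N = measure_of UNIV (sets borel) (\<lambda>A. emeasure (interval_measure L) A + emeasure (interval_measure B) A)"
  have sN: "sets N = sets borel" using sets.sigma_sets_eq[of "borel :: real measure"] by (simp add: N_def)
  have eN: "emeasure N A = emeasure (interval_measure L) A + emeasure (interval_measure B) A" if A: "A \<in> sets borel" for A
    unfolding N_def
  proof (rule emeasure_measure_of_sigma)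
    show "sigma_algebra UNIV (sets (borel :: real measure))" using sets.sigma_algebra_axioms[of "borel :: real measure"] by simp
    show "countably_additive (sets borel) (\<lambda>A. emeasure (interval_measure L) A + emeasure (interval_measure B) A)"
    proof (rule countably_additiveI)
      fix A :: "nat \<Rightarrow> real set" assume A: "range A \<subseteq> sets borel" "disjoint_family A"
      have "(\<Sum>i. emeasure (interval_measure L) (A i) + emeasure (interval_measure B) (A i))
        = (\<Sum>i. emeasure (interval_measure L) (A i)) + (\<Sum>i. emeasure (interval_measure B) (A i))"
        by (simp add: suminf_add)
      then show "(\<Sum>i. emeasure (interval_measure L) (A i) + emeasure (interval_measure B) (A i)) =
        emeasure (interval_measure L) (\<Union> (range A)) + emeasure (interval_measure B) (\<Union> (range A))"
        using A by (simp add: suminf_emeasure)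
    qed
  qed (use A in \<open>auto simp: positive_def\<close>)
  have lam_Ioc: "(LBINT x:{a<..b}. l x) = (LBINT x:{0..c b}. lam x) - (LBINT x:{0..c a}. lam x)" if "a \<le> b" for a b
    unfolding l_def c_def by (rule LBINT_Ioc_clamped[OF T lam that])
  have "N = density lborel (\<lambda>x. ennreal (l x))"
  proof (rule measure_eqI_Ioc)
    fix a b :: real assume ab: "a \<le> b"
    have e: "emeasure N {a<..b} = ennreal ((LBINT x:{0..c b}. lam x) - (LBINT x:{0..c a}. lam x))"
      using monoD[OF L(1) ab] monoD[OF Bm ab] by (simp add: eN eL eB ab B_def flip: ennreal_plus)
    then show "emeasure N {a<..b} \<noteq> \<infinity>" by simp
    have "emeasure (density lborel (\<lambda>x. ennreal (l x))) {a<..b} = (\<integral>\<^sup>+x. ennreal (indicator {a<..b} x *\<^sub>R l x) \<partial>lborel)"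
      by (subst emeasure_density) (auto intro!: nn_integral_cong simp: indicator_def)
    also have "\<dots> = ennreal (LBINT x:{a<..b}. l x)"
      unfolding set_lebesgue_integral_def
      by (rule nn_integral_eq_integral) (use l_nn integrable_mult_indicator[OF _ l_int, of "{a<..b}"] in auto)
    finally show "emeasure N {a<..b} = emeasure (density lborel (\<lambda>x. ennreal (l x))) {a<..b}"
      by (simp add: e lam_Ioc[OF ab])
  qed (use sN in auto)
  note N = this
  have acN: "absolutely_continuous lborel N" unfolding N by (rule absolutely_continuousI_density) auto
  have ac: "absolutely_continuous lborel (interval_measure L)" "absolutely_continuous lborel (interval_measure B)"
    using acN sN eN unfolding absolutely_continuous_def null_sets_def by auto
  obtain k1 where k1: "k1 \<in> borel_measurable borel" "density lborel k1 = interval_measure L"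
    using sigma_finite_measure.Radon_Nikodym[OF sigma_finite_lborel ac(1)] by auto
  obtain k2 where k2: "k2 \<in> borel_measurable borel" "density lborel k2 = interval_measure B"
    using sigma_finite_measure.Radon_Nikodym[OF sigma_finite_lborel ac(2)] by auto
  note [measurable] = k1(1) k2(1)
  have "density lborel (\<lambda>x. k1 x + k2 x) = density lborel (\<lambda>x. ennreal (l x))"
  proof (rule measure_eqI)
    fix A assume "A \<in> sets (density lborel (\<lambda>x. k1 x + k2 x))"
    then have A: "A \<in> sets borel" by simp
    have "emeasure (density lborel (\<lambda>x. k1 x + k2 x)) A = emeasure (density lborel k1) A + emeasure (density lborel k2) A"
      using A by (simp add: emeasure_density_add)
    then show "emeasure (density lborel (\<lambda>x. k1 x + k2 x)) A = emeasure (density lborel (\<lambda>x. ennreal (l x))) A"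
      by (simp only: k1(2) k2(2) eN[OF A, symmetric] N)
  qed simp
  then have "AE x in lborel. k1 x + k2 x = ennreal (l x)"
    by (intro sigma_finite_measure.density_unique[OF sigma_finite_lborel]) auto
  then have kl: "AE x in lborel. k1 x \<le> ennreal (l x)"
    by eventually_elim (metis le_iff_add)
  \<comment> \<open>Radon-Nikodym densities are extended-valued; almost everywhere \<open>k1\<close>
    is bounded by \<open>l\<close>, hence finite and equal to \<open>k\<close>.\<close>
  define k where "k x = enn2real (k1 x)" for x
  have [measurable]: "k \<in> borel_measurable borel" unfolding k_def[abs_def] by measurable
  have k_le: "AE x in lborel. k x \<le> l x" using kl
    by eventually_elim (simp add: k_def enn2real_leI l_nn)
  have k_eq: "AE x in lborel. k1 x = ennreal (k x)" using kl
    by eventually_elim (simp add: k_def le_less_trans[OF _ ennreal_less_top])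
  have k_nn: "0 \<le> k x" for x by (simp add: k_def)
  have k_int: "integrable lborel k"
    by (rule Bochner_Integration.integrable_bound[OF l_int]) (use k_le k_nn l_nn in \<open>auto elim!: eventually_mono\<close>)
  show thesis
  proof (rule that[of k])
    show "AE x in lborel. x \<in> {0..T} \<longrightarrow> k x \<le> lam x" using k_le by eventually_elim (auto simp: l_def)
    show "set_integrable lborel {0..T} k" unfolding set_integrable_def by (intro integrable_mult_indicator k_int) auto
    fix t assume t: "t \<in> {0..T}"
    have "ennreal (L t) = emeasure (interval_measure L) {0<..t}" using eL[of 0 t] t L(2)[of 0] by simp
    also have "\<dots> = (\<integral>\<^sup>+x. k1 x * indicator {0<..t} x \<partial>lborel)"
      unfolding k1(2)[symmetric] by (rule emeasure_density) auto
    also have "\<dots> = (\<integral>\<^sup>+x. ennreal (indicator {0..t} x *\<^sub>R k x) \<partial>lborel)"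
      by (rule nn_integral_cong_AE, use k_eq AE_lborel_singleton[of 0] in eventually_elim) (auto simp: indicator_def)
    also have "\<dots> = ennreal (LBINT x:{0..t}. k x)"
      unfolding set_lebesgue_integral_def
      by (rule nn_integral_eq_integral) (use k_nn integrable_mult_indicator[OF _ k_int, of "{0..t}"] in auto)
    finally show "L t = (LBINT x:{0..t}. k x)"
      using monoD[OF L(1), of 0 t] L(2)[of 0] t k_nn
      by (subst (asm) ennreal_inj) (auto simp: set_lebesgue_integral_def intro!: Bochner_Integration.integral_nonneg)
  qed (use k_nn in auto)
qed

text \<open>The positive and the negative part of \<open>h\<close> on \<open>{0..T}\<close> define
  measures that agree on half-open intervals and hence coincide. Their densities are then equal
  almost everywhere, which forces both parts to vanish.\<close>

lemma AE_eq_0_if_LBINT_upto_eq_0: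
  fixes h :: "real \<Rightarrow> real"
  assumes h: "set_integrable lborel {0..T} h" and z: "\<And>t. t \<in> {0..T} \<Longrightarrow> (LBINT x:{0..t}. h x) = 0"
  shows "AE x in lborel. x \<in> {0..T} \<longrightarrow> h x = 0"
proof (cases "0 < T")
  case False
  have "AE x in lborel. x \<noteq> (0::real)" by (rule AE_lborel_singleton)
  then show ?thesis by eventually_elim (use False in auto)
next
  case T: True
  define l where "l x = indicator {0..T} x * h x" for x
  have l: "integrable lborel l" using h by (simp add: l_def[abs_def] set_integrable_def)
  have [measurable]: "l \<in> borel_measurable borel" using l by (auto dest: borel_measurable_integrable)
  define c where "c t = max 0 (min t T)" for t :: real
  have cI: "c t \<in> {0..T}" for t using T by (auto simp: c_def)
  have z': "(\<integral>x. indicator {a<..b} x * l x \<partial>lborel) = 0" if "a \<le> b" for a b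
    using LBINT_Ioc_clamped[OF T h that] z[OF cI] by (simp add: l_def set_lebesgue_integral_def c_def)
  have ip: "integrable lborel (\<lambda>x. indicator {a<..b} x * max 0 (l x))" "integrable lborel (\<lambda>x. indicator {a<..b} x * max 0 (- l x))" for a b
    by (rule Bochner_Integration.integrable_bound[OF l]; auto simp: indicator_def)+
  have "density lborel (\<lambda>x. ennreal (max 0 (l x))) = density lborel (\<lambda>x. ennreal (max 0 (- l x)))"
  proof (rule measure_eqI_Ioc)
    fix a b :: real assume ab: "a \<le> b"
    have p: "emeasure (density lborel (\<lambda>x. ennreal (max 0 (l x)))) {a<..b} = ennreal (\<integral>x. indicator {a<..b} x * max 0 (l x) \<partial>lborel)"
      by (subst nn_integral_eq_integral[symmetric, OF ip(1)]) (auto simp: emeasure_density indicator_def intro!: nn_integral_cong)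
    have m: "emeasure (density lborel (\<lambda>x. ennreal (max 0 (- l x)))) {a<..b} = ennreal (\<integral>x. indicator {a<..b} x * max 0 (- l x) \<partial>lborel)"
      by (subst nn_integral_eq_integral[symmetric, OF ip(2)]) (auto simp: emeasure_density indicator_def intro!: nn_integral_cong)
    have "(\<integral>x. indicator {a<..b} x * max 0 (l x) \<partial>lborel) - (\<integral>x. indicator {a<..b} x * max 0 (- l x) \<partial>lborel)
      = (\<integral>x. indicator {a<..b} x * max 0 (l x) - indicator {a<..b} x * max 0 (- l x) \<partial>lborel)"
      by (rule Bochner_Integration.integral_diff[symmetric, OF ip])
    also have "\<dots> = (\<integral>x. indicator {a<..b} x * l x \<partial>lborel)"
      by (rule Bochner_Integration.integral_cong) (auto simp: indicator_def max_def)
    finally show "emeasure (density lborel (\<lambda>x. ennreal (max 0 (l x)))) {a<..b} = emeasure (density lborel (\<lambda>x. ennreal (max 0 (- l x)))) {a<..b}"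
      using p m z'[OF ab] by simp
    show "emeasure (density lborel (\<lambda>x. ennreal (max 0 (l x)))) {a<..b} \<noteq> \<infinity>" using p by simp
  qed auto
  then have "AE x in lborel. ennreal (max 0 (l x)) = ennreal (max 0 (- l x))"
    by (intro sigma_finite_measure.density_unique[OF sigma_finite_lborel]) auto
  then show ?thesis by eventually_elim (auto simp: l_def max_def split: if_splits)
qed

text \<open>Integration by parts: Fubini on the square with side \<open>{0..t}\<close>, cut along
  the diagonal into \<open>v \<le> u\<close> and \<open>u < v\<close>.\<close>

lemma product_of_integrals:
  fixes a b :: "real \<Rightarrow> real"
  assumes a: "set_integrable lborel {0..T} a" and b: "set_integrable lborel {0..T} b" and t: "t \<in> {0..T}"
  shows "(LBINT u:{0..t}. a u) * (LBINT v:{0..t}. b v)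
    = (LBINT u:{0..t}. a u * (LBINT v:{0..u}. b v) + (LBINT v:{0..u}. a v) * b u)"
proof -
  define A where "A x = indicator {0..t} x * a x" for x
  define B where "B x = indicator {0..t} x * b x" for x
  have "set_integrable lborel {0..t} a" "set_integrable lborel {0..t} b"
    using t by (auto intro: set_integrable_subset[OF a] set_integrable_subset[OF b])
  then have A: "integrable lborel A" and B: "integrable lborel B"
    by (simp_all add: A_def[abs_def] B_def[abs_def] set_integrable_def)
  have [measurable]: "A \<in> borel_measurable borel" "B \<in> borel_measurable borel"
    using A B by (auto dest: borel_measurable_integrable)
  have AB: "integrable (lborel \<Otimes>\<^sub>M lborel) (\<lambda>(u, v). A u * B v)"
  proof (rule lborel_pair.Fubini_integrable)
    show "integrable lborel (\<lambda>u. \<integral>v. norm (case (u, v) of (u, v) \<Rightarrow> A u * B v) \<partial>lborel)"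
      using A by (simp add: abs_mult)
    show "AE u in lborel. integrable lborel (\<lambda>v. case (u, v) of (u, v) \<Rightarrow> A u * B v)"
      using B by (intro AE_I2) simp
  qed measurable
  have cut: "integrable (lborel \<Otimes>\<^sub>M lborel) (\<lambda>(u, v). A u * (B v * of_bool (v \<le> u)))"
    "integrable (lborel \<Otimes>\<^sub>M lborel) (\<lambda>(u, v). B v * (A u * of_bool (u < v)))"
    by (rule Bochner_Integration.integrable_bound[OF AB]; auto simp: abs_mult mult.commute intro!: AE_I2)+
  have Fa: "(\<integral>v. B v * of_bool (v \<le> u) \<partial>lborel) = (LBINT v:{0..u}. b v)" if "u \<in> {0..t}" for u
    unfolding set_lebesgue_integral_def
    by (rule Bochner_Integration.integral_cong) (use that in \<open>auto simp: B_def indicator_def\<close>)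
  have Fb: "(\<integral>u. A u * of_bool (u < v) \<partial>lborel) = (LBINT u:{0..v}. a u)" if "v \<in> {0..t}" for v
    unfolding set_lebesgue_integral_def
  proof (rule integral_cong_AE)
    show "AE u in lborel. A u * of_bool (u < v) = indicator {0..v} u *\<^sub>R a u"
      using AE_lborel_singleton[of v] by eventually_elim (use that in \<open>auto simp: A_def indicator_def\<close>)
    have "set_integrable lborel {0..v} a" by (rule set_integrable_subset[OF a]) (use that t in auto)
    then show "(\<lambda>u. indicator {0..v} u *\<^sub>R a u) \<in> borel_measurable lborel"
      by (auto simp: set_integrable_def dest: borel_measurable_integrable)
  qed measurable
  have 1: "(\<integral>u. A u * (\<integral>v. B v * of_bool (v \<le> u) \<partial>lborel) \<partial>lborel) = (LBINT u:{0..t}. a u * (LBINT v:{0..u}. b v))"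
    unfolding set_lebesgue_integral_def[of lborel "{0..t}"]
    by (rule Bochner_Integration.integral_cong) (auto simp: A_def indicator_def Fa)
  have 2: "(\<integral>v. B v * (\<integral>u. A u * of_bool (u < v) \<partial>lborel) \<partial>lborel) = (LBINT u:{0..t}. (LBINT v:{0..u}. a v) * b u)"
    unfolding set_lebesgue_integral_def[of lborel "{0..t}"]
    by (rule Bochner_Integration.integral_cong) (auto simp: B_def indicator_def Fb)
  have i1: "integrable lborel (\<lambda>u. A u * (\<integral>v. B v * of_bool (v \<le> u) \<partial>lborel))"
    using lborel_pair.integrable_fst'[OF cut(1)] by simp
  have i2: "integrable lborel (\<lambda>v. B v * (\<integral>u. A u * of_bool (u < v) \<partial>lborel))"
    using lborel_pair.integrable_snd[OF cut(2)] by simp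
  have s1: "set_integrable lborel {0..t} (\<lambda>u. a u * (LBINT v:{0..u}. b v))"
    unfolding set_integrable_def
    by (rule Bochner_Integration.integrable_cong[THEN iffD1, OF refl _ i1]) (auto simp: A_def indicator_def Fa)
  have s2: "set_integrable lborel {0..t} (\<lambda>u. (LBINT v:{0..u}. a v) * b u)"
    unfolding set_integrable_def
    by (rule Bochner_Integration.integrable_cong[THEN iffD1, OF refl _ i2]) (auto simp: B_def indicator_def Fb)
  have "(LBINT u:{0..t}. a u) * (LBINT v:{0..t}. b v) = (\<integral>u. A u \<partial>lborel) * (\<integral>v. B v \<partial>lborel)"
    by (simp add: A_def B_def set_lebesgue_integral_def)
  also have "\<dots> = (\<integral>u. (\<integral>v. A u * B v \<partial>lborel) \<partial>lborel)" by simp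
  also have "\<dots> = (\<integral>z. (case z of (u, v) \<Rightarrow> A u * B v) \<partial>(lborel \<Otimes>\<^sub>M lborel))"
    using lborel_pair.integral_fst'[OF AB] by simp
  also have "\<dots> = (\<integral>z. (case z of (u, v) \<Rightarrow> A u * (B v * of_bool (v \<le> u))) + (case z of (u, v) \<Rightarrow> B v * (A u * of_bool (u < v))) \<partial>(lborel \<Otimes>\<^sub>M lborel))"
    by (rule Bochner_Integration.integral_cong) (auto simp: of_bool_def not_le mult.commute)
  also have "\<dots> = (\<integral>z. (case z of (u, v) \<Rightarrow> A u * (B v * of_bool (v \<le> u))) \<partial>(lborel \<Otimes>\<^sub>M lborel)) + (\<integral>z. (case z of (u, v) \<Rightarrow> B v * (A u * of_bool (u < v))) \<partial>(lborel \<Otimes>\<^sub>M lborel))"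
    by (rule Bochner_Integration.integral_add[OF cut])
  also have "(\<integral>z. (case z of (u, v) \<Rightarrow> A u * (B v * of_bool (v \<le> u))) \<partial>(lborel \<Otimes>\<^sub>M lborel)) = (LBINT u:{0..t}. a u * (LBINT v:{0..u}. b v))"
    using lborel_pair.integral_fst'[OF cut(1)] 1 by simp
  also have "(\<integral>z. (case z of (u, v) \<Rightarrow> B v * (A u * of_bool (u < v))) \<partial>(lborel \<Otimes>\<^sub>M lborel)) = (LBINT u:{0..t}. (LBINT v:{0..u}. a v) * b u)"
    using lborel_pair.integral_snd[OF cut(2)] 2 by simp
  also have "(LBINT u:{0..t}. a u * (LBINT v:{0..u}. b v)) + (LBINT u:{0..t}. (LBINT v:{0..u}. a v) * b u)
    = (LBINT u:{0..t}. a u * (LBINT v:{0..u}. b v) + (LBINT v:{0..u}. a v) * b u)"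
    by (rule set_integral_add(2)[OF s1 s2, symmetric])
  finally show ?thesis .
qed

lemma set_integrable_mult_continuous:
  fixes h X :: "real \<Rightarrow> real"
  assumes h: "set_integrable lborel {0..T} h" and X: "continuous_on {0..T} X"
  shows "set_integrable lborel {0..T} (\<lambda>u. X u * h u)"
proof -
  have "bounded (X ` {0..T})" by (intro compact_imp_bounded compact_continuous_image X) auto
  then obtain C where C: "\<And>u. u \<in> {0..T} \<Longrightarrow> \<bar>X u\<bar> \<le> C" unfolding bounded_iff by force
  have Xm: "(\<lambda>u. indicator {0..T} u *\<^sub>R X u) \<in> borel_measurable borel"
    using borel_measurable_continuous_on_indicator[OF _ X] by simp
  have hm: "(\<lambda>u. indicator {0..T} u *\<^sub>R h u) \<in> borel_measurable borel"
    using h by (auto simp: set_integrable_def dest: borel_measurable_integrable)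
  have "(\<lambda>u. (indicator {0..T} u *\<^sub>R X u) * (indicator {0..T} u *\<^sub>R h u)) \<in> borel_measurable borel"
    by (intro borel_measurable_times Xm hm)
  also have "(\<lambda>u. (indicator {0..T} u *\<^sub>R X u) * (indicator {0..T} u *\<^sub>R h u)) = (\<lambda>u. indicator {0..T} u *\<^sub>R (X u * h u))"
    by (auto simp: fun_eq_iff indicator_def)
  finally have m: "set_borel_measurable lborel {0..T} (\<lambda>u. X u * h u)" by (simp add: set_borel_measurable_def)
  show ?thesis
  proof (rule set_integrable_bound[OF set_integrable_mult_right[OF h, of C] m])
    show "AE u in lborel. u \<in> {0..T} \<longrightarrow> norm (X u * h u) \<le> norm (C * h u)"
      using C by (intro AE_I2 impI) (auto simp: abs_mult intro!: mult_right_mono order_trans[OF C abs_ge_self])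
  qed
qed

text \<open>The chain rule for powers of an absolutely continuous function, by induction on
  \<open>k\<close> through integration by parts; no pointwise derivative of \<open>X\<close> is
  used.\<close>

lemma power_of_integral:
  fixes h X :: "real \<Rightarrow> real"
  assumes h: "set_integrable lborel {0..T} h" and X: "\<And>t. t \<in> {0..T} \<Longrightarrow> X t = x0 + (LBINT u:{0..t}. h u)"
    and t: "t \<in> {0..T}"
  shows "X t ^ Suc k = x0 ^ Suc k + (LBINT u:{0..t}. real (Suc k) * X u ^ k * h u)"
proof -
  have Xc: "continuous_on {0..T} X"
    by (rule continuous_on_cong[THEN iffD2, OF refl X]) (auto intro!: continuous_intros continuous_on_LBINT_upto h)
  show ?thesis
    using t
  proof (induction k arbitrary: t)
    case 0
    then show ?case using X by simp
  next
    case (Suc k)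
    let ?b = "\<lambda>u. real (Suc k) * X u ^ k * h u"
    have b: "set_integrable lborel {0..T} ?b"
      by (intro set_integrable_mult_continuous h continuous_intros Xc)
    have ht: "set_integrable lborel {0..t} f" if "set_integrable lborel {0..T} f" for f :: "real \<Rightarrow> real"
      by (rule set_integrable_subset[OF that]) (use Suc.prems in auto)
    have "X t ^ Suc (Suc k) = (x0 + (LBINT u:{0..t}. h u)) * (x0 ^ Suc k + (LBINT u:{0..t}. ?b u))"
      using Suc.IH[OF Suc.prems] X[OF Suc.prems] by simp
    also have "\<dots> = x0 ^ Suc (Suc k) + (x0 ^ Suc k * (LBINT u:{0..t}. h u) + x0 * (LBINT u:{0..t}. ?b u)
        + (LBINT u:{0..t}. h u) * (LBINT u:{0..t}. ?b u))"
      by (simp add: algebra_simps)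
    also have "(LBINT u:{0..t}. h u) * (LBINT u:{0..t}. ?b u)
      = (LBINT u:{0..t}. h u * (LBINT v:{0..u}. ?b v) + (LBINT v:{0..u}. h v) * ?b u)"
      by (rule product_of_integrals[OF h b Suc.prems])
    also have "\<dots> = (LBINT u:{0..t}. (X u ^ Suc k - x0 ^ Suc k) * h u + (X u - x0) * ?b u)"
    proof (rule set_lebesgue_integral_cong)
      show "\<forall>u. u \<in> {0..t} \<longrightarrow> h u * (LBINT v:{0..u}. ?b v) + (LBINT v:{0..u}. h v) * ?b u
          = (X u ^ Suc k - x0 ^ Suc k) * h u + (X u - x0) * ?b u"
      proof (intro allI impI)
        fix u assume "u \<in> {0..t}"
        then have u: "u \<in> {0..T}" using Suc.prems by auto
        have "(LBINT v:{0..u}. ?b v) = X u ^ Suc k - x0 ^ Suc k" using Suc.IH[OF u] by simp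
        moreover have "(LBINT v:{0..u}. h v) = X u - x0" using X[OF u] by simp
        ultimately show "h u * (LBINT v:{0..u}. ?b v) + (LBINT v:{0..u}. h v) * ?b u
          = (X u ^ Suc k - x0 ^ Suc k) * h u + (X u - x0) * ?b u" by (simp only: mult.commute)
      qed
    qed simp
    also have "x0 ^ Suc k * (LBINT u:{0..t}. h u) + x0 * (LBINT u:{0..t}. ?b u) + \<dots>
      = (LBINT u:{0..t}. (x0 ^ Suc k * h u + x0 * ?b u) + ((X u ^ Suc k - x0 ^ Suc k) * h u + (X u - x0) * ?b u))"
    proof -
      have i: "set_integrable lborel {0..t} (\<lambda>u. x0 ^ Suc k * h u)" "set_integrable lborel {0..t} (\<lambda>u. x0 * ?b u)"
        using ht[OF h] ht[OF b] by (auto intro: set_integrable_mult_right)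
      have j: "set_integrable lborel {0..t} (\<lambda>u. (X u ^ Suc k - x0 ^ Suc k) * h u)" "set_integrable lborel {0..t} (\<lambda>u. (X u - x0) * ?b u)"
        by (intro ht set_integrable_mult_continuous h b continuous_intros Xc)+
      show ?thesis
        by (subst set_integral_add(2)[OF set_integral_add(1)[OF i] set_integral_add(1)[OF j]], subst set_integral_add(2)[OF i]) simp
    qed
    also have "\<dots> = (LBINT u:{0..t}. real (Suc (Suc k)) * X u ^ Suc k * h u)"
      by (rule set_lebesgue_integral_cong) (auto simp: algebra_simps)
    finally show ?case .
  qed
qed

text \<open>The derivative of \<open>X ^ Suc k / Suc k\<close> is \<open>X ^ k * h\<close>, which tends to \<open>h\<close> on the level set
  \<open>X = 1\<close> and to \<open>0\<close> elsewhere, while the functions themselves tend to \<open>0\<close> uniformly.\<close>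

lemma derivative_zero_on_level_set:
  fixes h X :: "real \<Rightarrow> real"
  assumes h: "set_integrable lborel {0..T} h" and X: "\<And>t. t \<in> {0..T} \<Longrightarrow> X t = x0 + (LBINT u:{0..t}. h u)"
    and X01: "\<And>t. t \<in> {0..T} \<Longrightarrow> 0 \<le> X t \<and> X t \<le> 1"
  shows "AE t in lborel. t \<in> {0..T} \<longrightarrow> X t = 1 \<longrightarrow> h t = 0"
proof (cases "0 \<le> T")
  case False
  then show ?thesis by (intro AE_I2) auto
next
  case True
  have Xc: "continuous_on {0..T} X"
    by (rule continuous_on_cong[THEN iffD2, OF refl X]) (auto intro!: continuous_intros continuous_on_LBINT_upto h)
  have x0: "0 \<le> x0" "x0 \<le> 1"
  proof -
    have "(LBINT u:{0..0}. h u) = 0"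
      unfolding set_lebesgue_integral_def
      by (rule integral_eq_zero_AE, rule AE_mp[OF AE_lborel_singleton[of 0]]) (auto simp: indicator_def)
    then show "0 \<le> x0" "x0 \<le> 1" using X[of 0] X01[of 0] True by auto
  qed
  have km: "set_integrable lborel {0..T} (\<lambda>u. X u ^ k * h u)" for k
    by (intro set_integrable_mult_continuous h continuous_intros Xc)
  have pw: "(\<lambda>k. X u ^ k * h u) \<longlonglongrightarrow> of_bool (X u = 1) * h u" if "u \<in> {0..T}" for u
  proof (cases "X u = 1")
    case False
    then have "\<bar>X u\<bar> < 1" using X01[OF that] by auto
    then have "(\<lambda>k. X u ^ k) \<longlonglongrightarrow> 0" by (intro LIMSEQ_power_zero) simp
    then show ?thesis using False tendsto_mult_left_zero by fastforce
  qed simp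
  have lm: "(\<lambda>u. indicator {0..T} u *\<^sub>R (of_bool (X u = 1) * h u)) \<in> borel_measurable borel"
  proof (rule borel_measurable_LIMSEQ_real)
    show "(\<lambda>k. indicator {0..T} u *\<^sub>R (X u ^ k * h u)) \<longlonglongrightarrow> indicator {0..T} u *\<^sub>R (of_bool (X u = 1) * h u)" for u
      using pw by (cases "u \<in> {0..T}") auto
    show "(\<lambda>u. indicator {0..T} u *\<^sub>R (X u ^ k * h u)) \<in> borel_measurable borel" for k
      using km[of k] by (auto simp: set_integrable_def dest: borel_measurable_integrable)
  qed
  have li: "set_integrable lborel {0..T} (\<lambda>u. of_bool (X u = 1) * h u)"
    by (rule set_integrable_bound[OF h]) (use lm in \<open>auto simp: set_borel_measurable_def\<close>)
  have "AE t in lborel. t \<in> {0..T} \<longrightarrow> of_bool (X t = 1) * h t = 0"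
  proof (rule AE_eq_0_if_LBINT_upto_eq_0[OF li])
    fix t assume t: "t \<in> {0..T}"
    have "(\<lambda>k. (LBINT u:{0..t}. X u ^ k * h u)) \<longlonglongrightarrow> (LBINT u:{0..t}. of_bool (X u = 1) * h u)"
      unfolding set_lebesgue_integral_def
    proof (rule integral_dominated_convergence[where w="\<lambda>u. indicator {0..T} u * \<bar>h u\<bar>"])
      show "integrable lborel (\<lambda>u. indicator {0..T} u * \<bar>h u\<bar>)"
        using set_integrable_abs[OF h] by (simp add: set_integrable_def)
      have sub: "set_integrable lborel {0..t} f" if "set_integrable lborel {0..T} f" for f :: "real \<Rightarrow> real"
        by (rule set_integrable_subset[OF that]) (use t in auto)
      show "(\<lambda>u. indicator {0..t} u *\<^sub>R (of_bool (X u = 1) * h u)) \<in> borel_measurable lborel"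
        using sub[OF li] by (auto simp: set_integrable_def dest: borel_measurable_integrable)
      show "(\<lambda>u. indicator {0..t} u *\<^sub>R (X u ^ k * h u)) \<in> borel_measurable lborel" for k
        using sub[OF km[of k]] by (auto simp: set_integrable_def dest: borel_measurable_integrable)
      show "AE u in lborel. (\<lambda>k. indicator {0..t} u *\<^sub>R (X u ^ k * h u)) \<longlonglongrightarrow> indicator {0..t} u *\<^sub>R (of_bool (X u = 1) * h u)"
        using pw t by (intro AE_I2) (auto simp: indicator_def)
      show "AE u in lborel. norm (indicator {0..t} u *\<^sub>R (X u ^ k * h u)) \<le> indicator {0..T} u * \<bar>h u\<bar>" for k
      proof (intro AE_I2)
        fix u
        have "\<bar>X u ^ k * h u\<bar> \<le> 1 * \<bar>h u\<bar>" if "u \<in> {0..T}"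
          using X01[OF that] unfolding abs_mult by (intro mult_right_mono) (auto simp: power_abs power_le_one)
        then show "norm (indicator {0..t} u *\<^sub>R (X u ^ k * h u)) \<le> indicator {0..T} u * \<bar>h u\<bar>"
          using t by (auto simp: indicator_def)
      qed
    qed
    moreover have "(\<lambda>k. (LBINT u:{0..t}. X u ^ k * h u)) \<longlonglongrightarrow> 0"
    proof (rule Lim_null_comparison)
      show "\<forall>\<^sub>F k in sequentially. norm (LBINT u:{0..t}. X u ^ k * h u) \<le> 1 * inverse (real (Suc k))"
      proof (intro always_eventually allI)
        fix k
        have "X t ^ Suc k = x0 ^ Suc k + (LBINT u:{0..t}. real (Suc k) * (X u ^ k * h u))"
          using power_of_integral[OF h X t, of k] by (simp add: mult.assoc)
        then have "real (Suc k) * (LBINT u:{0..t}. X u ^ k * h u) = X t ^ Suc k - x0 ^ Suc k" by simp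
        moreover have "\<bar>X t ^ Suc k - x0 ^ Suc k\<bar> \<le> 1"
          using X01[OF t] x0 power_le_one[of "X t" "Suc k"] power_le_one[of x0 "Suc k"]
            zero_le_power[of "X t" "Suc k"] zero_le_power[of x0 "Suc k"] unfolding abs_le_iff by linarith
        ultimately have "\<bar>real (Suc k) * (LBINT u:{0..t}. X u ^ k * h u)\<bar> \<le> 1" by simp
        then show "norm (LBINT u:{0..t}. X u ^ k * h u) \<le> 1 * inverse (real (Suc k))"
          by (simp add: abs_mult field_simps)
      qed
      show "(\<lambda>k. 1 * inverse (real (Suc k))) \<longlonglongrightarrow> 0" using LIMSEQ_inverse_real_of_nat by simp
    qed
    ultimately show "(LBINT u:{0..t}. of_bool (X u = 1) * h u) = 0" by (rule LIMSEQ_unique)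
  qed
  then show ?thesis by eventually_elim auto
qed

section \<open>Convolution of a density with the service law\<close>

context service_density
begin

text \<open>Fubini is applied in two ways to the integral of
  \<open>l u * (1 - tail (t - u))\<close>. In the variables \<open>u\<close> and \<open>v\<close> it
  is the convolution of \<open>g\<close> with the primitive of \<open>l\<close>; in \<open>u\<close>
  and \<open>s = u + v\<close> it is the integral up to \<open>t\<close> of the function in the
  second claim. The first form leads to the integral equation, the second exhibits a density of the
  convolution.\<close>

lemma convolution_Fubini:
  fixes l :: "real \<Rightarrow> real"
  assumes l: "set_integrable lborel {0..T} l" and t: "t \<in> {0..T}"
  shows "(LBINT u:{0..t}. l u * tail (t - u)) = (LBINT u:{0..t}. l u) - conv_upto g (\<lambda>s. LBINT u:{0..s}. l u) t"
    and "set_integrable lborel {0..T} (\<lambda>s. LBINT u:{0..s}. l u * g (s - u))"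
    and "conv_upto g (\<lambda>s. LBINT u:{0..s}. l u) t = (LBINT s:{0..t}. (LBINT u:{0..s}. l u * g (s - u)))"
proof -
  \<comment> \<open>Extension by zero lets the integrals run over the whole line, where translation
    invariance applies.\<close>
  define A where "A x = indicator {0..T} x * l x" for x
  define B where "B x = indicator {0..} x * g x" for x
  have A: "integrable lborel A" using l by (simp add: A_def[abs_def] set_integrable_def)
  have B: "integrable lborel B" using g_integrable by (simp add: B_def[abs_def] set_integrable_def)
  have [measurable]: "A \<in> borel_measurable borel" "B \<in> borel_measurable borel"
    using A B by (auto dest: borel_measurable_integrable)
  have Bs: "integrable lborel (\<lambda>s. B (s - u))" "(\<integral>s. \<bar>B (s - u)\<bar> \<partial>lborel) = (\<integral>s. \<bar>B s\<bar> \<partial>lborel)" for u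
    using lborel_integrable_real_affine[OF B, of 1 "- u"] lborel_integral_real_affine[of 1 "\<lambda>s. \<bar>B s\<bar>" "- u"] by simp_all
  have H: "integrable (lborel \<Otimes>\<^sub>M lborel) (\<lambda>(u, s). A u * B (s - u))"
  proof (rule lborel_pair.Fubini_integrable)
    show "integrable lborel (\<lambda>u. \<integral>s. norm (case (u, s) of (u, s) \<Rightarrow> A u * B (s - u)) \<partial>lborel)"
      using A Bs by (simp add: abs_mult)
    show "AE u in lborel. integrable lborel (\<lambda>s. case (u, s) of (u, s) \<Rightarrow> A u * B (s - u))"
      using Bs by (intro AE_I2) simp
  qed measurable
  have Ht: "integrable (lborel \<Otimes>\<^sub>M lborel) (\<lambda>(u, s). A u * (B (s - u) * of_bool (s \<le> t)))"
    by (rule Bochner_Integration.integrable_bound[OF H]) auto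
  have inner: "(\<integral>u. A u * B (s - u) \<partial>lborel) = (if s \<in> {0..} then (LBINT u:{0..s}. l u * g (s - u)) else 0)" if "s \<le> T" for s
  proof (cases "0 \<le> s")
    case True
    have "(\<integral>u. A u * B (s - u) \<partial>lborel) = (LBINT u:{0..s}. l u * g (s - u))"
      unfolding set_lebesgue_integral_def
      by (rule Bochner_Integration.integral_cong) (use that True in \<open>auto simp: A_def B_def indicator_def\<close>)
    then show ?thesis using True by simp
  next
    case False
    then have "(\<integral>u. A u * B (s - u) \<partial>lborel) = 0"
      by (intro integral_eq_zero_AE AE_I2) (auto simp: A_def B_def indicator_def)
    then show ?thesis using False by simp
  qed
  have "integrable lborel (\<lambda>s. \<integral>u. A u * B (s - u) \<partial>lborel)"
    using lborel_pair.integrable_snd[OF H] by simp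
  from integrable_mult_indicator[OF _ this, of "{0..T}"]
  have "integrable lborel (\<lambda>s. indicator {0..T} s *\<^sub>R (\<integral>u. A u * B (s - u) \<partial>lborel))" by simp
  then show "set_integrable lborel {0..T} (\<lambda>s. LBINT u:{0..s}. l u * g (s - u))"
    unfolding set_integrable_def
    by (rule Bochner_Integration.integrable_cong[THEN iffD1, OF refl, rotated]) (auto simp: indicator_def inner)
  have tl: "(\<integral>s. B (s - u) * of_bool (s \<le> t) \<partial>lborel) = 1 - tail (t - u)" if "u \<in> {0..t}" for u
  proof -
    have "(\<integral>s. B (s - u) * of_bool (s \<le> t) \<partial>lborel) = (\<integral>v. B (u + v - u) * of_bool (u + v \<le> t) \<partial>lborel)"
      using lborel_integral_real_affine[of 1 "\<lambda>s. B (s - u) * of_bool (s \<le> t)" u] by simp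
    also have "\<dots> = (LBINT v:{0..t - u}. g v)"
      unfolding set_lebesgue_integral_def by (rule Bochner_Integration.integral_cong) (auto simp: B_def indicator_def)
    finally show ?thesis by (simp add: tail_def)
  qed
  have Atl: "A u * (\<integral>s. B (s - u) * of_bool (s \<le> t) \<partial>lborel) = indicator {0..t} u *\<^sub>R (l u * (1 - tail (t - u)))" for u
  proof (cases "u \<in> {0..t}")
    case True
    then show ?thesis using t by (simp add: tl A_def)
  next
    case False
    then have "(\<integral>s. A u * (B (s - u) * of_bool (s \<le> t)) \<partial>lborel) = 0"
      by (intro integral_eq_zero_AE AE_I2) (auto simp: A_def B_def indicator_def)
    then show ?thesis using False by simp
  qed
  have swap: "(LBINT u:{0..t}. l u * (1 - tail (t - u))) = (LBINT s:{0..t}. (LBINT u:{0..s}. l u * g (s - u)))"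
  proof -
    have "(LBINT u:{0..t}. l u * (1 - tail (t - u))) = (\<integral>u. (\<integral>s. A u * (B (s - u) * of_bool (s \<le> t)) \<partial>lborel) \<partial>lborel)"
      by (simp add: Atl set_lebesgue_integral_def)
    also have "\<dots> = (\<integral>s. (\<integral>u. A u * (B (s - u) * of_bool (s \<le> t)) \<partial>lborel) \<partial>lborel)"
      using lborel_pair.integral_fst[OF Ht] lborel_pair.integral_snd[OF Ht] by simp
    also have "\<dots> = (LBINT s:{0..t}. (LBINT u:{0..s}. l u * g (s - u)))"
      unfolding set_lebesgue_integral_def[of lborel "{0..t}"]
    proof (rule Bochner_Integration.integral_cong)
      fix s
      have "(\<integral>u. A u * (B (s - u) * of_bool (s \<le> t)) \<partial>lborel) = (\<integral>u. A u * B (s - u) \<partial>lborel) * of_bool (s \<le> t)"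
        by (simp add: mult.assoc[symmetric])
      then show "(\<integral>u. A u * (B (s - u) * of_bool (s \<le> t)) \<partial>lborel) = indicator {0..t} s *\<^sub>R (LBINT u:{0..s}. l u * g (s - u))"
        using t by (auto simp: indicator_def inner)
    qed simp
    finally show ?thesis .
  qed
  have AB: "integrable (lborel \<Otimes>\<^sub>M lborel) (\<lambda>(u, v). A u * (B v * of_bool (u + v \<le> t)))"
  proof (rule Bochner_Integration.integrable_bound)
    show "integrable (lborel \<Otimes>\<^sub>M lborel) (\<lambda>(u, v). A u * B v)"
    proof (rule lborel_pair.Fubini_integrable)
      show "integrable lborel (\<lambda>u. \<integral>v. norm (case (u, v) of (u, v) \<Rightarrow> A u * B v) \<partial>lborel)"
        using A by (simp add: abs_mult)
      show "AE u in lborel. integrable lborel (\<lambda>v. case (u, v) of (u, v) \<Rightarrow> A u * B v)"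
        using B by (intro AE_I2) simp
    qed measurable
  qed auto
  have swap': "(LBINT u:{0..t}. l u * (1 - tail (t - u))) = conv_upto g (\<lambda>s. LBINT u:{0..s}. l u) t"
  proof -
    have e: "(\<integral>v. B v * of_bool (u + v \<le> t) \<partial>lborel) = (\<integral>s. B (s - u) * of_bool (s \<le> t) \<partial>lborel)" for u
      using lborel_integral_real_affine[of 1 "\<lambda>s. B (s - u) * of_bool (s \<le> t)" u] by simp
    have "(LBINT u:{0..t}. l u * (1 - tail (t - u))) = (\<integral>u. (\<integral>v. A u * (B v * of_bool (u + v \<le> t)) \<partial>lborel) \<partial>lborel)"
      by (simp add: Atl set_lebesgue_integral_def e)
    also have "\<dots> = (\<integral>v. (\<integral>u. A u * (B v * of_bool (u + v \<le> t)) \<partial>lborel) \<partial>lborel)"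
      using lborel_pair.integral_fst[OF AB] lborel_pair.integral_snd[OF AB] by simp
    also have "\<dots> = conv_upto g (\<lambda>s. LBINT u:{0..s}. l u) t"
      unfolding conv_upto_def set_lebesgue_integral_def[of lborel "{0..t}"]
    proof (rule Bochner_Integration.integral_cong)
      fix v
      have "(\<integral>u. A u * (B v * of_bool (u + v \<le> t)) \<partial>lborel) = (\<integral>u. B v * (A u * of_bool (u + v \<le> t)) \<partial>lborel)"
        by (simp add: mult_ac)
      also have "\<dots> = B v * (\<integral>u. A u * of_bool (u + v \<le> t) \<partial>lborel)" by simp
      also have "\<dots> = indicator {0..t} v *\<^sub>R (g v * (LBINT u:{0..t - v}. l u))"
      proof (cases "v \<in> {0..t}")
        case True
        then have "(\<integral>u. A u * of_bool (u + v \<le> t) \<partial>lborel) = (LBINT u:{0..t - v}. l u)"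
          unfolding set_lebesgue_integral_def
          by (intro Bochner_Integration.integral_cong) (use t in \<open>auto simp: A_def indicator_def\<close>)
        then show ?thesis using True by (simp add: B_def)
      next
        case False
        then have "(\<integral>u. B v * (A u * of_bool (u + v \<le> t)) \<partial>lborel) = 0"
          by (intro integral_eq_zero_AE AE_I2) (auto simp: A_def B_def indicator_def)
        then show ?thesis using False by simp
      qed
      finally show "(\<integral>u. A u * (B v * of_bool (u + v \<le> t)) \<partial>lborel) = indicator {0..t} v *\<^sub>R (g v * (LBINT u:{0..t - v}. l u))" .
    qed simp
    finally show ?thesis .
  qed
  then show "conv_upto g (\<lambda>s. LBINT u:{0..s}. l u) t = (LBINT s:{0..t}. (LBINT u:{0..s}. l u * g (s - u)))"
    using swap by simp
  have it: "set_integrable lborel {0..t} l" by (rule set_integrable_subset[OF l]) (use t in auto)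
  have "set_integrable lborel {0..t} (\<lambda>u. tail (t - u) * l u)"
    by (rule set_integrable_mult_continuous[OF it])
       (intro continuous_on_compose2[OF continuous_on_tail[of UNIV]] continuous_intros; auto)
  then have itl: "set_integrable lborel {0..t} (\<lambda>u. l u * tail (t - u))" by (simp add: mult.commute)
  have "(LBINT u:{0..t}. l u * (1 - tail (t - u))) = (LBINT u:{0..t}. l u) - (LBINT u:{0..t}. l u * tail (t - u))"
    by (subst set_integral_diff(2)[OF it itl, symmetric]) (simp add: algebra_simps)
  then show "(LBINT u:{0..t}. l u * tail (t - u)) = (LBINT u:{0..t}. l u) - conv_upto g (\<lambda>s. LBINT u:{0..s}. l u) t"
    using swap' by simp
qed

end

text \<open>With respect to the finite measure \<open>\<mu>\<close> of density \<open>lam\<close> on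
  \<open>{0..T}\<close>, the integrals of \<open>h n - w\<close> over initial intervals with
  rational end tend to 0. Boundedness extends this to all initial intervals, a Dynkin argument to
  Borel sets, and approximation to integrable functions.\<close>

lemma weak_star_density:
  fixes lam w :: "real \<Rightarrow> real" and h :: "nat \<Rightarrow> real \<Rightarrow> real"
  assumes T: "0 < T" and lam: "set_integrable lborel {0..T} lam" and lam_nn: "\<And>x. 0 \<le> x \<Longrightarrow> 0 \<le> lam x"
    and h: "\<And>n. n \<ge> 1 \<Longrightarrow> set_borel_measurable borel {0..T} (h n)" "\<And>n x. n \<ge> 1 \<Longrightarrow> \<bar>h n x\<bar> \<le> 1"
    and w: "w \<in> borel_measurable borel" "\<And>x. \<bar>w x\<bar> \<le> 1"
    and conv: "\<And>p. p \<in> \<rat> \<Longrightarrow> p \<in> {0..T} \<Longrightarrow>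
      (\<lambda>n. LBINT u:{0..p}. h n u * lam u) \<longlonglongrightarrow> (LBINT u:{0..p}. w u * lam u)"
  shows "weak_star_conv_on {t \<in> {0..T}. 0 < lam t} h w"
proof -
  define l where "l x = indicator {0..T} x * lam x" for x
  have l_int: "integrable lborel l" using lam by (simp add: l_def[abs_def] set_integrable_def)
  have [measurable]: "l \<in> borel_measurable borel" using l_int by (auto dest: borel_measurable_integrable)
  have l_nn: "0 \<le> l x" for x using lam_nn by (auto simp: l_def indicator_def)
  \<comment> \<open>Putting 0 for \<open>n = 0\<close> and outside \<open>{0..T}\<close> makes
    \<open>d n\<close> Borel and bounded for every \<open>n\<close>.\<close>
  define d where "d n x = (if n \<ge> 1 then indicator {0..T} x * (h n x - w x) else 0)" for n x
  have hm: "(\<lambda>x. indicator {0..T} x * h n x) \<in> borel_measurable borel" if "n \<ge> 1" for n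
    using h(1)[OF that] by (simp add: set_borel_measurable_def)
  have [measurable]: "d n \<in> borel_measurable borel" for n
  proof (cases "n \<ge> 1")
    case True
    note [measurable] = hm[OF True] w(1)
    have "(\<lambda>x. indicator {0..T} x * h n x - indicator {0..T} x * w x) \<in> borel_measurable borel" by measurable
    then show ?thesis using True by (simp add: d_def[abs_def] right_diff_distrib)
  qed (simp add: d_def[abs_def])
  have d2: "\<bar>d n x\<bar> \<le> 2" for n x
    using h(2)[of n x] w(2)[of x] by (auto simp: d_def indicator_def)
  define \<mu> where "\<mu> = density lborel (\<lambda>x. ennreal (l x))"
  have s\<mu>[measurable_cong, simp]: "sets \<mu> = sets borel" by (simp add: \<mu>_def)
  have sp\<mu>[simp]: "space \<mu> = UNIV" by (simp add: \<mu>_def)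
  interpret \<mu>: finite_measure \<mu>
  proof
    have "emeasure \<mu> (space \<mu>) = (\<integral>\<^sup>+x. ennreal (l x) \<partial>lborel)" by (simp add: \<mu>_def emeasure_density)
    also have "\<dots> = ennreal (\<integral>x. l x \<partial>lborel)" by (rule nn_integral_eq_integral[OF l_int]) (use l_nn in auto)
    finally show "emeasure \<mu> (space \<mu>) \<noteq> \<infinity>" by simp
  qed
  have d_int: "integrable \<mu> (d n)" for n
    by (rule \<mu>.integrable_const_bound[of _ 2]) (use d2 in auto)
  have int\<mu>: "(\<integral>x. f x \<partial>\<mu>) = (\<integral>x. l x * f x \<partial>lborel)" if "f \<in> borel_measurable borel" for f :: "real \<Rightarrow> real"
    unfolding \<mu>_def using that l_nn by (subst integral_real_density) auto
  define I where "I n A = (\<integral>x. indicator A x * d n x \<partial>\<mu>)" for n A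
  have Iint: "integrable \<mu> (\<lambda>x. indicator A x * d n x)" if "A \<in> sets borel" for n A
    using integrable_mult_indicator[OF _ d_int, of A] that by simp
  \<comment> \<open>This bound is uniform in \<open>n\<close>, so sets of small measure can be
    neglected before passing to the limit.\<close>
  have Ib: "\<bar>I n A\<bar> \<le> 2 * measure \<mu> A" if A: "A \<in> sets borel" for n A
  proof -
    have "\<bar>I n A\<bar> \<le> (\<integral>x. \<bar>indicator A x * d n x\<bar> \<partial>\<mu>)" unfolding I_def by (rule integral_abs_bound)
    also have "\<dots> \<le> (\<integral>x. 2 * indicator A x \<partial>\<mu>)"
    proof (rule integral_mono)
      show "integrable \<mu> (\<lambda>x. \<bar>indicator A x * d n x\<bar>)" using Iint[OF A] by (rule integrable_abs)
      show "integrable \<mu> (\<lambda>x. 2 * indicator A x :: real)"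
        by (intro integrable_mult_right integrable_real_indicator) (use A in \<open>auto simp: \<mu>.emeasure_eq_measure\<close>)
      show "\<bar>indicator A x * d n x\<bar> \<le> 2 * indicator A x" for x using d2 by (auto simp: indicator_def)
    qed
    finally show ?thesis using A by simp
  qed
  have Iun: "I n (A \<union> B) = I n A + I n B" if "A \<in> sets borel" "B \<in> sets borel" "A \<inter> B = {}" for n A B
  proof -
    have "I n (A \<union> B) = (\<integral>x. indicator A x * d n x + indicator B x * d n x \<partial>\<mu>)"
      unfolding I_def by (rule Bochner_Integration.integral_cong) (use that in \<open>auto simp: indicator_def\<close>)
    also have "\<dots> = I n A + I n B" unfolding I_def by (rule Bochner_Integration.integral_add) (use that Iint in auto)
    finally show ?thesis .
  qed
  have I0p: "(\<lambda>n. I n {..p}) \<longlonglongrightarrow> 0" if p: "p \<in> \<rat>" "p \<in> {0..T}" for p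
  proof -
    have pT: "p \<le> T" using p by simp
    have li: "set_integrable lborel {0..p} lam" by (rule set_integrable_subset[OF lam]) (use p in auto)
    have lm: "(\<lambda>x. indicator {0..p} x * lam x) \<in> borel_measurable borel"
      using li by (auto simp: set_integrable_def dest: borel_measurable_integrable)
    have wi: "set_integrable lborel {0..p} (\<lambda>u. w u * lam u)"
    proof (rule set_integrable_bound[OF li])
      have "(\<lambda>x. w x * (indicator {0..p} x * lam x)) \<in> borel_measurable borel" using w(1) lm by measurable
      then show "set_borel_measurable lborel {0..p} (\<lambda>u. w u * lam u)" by (simp add: set_borel_measurable_def mult_ac)
    qed (use w(2) in \<open>auto intro!: AE_I2 simp: abs_mult mult_left_le_one_le\<close>)
    have hi: "set_integrable lborel {0..p} (\<lambda>u. h n u * lam u)" if n: "n \<ge> 1" for n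
    proof (rule set_integrable_bound[OF li])
      have "(\<lambda>x. (indicator {0..T} x * h n x) * (indicator {0..p} x * lam x)) \<in> borel_measurable borel"
        using hm[OF n] lm by measurable
      also have "(\<lambda>x. (indicator {0..T} x * h n x) * (indicator {0..p} x * lam x)) = (\<lambda>x. indicator {0..p} x *\<^sub>R (h n x * lam x))"
        using pT by (auto simp: indicator_def fun_eq_iff)
      finally show "set_borel_measurable lborel {0..p} (\<lambda>u. h n u * lam u)" by (simp add: set_borel_measurable_def)
    qed (use h(2)[OF n] in \<open>auto intro!: AE_I2 simp: abs_mult mult_left_le_one_le\<close>)
    have "I n {..p} = (LBINT u:{0..p}. h n u * lam u) - (LBINT u:{0..p}. w u * lam u)" if n: "n \<ge> 1" for n
    proof -
      have "I n {..p} = (\<integral>x. l x * (indicator {..p} x * d n x) \<partial>lborel)" unfolding I_def by (rule int\<mu>) measurable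
      also have "\<dots> = (LBINT u:{0..p}. h n u * lam u - w u * lam u)"
        unfolding set_lebesgue_integral_def
        by (rule Bochner_Integration.integral_cong) (use n pT in \<open>auto simp: l_def d_def indicator_def algebra_simps\<close>)
      also have "\<dots> = (LBINT u:{0..p}. h n u * lam u) - (LBINT u:{0..p}. w u * lam u)"
        by (rule set_integral_diff(2)[OF hi[OF n] wi])
      finally show ?thesis .
    qed
    then have "\<forall>\<^sub>F n in sequentially. (LBINT u:{0..p}. h n u * lam u) - (LBINT u:{0..p}. w u * lam u) = I n {..p}"
      unfolding eventually_sequentially by (intro exI[of _ 1]) auto
    moreover have "(\<lambda>n. (LBINT u:{0..p}. h n u * lam u) - (LBINT u:{0..p}. w u * lam u)) \<longlonglongrightarrow> 0"
      using conv[OF p] by (simp add: LIM_zero_iff)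
    ultimately show ?thesis by (rule Lim_transform_eventually[rotated])
  qed
  have negl: "I n A = 0" if "A \<inter> {0..T} = {}" for n A
    unfolding I_def using that by (intro integral_eq_zero_AE AE_I2) (auto simp: d_def indicator_def)
  have I0: "(\<lambda>n. I n {..t}) \<longlonglongrightarrow> 0" for t
  proof (cases "t \<le> 0")
    case True
    have "measure \<mu> {..t} = 0"
    proof -
      have "emeasure \<mu> {..t} = (\<integral>\<^sup>+x. ennreal (l x) * indicator {..t} x \<partial>lborel)" by (simp add: \<mu>_def emeasure_density)
      also have "\<dots> = (\<integral>\<^sup>+x. 0 \<partial>(lborel :: real measure))"
        by (rule nn_integral_cong_AE, rule AE_mp[OF AE_lborel_singleton[of 0]]) (use True in \<open>auto simp: l_def indicator_def\<close>)
      finally show ?thesis by (simp add: measure_def)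
    qed
    then have "I n {..t} = 0" for n using Ib[of "{..t}" n] by simp
    then show ?thesis by simp
  next
    case False
    define t' where "t' = min t T"
    have t': "0 < t'" "t' \<le> T" using False T by (auto simp: t'_def)
    have "{..t} = {..t'} \<union> {t'<..t}" "{t'<..t} \<inter> {0..T} = {}" "{..t'} \<inter> {t'<..t} = {}" by (auto simp: t'_def)
    then have tt': "I n {..t} = I n {..t'}" for n
      using Iun[of "{..t'}" "{t'<..t}" n] negl[of "{t'<..t}" n] by simp
    show ?thesis
    proof (rule LIMSEQ_I)
      fix e :: real assume e: "0 < e"
      have "(\<lambda>i. measure \<mu> {t' - inverse (real (Suc i))<..<t'}) \<longlonglongrightarrow> measure \<mu> (\<Inter>i. {t' - inverse (real (Suc i))<..<t'})"
      proof (rule \<mu>.finite_Lim_measure_decseq)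
        show "decseq (\<lambda>i. {t' - inverse (real (Suc i))<..<t'})"
        proof (rule decseq_SucI)
          fix n
          have "inverse (real (Suc (Suc n))) \<le> inverse (real (Suc n))" by (rule le_imp_inverse_le) auto
          then show "{t' - inverse (real (Suc (Suc n)))<..<t'} \<subseteq> {t' - inverse (real (Suc n))<..<t'}"
            by (intro subsetI) (unfold greaterThanLessThan_iff, intro conjI; linarith)
        qed
      qed auto
      moreover have "(\<Inter>i. {t' - inverse (real (Suc i))<..<t'}) = {}"
      proof (rule equals0I)
        fix x assume x: "x \<in> (\<Inter>i. {t' - inverse (real (Suc i))<..<t'})"
        then have "0 < t' - x" by auto
        then obtain i where "inverse (real (Suc i)) < t' - x" using reals_Archimedean by blast
        moreover have "x \<in> {t' - inverse (real (Suc i))<..<t'}" using x by blast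
        then have "t' - inverse (real (Suc i)) < x" unfolding greaterThanLessThan_iff by simp
        ultimately show False by linarith
      qed
      ultimately have "(\<lambda>i. measure \<mu> {t' - inverse (real (Suc i))<..<t'}) \<longlonglongrightarrow> 0" by simp
      then have "\<forall>\<^sub>F i in sequentially. measure \<mu> {t' - inverse (real (Suc i))<..<t'} < e / 4"
        using e by (intro order_tendstoD) auto
      then obtain i where i: "measure \<mu> {t' - inverse (real (Suc i))<..<t'} < e / 4" by (auto simp: eventually_sequentially)
      \<comment> \<open>A rational \<open>p\<close> is taken so close to the left of
        \<open>t'\<close> that the interval in between has small measure; this is possible because
        \<open>{t'}\<close> is null.\<close>
      have "max 0 (t' - inverse (real (Suc i))) < t'" using t' by simp
      then obtain p where p: "p \<in> \<rat>" "max 0 (t' - inverse (real (Suc i))) < p" "p < t'" using Rats_dense_in_real by blast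
      have pT: "p \<in> {0..T}" using p t' by auto
      have m0: "measure \<mu> {t'} = 0"
      proof -
        have "emeasure \<mu> {t'} = (\<integral>\<^sup>+x. ennreal (l x) * indicator {t'} x \<partial>lborel)" by (simp add: \<mu>_def emeasure_density)
        also have "\<dots> = (\<integral>\<^sup>+x. 0 \<partial>(lborel :: real measure))"
          by (rule nn_integral_cong_AE, rule AE_mp[OF AE_lborel_singleton[of t']]) (auto simp: indicator_def)
        finally show ?thesis by (simp add: measure_def)
      qed
      have "measure \<mu> {p<..t'} \<le> measure \<mu> ({t' - inverse (real (Suc i))<..<t'} \<union> {t'})"
        by (rule \<mu>.finite_measure_mono) (use p in auto)
      also have "\<dots> \<le> measure \<mu> {t' - inverse (real (Suc i))<..<t'} + measure \<mu> {t'}"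
        by (rule measure_Un_le) auto
      finally have mp: "measure \<mu> {p<..t'} < e / 4" using i m0 by simp
      have "{..t'} = {..p} \<union> {p<..t'}" using p by auto
      then have dec: "I n {..t} = I n {..p} + I n {p<..t'}" for n
        using Iun[of "{..p}" "{p<..t'}" n] by (simp add: tt' disjoint_iff)
      from LIMSEQ_D[OF I0p[OF p(1) pT], of "e / 2"] e obtain no where no: "\<And>n. n \<ge> no \<Longrightarrow> \<bar>I n {..p}\<bar> < e / 2" by auto
      show "\<exists>no. \<forall>n\<ge>no. norm (I n {..t} - 0) < e"
      proof (intro exI[of _ no] allI impI)
        fix n assume "no \<le> n"
        then show "norm (I n {..t} - 0) < e" using no[of n] Ib[of "{p<..t'}" n] mp dec[of n] by simp
      qed
    qed
  qed
  have I_all: "(\<lambda>n. I n A) \<longlonglongrightarrow> 0" if "A \<in> sets borel" for A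
  proof -
    have IUNIV: "I n UNIV = I n {..T}" for n
    proof -
      have "(UNIV :: real set) = {..T} \<union> {T<..}" "{..T} \<inter> {T<..} = {}" "{T<..} \<inter> {0..T} = {}" by auto
      then show ?thesis using Iun[of "{..T}" "{T<..}" n] negl[of "{T<..}" n] by simp
    qed
    have bs: "sets borel = sigma_sets UNIV (range (\<lambda>t::real. {..t}))" by (subst borel_eq_atMost) simp
    have "Int_stable (range (\<lambda>t::real. {..t}))"
      unfolding Int_stable_def
    proof safe
      fix a b :: real
      have "{..a} \<inter> {..b} = {..min a b}" by auto
      then show "{..a} \<inter> {..b} \<in> range (\<lambda>t::real. {..t})" by blast
    qed
    moreover have "range (\<lambda>t::real. {..t}) \<subseteq> Pow UNIV" by simp
    moreover have "A \<in> sigma_sets UNIV (range (\<lambda>t::real. {..t}))" using that bs by simp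
    ultimately show ?thesis
    proof (induction rule: sigma_sets_induct_disjoint)
      case (basic A)
      then show ?case using I0 by auto
    next
      case empty
      then show ?case by (simp add: I_def)
    next
      case (compl A)
      then have A: "A \<in> sets borel" by (simp add: bs)
      have "I n (UNIV - A) = I n {..T} - I n A" for n
        using Iun[of A "UNIV - A" n] A IUNIV[of n] by simp
      then show ?case using tendsto_diff[OF I0[of T] compl(2)] by simp
    next
      case (union A)
      then have A: "A i \<in> sets borel" for i by (auto simp: bs)
      show ?case
      proof (rule LIMSEQ_I)
        fix e :: real assume e: "0 < e"
        \<comment> \<open>The remainder after \<open>m\<close> sets has small measure, so the
          countable union reduces to a finite one uniformly in \<open>n\<close>.\<close>
        define R where "R m = (\<Union>i. A i) - (\<Union>i<m. A i)" for m
        have Rb: "R m \<in> sets borel" for m unfolding R_def using A by auto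
        have "(\<lambda>m. measure \<mu> (R m)) \<longlonglongrightarrow> measure \<mu> (\<Inter>m. R m)"
          by (rule \<mu>.finite_Lim_measure_decseq) (use Rb in \<open>auto simp: R_def decseq_def\<close>)
        moreover have "(\<Inter>m. R m) = {}" by (auto simp: R_def)
        ultimately have "(\<lambda>m. measure \<mu> (R m)) \<longlonglongrightarrow> 0" by simp
        then have "\<forall>\<^sub>F m in sequentially. measure \<mu> (R m) < e / 4" using e by (intro order_tendstoD) auto
        then obtain m where m: "measure \<mu> (R m) < e / 4" by (auto simp: eventually_sequentially)
        have fin: "I n (\<Union>i<k. A i) = (\<Sum>i<k. I n (A i))" for n k
        proof (induction k)
          case 0
          then show ?case by (simp add: I_def)
        next
          case (Suc k)
          have "A k \<inter> A i = {}" if "i < k" for i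
            by (rule disjoint_family_onD[OF union(1)]) (use that in auto)
          then have "A k \<inter> (\<Union>i<k. A i) = {}" by blast
          then show ?case using Iun[of "A k" "\<Union>i<k. A i" n] A Suc by (simp add: lessThan_Suc)
        qed
        have dec: "I n (\<Union>i. A i) = (\<Sum>i<m. I n (A i)) + I n (R m)" for n
        proof -
          have "(\<Union>i. A i) = (\<Union>i<m. A i) \<union> R m" by (auto simp: R_def)
          moreover have "(\<Union>i<m. A i) \<inter> R m = {}" by (auto simp: R_def)
          ultimately show ?thesis using Iun[of "\<Union>i<m. A i" "R m" n] A Rb fin by simp
        qed
        have "(\<lambda>n. \<Sum>i<m. I n (A i)) \<longlonglongrightarrow> (\<Sum>i<m. 0)" by (intro tendsto_sum union(3))
        then have "(\<lambda>n. \<Sum>i<m. I n (A i)) \<longlonglongrightarrow> 0" by simp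
        from LIMSEQ_D[OF this, of "e / 2"] e obtain no where no: "\<And>n. n \<ge> no \<Longrightarrow> \<bar>\<Sum>i<m. I n (A i)\<bar> < e / 2" by auto
        show "\<exists>no. \<forall>n\<ge>no. norm (I n (\<Union>i. A i) - 0) < e"
        proof (intro exI[of _ no] allI impI)
          fix n assume "no \<le> n"
          then show "norm (I n (\<Union>i. A i) - 0) < e" using no[of n] Ib[OF Rb, of n m] m dec[of n] by simp
        qed
      qed
    qed
  qed
  have dint: "integrable \<mu> (\<lambda>x. f x * d n x)" if "integrable \<mu> f" for f :: "real \<Rightarrow> real" and n
  proof (rule Bochner_Integration.integrable_bound)
    show "integrable \<mu> (\<lambda>x. 2 * f x)" using that by simp
    show "AE x in \<mu>. norm (f x * d n x) \<le> norm (2 * f x)"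
    proof (rule AE_I2)
      fix x show "norm (f x * d n x) \<le> norm (2 * f x)"
        using mult_left_mono[OF d2[of n x], of "\<bar>f x\<bar>"] by (simp add: abs_mult)
    qed
  qed (use that in measurable)
  have J: "(\<lambda>n. \<integral>x. f x * d n x \<partial>\<mu>) \<longlonglongrightarrow> 0" if "integrable \<mu> f" for f :: "real \<Rightarrow> real"
    using that
  proof (induction rule: integrable_induct)
    case (base A c)
    have "(\<integral>x. indicator A x *\<^sub>R c * d n x \<partial>\<mu>) = c * I n A" for n
      unfolding I_def by (subst integral_mult_right_zero[symmetric]) (simp add: mult_ac)
    then show ?case using tendsto_mult_right_zero[OF I_all[of A]] base by simp
  next
    case (add f1 f2)
    have "(\<integral>x. (f1 x + f2 x) * d n x \<partial>\<mu>) = (\<integral>x. f1 x * d n x \<partial>\<mu>) + (\<integral>x. f2 x * d n x \<partial>\<mu>)" for n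
      by (subst Bochner_Integration.integral_add[symmetric]) (use add dint in \<open>auto simp: distrib_right\<close>)
    then show ?case using tendsto_add[OF add.IH] by simp
  next
    case (lim f s)
    show ?case
    proof (rule LIMSEQ_I)
      fix e :: real assume e: "0 < e"
      have "(\<lambda>i. \<integral>x. \<bar>s i x - f x\<bar> \<partial>\<mu>) \<longlonglongrightarrow> (\<integral>x. 0 \<partial>\<mu>)"
      proof (rule integral_dominated_convergence[where w="\<lambda>x. 3 * \<bar>f x\<bar>"])
        show "integrable \<mu> (\<lambda>x. 3 * \<bar>f x\<bar>)" using lim by simp
        show "AE x in \<mu>. (\<lambda>i. \<bar>s i x - f x\<bar>) \<longlonglongrightarrow> 0"
          using lim.hyps(2) by (intro AE_I2 tendsto_rabs_zero) (simp add: LIM_zero)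
        show "AE x in \<mu>. norm \<bar>s i x - f x\<bar> \<le> 3 * \<bar>f x\<bar>" for i
        proof (rule AE_I2)
          fix x assume "x \<in> space \<mu>"
          from lim.hyps(3)[OF this, of i] show "norm \<bar>s i x - f x\<bar> \<le> 3 * \<bar>f x\<bar>" by simp
        qed
      qed (use lim in \<open>auto dest: borel_measurable_integrable\<close>)
      then have "\<forall>\<^sub>F i in sequentially. (\<integral>x. \<bar>s i x - f x\<bar> \<partial>\<mu>) < e / 4" using e by (intro order_tendstoD) auto
      then obtain i where i: "(\<integral>x. \<bar>s i x - f x\<bar> \<partial>\<mu>) < e / 4" by (auto simp: eventually_sequentially)
      have diff: "\<bar>(\<integral>x. f x * d n x \<partial>\<mu>) - (\<integral>x. s i x * d n x \<partial>\<mu>)\<bar> \<le> e / 2" for n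
      proof -
        have "(\<integral>x. f x * d n x \<partial>\<mu>) - (\<integral>x. s i x * d n x \<partial>\<mu>) = (\<integral>x. f x * d n x - s i x * d n x \<partial>\<mu>)"
          by (rule Bochner_Integration.integral_diff[symmetric]) (use lim dint in auto)
        also have "\<bar>\<dots>\<bar> \<le> (\<integral>x. \<bar>f x * d n x - s i x * d n x\<bar> \<partial>\<mu>)" by (rule integral_abs_bound)
        also have "\<dots> \<le> (\<integral>x. 2 * \<bar>s i x - f x\<bar> \<partial>\<mu>)"
        proof (rule integral_mono)
          show "integrable \<mu> (\<lambda>x. \<bar>f x * d n x - s i x * d n x\<bar>)" "integrable \<mu> (\<lambda>x. 2 * \<bar>s i x - f x\<bar>)"
            using lim dint by auto
          fix x
          have "\<bar>f x * d n x - s i x * d n x\<bar> = \<bar>s i x - f x\<bar> * \<bar>d n x\<bar>"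
            by (simp add: abs_mult[symmetric] abs_minus_commute algebra_simps)
          also have "\<dots> \<le> \<bar>s i x - f x\<bar> * 2" by (intro mult_left_mono d2) auto
          finally show "\<bar>f x * d n x - s i x * d n x\<bar> \<le> 2 * \<bar>s i x - f x\<bar>" by simp
        qed
        also have "\<dots> = 2 * (\<integral>x. \<bar>s i x - f x\<bar> \<partial>\<mu>)" by simp
        finally show ?thesis using i by simp
      qed
      from LIMSEQ_D[OF lim.IH[of i], of "e / 2"] e obtain no where no: "\<And>n. n \<ge> no \<Longrightarrow> \<bar>\<integral>x. s i x * d n x \<partial>\<mu>\<bar> < e / 2" by auto
      show "\<exists>no. \<forall>n\<ge>no. norm ((\<integral>x. f x * d n x \<partial>\<mu>) - 0) < e"
      proof (intro exI[of _ no] allI impI)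
        fix n assume "no \<le> n"
        then show "norm ((\<integral>x. f x * d n x \<partial>\<mu>) - 0) < e" using no[of n] diff[of n] unfolding real_norm_def by linarith
      qed
    qed
  qed
  show ?thesis
    unfolding weak_star_conv_on_def
  proof (intro allI impI)
    fix \<phi> :: "real \<Rightarrow> real" assume \<phi>: "set_integrable lborel {t \<in> {0..T}. 0 < lam t} \<phi>"
    let ?E = "{t \<in> {0..T}. 0 < lam t}"
    have E: "?E = {x. 0 < l x}" by (auto simp: l_def indicator_def split: if_splits)
    have [measurable]: "?E \<in> sets borel" unfolding E by measurable
    \<comment> \<open>Division by \<open>l\<close> turns a Lebesgue integrable function on the set
      where \<open>lam\<close> is positive into a \<open>\<mu>\<close>-integrable one.\<close>
    define \<psi> where "\<psi> x = indicator ?E x * \<phi> x / l x" for x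
    have \<phi>m[measurable]: "(\<lambda>x. indicator ?E x * \<phi> x) \<in> borel_measurable borel"
      using \<phi> by (auto simp: set_integrable_def dest: borel_measurable_integrable)
    have [measurable]: "\<psi> \<in> borel_measurable borel" unfolding \<psi>_def[abs_def] by measurable
    have l\<psi>: "l x * \<psi> x = indicator ?E x * \<phi> x" for x
      by (auto simp: \<psi>_def l_def indicator_def)
    have \<psi>: "integrable \<mu> \<psi>"
      unfolding \<mu>_def using \<phi> l_nn by (subst integrable_real_density) (auto simp: l\<psi> set_integrable_def)
    have eq: "(LBINT t:?E. \<phi> t * h n t) - (LBINT t:?E. \<phi> t * w t) = (\<integral>x. \<psi> x * d n x \<partial>\<mu>)" if n: "n \<ge> 1" for n
    proof -
      have i1: "set_integrable lborel ?E (\<lambda>t. \<phi> t * h n t)"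
      proof (rule set_integrable_bound[OF \<phi>])
        have "(\<lambda>x. (indicator ?E x * \<phi> x) * (indicator {0..T} x * h n x)) \<in> borel_measurable borel"
          using hm[OF n] \<phi>m by measurable
        also have "(\<lambda>x. (indicator ?E x * \<phi> x) * (indicator {0..T} x * h n x)) = (\<lambda>x. indicator ?E x *\<^sub>R (\<phi> x * h n x))"
          by (auto simp: indicator_def fun_eq_iff)
        finally show "set_borel_measurable lborel ?E (\<lambda>t. \<phi> t * h n t)" by (simp add: set_borel_measurable_def)
      qed (use h(2)[OF n] in \<open>auto intro!: AE_I2 simp: abs_mult mult_left_le\<close>)
      have i2: "set_integrable lborel ?E (\<lambda>t. \<phi> t * w t)"
      proof (rule set_integrable_bound[OF \<phi>])
        have "(\<lambda>x. (indicator ?E x * \<phi> x) * w x) \<in> borel_measurable borel"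
          using w(1) \<phi>m by measurable
        then show "set_borel_measurable lborel ?E (\<lambda>t. \<phi> t * w t)" by (simp add: set_borel_measurable_def mult_ac)
      qed (use w(2) in \<open>auto intro!: AE_I2 simp: abs_mult mult_left_le\<close>)
      have "(LBINT t:?E. \<phi> t * h n t) - (LBINT t:?E. \<phi> t * w t) = (LBINT t:?E. \<phi> t * h n t - \<phi> t * w t)"
        by (rule set_integral_diff(2)[OF i1 i2, symmetric])
      also have "\<dots> = (\<integral>x. l x * (\<psi> x * d n x) \<partial>lborel)"
        unfolding set_lebesgue_integral_def mult.assoc[symmetric] l\<psi>
        by (rule Bochner_Integration.integral_cong) (use n in \<open>auto simp: d_def indicator_def algebra_simps\<close>)
      also have "\<dots> = (\<integral>x. \<psi> x * d n x \<partial>\<mu>)" by (rule int\<mu>[symmetric]) measurable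
      finally show ?thesis .
    qed
    then have "\<forall>\<^sub>F n in sequentially. (\<integral>x. \<psi> x * d n x \<partial>\<mu>) = (LBINT t:?E. \<phi> t * h n t) - (LBINT t:?E. \<phi> t * w t)"
      unfolding eventually_sequentially by (intro exI[of _ 1]) auto
    then have "(\<lambda>n. (LBINT t:?E. \<phi> t * h n t) - (LBINT t:?E. \<phi> t * w t)) \<longlonglongrightarrow> 0"
      by (rule Lim_transform_eventually[OF J[OF \<psi>]])
    then show "(\<lambda>n. LBINT t:?E. \<phi> t * h n t) \<longlonglongrightarrow> (LBINT t:?E. \<phi> t * w t)"
      by (simp add: LIM_zero_iff)
  qed
qed

section \<open>Almost every path is good\<close>

text \<open>For \<open>u > 0\<close>, the index \<open>j\<close> of the cell
  \<open>t * j / m < u \<le> t * (j + 1) / m\<close>. Cells are left-open, so that the left end lies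
  strictly before \<open>u\<close>, as a left limit requires.\<close>

definition mesh_index :: "real \<Rightarrow> nat \<Rightarrow> real \<Rightarrow> nat" where
  "mesh_index t m u = nat (\<lceil>u * real m / t\<rceil> - 1)"

lemma mesh_index_iff:
  assumes t: "0 < t" and m: "0 < m" and u: "0 < u"
  shows "mesh_index t m u = j \<longleftrightarrow> t * real j / m < u \<and> u \<le> t * real (Suc j) / m"
proof -
  have pos: "0 < u * m / t" using assms by simp
  have "mesh_index t m u = j \<longleftrightarrow> \<lceil>u * m / t\<rceil> = int j + 1"
    using pos by (simp add: mesh_index_def) linarith
  also have "\<dots> \<longleftrightarrow> real j < u * m / t \<and> u * m / t \<le> real (Suc j)"
    by (simp add: ceiling_eq_iff add.commute)
  also have "real j < u * m / t \<longleftrightarrow> t * real j / m < u" using t m by (simp add: field_simps)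
  also have "u * m / t \<le> real (Suc j) \<longleftrightarrow> u \<le> t * real (Suc j) / m" using t m by (simp add: field_simps)
  finally show ?thesis .
qed

lemma mesh_point_le:
  assumes "0 < t" "j < m"
  shows "t * real (Suc j) / real m \<le> t"
proof -
  have "t * real (Suc j) \<le> t * real m" using assms by (intro mult_left_mono) auto
  then show ?thesis using assms by (simp add: pos_divide_le_eq)
qed

lemma mesh_index_less:
  assumes t: "0 < t" and m: "0 < m" and u: "0 < u" "u \<le> t"
  shows "mesh_index t m u < m"
proof -
  have "t * real (mesh_index t m u) / m < u" using mesh_index_iff[OF t m u(1)] by blast
  also have "u \<le> t" by fact
  finally show ?thesis using t m by (simp add: field_simps)
qed

lemma filterlim_mesh:
  assumes t: "0 < t" and u: "0 < u"
  shows "filterlim (\<lambda>m. t * real (mesh_index t m u) / m) (at_left u) sequentially"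
proof -
  have ev: "\<forall>\<^sub>F m in sequentially. t * real (mesh_index t m u) / m < u \<and> u - t / real m \<le> t * real (mesh_index t m u) / m"
    using eventually_gt_at_top[of 0]
  proof eventually_elim
    case (elim m)
    have "t * real (mesh_index t m u) / m < u" "u \<le> t * real (Suc (mesh_index t m u)) / m"
      using mesh_index_iff[OF t elim u] by blast+
    then show ?case by (simp add: field_simps add_divide_distrib)
  qed
  have "(\<lambda>m. t * real (mesh_index t m u) / m) \<longlonglongrightarrow> u"
  proof (rule tendsto_sandwich)
    show "\<forall>\<^sub>F m in sequentially. u - t / real m \<le> t * real (mesh_index t m u) / m" using ev by eventually_elim simp
    show "\<forall>\<^sub>F m in sequentially. t * real (mesh_index t m u) / m \<le> u" using ev by eventually_elim simp
    have "(\<lambda>m. t / real m) \<longlonglongrightarrow> 0" by (rule tendsto_divide_0[OF tendsto_const]) (simp add: filterlim_at_infinity_imp_norm_at_top filterlim_real_sequentially filterlim_at_top_imp_at_infinity)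
    then show "(\<lambda>m. u - t / real m) \<longlonglongrightarrow> u" using tendsto_diff[OF tendsto_const[of u]] by fastforce
  qed simp
  then show ?thesis
    unfolding filterlim_at using ev by (auto elim: eventually_mono)
qed

text \<open>A Riemann-Stieltjes sum against the arrival path, regrouped by customer: the increment
  over a cell is the number of epochs in it.\<close>

lemma mesh_sum_counts:
  assumes a: "counting_path a" and t: "0 < t" and m: "0 < m"
  shows "(\<Sum>j<m. of_bool (h (t * real j / m)) * (real (a (t * real (Suc j) / m)) - real (a (t * real j / m))))
    = (\<Sum>i<a t. of_bool (h (t * real (mesh_index t m (arrival_time a i)) / m)))"
proof -
  let ?c = "\<lambda>i. mesh_index t m (arrival_time a i)"
  have cell: "{i\<in>{..<a t}. ?c i = j} = {a (t * real j / m)..<a (t * real (Suc j) / m)}" if j: "j < m" for j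
  proof -
    have q: "0 \<le> t * real j / m" "0 \<le> t * real (Suc j) / m" "t * real (Suc j) / m \<le> t"
      using t m j by (auto simp: mesh_point_le simp del: of_nat_Suc)
    have le: "a (t * real (Suc j) / m) \<le> a t" by (rule counting_path_mono[OF a q(2,3)])
    have iff: "?c i = j \<longleftrightarrow> a (t * real j / m) \<le> i \<and> i < a (t * real (Suc j) / m)" if i: "i < a t" for i
      using mesh_index_iff[OF t m arrival_time_pos[OF a i], of j] arrival_time_le_iff[OF a i _ q(1)]
        arrival_time_le_iff[OF a i _ q(2)] t by (auto simp: not_le not_less)
    have "{i\<in>{..<a t}. ?c i = j} = {i\<in>{..<a t}. a (t * real j / m) \<le> i \<and> i < a (t * real (Suc j) / m)}"
      using iff by (intro Collect_cong conj_cong refl) auto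
    also have "\<dots> = {a (t * real j / m)..<a (t * real (Suc j) / m)}" using le by auto
    finally show ?thesis .
  qed
  have "(\<Sum>i<a t. of_bool (h (t * real (?c i) / m))) = (\<Sum>j<m. \<Sum>i\<in>{i\<in>{..<a t}. ?c i = j}. of_bool (h (t * real (?c i) / m)) :: real)"
  proof (rule sum.group[symmetric])
    show "?c ` {..<a t} \<subseteq> {..<m}"
    proof (rule image_subsetI)
      fix i assume "i \<in> {..<a t}"
      then have i: "i < a t" by simp
      have "arrival_time a i \<le> t" using arrival_time_le_iff[OF a i] t i by simp
      then show "?c i \<in> {..<m}" using mesh_index_less[OF t m arrival_time_pos[OF a i]] t by simp
    qed
  qed auto
  also have "\<dots> = (\<Sum>j<m. of_bool (h (t * real j / m)) * (real (a (t * real (Suc j) / m)) - real (a (t * real j / m))))"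
  proof (intro sum.cong refl)
    fix j assume "j \<in> {..<m}"
    then have j: "j < m" by simp
    have "a (t * real j / m) \<le> a (t * real (Suc j) / m)"
      using t by (intro counting_path_mono[OF a]) (auto simp: divide_right_mono)
    moreover have "(\<Sum>i\<in>{i\<in>{..<a t}. ?c i = j}. of_bool (h (t * real (?c i) / m)) :: real) = (\<Sum>i\<in>{i\<in>{..<a t}. ?c i = j}. of_bool (h (t * real j / m)))"
      by (rule sum.cong) auto
    ultimately show "(\<Sum>i\<in>{i\<in>{..<a t}. ?c i = j}. of_bool (h (t * real (?c i) / m)) :: real)
        = of_bool (h (t * real j / m)) * (real (a (t * real (Suc j) / m)) - real (a (t * real j / m)))"
      unfolding cell[OF j] by (simp add: of_nat_diff)
  qed
  finally show ?thesis ..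
qed

text \<open>The argument \<open>u\<close> enters through an integer index, so \<open>h\<close> may
  be arbitrary, in particular a path functional of unknown regularity.\<close>

lemma borel_measurable_mesh:
  "(\<lambda>u. of_bool (h (t * real (mesh_index t m u) / m)) :: real) \<in> borel_measurable borel"
proof -
  have "(\<lambda>u. \<lceil>u * real m / t\<rceil>) \<in> measurable borel (count_space UNIV)" by measurable
  then have "(\<lambda>u. (\<lambda>z. of_bool (h (t * real (nat (z - 1)) / m)) :: real) \<lceil>u * real m / t\<rceil>) \<in> borel_measurable borel"
    by (rule measurable_compose) simp
  then show ?thesis by (simp add: mesh_index_def)
qed

text \<open>The counterpart for the intensity: neighbouring cells overlap only in mesh points, which
  form a null set.\<close>

lemma mesh_sum_integrals:
  fixes lam :: "real \<Rightarrow> real"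
  assumes lam: "set_integrable lborel {0..t} lam" and t: "0 < t" and m: "0 < m"
  shows "(\<Sum>j<m. of_bool (h (t * real j / m)) * (LBINT u:{t * real j / m..t * real (Suc j) / m}. lam u))
    = (LBINT u:{0..t}. of_bool (h (t * real (mesh_index t m u) / m)) * lam u)"
proof -
  let ?q = "\<lambda>j. t * real j / m"
  have sub: "{?q j..?q (Suc j)} \<subseteq> {0..t}" if "j < m" for j
  proof -
    have "0 \<le> ?q j" "?q (Suc j) \<le> t" using t m that mesh_point_le[OF t that] by auto
    then show ?thesis by auto
  qed
  have i: "set_integrable lborel {?q j..?q (Suc j)} lam" if "j < m" for j
    by (rule set_integrable_subset[OF lam _ sub[OF that]]) simp
  have "(\<Sum>j<m. of_bool (h (?q j)) * (LBINT u:{?q j..?q (Suc j)}. lam u))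
    = (\<integral>u. (\<Sum>j<m. of_bool (h (?q j)) * (indicator {?q j..?q (Suc j)} u *\<^sub>R lam u)) \<partial>lborel)"
    unfolding set_lebesgue_integral_def
    by (subst Bochner_Integration.integral_sum) (use i in \<open>auto simp: set_integrable_def\<close>)
  also have "\<dots> = (LBINT u:{0..t}. of_bool (h (?q (mesh_index t m u))) * lam u)"
    unfolding set_lebesgue_integral_def
  proof (rule integral_cong_AE)
    have "AE u in lborel. \<forall>j\<in>{..<m}. u \<noteq> ?q j"
      by (intro AE_finite_allI AE_lborel_singleton) simp
    with AE_lborel_singleton[of 0]
    show "AE u in lborel. (\<Sum>j<m. of_bool (h (?q j)) * (indicator {?q j..?q (Suc j)} u *\<^sub>R lam u))
        = indicator {0..t} u *\<^sub>R (of_bool (h (?q (mesh_index t m u))) * lam u)"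
    proof eventually_elim
      case (elim u)
      show ?case
      proof (cases "u \<in> {0..t}")
        case True
        then have u: "0 < u" "u \<le> t" using elim by auto
        let ?k = "mesh_index t m u"
        have k: "?k < m" using mesh_index_less[OF t m u] .
        have "indicator {?q j..?q (Suc j)} u = (if j = ?k then 1 else 0 :: real)" if "j \<in> {..<m}" for j
          using mesh_index_iff[OF t m u(1), of j] elim(2)[rule_format, OF that] by (auto simp: indicator_def)
        then have "(\<Sum>j<m. of_bool (h (?q j)) * (indicator {?q j..?q (Suc j)} u *\<^sub>R lam u))
          = (\<Sum>j<m. if j = ?k then of_bool (h (?q j)) * lam u else 0)"
          by (intro sum.cong) auto
        also have "\<dots> = of_bool (h (?q ?k)) * lam u" using k by simp
        finally show ?thesis using True by simp
      next
        case False
        then have "u \<notin> {?q j..?q (Suc j)}" if "j < m" for j using sub[OF that] by blast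
        then have "(\<Sum>j<m. of_bool (h (?q j)) * (indicator {?q j..?q (Suc j)} u *\<^sub>R lam u)) = 0"
          by (intro sum.neutral) auto
        then show ?thesis using False by simp
      qed
    qed
    have lm: "(\<lambda>u. indicator {0..t} u *\<^sub>R lam u) \<in> borel_measurable borel"
      using lam by (auto simp: set_integrable_def dest: borel_measurable_integrable)
    have "(\<lambda>u. of_bool (h (?q (mesh_index t m u))) * (indicator {0..t} u *\<^sub>R lam u)) \<in> borel_measurable borel"
      by (intro borel_measurable_times borel_measurable_mesh lm)
    then show "(\<lambda>u. indicator {0..t} u *\<^sub>R (of_bool (h (?q (mesh_index t m u))) * lam u)) \<in> borel_measurable lborel"
      by (simp add: mult_ac)
    show "(\<lambda>u. \<Sum>j<m. of_bool (h (?q j)) * (indicator {?q j..?q (Suc j)} u *\<^sub>R lam u)) \<in> borel_measurable lborel"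
      by (intro borel_measurable_sum borel_measurable_times borel_measurable_const)
         (use i in \<open>auto simp: set_integrable_def dest: borel_measurable_integrable\<close>)
  qed
  finally show ?thesis .
qed

definition free_before where
  "free_before n a n0 r s u = (of_bool (left_lim (\<lambda>t. real (busy_servers n a n0 r s t) / real n) u < 1) :: real)"

text \<open>To the left of \<open>u\<close> the occupancy is eventually constant, and the sampled
  times approach \<open>u\<close> strictly from the left; hence sampling is eventually
  exact.\<close>

lemma free_before_mesh:
  assumes a: "counting_path a" and n: "n \<ge> 1" and u: "0 < u" and t: "0 < t"
  shows "\<forall>\<^sub>F m in sequentially. of_bool (busy_servers n a n0 r s (t * real (mesh_index t m u) / m) < n) = free_before n a n0 r s u"
proof -
  obtain k where "\<forall>\<^sub>F q in at_left u. a q = k"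
    using counting_path_eventually_const_at_left[OF a u] by blast
  from busy_servers_eventually_at_left[OF this, of n n0 r s]
  have ev: "\<forall>\<^sub>F q in at_left u. busy_servers n a n0 r s q = present_before n n0 r (arrival_time a) s k u" .
  then have "\<forall>\<^sub>F q in at_left u. real (busy_servers n a n0 r s q) / n = real (present_before n n0 r (arrival_time a) s k u) / n"
    by eventually_elim simp
  note lv = left_lim_eventually_const[OF this]
  have "free_before n a n0 r s u = of_bool (present_before n n0 r (arrival_time a) s k u < n)"
    unfolding free_before_def lv using n by simp
  with filterlim_mesh[OF t u] ev show ?thesis
    unfolding filterlim_iff by (auto elim!: eventually_mono)
qed

text \<open>On positive times the function is a pointwise limit of mesh samples. Time 0 has no
  sample to its left and is added separately.\<close>

lemma free_before_measurable:
  assumes a: "counting_path a" and n: "n \<ge> 1" and T: "0 < T"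
  shows "set_borel_measurable borel {0..T} (free_before n a n0 r s)"
proof -
  have "(\<lambda>u. indicator {0<..T} u * free_before n a n0 r s u) \<in> borel_measurable borel"
  proof (rule borel_measurable_LIMSEQ_real)
    show "(\<lambda>m. indicator {0<..T} u * of_bool (busy_servers n a n0 r s (T * real (mesh_index T m u) / m) < n)) \<longlonglongrightarrow> indicator {0<..T} u * free_before n a n0 r s u" for u
    proof (cases "0 < u")
      case True
      then show ?thesis
        by (intro tendsto_mult tendsto_const tendsto_eventually free_before_mesh[OF a n _ T])
    qed simp
    show "(\<lambda>u. indicator {0<..T} u * of_bool (busy_servers n a n0 r s (T * real (mesh_index T m u) / m) < n) :: real) \<in> borel_measurable borel" for m
      by (intro borel_measurable_times borel_measurable_mesh[of "\<lambda>q. busy_servers n a n0 r s q < n"]) simp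
  qed
  moreover have "indicator {0..T} u *\<^sub>R free_before n a n0 r s u = indicator {0<..T} u * free_before n a n0 r s u + indicator {0} u * free_before n a n0 r s 0" for u
    using T by (auto simp: indicator_def)
  ultimately show ?thesis unfolding set_borel_measurable_def by simp
qed

text \<open>Finitely many customers arrive up to \<open>t\<close>, and for each the sampled
  indicator is eventually the admission decision, as epochs are distinct; so the first sum is
  eventually constant. For the intensity, sampling is eventually exact at each positive time, and
  dominated convergence applies.\<close>

lemma mesh_sums_tendsto:
  fixes lam :: "real \<Rightarrow> real" and n n0 :: nat and r s :: "nat \<Rightarrow> real"
  assumes a: "counting_path a" and n: "n \<ge> 1" and t: "0 < t" and sp: "simple_arrivals a t"
    and lam: "set_integrable lborel {0..t} lam"
  defines "b \<equiv> \<lambda>q. of_bool (busy_servers n a n0 r s q < n) :: real"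
  shows "(\<lambda>m. \<Sum>j<m. b (t * real j / m) * (real (a (t * real (Suc j) / m)) - real (a (t * real j / m))))
      \<longlonglongrightarrow> real (card (admitted n n0 r (arrival_time a) s (a t)))"
    and "(\<lambda>m. \<Sum>j<m. b (t * real j / m) * (LBINT u:{t * real j / m..t * real (Suc j) / m}. lam u))
      \<longlonglongrightarrow> (LBINT u:{0..t}. free_before n a n0 r s u * lam u)"
proof -
  let ?A = "admitted n n0 r (arrival_time a) s"
  have "\<forall>\<^sub>F m in sequentially. \<forall>i\<in>{..<a t}. b (t * real (mesh_index t m (arrival_time a i)) / m) = of_bool (i \<in> ?A (a t))"
  proof (rule eventually_ball_finite)
    show "\<forall>i\<in>{..<a t}. \<forall>\<^sub>F m in sequentially. b (t * real (mesh_index t m (arrival_time a i)) / m) = of_bool (i \<in> ?A (a t))"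
    proof
      fix i assume "i \<in> {..<a t}"
      then have i: "i < a t" by simp
      have "0 < arrival_time a i" using arrival_time_pos[OF a i] t by simp
      from filterlim_mesh[OF t this] eventually_busy_less_iff_admitted[OF a _ sp i, of n n0 r s] t
      have "\<forall>\<^sub>F m in sequentially. (busy_servers n a n0 r s (t * real (mesh_index t m (arrival_time a i)) / m) < n) = (i \<in> ?A (Suc i))"
        unfolding filterlim_iff by auto
      then show "\<forall>\<^sub>F m in sequentially. b (t * real (mesh_index t m (arrival_time a i)) / m) = of_bool (i \<in> ?A (a t))"
        by eventually_elim (simp add: b_def in_admitted_iff[OF i])
    qed
  qed simp
  with eventually_gt_at_top[of 0]
  have "\<forall>\<^sub>F m in sequentially. (\<Sum>j<m. b (t * real j / m) * (real (a (t * real (Suc j) / m)) - real (a (t * real j / m)))) = real (card (?A (a t)))"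
  proof eventually_elim
    case (elim m)
    have "(\<Sum>j<m. b (t * real j / m) * (real (a (t * real (Suc j) / m)) - real (a (t * real j / m))))
      = (\<Sum>i<a t. b (t * real (mesh_index t m (arrival_time a i)) / m))"
      unfolding b_def by (rule mesh_sum_counts[OF a t elim(1)])
    also have "\<dots> = (\<Sum>i<a t. of_bool (i \<in> ?A (a t)))" using elim(2) by (intro sum.cong) auto
    also have "\<dots> = real (card ({..<a t} \<inter> ?A (a t)))" by (simp add: of_bool_def sum.If_cases Int_def)
    also have "{..<a t} \<inter> ?A (a t) = ?A (a t)" using admitted_subset[of n n0 r "arrival_time a" s "a t"] by auto
    finally show ?case .
  qed
  then show "(\<lambda>m. \<Sum>j<m. b (t * real j / m) * (real (a (t * real (Suc j) / m)) - real (a (t * real j / m))))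
      \<longlonglongrightarrow> real (card (?A (a t)))" by (rule tendsto_eventually)
  have lm: "(\<lambda>u. indicator {0..t} u *\<^sub>R lam u) \<in> borel_measurable borel"
    using lam by (auto simp: set_integrable_def dest: borel_measurable_integrable)
  have "(\<lambda>m. LBINT u:{0..t}. b (t * real (mesh_index t m u) / m) * lam u) \<longlonglongrightarrow> (LBINT u:{0..t}. free_before n a n0 r s u * lam u)"
    unfolding set_lebesgue_integral_def
  proof (rule integral_dominated_convergence[where w="\<lambda>u. indicator {0..t} u * \<bar>lam u\<bar>"])
    show "integrable lborel (\<lambda>u. indicator {0..t} u * \<bar>lam u\<bar>)"
      using set_integrable_abs[OF lam] by (simp add: set_integrable_def)
    have "(\<lambda>u. b (t * real (mesh_index t m u) / m) * (indicator {0..t} u *\<^sub>R lam u)) \<in> borel_measurable borel" for m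
      unfolding b_def by (intro borel_measurable_times borel_measurable_mesh[of "\<lambda>q. busy_servers n a n0 r s q < n"] lm)
    then show "(\<lambda>u. indicator {0..t} u *\<^sub>R (b (t * real (mesh_index t m u) / m) * lam u)) \<in> borel_measurable lborel" for m
      by (simp add: mult_ac)
    have "(\<lambda>u. (indicator {0..t} u *\<^sub>R free_before n a n0 r s u) * (indicator {0..t} u *\<^sub>R lam u)) \<in> borel_measurable borel"
      using free_before_measurable[OF a n t, of n0 r s] lm unfolding set_borel_measurable_def by (intro borel_measurable_times) auto
    also have "(\<lambda>u. (indicator {0..t} u *\<^sub>R free_before n a n0 r s u) * (indicator {0..t} u *\<^sub>R lam u)) = (\<lambda>u. indicator {0..t} u *\<^sub>R (free_before n a n0 r s u * lam u))"
      by (auto simp: indicator_def fun_eq_iff)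
    finally show "(\<lambda>u. indicator {0..t} u *\<^sub>R (free_before n a n0 r s u * lam u)) \<in> borel_measurable lborel" by simp
    show "AE u in lborel. (\<lambda>m. indicator {0..t} u *\<^sub>R (b (t * real (mesh_index t m u) / m) * lam u)) \<longlonglongrightarrow> indicator {0..t} u *\<^sub>R (free_before n a n0 r s u * lam u)"
      using AE_lborel_singleton[of 0]
    proof eventually_elim
      case (elim u)
      show ?case
      proof (cases "0 < u")
        case True
        then show ?thesis unfolding b_def
          by (intro tendsto_intros tendsto_eventually free_before_mesh[OF a n _ t])
      next
        case False
        then show ?thesis using elim by (simp add: indicator_def)
      qed
    qed
    show "AE u in lborel. norm (indicator {0..t} u *\<^sub>R (b (t * real (mesh_index t m u) / m) * lam u)) \<le> indicator {0..t} u * \<bar>lam u\<bar>" for m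
      by (intro AE_I2) (auto simp: indicator_def b_def of_bool_def)
  qed
  then show "(\<lambda>m. \<Sum>j<m. b (t * real j / m) * (LBINT u:{t * real j / m..t * real (Suc j) / m}. lam u))
      \<longlonglongrightarrow> (LBINT u:{0..t}. free_before n a n0 r s u * lam u)"
  proof (rule Lim_transform_eventually)
    show "\<forall>\<^sub>F m in sequentially. (LBINT u:{0..t}. b (t * real (mesh_index t m u) / m) * lam u)
      = (\<Sum>j<m. b (t * real j / m) * (LBINT u:{t * real j / m..t * real (Suc j) / m}. lam u))"
      using eventually_gt_at_top[of 0]
    proof eventually_elim
      case (elim m)
      show ?case unfolding b_def by (rule mesh_sum_integrals[OF lam t elim, symmetric])
    qed
  qed
qed

section \<open>The sources of randomness of a single system\<close>

lemma Int_stable_vimage: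
  assumes "\<And>B C. B \<in> \<B> \<Longrightarrow> C \<in> \<B> \<Longrightarrow> B \<inter> C \<in> \<B>"
  shows "Int_stable {f -` B \<inter> \<Omega> | B. B \<in> \<B>}"
  unfolding Int_stable_def
proof (intro ballI)
  fix X Y assume "X \<in> {f -` B \<inter> \<Omega> | B. B \<in> \<B>}" "Y \<in> {f -` B \<inter> \<Omega> | B. B \<in> \<B>}"
  then obtain B C where BC: "B \<in> \<B>" "C \<in> \<B>" and X: "X = f -` B \<inter> \<Omega>" and Y: "Y = f -` C \<inter> \<Omega>"
    by (elim CollectE exE conjE)
  have "X \<inter> Y = f -` (B \<inter> C) \<inter> \<Omega>" unfolding X Y vimage_Int by (simp add: Int_ac)
  then show "X \<inter> Y \<in> {f -` B \<inter> \<Omega> | B. B \<in> \<B>}"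
    by (intro CollectI exI[of _ "B \<inter> C"] conjI assms BC)
qed

locale loss_queue = prob_space M for M :: "'a measure" +
  fixes n :: nat and lam :: "real \<Rightarrow> real" and G Fn :: "real measure" and A :: "real \<Rightarrow> 'a \<Rightarrow> nat"
    and N0 :: "'a \<Rightarrow> nat" and R S :: "nat \<Rightarrow> 'a \<Rightarrow> real"
  assumes data: "loss_queue_data M n lam G Fn A N0 R S" and n_ge_1: "1 \<le> n"
    and lam_nonneg: "\<And>t. 0 \<le> t \<Longrightarrow> 0 \<le> lam t" and lam_local: "locally_integrable lam"
begin

abbreviation "src j \<equiv> source_sigma M A N0 R S j"

definition gen :: "source set \<Rightarrow> 'a measure" where
  "gen J = sigma (space M) (\<Union>j\<in>J. src j)"

lemma indep_src: "indep_sets (source_sigma M A N0 R S) UNIV"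
  using data by (simp add: loss_queue_data_def)

lemma src_events: "src j \<subseteq> events"
  using indep_src by (auto simp: indep_sets_def)

lemma space_gen [simp]: "space (gen J) = space M"
  by (simp add: gen_def space_measure_of_conv)

lemma sets_gen: "sets (gen J) = sigma_sets (space M) (\<Union>j\<in>J. src j)"
  unfolding gen_def using src_events sets.space_closed by (intro sets_measure_of) blast

lemma gen_events: "sets (gen J) \<subseteq> events"
  unfolding sets_gen using src_events by (intro sets.sigma_sets_subset) blast

lemma measurable_gen: "f \<in> measurable (gen J) N \<Longrightarrow> f \<in> measurable M N"
  using gen_events[of J] by (auto simp: measurable_def)

lemma src_Int_stable: "Int_stable (src j)"
proof (cases j)
  case Arrivals
  have "sigma_algebra (space M) (sigma_sets (space M) {A t -` B \<inter> space M | t B. 0 \<le> t})"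
    by (rule sigma_algebra_sigma_sets) auto
  then interpret s: sigma_algebra "space M" "sigma_sets (space M) {A t -` B \<inter> space M | t B. 0 \<le> t}" .
  show ?thesis unfolding Arrivals source_sigma.simps Int_stable_def by (intro ballI s.Int)
next
  case Initial_Number
  then show ?thesis using Int_stable_vimage[of UNIV N0 "space M"] by simp
next
  case (Residual i)
  then show ?thesis using Int_stable_vimage[of "sets borel" "R i" "space M"] by (simp add: sets.Int)
next
  case (Service i)
  then show ?thesis using Int_stable_vimage[of "sets borel" "S i" "space M"] by (simp add: sets.Int)
qed

text \<open>The sources are mutually independent and stable under intersection, so collecting them
  into two disjoint groups keeps independence. Predictability with respect to residual and service
  times reduces to this.\<close>

lemma gen_indep:
  assumes J: "J1 \<inter> J2 = {}" and a: "a \<in> sets (gen J1)" and b: "b \<in> sets (gen J2)"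
  shows "prob (a \<inter> b) = prob a * prob b"
proof -
  have "indep_sets (\<lambda>j. sigma_sets (space M) (\<Union>i\<in>case_bool J1 J2 j. src i)) UNIV"
  proof (rule indep_sets_collect_sigma)
    show "indep_sets (source_sigma M A N0 R S) (\<Union>j\<in>UNIV. case_bool J1 J2 j)"
      by (rule indep_sets_mono_index[OF _ indep_src]) simp
    show "disjoint_family_on (case_bool J1 J2) UNIV"
      using J by (auto simp: disjoint_family_on_def split: bool.split)
  qed (rule src_Int_stable)
  from indep_setsD[OF this, of UNIV "case_bool a b"]
  have "prob (\<Inter>j\<in>UNIV. case_bool a b j) = (\<Prod>j\<in>UNIV. prob (case_bool a b j))"
    using a b by (auto simp: sets_gen UNIV_bool split: bool.split)
  then show ?thesis by (simp add: UNIV_bool Int_commute mult.commute)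
qed

lemma in_gen: "j \<in> J \<Longrightarrow> x \<in> src j \<Longrightarrow> x \<in> sets (gen J)"
  by (auto simp: sets_gen intro: sigma_sets.Basic)

lemma A_gen: "Arrivals \<in> J \<Longrightarrow> 0 \<le> t \<Longrightarrow> A t \<in> measurable (gen J) (count_space UNIV)"
  by (intro measurableI in_gen[of Arrivals]) (auto intro!: sigma_sets.Basic)

lemma N0_gen: "Initial_Number \<in> J \<Longrightarrow> N0 \<in> measurable (gen J) (count_space UNIV)"
  by (intro measurableI in_gen[of Initial_Number]) auto

lemma R_gen: "Residual i \<in> J \<Longrightarrow> R i \<in> borel_measurable (gen J)"
  by (intro measurableI in_gen[of "Residual i"]) auto

lemma S_gen: "Service i \<in> J \<Longrightarrow> S i \<in> borel_measurable (gen J)"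
  by (intro measurableI in_gen[of "Service i"]) auto

lemma A_measurable: "0 \<le> t \<Longrightarrow> A t \<in> measurable M (count_space UNIV)"
  by (rule measurable_gen[OF A_gen[of UNIV]]) auto

lemma N0_measurable [measurable]: "N0 \<in> measurable M (count_space UNIV)"
  by (rule measurable_gen[OF N0_gen[of UNIV]]) auto

lemma R_measurable [measurable]: "R i \<in> borel_measurable M"
  by (rule measurable_gen[OF R_gen[of _ UNIV]]) auto

lemma S_measurable [measurable]: "S i \<in> borel_measurable M"
  by (rule measurable_gen[OF S_gen[of _ UNIV]]) auto

lemma AE_N0_le: "AE \<omega> in M. N0 \<omega> \<le> n"
  using data by (simp add: loss_queue_data_def)

lemma poisson: "nonhom_poisson_process M (\<lambda>t. real n * lam t) A"
  using data by (simp add: loss_queue_data_def)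

lemma AE_counting_path: "AE \<omega> in M. counting_path (\<lambda>t. A t \<omega>)"
  using poisson by (simp add: nonhom_poisson_process_def counting_path_def)

lemma lam_integrable: "0 \<le> s \<Longrightarrow> set_integrable lborel {s..t} lam"
proof (cases "0 \<le> t")
  case True
  then show "0 \<le> s \<Longrightarrow> set_integrable lborel {s..t} lam"
    using lam_local unfolding locally_integrable_def by (auto intro: set_integrable_subset[of _ "{0..t}"])
next
  case False
  then show "0 \<le> s \<Longrightarrow> set_integrable lborel {s..t} lam" by (simp add: set_integrable_def)
qed

definition Lam :: "real \<Rightarrow> real \<Rightarrow> real" where
  "Lam s t = (LBINT u:{s..t}. lam u)"

lemma Lam_nonneg: "0 \<le> s \<Longrightarrow> 0 \<le> Lam s t"
  unfolding Lam_def set_lebesgue_integral_def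
  by (intro Bochner_Integration.integral_nonneg) (auto simp: indicator_def lam_nonneg)

lemma increment_measurable:
  assumes "0 \<le> s" "s \<le> t"
  shows "(\<lambda>\<omega>. A t \<omega> - A s \<omega>) \<in> measurable M (count_space UNIV)"
proof -
  have [measurable]: "A s \<in> measurable M (count_space UNIV)" "A t \<in> measurable M (count_space UNIV)"
    using assms A_measurable by auto
  show ?thesis by measurable
qed

lemma increment_poisson:
  assumes "0 \<le> s" "s \<le> t"
  shows "prob {\<omega>\<in>space M. A t \<omega> - A s \<omega> = k} = (n * Lam s t) ^ k / fact k * exp (- (n * Lam s t))"
  using poisson assms unfolding nonhom_poisson_process_def Lam_def by simp

lemma increment_exp:
  assumes "0 \<le> s" "s \<le> t"
  shows "(\<integral>\<^sup>+\<omega>. ennreal (exp (\<theta> * real (A t \<omega> - A s \<omega>) - (exp \<theta> - 1) * (n * Lam s t))) \<partial>M) = 1"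
  by (rule nn_integral_exp_poisson[OF increment_measurable[OF assms] _ increment_poisson[OF assms]])
     (use Lam_nonneg assms in auto)

text \<open>The Poisson moment generating function together with
  \<open>exp \<theta> - 1 \<le> \<theta> + \<theta>\<^sup>2\<close>; the quadratic part produces the
  constant \<open>Lam 0 t\<close>. Almost everywhere the increment from time 0 is \<open>A t\<close>
  itself.\<close>

lemma arrivals_exp_bound:
  assumes t: "0 \<le> t" and \<theta>: "\<bar>\<theta>\<bar> \<le> 1"
  shows "\<exists>Z\<in>borel_measurable M. (\<integral>\<^sup>+\<omega>. Z \<omega> \<partial>M) \<le> 1 \<and>
    (AE \<omega> in M. ennreal (exp (real n * (\<theta> * (real (A t \<omega>) / n - Lam 0 t) - Lam 0 t * \<theta>\<^sup>2))) \<le> Z \<omega>)"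
proof (intro bexI conjI)
  let ?Z = "\<lambda>\<omega>. ennreal (exp (\<theta> * real (A t \<omega> - A 0 \<omega>) - (exp \<theta> - 1) * (n * Lam 0 t)))"
  show "(\<integral>\<^sup>+\<omega>. ?Z \<omega> \<partial>M) \<le> 1" using increment_exp[of 0 t] t by simp
  have [measurable]: "(\<lambda>\<omega>. A t \<omega> - A 0 \<omega>) \<in> measurable M (count_space UNIV)" using increment_measurable[of 0 t] t by simp
  show "?Z \<in> borel_measurable M" by measurable
  show "AE \<omega> in M. ennreal (exp (real n * (\<theta> * (real (A t \<omega>) / n - Lam 0 t) - Lam 0 t * \<theta>\<^sup>2))) \<le> ?Z \<omega>"
    using AE_counting_path
  proof eventually_elim
    case (elim \<omega>)
    have a0: "A 0 \<omega> = 0" using counting_path_0[OF elim] .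
    have "(exp \<theta> - 1) * (n * Lam 0 t) \<le> (\<theta> + \<theta>\<^sup>2) * (n * Lam 0 t)"
      using exp_le_quadratic[OF \<theta>] Lam_nonneg[of 0 t] by (intro mult_right_mono) auto
    then show ?case using n_ge_1 a0 by (intro ennreal_leI) (simp add: algebra_simps)
  qed
qed

section \<open>Exponential bounds for residual and service times\<close>

lemma prod_if_exp:
  fixes y :: "nat \<Rightarrow> real"
  shows "(\<Prod>k<K. if D k then exp (y k) else 1) = exp (\<Sum>k<K. if D k then y k else 0)"
  by (subst exp_sum) (auto intro!: prod.cong)

lemma vimage_prob:
  "X \<in> borel_measurable M \<Longrightarrow> prob (X -` B \<inter> space M) = measure (distr M borel X) B" if "B \<in> sets borel"
  using that by (simp add: measure_distr)

lemma scale_arg: "real n * (\<theta> * (x / real n) - \<kappa> * \<theta>\<^sup>2) = \<theta> * x - \<kappa> * (real n * \<theta>\<^sup>2)"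
  using n_ge_1 by (simp add: field_simps)

text \<open>The random number of summands is handled by predictability: \<open>N0\<close> is
  measurable for every sigma-algebra in the sequence, and the condition
  \<open>j < N0 \<omega>\<close> switches factor \<open>j\<close> on. Almost everywhere at most
  \<open>n\<close> factors are active, each paying \<open>\<theta>\<^sup>2\<close>, hence the
  constant 1.\<close>

lemma residuals_exp_bound:
  assumes \<theta>: "\<bar>\<theta>\<bar> \<le> 1"
  shows "\<exists>Z\<in>borel_measurable M. (\<integral>\<^sup>+\<omega>. Z \<omega> \<partial>M) \<le> 1 \<and>
    (AE \<omega> in M. ennreal (exp (real n * (\<theta> * ((real (card {j. j < N0 \<omega> \<and> q < R j \<omega>}) - N0 \<omega> * measure Fn {q<..}) / n) - 1 * \<theta>\<^sup>2))) \<le> Z \<omega>)"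
proof (intro bexI conjI)
  define p where "p = measure Fn {q<..}"
  define \<xi> where "\<xi> j \<omega> = of_bool (q < R j \<omega>) - p" for j \<omega>
  define Y where "Y j \<omega> = exp (\<theta> * \<xi> j \<omega> - \<theta>\<^sup>2)" for j \<omega>
  let ?Z = "\<lambda>\<omega>. ennreal (\<Prod>j<n. if j < N0 \<omega> then Y j \<omega> else 1)"
  have p: "prob {\<omega>\<in>space M. q < R j \<omega>} = p" for j
    using vimage_prob[of "{q<..}" "R j"] data by (simp add: p_def loss_queue_data_def vimage_def Int_def conj_commute)
  have Fn01: "0 \<le> p" "p \<le> 1" unfolding p[of 0, symmetric] by auto
  have [measurable]: "\<xi> j \<in> borel_measurable M" for j unfolding \<xi>_def[abs_def] by measurable
  have [measurable]: "Y j \<in> borel_measurable M" for j unfolding Y_def[abs_def] by measurable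
  have Yg: "Y j \<in> borel_measurable (gen J)" if "Residual j \<in> J" for j J
  proof -
    note [measurable] = R_gen[OF that]
    show ?thesis unfolding Y_def[abs_def] \<xi>_def by measurable
  qed
  have Yint: "(\<integral>\<^sup>+\<omega>. ennreal (Y j \<omega>) \<partial>M) \<le> 1" for j
    unfolding Y_def
  proof (rule nn_integral_exp_centered_le_1[OF _ _ _ \<theta>])
    show "\<bar>\<xi> j \<omega>\<bar> \<le> 1" for \<omega> using Fn01 by (auto simp: \<xi>_def of_bool_def)
    have "expectation (\<lambda>\<omega>. of_bool (q < R j \<omega>) :: real) = expectation (indicator {\<omega>\<in>space M. q < R j \<omega>})"
      by (rule Bochner_Integration.integral_cong) (auto simp: indicator_def)
    also have "\<dots> = p" using p[of j] by (subst Bochner_Integration.integral_indicator) (simp add: Int_def conj_commute)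
    finally have e: "expectation (\<lambda>\<omega>. of_bool (q < R j \<omega>)) = p" .
    have "integrable M (\<lambda>\<omega>. of_bool (q < R j \<omega>) :: real)" by (rule integrable_const_bound[of _ 1]) auto
    then show "expectation (\<xi> j) = 0" unfolding \<xi>_def by (simp add: e prob_space)
  qed measurable
  show "(\<integral>\<^sup>+\<omega>. ?Z \<omega> \<partial>M) \<le> 1"
  proof (rule nn_integral_predictable_prod_le_1[where E="\<lambda>k. gen (insert Initial_Number (Residual ` {..<k}))"])
    fix k a B assume a: "a \<in> sets (gen (insert Initial_Number (Residual ` {..<k})))" and B: "(B :: real set) \<in> sets borel"
    have "Y k -` B \<inter> space M \<in> sets (gen {Residual k})"
      using measurable_sets[OF Yg[of k "{Residual k}"] B] by simp
    from gen_indep[OF _ a this] show "prob (a \<inter> (Y k -` B \<inter> space M)) = prob a * prob (Y k -` B \<inter> space M)" by auto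
  next
    fix i k :: nat assume "i \<le> k"
    have [measurable]: "N0 \<in> measurable (gen (insert Initial_Number (Residual ` {..<k}))) (count_space UNIV)" by (rule N0_gen) auto
    have "{\<omega>\<in>space (gen (insert Initial_Number (Residual ` {..<k}))). i < N0 \<omega>} \<in> sets (gen (insert Initial_Number (Residual ` {..<k})))"
      by measurable
    then show "{\<omega>\<in>space M. i < N0 \<omega>} \<in> sets (gen (insert Initial_Number (Residual ` {..<k})))" by simp
  qed (use gen_events Yint in \<open>auto simp: Y_def intro!: Yg[unfolded Y_def]\<close>)
  show "?Z \<in> borel_measurable M" by measurable
  show "AE \<omega> in M. ennreal (exp (real n * (\<theta> * ((real (card {j. j < N0 \<omega> \<and> q < R j \<omega>}) - N0 \<omega> * measure Fn {q<..}) / n) - 1 * \<theta>\<^sup>2))) \<le> ?Z \<omega>"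
    using AE_N0_le
  proof eventually_elim
    case (elim \<omega>)
    have "(\<Sum>j<n. if j < N0 \<omega> then \<theta> * \<xi> j \<omega> - \<theta>\<^sup>2 else 0) = (\<Sum>j<N0 \<omega>. \<theta> * \<xi> j \<omega> - \<theta>\<^sup>2)"
      by (rule sum.mono_neutral_cong_right) (use elim in auto)
    also have "\<dots> = \<theta> * (\<Sum>j<N0 \<omega>. \<xi> j \<omega>) - N0 \<omega> * \<theta>\<^sup>2" by (simp add: sum_subtractf sum_distrib_left)
    also have "(\<Sum>j<N0 \<omega>. \<xi> j \<omega>) = real (card {j. j < N0 \<omega> \<and> q < R j \<omega>}) - N0 \<omega> * p"
    proof -
      have "{j. j < N0 \<omega> \<and> q < R j \<omega>} = {..<N0 \<omega>} \<inter> {j. q < R j \<omega>}" by auto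
      then show ?thesis by (simp add: \<xi>_def sum_subtractf of_bool_def sum.If_cases)
    qed
    finally have Z: "(\<Prod>j<n. if j < N0 \<omega> then Y j \<omega> else 1)
        = exp (\<theta> * (real (card {j. j < N0 \<omega> \<and> q < R j \<omega>}) - N0 \<omega> * p) - N0 \<omega> * \<theta>\<^sup>2)"
      unfolding Y_def prod_if_exp by simp
    have "real (N0 \<omega>) * \<theta>\<^sup>2 \<le> real n * \<theta>\<^sup>2" using elim by (intro mult_right_mono) auto
    then show ?case unfolding Z p_def[symmetric] scale_arg by (intro ennreal_leI) simp
  qed
qed

lemma arrival_before_measurable:
  assumes "\<And>s. s \<in> {0..t} \<Longrightarrow> A s \<in> measurable E (count_space UNIV)" and t: "0 \<le> t"
  shows "(\<lambda>\<omega>. arrival_before (\<lambda>s. A s \<omega>) t i) \<in> borel_measurable E"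
  unfolding arrival_before_def
proof (rule borel_measurable_cINF_real)
  show "countable (insert t ({0..t} \<inter> \<rat>))" using countable_rat by auto
  fix s assume "s \<in> insert t ({0..t} \<inter> \<rat>)"
  then have [measurable]: "A s \<in> measurable E (count_space UNIV)" using assms by auto
  show "(\<lambda>\<omega>. if i < A s \<omega> then s else t) \<in> borel_measurable E" by measurable
qed

text \<open>The admission sets computed from the measurable substitute epochs; on counting paths
  they are the true ones for the customers arriving up to \<open>t\<close>.\<close>

definition adm :: "real \<Rightarrow> nat \<Rightarrow> 'a \<Rightarrow> nat set" where
  "adm t k \<omega> = admitted n (N0 \<omega>) (\<lambda>j. R j \<omega>) (arrival_before (\<lambda>s. A s \<omega>) t) (\<lambda>k. S k \<omega>) k"

lemma pred_adm:
  assumes "\<And>s. s \<in> {0..t} \<Longrightarrow> A s \<in> measurable E (count_space UNIV)" and t: "0 \<le> t"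
    and "N0 \<in> measurable E (count_space UNIV)" "\<And>j. R j \<in> borel_measurable E"
    and "\<And>i. Suc i < k \<Longrightarrow> S i \<in> borel_measurable E"
  shows "Measurable.pred E (\<lambda>\<omega>. i \<in> adm t k \<omega>)"
  unfolding adm_def by (rule pred_admitted) (use assms arrival_before_measurable in auto)

lemma adm_eq:
  assumes a: "counting_path (\<lambda>s. A s \<omega>)" and t: "0 \<le> t" and k: "k \<le> A t \<omega>"
  shows "adm t k \<omega> = admitted n (N0 \<omega>) (\<lambda>j. R j \<omega>) (arrival_time (\<lambda>s. A s \<omega>)) (\<lambda>k. S k \<omega>) k"
  unfolding adm_def by (rule admitted_cong) (use arrival_before_eq[OF a t] k in auto)

lemma services_exp_bound:
  assumes q: "0 \<le> p" "p \<le> q" and \<theta>: "\<bar>\<theta>\<bar> \<le> 1"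
  shows "\<exists>Z\<in>borel_measurable M. (\<integral>\<^sup>+\<omega>. Z \<omega> \<partial>M) \<le> 1 \<and>
    (AE \<omega> in M. ennreal (exp (real n * (\<theta> * (
      (\<Sum>i\<in>{i\<in>admitted n (N0 \<omega>) (\<lambda>j. R j \<omega>) (arrival_time (\<lambda>s. A s \<omega>)) (\<lambda>k. S k \<omega>) (A q \<omega>). A p \<omega> \<le> i \<and> i < C * n}.
         of_bool (c < S i \<omega>) - measure G {c<..}) / n) - real C * \<theta>\<^sup>2))) \<le> Z \<omega>)"
proof (intro bexI conjI)
  define pc where "pc = measure G {c<..}"
  define \<xi> where "\<xi> j \<omega> = of_bool (c < S j \<omega>) - pc" for j \<omega>
  define Y where "Y j \<omega> = exp (\<theta> * \<xi> j \<omega> - \<theta>\<^sup>2)" for j \<omega>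
  define D where "D i \<omega> \<longleftrightarrow> A p \<omega> \<le> i \<and> i < A q \<omega> \<and> i \<in> adm q (Suc i) \<omega>" for i \<omega>
  let ?K = "C * n"
  let ?Z = "\<lambda>\<omega>. ennreal (\<Prod>j<?K. if D j \<omega> then Y j \<omega> else 1)"
  \<comment> \<open>All sources that may enter the decision on customer \<open>k\<close>, with the
    whole arrival process included.\<close>
  define J where "J k = {Arrivals, Initial_Number} \<union> range Residual \<union> Service ` {..<k}" for k
  have Jm: "Arrivals \<in> J k" "Initial_Number \<in> J k" "Residual i \<in> J k" "i < k \<Longrightarrow> Service i \<in> J k" for i k
    by (auto simp: J_def)
  have p: "prob {\<omega>\<in>space M. c < S j \<omega>} = pc" for j
    using vimage_prob[of "{c<..}" "S j"] data by (simp add: pc_def loss_queue_data_def vimage_def Int_def conj_commute)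
  have G01: "0 \<le> pc" "pc \<le> 1" unfolding p[of 0, symmetric] by auto
  have [measurable]: "\<xi> j \<in> borel_measurable M" for j unfolding \<xi>_def[abs_def] by measurable
  have [measurable]: "Y j \<in> borel_measurable M" for j unfolding Y_def[abs_def] by measurable
  have Yg: "Y j \<in> borel_measurable (gen J)" if "Service j \<in> J" for j J
  proof -
    note [measurable] = S_gen[OF that]
    show ?thesis unfolding Y_def[abs_def] \<xi>_def by measurable
  qed
  have Yint: "(\<integral>\<^sup>+\<omega>. ennreal (Y j \<omega>) \<partial>M) \<le> 1" for j
    unfolding Y_def
  proof (rule nn_integral_exp_centered_le_1[OF _ _ _ \<theta>])
    show "\<bar>\<xi> j \<omega>\<bar> \<le> 1" for \<omega> using G01 by (auto simp: \<xi>_def of_bool_def)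
    have "expectation (\<lambda>\<omega>. of_bool (c < S j \<omega>) :: real) = expectation (indicator {\<omega>\<in>space M. c < S j \<omega>})"
      by (rule Bochner_Integration.integral_cong) (auto simp: indicator_def)
    also have "\<dots> = pc" using p[of j] by (subst Bochner_Integration.integral_indicator) (simp add: Int_def conj_commute)
    finally have e: "expectation (\<lambda>\<omega>. of_bool (c < S j \<omega>)) = pc" .
    have "integrable M (\<lambda>\<omega>. of_bool (c < S j \<omega>) :: real)" by (rule integrable_const_bound[of _ 1]) auto
    then show "expectation (\<xi> j) = 0" unfolding \<xi>_def by (simp add: e prob_space)
  qed measurable
  have Dg: "Measurable.pred (gen (J k)) (D i)" if "i \<le> k" for i k
  proof -
    have Ag: "A s \<in> measurable (gen (J k)) (count_space UNIV)" if "0 \<le> s" for s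
      by (rule A_gen[OF Jm(1) that])
    have [measurable]: "A p \<in> measurable (gen (J k)) (count_space UNIV)" "A q \<in> measurable (gen (J k)) (count_space UNIV)"
      using Ag q by auto
    have [measurable]: "Measurable.pred (gen (J k)) (\<lambda>\<omega>. i \<in> adm q (Suc i) \<omega>)"
      by (rule pred_adm) (use q \<open>i \<le> k\<close> in \<open>auto intro!: Ag N0_gen R_gen S_gen Jm\<close>)
    show ?thesis unfolding D_def[abs_def] by measurable
  qed
  have [measurable]: "Measurable.pred M (D i)" for i by (rule measurable_gen[OF Dg[of i i]]) simp
  show "(\<integral>\<^sup>+\<omega>. ?Z \<omega> \<partial>M) \<le> 1"
  proof (rule nn_integral_predictable_prod_le_1[where E="\<lambda>k. gen (J k)"])
    fix k a B assume a: "a \<in> sets (gen (J k))" and B: "(B :: real set) \<in> sets borel"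
    have b: "Y k -` B \<inter> space M \<in> sets (gen {Service k})"
      using measurable_sets[OF Yg[of k "{Service k}"] B] by simp
    show "prob (a \<inter> (Y k -` B \<inter> space M)) = prob a * prob (Y k -` B \<inter> space M)"
      by (rule gen_indep[OF _ a b]) (auto simp: J_def)
  next
    fix i k :: nat assume "i \<le> k"
    from Dg[OF this] show "{\<omega>\<in>space M. D i \<omega>} \<in> sets (gen (J k))" by (simp add: pred_def)
  next
    fix i k :: nat assume "i < k"
    then show "Y i \<in> borel_measurable (gen (J k))" by (intro Yg) (auto simp: J_def)
  qed (use gen_events Yint in \<open>auto simp: Y_def\<close>)
  show "?Z \<in> borel_measurable M" by measurable
  show "AE \<omega> in M. ennreal (exp (real n * (\<theta> * (
      (\<Sum>i\<in>{i\<in>admitted n (N0 \<omega>) (\<lambda>j. R j \<omega>) (arrival_time (\<lambda>s. A s \<omega>)) (\<lambda>k. S k \<omega>) (A q \<omega>). A p \<omega> \<le> i \<and> i < C * n}.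
         of_bool (c < S i \<omega>) - measure G {c<..}) / n) - real C * \<theta>\<^sup>2))) \<le> ?Z \<omega>"
    using AE_counting_path
  proof eventually_elim
    case (elim \<omega>)
    let ?A = "{i\<in>admitted n (N0 \<omega>) (\<lambda>j. R j \<omega>) (arrival_time (\<lambda>s. A s \<omega>)) (\<lambda>k. S k \<omega>) (A q \<omega>). A p \<omega> \<le> i \<and> i < C * n}"
    define W where "W = {j\<in>{..<?K}. D j \<omega>}"
    have q0: "0 \<le> q" using q by simp
    have Diff: "i < ?K \<and> D i \<omega> \<longleftrightarrow> i \<in> ?A" for i
    proof (cases "i < A q \<omega>")
      case True
      then show ?thesis using adm_eq[OF elim q0, of "Suc i"] in_admitted_iff[OF True] by (auto simp: D_def)
    next
      case False
      then show ?thesis using admitted_subset[of n "N0 \<omega>" "\<lambda>j. R j \<omega>" "arrival_time (\<lambda>s. A s \<omega>)" "\<lambda>k. S k \<omega>" "A q \<omega>"]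
        by (auto simp: D_def)
    qed
    have "(\<Prod>j<?K. if D j \<omega> then Y j \<omega> else 1) = exp (\<Sum>j<?K. if D j \<omega> then \<theta> * \<xi> j \<omega> - \<theta>\<^sup>2 else 0)"
      unfolding Y_def by (rule prod_if_exp)
    also have "(\<Sum>j<?K. if D j \<omega> then \<theta> * \<xi> j \<omega> - \<theta>\<^sup>2 else 0) = (\<Sum>j\<in>W. \<theta> * \<xi> j \<omega> - \<theta>\<^sup>2)"
      by (simp add: W_def sum.If_cases Int_def)
    also have "\<dots> = \<theta> * (\<Sum>j\<in>W. \<xi> j \<omega>) - card W * \<theta>\<^sup>2" by (simp add: sum_subtractf sum_distrib_left)
    finally have Z: "(\<Prod>j<?K. if D j \<omega> then Y j \<omega> else 1) = exp (\<theta> * (\<Sum>j\<in>W. \<xi> j \<omega>) - card W * \<theta>\<^sup>2)" .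
    have "card W \<le> card {..<?K}" unfolding W_def by (rule card_mono) auto
    then have cW: "real (card W) * \<theta>\<^sup>2 \<le> real C * real n * \<theta>\<^sup>2"
      by (intro mult_right_mono) (auto simp flip: of_nat_mult)
    have "W = ?A" using Diff unfolding W_def by auto
    then have "(\<Sum>i\<in>?A. of_bool (c < S i \<omega>) - measure G {c<..}) = (\<Sum>j\<in>W. \<xi> j \<omega>)" by (simp add: \<xi>_def pc_def)
    then show ?case unfolding Z scale_arg using cW by (intro ennreal_leI) simp
  qed
qed

section \<open>Independence of arrival increments from the past\<close>

definition arrivals_upto :: "real \<Rightarrow> 'a set set" where
  "arrivals_upto q = {A s -` B \<inter> space M | s B. 0 \<le> s \<and> s \<le> q}"

text \<open>Besides the arrivals up to \<open>q\<close>, the past contains all initial data and all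
  service times, even those of later customers. They are independent of the arrivals, so later
  increments remain independent of this larger sigma-algebra, and the occupancy at \<open>q\<close>
  becomes measurable for it.\<close>

definition past :: "real \<Rightarrow> 'a measure" where
  "past q = sigma (space M) (arrivals_upto q \<union> (\<Union>j\<in>-{Arrivals}. src j))"

lemma space_past [simp]: "space (past q) = space M"
  by (simp add: past_def space_measure_of_conv)

lemma past_gen_sub: "arrivals_upto q \<union> (\<Union>j\<in>-{Arrivals}. src j) \<subseteq> events"
proof -
  have "arrivals_upto q \<subseteq> src Arrivals"
    unfolding arrivals_upto_def source_sigma.simps by (auto intro!: sigma_sets.Basic)
  then show ?thesis using src_events by blast
qed

lemma sets_past: "sets (past q) = sigma_sets (space M) (arrivals_upto q \<union> (\<Union>j\<in>-{Arrivals}. src j))"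
  unfolding past_def using past_gen_sub sets.space_closed by (intro sets_measure_of) blast

lemma past_events: "sets (past q) \<subseteq> events"
  unfolding sets_past by (intro sets.sigma_sets_subset past_gen_sub)

lemma A_past:
  assumes "0 \<le> s" "s \<le> q" shows "A s \<in> measurable (past q) (count_space UNIV)"
proof (rule measurableI)
  fix B
  have 1: "A s -` B \<inter> space M \<in> arrivals_upto q"
    unfolding arrivals_upto_def using assms by (intro CollectI exI[of _ s] exI[of _ B]) simp
  have "A s -` B \<inter> space M \<in> sets (past q)"
    unfolding sets_past by (rule sigma_sets.Basic, rule UnI1, rule 1)
  then show "A s -` B \<inter> space (past q) \<in> sets (past q)"
    by (simp only: space_past)
next
  fix x show "A s x \<in> space (count_space UNIV)"
    by (simp only: space_count_space UNIV_I)
qed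

lemma gen_past: "Arrivals \<notin> J \<Longrightarrow> f \<in> measurable (gen J) N \<Longrightarrow> f \<in> measurable (past q) N"
proof -
  assume J: "Arrivals \<notin> J" and f: "f \<in> measurable (gen J) N"
  have "sets (gen J) \<subseteq> sets (past q)"
    unfolding sets_gen sets_past by (rule sigma_sets_mono', rule le_supI2, rule UN_mono) (use J in auto)
  then show ?thesis using f by (auto simp: measurable_def)
qed

lemma increments_sum:
  assumes c: "counting_path a" and ts: "ts 0 = 0" "mono ts"
  shows "(\<Sum>j<i. a (ts (Suc j)) - a (ts j)) = a (ts i)"
proof (induction i)
  case 0
  then show ?case using counting_path_0[OF c] ts by simp
next
  case (Suc i)
  have "0 \<le> ts i" using monoD[OF ts(2), of 0 i] ts(1) by simp
  moreover have "ts i \<le> ts (Suc i)" using ts(2) by (simp add: monoD)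
  ultimately have "a (ts i) \<le> a (ts (Suc i))" by (rule counting_path_mono[OF c])
  then show ?case using Suc by simp
qed

text \<open>The arrival counts at finitely many times are partial sums of independent increments.
  Having 0 and \<open>q\<close> in \<open>J\<close> makes the sorted times start at 0 and end at
  \<open>q\<close>, so that the next increment is the one from \<open>q\<close> to
  \<open>q'\<close>.\<close>

lemma past_increment_indep_finite:
  assumes q: "0 \<le> q" "q \<le> q'" and J: "finite J" "{0, q} \<subseteq> J" "J \<subseteq> {0..q}"
  shows "prob ({\<omega>\<in>space M. \<forall>s\<in>J. A s \<omega> \<in> B s} \<inter> {\<omega>\<in>space M. A q' \<omega> - A q \<omega> \<in> C})
    = prob {\<omega>\<in>space M. \<forall>s\<in>J. A s \<omega> \<in> B s} * prob {\<omega>\<in>space M. A q' \<omega> - A q \<omega> \<in> C}"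
proof -
  define xs where "xs = sorted_list_of_set J"
  define l where "l = length xs - 1"
  have xs: "set xs = J" "sorted xs" "xs \<noteq> []" using J by (auto simp: xs_def)
  have len: "length xs = Suc l" using xs(3) by (cases xs) (auto simp: l_def)
  \<comment> \<open>The sorted times, continued by \<open>q'\<close> forever; step \<open>l\<close>
    leads from \<open>q\<close> to \<open>q'\<close>.\<close>
  define ts where "ts i = (if i < length xs then xs ! i else q')" for i
  have J0: "0 \<le> s" "s \<le> q" if "s \<in> J" for s using J that by auto
  have ts_mono: "mono ts"
  proof (rule monoI)
    fix i j :: nat assume ij: "i \<le> j"
    have "xs ! i \<le> q'" if "i < length xs" using J0[of "xs ! i"] q xs(1) that nth_mem by fastforce
    then show "ts i \<le> ts j" using ij sorted_nth_mono[OF xs(2) ij] by (auto simp: ts_def)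
  qed
  have tsJ: "ts ` {..l} = J"
    using xs(1) len by (auto simp: ts_def set_conv_nth image_iff less_Suc_eq_le)
  have ts0: "ts 0 = 0"
  proof -
    obtain i where "i \<le> l" "ts i = 0" using tsJ J(2) by (metis (no_types, lifting) atMost_iff imageE insert_subset)
    then have "ts 0 \<le> 0" using monoD[OF ts_mono, of 0 i] by simp
    moreover have "ts 0 \<in> J" using tsJ by auto
    ultimately show ?thesis using J0 by force
  qed
  have tsl: "ts l = q"
  proof -
    obtain i where "i \<le> l" "ts i = q" using tsJ J(2) by (metis (no_types, lifting) atMost_iff imageE insert_subset)
    then have "q \<le> ts l" using monoD[OF ts_mono, of i l] by simp
    moreover have "ts l \<in> J" using tsJ by auto
    ultimately show ?thesis using J0 by force
  qed
  have tsSl: "ts (Suc l) = q'" using len by (simp add: ts_def)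
  define V where "V i \<omega> = A (ts (Suc i)) \<omega> - A (ts i) \<omega>" for i \<omega>
  have "indep_vars (\<lambda>_. count_space UNIV) V {..<Suc l}"
    using poisson ts0 ts_mono unfolding nonhom_poisson_process_def V_def[abs_def] by simp
  then have iv: "indep_var (PiM {..<l} (\<lambda>_. count_space UNIV)) (\<lambda>\<omega>. restrict (\<lambda>i. V i \<omega>) {..<l})
      (PiM {l} (\<lambda>_. count_space UNIV)) (\<lambda>\<omega>. restrict (\<lambda>i. V i \<omega>) {l})"
    by (rule indep_var_restrict) auto
  define Xa where "Xa = {x\<in>space (PiM {..<l} (\<lambda>_. count_space (UNIV::nat set))). \<forall>i\<in>{..l}. (\<Sum>j<i. x j) \<in> B (ts i)}"
  define Xb where "Xb = {x\<in>space (PiM {l} (\<lambda>_. count_space (UNIV::nat set))). x l \<in> C}"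
  have "Measurable.pred (PiM {..<l} (\<lambda>_. count_space (UNIV::nat set))) (\<lambda>x. (\<Sum>j<i. x j) \<in> B (ts i))" if "i \<le> l" for i
  proof -
    have "(\<lambda>x. \<Sum>j<i. x j) \<in> measurable (PiM {..<l} (\<lambda>_. count_space (UNIV::nat set))) (count_space UNIV)"
      using that by (intro measurable_sum_nat measurable_component_singleton) auto
    then show ?thesis by (rule measurable_compose) simp
  qed
  then have Xa: "Xa \<in> sets (PiM {..<l} (\<lambda>_. count_space UNIV))"
    unfolding Xa_def by (intro sets.sets_Collect_finite_All) (auto simp: pred_def)
  have "(\<lambda>x. x l) \<in> measurable (PiM {l} (\<lambda>_. count_space (UNIV::nat set))) (count_space UNIV)"
    by (rule measurable_component_singleton) simp
  then have "Measurable.pred (PiM {l} (\<lambda>_. count_space (UNIV::nat set))) (\<lambda>x. x l \<in> C)"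
    by (rule measurable_compose) simp
  then have Xb: "Xb \<in> sets (PiM {l} (\<lambda>_. count_space UNIV))"
    unfolding Xb_def by (simp add: pred_def)
  let ?a = "{\<omega>\<in>space M. \<forall>s\<in>J. A s \<omega> \<in> B s}" and ?b = "{\<omega>\<in>space M. A q' \<omega> - A q \<omega> \<in> C}"
  let ?a' = "(\<lambda>\<omega>. restrict (\<lambda>i. V i \<omega>) {..<l}) -` Xa \<inter> space M" and ?b' = "(\<lambda>\<omega>. restrict (\<lambda>i. V i \<omega>) {l}) -` Xb \<inter> space M"
  have b: "?b' = ?b" by (auto simp: Xb_def V_def tsl tsSl space_PiM)
  have am: "?a' \<in> events"
    using iv Xa by (auto simp: indep_var_eq intro: measurable_sets)
  have bm: "?b \<in> events"
    using increment_measurable[OF q] by measurable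
  have Am: "A s \<in> measurable M (count_space UNIV)" if "s \<in> J" for s using A_measurable J0[OF that] by simp
  have am': "?a \<in> events"
  proof (rule sets.sets_Collect_finite_All[OF _ J(1)])
    fix s assume "s \<in> J"
    note [measurable] = Am[OF this]
    show "{\<omega>\<in>space M. A s \<omega> \<in> B s} \<in> events" by measurable
  qed
  \<comment> \<open>Counts are sums of increments on counting paths, hence the two events agree
    almost everywhere rather than everywhere.\<close>
  have ae: "AE \<omega> in M. \<omega> \<in> ?a' \<longleftrightarrow> \<omega> \<in> ?a"
    using AE_counting_path
  proof eventually_elim
    case (elim \<omega>)
    have sum: "(\<Sum>j<i. V j \<omega>) = A (ts i) \<omega>" for i
      unfolding V_def by (rule increments_sum[OF elim ts0 ts_mono])
    have "(\<Sum>j<i. restrict (\<lambda>i. V i \<omega>) {..<l} j) = A (ts i) \<omega>" if "i \<le> l" for i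
      unfolding sum[symmetric] using that by (intro sum.cong) auto
    then have "(\<forall>i\<in>{..l}. (\<Sum>j<i. restrict (\<lambda>i. V i \<omega>) {..<l} j) \<in> B (ts i)) \<longleftrightarrow> (\<forall>s\<in>J. A s \<omega> \<in> B s)"
      unfolding tsJ[symmetric] by simp
    then show ?case by (auto simp: Xa_def space_PiM)
  qed
  have "prob (?a \<inter> ?b) = prob (?a' \<inter> ?b)"
    by (rule measure_eq_AE) (use ae am am' bm in auto)
  also have "?a' \<inter> ?b = (\<lambda>\<omega>. (restrict (\<lambda>i. V i \<omega>) {..<l}, restrict (\<lambda>i. V i \<omega>) {l})) -` (Xa \<times> Xb) \<inter> space M"
    unfolding b[symmetric] by auto
  also have "prob \<dots> = prob ?a' * prob ?b'" by (rule indep_varD[OF iv Xa Xb])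
  also have "prob ?a' = prob ?a" by (rule measure_eq_AE) (use ae am am' in auto)
  finally show ?thesis by (simp only: b)
qed

text \<open>Cylinders over finitely many times form an intersection-stable family generating the
  arrivals up to \<open>q\<close>. The times 0 and \<open>q\<close> can always be adjoined without
  constraint, and intersections unite the time sets.\<close>

lemma past_increment_indep_arrivals:
  assumes q: "0 \<le> q" "q \<le> q'" and a: "a \<in> sigma_sets (space M) (arrivals_upto q)"
    and b: "b = {\<omega>\<in>space M. A q' \<omega> - A q \<omega> \<in> C}"
  shows "prob (a \<inter> b) = prob a * prob b"
proof -
  define \<G> where "\<G> = {{\<omega>\<in>space M. \<forall>s\<in>J. A s \<omega> \<in> B s} | J B. finite J \<and> {0, q} \<subseteq> J \<and> J \<subseteq> {0..q}}"
  have bm: "b \<in> events" unfolding b using increment_measurable[OF q] by measurable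
  have Gm: "\<G> \<subseteq> events"
  proof
    fix x assume "x \<in> \<G>"
    then obtain J B where x: "x = {\<omega>\<in>space M. \<forall>s\<in>J. A s \<omega> \<in> B s}" "finite J" "J \<subseteq> {0..q}" by (auto simp: \<G>_def)
    show "x \<in> events" unfolding x(1)
    proof (rule sets.sets_Collect_finite_All[OF _ x(2)])
      fix s assume "s \<in> J"
      then have [measurable]: "A s \<in> measurable M (count_space UNIV)" using A_measurable x(3) by auto
      show "{\<omega>\<in>space M. A s \<omega> \<in> B s} \<in> events" by measurable
    qed
  qed
  have st: "Int_stable \<G>"
    unfolding Int_stable_def
  proof (intro ballI)
    fix x y assume "x \<in> \<G>" "y \<in> \<G>"
    then obtain J B J' B' where x: "x = {\<omega>\<in>space M. \<forall>s\<in>J. A s \<omega> \<in> B s}" "finite J" "{0,q} \<subseteq> J" "J \<subseteq> {0..q}"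
      and y: "y = {\<omega>\<in>space M. \<forall>s\<in>J'. A s \<omega> \<in> B' s}" "finite J'" "{0,q} \<subseteq> J'" "J' \<subseteq> {0..q}" unfolding \<G>_def by blast
    define B'' where "B'' s = (if s \<in> J then B s else UNIV) \<inter> (if s \<in> J' then B' s else UNIV)" for s
    have "x \<inter> y = {\<omega>\<in>space M. \<forall>s\<in>J \<union> J'. A s \<omega> \<in> B'' s}" unfolding x y by (auto simp: B''_def)
    then show "x \<inter> y \<in> \<G>" unfolding \<G>_def using x y by (intro CollectI exI[of _ "J \<union> J'"] exI[of _ B'']) auto
  qed
  have "indep_set \<G> {b}"
    unfolding indep_sets2_eq
  proof (intro conjI ballI)
    fix x y assume "x \<in> \<G>" "y \<in> {b}"
    then obtain J B where "x = {\<omega>\<in>space M. \<forall>s\<in>J. A s \<omega> \<in> B s}" "finite J" "{0,q} \<subseteq> J" "J \<subseteq> {0..q}" "y = b"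
      unfolding \<G>_def by blast
    then show "prob (x \<inter> y) = prob x * prob y" unfolding b using past_increment_indep_finite[OF q] by simp
  qed (use Gm bm in auto)
  then have "indep_set (sigma_sets (space M) \<G>) (sigma_sets (space M) {b})"
    by (rule indep_set_sigma_sets[OF _ st]) (auto simp: Int_stable_def)
  moreover have "arrivals_upto q \<subseteq> \<G>"
  proof
    fix x assume "x \<in> arrivals_upto q"
    then obtain s B where x: "x = A s -` B \<inter> space M" "0 \<le> s" "s \<le> q" by (auto simp: arrivals_upto_def)
    have "x = {\<omega>\<in>space M. \<forall>u\<in>{0, q, s}. A u \<omega> \<in> (if u = s then B else UNIV)}" unfolding x by auto
    then show "x \<in> \<G>" unfolding \<G>_def using x q
      by (intro CollectI exI[of _ "{0, q, s}"] exI[of _ "\<lambda>u. if u = s then B else UNIV"]) auto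
  qed
  then have "a \<in> sigma_sets (space M) \<G>" using a sigma_sets_mono'[of "arrivals_upto q" \<G> "space M"] by auto
  ultimately show ?thesis unfolding indep_sets2_eq by (auto intro: sigma_sets.Basic)
qed

text \<open>The generating family now consists of intersections of an arrival event up to
  \<open>q\<close> with an event of the other sources. The latter splits off by independence of the
  sources, the former by independence of the increments.\<close>

lemma past_increment_indep:
  assumes q: "0 \<le> q" "q \<le> q'" and a: "a \<in> sets (past q)"
    and b: "b = {\<omega>\<in>space M. A q' \<omega> - A q \<omega> \<in> C}"
  shows "prob (a \<inter> b) = prob a * prob b"
proof -
  let ?P = "sigma_sets (space M) (arrivals_upto q)" and ?O = "sets (gen (-{Arrivals}))"
  define \<K> where "\<K> = {x \<inter> y | x y. x \<in> ?P \<and> y \<in> ?O}"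
  have bm: "b \<in> events" unfolding b using increment_measurable[OF q] by measurable
  have "sigma_algebra (space M) ?P"
    by (rule sigma_algebra_sigma_sets) (auto simp: arrivals_upto_def)
  then interpret P: sigma_algebra "space M" ?P .
  have PA: "?P \<subseteq> sets (gen {Arrivals})"
  proof -
    have "arrivals_upto q \<subseteq> src Arrivals"
      unfolding arrivals_upto_def source_sigma.simps by (auto intro!: sigma_sets.Basic)
    then show ?thesis unfolding sets_gen by (intro sigma_sets_mono') simp
  qed
  have bA: "b \<in> sets (gen {Arrivals})"
  proof -
    have [measurable]: "A q \<in> measurable (gen {Arrivals}) (count_space UNIV)" "A q' \<in> measurable (gen {Arrivals}) (count_space UNIV)"
      using q by (auto intro!: A_gen)
    have "{\<omega>\<in>space (gen {Arrivals}). A q' \<omega> - A q \<omega> \<in> C} \<in> sets (gen {Arrivals})" by measurable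
    then show ?thesis by (simp add: b)
  qed
  have KA: "\<K> \<subseteq> events" unfolding \<K>_def using PA gen_events by blast
  have st: "Int_stable \<K>"
    unfolding Int_stable_def
  proof (intro ballI)
    fix u v assume "u \<in> \<K>" "v \<in> \<K>"
    then obtain x y x' y' where "u = x \<inter> y" "v = x' \<inter> y'" "x \<in> ?P" "x' \<in> ?P" "y \<in> ?O" "y' \<in> ?O" unfolding \<K>_def by blast
    then have "u \<inter> v = (x \<inter> x') \<inter> (y \<inter> y')" "x \<inter> x' \<in> ?P" "y \<inter> y' \<in> ?O" by auto
    then show "u \<inter> v \<in> \<K>" unfolding \<K>_def by blast
  qed
  have "indep_set \<K> {b}"
    unfolding indep_sets2_eq
  proof (intro conjI ballI)
    fix u v assume "u \<in> \<K>" "v \<in> {b}"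
    then obtain x y where xy: "u = x \<inter> y" "x \<in> ?P" "y \<in> ?O" "v = b" unfolding \<K>_def by blast
    have xA: "x \<in> sets (gen {Arrivals})" using xy PA by auto
    have "prob (u \<inter> v) = prob ((x \<inter> b) \<inter> y)" unfolding xy by (simp add: Int_ac)
    also have "\<dots> = prob (x \<inter> b) * prob y" by (rule gen_indep[of "{Arrivals}", OF _ _ xy(3)]) (use xA bA in auto)
    also have "prob (x \<inter> b) = prob x * prob b" by (rule past_increment_indep_arrivals[OF q xy(2) b])
    also have "prob x * prob b * prob y = (prob x * prob y) * prob b" by simp
    also have "prob x * prob y = prob u" unfolding xy(1) by (rule gen_indep[OF _ xA xy(3), symmetric]) auto
    finally show "prob (u \<inter> v) = prob u * prob v" by (simp add: xy)
  qed (use KA bm in auto)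
  then have ind: "indep_set (sigma_sets (space M) \<K>) (sigma_sets (space M) {b})"
    by (rule indep_set_sigma_sets[OF _ st]) (auto simp: Int_stable_def)
  have "arrivals_upto q \<union> (\<Union>j\<in>-{Arrivals}. src j) \<subseteq> \<K>"
  proof
    fix x assume x: "x \<in> arrivals_upto q \<union> (\<Union>j\<in>-{Arrivals}. src j)"
    then have sub: "x \<subseteq> space M" using past_gen_sub sets.sets_into_space by blast
    have "space M \<in> ?P" "space M \<in> ?O" using P.top sets.top[of "gen (-{Arrivals})"] by auto
    moreover have "x \<in> ?P \<or> x \<in> ?O" using x by (auto simp: sets_gen intro: sigma_sets.Basic)
    moreover have "x = x \<inter> space M" "x = space M \<inter> x" using sub by auto
    ultimately show "x \<in> \<K>" unfolding \<K>_def by blast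
  qed
  then have "a \<in> sigma_sets (space M) \<K>" using a sigma_sets_mono'[of _ \<K> "space M"] unfolding sets_past by blast
  then show ?thesis using ind unfolding indep_sets2_eq by (auto intro: sigma_sets.Basic)
qed

section \<open>Absence of simultaneous arrivals\<close>

lemma Lam_continuous: "0 \<le> t \<Longrightarrow> continuous_on {0..t} (Lam 0)"
  unfolding Lam_def[abs_def] by (intro continuous_on_LBINT_upto lam_integrable) simp

lemma Lam_diff:
  assumes "0 \<le> s" "s \<le> t"
  shows "Lam s t = Lam 0 t - Lam 0 s"
proof -
  have i: "set_integrable lborel {0..s} lam" "set_integrable lborel {s..t} lam"
    using assms lam_integrable by auto
  have "Lam 0 t = (LBINT u:{0..s} \<union> {s..t}. lam u)" unfolding Lam_def using assms by (simp add: ivl_disj_un_two_touch)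
  also have "\<dots> = Lam 0 s + Lam s t"
    unfolding Lam_def
  proof (rule set_integral_Un_AE[OF _ _ _ i])
    show "AE u in lborel. \<not> (u \<in> {0..s} \<and> u \<in> {s..t})"
      using AE_lborel_singleton[of s] by eventually_elim auto
  qed auto
  finally show ?thesis by simp
qed

text \<open>Two coinciding epochs lie in a common cell of every mesh. The probability of a cell with
  two arrivals is at most the sum of the squared cell means, which is small for a fine mesh; so the
  intersection of these events over all meshes is null.\<close>

lemma AE_simple_arrivals:
  assumes t: "0 < t"
  shows "AE \<omega> in M. simple_arrivals (\<lambda>s. A s \<omega>) t"
proof -
  define q where "q m j = t * real j / real m" for m j
  define E where "E m = {\<omega>\<in>space M. \<exists>j\<in>{..<m}. 2 \<le> A (q m (Suc j)) \<omega> - A (q m j) \<omega>}" for m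
  have q: "0 \<le> q m j" "q m j \<le> q m (Suc j)" for m j using t by (auto simp: q_def divide_right_mono)
  have qt: "q m (Suc j) \<le> t" if "j < m" for m j unfolding q_def by (rule mesh_point_le[OF t that])
  have Em: "E m \<in> events" for m
    unfolding E_def
  proof (rule sets.sets_Collect_finite_Ex)
    fix j
    note [measurable] = increment_measurable[OF q, of m j]
    show "{\<omega>\<in>space M. 2 \<le> A (q m (Suc j)) \<omega> - A (q m j) \<omega>} \<in> events" by measurable
  qed simp
  have small: "\<exists>m>0. prob (E m) \<le> e" if e: "0 < e" for e :: real
  proof -
    \<comment> \<open>If \<open>Lam\<close> grows by at most \<open>d\<close> over each cell, the
      sum of squares is at most \<open>n * n * d * Lam 0 t \<le> e\<close>; the added 1 keeps the
      denominator positive.\<close>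
    define d where "d = e / (real n * real n * (Lam 0 t + 1))"
    have L1: "0 < Lam 0 t + 1" using Lam_nonneg[of 0 t] by simp
    have d: "0 < d" using e n_ge_1 L1 by (simp add: d_def)
    have "uniformly_continuous_on {0..t} (Lam 0)"
      using t by (intro compact_uniformly_continuous Lam_continuous) auto
    then obtain \<delta> where \<delta>: "0 < \<delta>" "\<And>x y. x \<in> {0..t} \<Longrightarrow> y \<in> {0..t} \<Longrightarrow> dist y x < \<delta> \<Longrightarrow> dist (Lam 0 y) (Lam 0 x) < d"
      unfolding uniformly_continuous_on_def using d by blast
    obtain m :: nat where m: "0 < m" "inverse (real m) < \<delta> / t"
      using ex_inverse_of_nat_less[of "\<delta> / t"] \<delta> t by auto
    have mt: "t / m < \<delta>" using m t by (simp add: field_simps)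
    have cell: "Lam (q m j) (q m (Suc j)) \<le> d" if j: "j < m" for j
    proof -
      have "q m (Suc j) - q m j = t / m" by (simp add: q_def field_simps add_divide_distrib)
      then have "dist (q m (Suc j)) (q m j) < \<delta>" using mt q[of m j] by (simp add: dist_real_def)
      moreover have "q m j \<in> {0..t}" "q m (Suc j) \<in> {0..t}" using q[of m j] qt[OF j] q(1)[of m "Suc j"] by auto
      ultimately have "dist (Lam 0 (q m (Suc j))) (Lam 0 (q m j)) < d" using \<delta>(2) by blast
      then show ?thesis by (simp add: Lam_diff[OF q] dist_real_def)
    qed
    have Lsum: "(\<Sum>j<m. Lam (q m j) (q m (Suc j))) = Lam 0 t"
    proof -
      have "(\<Sum>j<m. Lam (q m j) (q m (Suc j))) = (\<Sum>j<m. Lam 0 (q m (Suc j)) - Lam 0 (q m j))"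
        by (simp add: Lam_diff[OF q])
      also have "\<dots> = Lam 0 (q m m) - Lam 0 (q m 0)" by (rule sum_lessThan_telescope)
      also have "\<dots> = Lam 0 t" using m Lam_diff[of 0 0] by (simp add: q_def)
      finally show ?thesis .
    qed
    have "E m = (\<Union>j\<in>{..<m}. {\<omega>\<in>space M. 2 \<le> A (q m (Suc j)) \<omega> - A (q m j) \<omega>})" by (auto simp: E_def)
    also have "prob \<dots> \<le> (\<Sum>j\<in>{..<m}. prob {\<omega>\<in>space M. 2 \<le> A (q m (Suc j)) \<omega> - A (q m j) \<omega>})"
    proof (rule finite_measure_subadditive_finite)
      have "{\<omega>\<in>space M. 2 \<le> A (q m (Suc j)) \<omega> - A (q m j) \<omega>} \<in> events" for j
      proof -
        note [measurable] = increment_measurable[OF q, of m j]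
        show ?thesis by measurable
      qed
      then show "(\<lambda>j. {\<omega>\<in>space M. 2 \<le> A (q m (Suc j)) \<omega> - A (q m j) \<omega>}) ` {..<m} \<subseteq> events" by auto
    qed simp
    also have "\<dots> \<le> (\<Sum>j<m. (n * Lam (q m j) (q m (Suc j)))\<^sup>2)"
      by (intro sum_mono prob_poisson_ge_2 increment_measurable increment_poisson q) (use Lam_nonneg q in auto)
    also have "\<dots> \<le> (\<Sum>j<m. (real n * real n * d) * Lam (q m j) (q m (Suc j)))"
    proof (intro sum_mono)
      fix j assume "j \<in> {..<m}"
      then have "Lam (q m j) (q m (Suc j)) * Lam (q m j) (q m (Suc j)) \<le> d * Lam (q m j) (q m (Suc j))"
        using cell Lam_nonneg[OF q(1)] by (intro mult_right_mono) auto
      then have "(real n * real n) * (Lam (q m j) (q m (Suc j)) * Lam (q m j) (q m (Suc j))) \<le> (real n * real n) * (d * Lam (q m j) (q m (Suc j)))"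
        by (intro mult_left_mono) auto
      then show "(n * Lam (q m j) (q m (Suc j)))\<^sup>2 \<le> (real n * real n * d) * Lam (q m j) (q m (Suc j))"
        by (simp add: power2_eq_square mult_ac)
    qed
    also have "\<dots> = real n * real n * d * Lam 0 t" by (simp only: sum_distrib_left[symmetric] Lsum)
    also have "\<dots> \<le> real n * real n * d * (Lam 0 t + 1)" using d by (intro mult_left_mono) auto
    also have "\<dots> = e" using n_ge_1 L1 by (simp add: d_def)
    finally show ?thesis using m(1) by blast
  qed
  have EI: "(\<Inter>m. E (Suc m)) \<in> events" using Em by auto
  have "prob (\<Inter>m. E (Suc m)) \<le> e" if e: "0 < e" for e :: real
  proof -
    obtain m where "prob (E (Suc m)) \<le> e" using small[OF e] gr0_conv_Suc by auto
    moreover have "prob (\<Inter>m. E (Suc m)) \<le> prob (E (Suc m))" by (rule finite_measure_mono) (use Em in auto)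
    ultimately show ?thesis by simp
  qed
  then have "prob (\<Inter>m. E (Suc m)) \<le> 0" by (rule field_le_epsilon) simp
  then have "prob (\<Inter>m. E (Suc m)) = 0" using measure_nonneg[of M] by (simp add: order_antisym)
  then have "(\<Inter>m. E (Suc m)) \<in> null_sets M" using EI by (simp add: emeasure_eq_measure null_setsI)
  then have "AE \<omega> in M. \<omega> \<notin> (\<Inter>m. E (Suc m))" by (rule AE_not_in)
  with AE_counting_path AE_space[of M] show ?thesis
  proof eventually_elim
    case (elim \<omega>)
    note c = elim(1) and wsp = elim(2) and nE = elim(3)
    show ?case
    proof (rule ccontr)
      assume ns: "\<not> simple_arrivals (\<lambda>s. A s \<omega>) t"
      let ?a = "\<lambda>s. A s \<omega>"
      obtain i where i: "Suc i < ?a t" "arrival_time ?a (Suc i) \<le> arrival_time ?a i" using ns by (auto simp: simple_arrivals_def not_less)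
      have i': "i < ?a t" using i by simp
      let ?u = "arrival_time ?a i"
      have u0: "0 < ?u" using arrival_time_pos[OF c i'] t by simp
      have ut: "?u \<le> t" using arrival_time_le_iff[OF c i'] i' t by simp
      have "\<omega> \<in> E (Suc m)" for m
      proof -
        define j where "j = mesh_index t (Suc m) ?u"
        have j: "j < Suc m" unfolding j_def by (rule mesh_index_less[OF t _ u0 ut]) simp
        have cell: "q (Suc m) j < ?u" "?u \<le> q (Suc m) (Suc j)"
          using mesh_index_iff[OF t _ u0, of "Suc m" j] unfolding q_def j_def by blast+
        have "\<not> i < ?a (q (Suc m) j)" using arrival_time_le_iff[OF c i' _ q(1)[of "Suc m" j]] cell t by auto
        moreover have "arrival_time ?a (Suc i) \<le> q (Suc m) (Suc j)" using i cell by simp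
        then have "Suc i < ?a (q (Suc m) (Suc j))" using arrival_time_le_iff[OF c i(1) _ q(1)[of "Suc m" "Suc j"]] t by auto
        ultimately have "2 \<le> A (q (Suc m) (Suc j)) \<omega> - A (q (Suc m) j) \<omega>" by simp
        then show ?thesis using wsp j unfolding E_def by blast
      qed
      then show False using nE by blast
    qed
  qed
qed

section \<open>Accepted arrivals against the integrated acceptance indicator\<close>

definition busy_rv :: "real \<Rightarrow> 'a \<Rightarrow> nat" where
  "busy_rv q \<omega> = card {j. j < N0 \<omega> \<and> q < R j \<omega>}
     + card {i \<in> adm q (A q \<omega>) \<omega>. q < arrival_before (\<lambda>s. A s \<omega>) q i + S i \<omega>}"

text \<open>The substitute epochs make the occupancy at \<open>q\<close> measurable for every
  sigma-algebra that carries the arrivals up to \<open>q\<close> and the other data; the true epochs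
  would also look at times after \<open>q\<close>.\<close>

lemma busy_rv_measurable:
  assumes A: "\<And>s. s \<in> {0..q} \<Longrightarrow> A s \<in> measurable E (count_space UNIV)" and q: "0 \<le> q"
    and N: "N0 \<in> measurable E (count_space UNIV)" and R: "\<And>j. R j \<in> borel_measurable E"
    and S: "\<And>i. S i \<in> borel_measurable E"
  shows "busy_rv q \<in> measurable E (count_space UNIV)"
proof -
  note [measurable] = N R S arrival_before_measurable[OF A q]
  define c where "c K \<omega> = card {i. i < K \<and> (i \<in> adm q K \<omega> \<and> q < arrival_before (\<lambda>s. A s \<omega>) q i + S i \<omega>)}" for K \<omega>
  have [measurable]: "c K \<in> measurable E (count_space UNIV)" for K
    unfolding c_def[abs_def]
  proof (rule measurable_card_initial)
    fix i
    have [measurable]: "Measurable.pred E (\<lambda>\<omega>. i \<in> adm q K \<omega>)"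
      by (rule pred_adm) (use A q N R S in auto)
    show "Measurable.pred E (\<lambda>\<omega>. i \<in> adm q K \<omega> \<and> q < arrival_before (\<lambda>s. A s \<omega>) q i + S i \<omega>)" by measurable
  qed simp
  have "A q \<in> measurable E (count_space UNIV)" using A q by simp
  then have [measurable]: "(\<lambda>\<omega>. c (A q \<omega>) \<omega>) \<in> measurable E (count_space UNIV)"
    by (rule measurable_compose_countable[rotated]) measurable
  have [measurable]: "(\<lambda>\<omega>. card {j. j < N0 \<omega> \<and> q < R j \<omega>}) \<in> measurable E (count_space UNIV)"
    by (rule measurable_card_initial) measurable
  have "c K \<omega> = card {i \<in> adm q K \<omega>. q < arrival_before (\<lambda>s. A s \<omega>) q i + S i \<omega>}" for K \<omega>
    unfolding c_def adm_def using admitted_subset[of n "N0 \<omega>" "\<lambda>j. R j \<omega>" "arrival_before (\<lambda>s. A s \<omega>) q" "\<lambda>k. S k \<omega>" K]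
    by (intro arg_cong[where f=card]) auto
  then have "busy_rv q = (\<lambda>\<omega>. card {j. j < N0 \<omega> \<and> q < R j \<omega>} + c (A q \<omega>) \<omega>)"
    by (auto simp: busy_rv_def fun_eq_iff)
  then show ?thesis by simp
qed

lemma busy_rv_eq:
  assumes a: "counting_path (\<lambda>s. A s \<omega>)" and q: "0 \<le> q"
  shows "busy_rv q \<omega> = busy_servers n (\<lambda>s. A s \<omega>) (N0 \<omega>) (\<lambda>j. R j \<omega>) (\<lambda>k. S k \<omega>) q"
proof -
  have "{i \<in> adm q (A q \<omega>) \<omega>. q < arrival_before (\<lambda>s. A s \<omega>) q i + S i \<omega>}
    = {i \<in> admitted n (N0 \<omega>) (\<lambda>j. R j \<omega>) (arrival_time (\<lambda>s. A s \<omega>)) (\<lambda>k. S k \<omega>) (A q \<omega>). q < arrival_time (\<lambda>s. A s \<omega>) i + S i \<omega>}"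
    unfolding adm_eq[OF a q order_refl]
    using arrival_before_eq[OF a q] admitted_subset[of n "N0 \<omega>" "\<lambda>j. R j \<omega>" "arrival_time (\<lambda>s. A s \<omega>)" "\<lambda>k. S k \<omega>" "A q \<omega>"]
    by (intro Collect_cong conj_cong refl) auto
  then show ?thesis by (simp add: busy_rv_def busy_servers_def)
qed

abbreviation "path_free \<omega> \<equiv> free_before n (\<lambda>s. A s \<omega>) (N0 \<omega>) (\<lambda>j. R j \<omega>) (\<lambda>k. S k \<omega>)"
abbreviation "path_admitted \<omega> \<equiv> admitted n (N0 \<omega>) (\<lambda>j. R j \<omega>) (arrival_time (\<lambda>s. A s \<omega>)) (\<lambda>k. S k \<omega>)"

text \<open>The acceptance indicator is sampled on a mesh, where it is predictable, so that the exponential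
  product bound applies; refining the mesh gives the bound for the admitted arrivals by Fatou's lemma.\<close>

lemma admissions_exp_bound:
  assumes t: "0 < t" and \<theta>: "\<bar>\<theta>\<bar> \<le> 1"
  shows "\<exists>Z\<in>borel_measurable M. (\<integral>\<^sup>+\<omega>. Z \<omega> \<partial>M) \<le> 1 \<and>
    (AE \<omega> in M. ennreal (exp (real n * (\<theta> * (real (card (path_admitted \<omega> (A t \<omega>))) / n
       - (LBINT u:{0..t}. path_free \<omega> u * lam u)) - Lam 0 t * \<theta>\<^sup>2))) \<le> Z \<omega>)"
proof (intro bexI conjI)
  define q where "q m j = t * real j / real m" for m j
  have q: "0 \<le> q m j" "q m j \<le> q m (Suc j)" for m j using t by (auto simp: q_def divide_right_mono)
  define D where "D m j \<omega> \<longleftrightarrow> busy_rv (q m j) \<omega> < n" for m j \<omega>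
  define y where "y m j \<omega> = \<theta> * real (A (q m (Suc j)) \<omega> - A (q m j) \<omega>) - (exp \<theta> - 1) * (n * Lam (q m j) (q m (Suc j)))" for m j \<omega>
  define Y where "Y m j \<omega> = exp (y m j \<omega>)" for m j \<omega>
  define U where "U m \<omega> = ennreal (\<Prod>j<m. if D m j \<omega> then Y m j \<omega> else 1)" for m \<omega>
  \<comment> \<open>The lower limit is defined and measurable without exceptional set; almost
    everywhere it is a limit, computed below.\<close>
  let ?Z = "\<lambda>\<omega>. liminf (\<lambda>m. U m \<omega>)"
  have qm: "q m i \<le> q m j" if "i \<le> j" for m i j using that t by (auto simp: q_def intro!: divide_right_mono mult_left_mono)
  have past_meas: "N0 \<in> measurable (past s) (count_space UNIV)" "R j \<in> borel_measurable (past s)" "S j \<in> borel_measurable (past s)" for s j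
    by (rule gen_past[of "-{Arrivals}"]; auto intro!: N0_gen R_gen S_gen)+
  have Dp: "{\<omega>\<in>space M. D m i \<omega>} \<in> sets (past (q m k))" if "i \<le> k" for m i k
  proof -
    have [measurable]: "busy_rv (q m i) \<in> measurable (past (q m k)) (count_space UNIV)"
      by (rule busy_rv_measurable) (use q qm[OF that, of m] past_meas in \<open>auto intro!: A_past\<close>)
    have "{\<omega>\<in>space (past (q m k)). busy_rv (q m i) \<omega> < n} \<in> sets (past (q m k))" by measurable
    then show ?thesis by (simp add: D_def)
  qed
  have Yp: "Y m i \<in> borel_measurable (past (q m k))" if "i < k" for m i k
  proof -
    have le: "q m (Suc i) \<le> q m k" "q m i \<le> q m k" using that qm[of "Suc i" k m] qm[of i k m] by auto
    have [measurable]: "A (q m (Suc i)) \<in> measurable (past (q m k)) (count_space UNIV)" "A (q m i) \<in> measurable (past (q m k)) (count_space UNIV)"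
      using A_past q le by auto
    show ?thesis unfolding Y_def[abs_def] y_def by measurable
  qed
  have YM: "Y m k \<in> borel_measurable M" for m k
  proof -
    note [measurable] = increment_measurable[OF q, of m k]
    show ?thesis unfolding Y_def[abs_def] y_def by measurable
  qed
  have Ynn: "0 \<le> Y m k \<omega>" for m k \<omega> by (simp add: Y_def)
  have DM: "Measurable.pred M (D m k)" for m k
    using Dp[of k k m] past_events by (auto simp: pred_def)
  have le1: "(\<integral>\<^sup>+\<omega>. U m \<omega> \<partial>M) \<le> 1" for m
    unfolding U_def
  proof (rule nn_integral_predictable_prod_le_1[where E="\<lambda>k. past (q m k)"])
    fix k a B assume a: "a \<in> sets (past (q m k))" and B: "(B :: real set) \<in> sets borel"
    have "Y m k -` B \<inter> space M = {\<omega>\<in>space M. A (q m (Suc k)) \<omega> - A (q m k) \<omega> \<in>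
        {d. exp (\<theta> * real d - (exp \<theta> - 1) * (n * Lam (q m k) (q m (Suc k)))) \<in> B}}"
      by (auto simp: Y_def y_def)
    from past_increment_indep[OF q a this]
    show "prob (a \<inter> (Y m k -` B \<inter> space M)) = prob a * prob (Y m k -` B \<inter> space M)" .
  next
    fix k show "(\<integral>\<^sup>+\<omega>. ennreal (Y m k \<omega>) \<partial>M) \<le> 1" unfolding Y_def y_def by (simp add: increment_exp[OF q])
  qed (use past_events Dp Yp YM Ynn in auto)
  have UM: "U m \<in> borel_measurable M" for m
  proof -
    note [measurable] = YM DM
    show ?thesis unfolding U_def[abs_def] by measurable
  qed
  then show "?Z \<in> borel_measurable M" by measurable
  have "(\<integral>\<^sup>+\<omega>. ?Z \<omega> \<partial>M) \<le> liminf (\<lambda>m. \<integral>\<^sup>+\<omega>. U m \<omega> \<partial>M)" by (rule nn_integral_liminf) (rule UM)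
  also have "\<dots> \<le> liminf (\<lambda>m. 1 :: ennreal)" by (rule Liminf_mono) (use le1 in simp)
  finally show "(\<integral>\<^sup>+\<omega>. ?Z \<omega> \<partial>M) \<le> 1" by (simp add: Liminf_const)
  show "AE \<omega> in M. ennreal (exp (real n * (\<theta> * (real (card (path_admitted \<omega> (A t \<omega>))) / n
       - (LBINT u:{0..t}. path_free \<omega> u * lam u)) - Lam 0 t * \<theta>\<^sup>2))) \<le> ?Z \<omega>"
    using AE_counting_path AE_simple_arrivals[OF t]
  proof eventually_elim
    case (elim \<omega>)
    let ?a = "\<lambda>s. A s \<omega>"
    define I where "I = (LBINT u:{0..t}. path_free \<omega> u * lam u)"
    define b where "b s = (of_bool (busy_servers n ?a (N0 \<omega>) (\<lambda>j. R j \<omega>) (\<lambda>k. S k \<omega>) s < n) :: real)" for s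
    have lam0: "set_integrable lborel {0..t} lam" by (rule lam_integrable) simp
    have Db: "of_bool (D m j \<omega>) = b (q m j)" for m j by (simp add: D_def b_def busy_rv_eq[OF elim(1) q(1)])
    have Ue: "U m \<omega> = ennreal (exp (\<theta> * (\<Sum>j<m. b (q m j) * (real (?a (q m (Suc j))) - real (?a (q m j))))
        - (exp \<theta> - 1) * (n * (\<Sum>j<m. b (q m j) * (LBINT u:{q m j..q m (Suc j)}. lam u)))))" for m
    proof -
      have "(\<Prod>j<m. if D m j \<omega> then Y m j \<omega> else 1) = exp (\<Sum>j<m. if D m j \<omega> then y m j \<omega> else 0)"
        unfolding Y_def by (rule prod_if_exp)
      also have "(\<Sum>j<m. if D m j \<omega> then y m j \<omega> else 0)
        = (\<Sum>j<m. \<theta> * (b (q m j) * (real (?a (q m (Suc j))) - real (?a (q m j))))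
            - (exp \<theta> - 1) * (n * (b (q m j) * (LBINT u:{q m j..q m (Suc j)}. lam u))))"
      proof (intro sum.cong refl)
        fix j
        have "?a (q m j) \<le> ?a (q m (Suc j))" by (rule counting_path_mono[OF elim(1) q])
        then show "(if D m j \<omega> then y m j \<omega> else 0) = \<theta> * (b (q m j) * (real (?a (q m (Suc j))) - real (?a (q m j))))
            - (exp \<theta> - 1) * (n * (b (q m j) * (LBINT u:{q m j..q m (Suc j)}. lam u)))"
          unfolding Db[symmetric] by (simp add: y_def Lam_def of_nat_diff)
      qed
      finally show ?thesis by (simp add: U_def sum_subtractf sum_distrib_left)
    qed
    have lim: "(\<lambda>m. U m \<omega>) \<longlonglongrightarrow> ennreal (exp (\<theta> * real (card (path_admitted \<omega> (A t \<omega>))) - (exp \<theta> - 1) * (n * I)))"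
      unfolding Ue I_def b_def q_def
      by (intro tendsto_ennrealI tendsto_exp tendsto_diff tendsto_mult tendsto_const
          mesh_sums_tendsto[OF elim(1) n_ge_1 t elim(2) lam0])
    have Z: "?Z \<omega> = ennreal (exp (\<theta> * real (card (path_admitted \<omega> (A t \<omega>))) - (exp \<theta> - 1) * (n * I)))"
      by (rule lim_imp_Liminf[OF _ lim]) simp
    have fi: "set_integrable lborel {0..t} (\<lambda>u. path_free \<omega> u * lam u)"
    proof (rule set_integrable_bound[OF lam0])
      have "(\<lambda>u. (indicator {0..t} u *\<^sub>R path_free \<omega> u) * (indicator {0..t} u *\<^sub>R lam u)) \<in> borel_measurable borel"
        using free_before_measurable[OF elim(1) n_ge_1 t] lam0
        by (intro borel_measurable_times) (auto simp: set_borel_measurable_def set_integrable_def dest: borel_measurable_integrable)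
      also have "(\<lambda>u. (indicator {0..t} u *\<^sub>R path_free \<omega> u) * (indicator {0..t} u *\<^sub>R lam u)) = (\<lambda>u. indicator {0..t} u *\<^sub>R (path_free \<omega> u * lam u))"
        by (auto simp: indicator_def fun_eq_iff)
      finally show "set_borel_measurable lborel {0..t} (\<lambda>u. path_free \<omega> u * lam u)" by (simp add: set_borel_measurable_def)
    qed (auto simp: free_before_def of_bool_def)
    have I0: "0 \<le> I" unfolding I_def set_lebesgue_integral_def
      by (intro Bochner_Integration.integral_nonneg) (auto simp: indicator_def free_before_def of_bool_def lam_nonneg)
    \<comment> \<open>The integrated acceptance indicator is at most \<open>Lam 0 t\<close>, which
      keeps the quadratic cost within \<open>Lam 0 t * \<theta>\<^sup>2\<close>.\<close>
    have IL: "I \<le> Lam 0 t" unfolding I_def Lam_def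
      by (rule set_integral_mono[OF fi lam0]) (auto simp: free_before_def of_bool_def lam_nonneg)
    have "(exp \<theta> - 1) * (n * I) \<le> (\<theta> + \<theta>\<^sup>2) * (n * I)"
      using exp_le_quadratic[OF \<theta>] I0 by (intro mult_right_mono) auto
    moreover have "\<theta>\<^sup>2 * (n * I) \<le> \<theta>\<^sup>2 * (n * Lam 0 t)" using IL by (intro mult_left_mono) auto
    moreover have "real n * (\<theta> * (real (card (path_admitted \<omega> (A t \<omega>))) / n - I) - Lam 0 t * \<theta>\<^sup>2)
      = \<theta> * real (card (path_admitted \<omega> (A t \<omega>))) - \<theta> * (n * I) - \<theta>\<^sup>2 * (n * Lam 0 t)"
      using n_ge_1 by (simp add: field_simps)
    ultimately show ?case unfolding Z I_def[symmetric] by (intro ennreal_leI) (simp add: algebra_simps)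
  qed
qed

end

section \<open>The limit theorem\<close>

text \<open>An interval of positive length inside the ball on which \<open>f\<close> attains its
  upper bound \<open>c\<close> keeps the essential supremum from dropping below
  \<open>c\<close>.\<close>

lemma esssup_ball_eq:
  fixes f :: "real \<Rightarrow> ereal"
  assumes f: "f \<in> borel_measurable borel" and le: "\<And>y. y \<in> ball x \<epsilon> \<Longrightarrow> f y \<le> c"
    and ab: "a < b" "{a<..<b} \<subseteq> ball x \<epsilon>" and eq: "\<And>y. y \<in> {a<..<b} \<Longrightarrow> f y = c"
  shows "esssup (restrict_space lborel (ball x \<epsilon>)) f = c"
proof (rule antisym)
  let ?N = "restrict_space lborel (ball x \<epsilon>)"
  have fm: "f \<in> borel_measurable ?N" by (rule measurable_restrict_space1) (use f in simp)
  show "esssup ?N f \<le> c"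
    by (rule esssup_I[OF fm]) (use le in \<open>auto intro!: AE_I2 simp: space_restrict_space\<close>)
  show "c \<le> esssup ?N f"
  proof (rule ccontr)
    assume "\<not> c \<le> esssup ?N f"
    then have lt: "esssup ?N f < c" by simp
    have "AE y in ?N. f y \<le> esssup ?N f" by (rule esssup_AE)
    then have "AE y in lborel. y \<in> ball x \<epsilon> \<longrightarrow> f y \<le> esssup ?N f"
      by (subst (asm) AE_restrict_space_iff) auto
    then have "AE y in lborel. y \<notin> {a<..<b}"
    proof eventually_elim
      case (elim y)
      show ?case
      proof
        assume y: "y \<in> {a<..<b}"
        then have "f y \<le> esssup ?N f" using elim ab by blast
        then show False using eq[OF y] lt by simp
      qed
    qed
    then have "emeasure lborel {a<..<b} = 0"
      by (subst (asm) AE_iff_measurable[of "{a<..<b}"]) auto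
    then show False using ab(1) by simp
  qed
qed

text \<open>Every ball around \<open>x \<le> 1\<close> contains an interval to the left of
  \<open>x\<close>, where the indicator is 1.\<close>

lemma upper_env_threshold:
  assumes "x \<le> 1" shows "upper_env (\<lambda>x. of_bool (x < 1)) x = 1"
  unfolding upper_env_def
proof (rule tendsto_Lim)
  have "\<forall>\<^sub>F \<epsilon> in at_right 0. esssup (restrict_space lborel (ball x \<epsilon>)) (\<lambda>y. ereal (of_bool (y < 1))) = 1"
    using eventually_at_right_less[of 0]
  proof eventually_elim
    case (elim \<epsilon>)
    show ?case
      by (rule esssup_ball_eq[where a="x - \<epsilon>" and b=x]) (use elim assms in \<open>auto simp: dist_real_def of_bool_def\<close>)
  qed
  then show "((\<lambda>\<epsilon>. esssup (restrict_space lborel (ball x \<epsilon>)) (\<lambda>y. ereal (of_bool (y < 1)))) \<longlongrightarrow> 1) (at_right 0)"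
    by (rule tendsto_eventually)
qed simp

text \<open>For \<open>x < 1\<close> a small ball meets only the value 1, and for
  \<open>x = 1\<close> its right half meets the value 0. Together with the upper envelope this
  reduces the abstract constraint on \<open>w\<close> to the indicator inequality.\<close>

lemma lower_env_threshold:
  assumes "x \<le> 1" shows "lower_env (\<lambda>x. of_bool (x < 1)) x = of_bool (x < 1)"
  unfolding lower_env_def
proof (rule tendsto_Lim)
  have "\<forall>\<^sub>F \<epsilon> in at_right 0. - esssup (restrict_space lborel (ball x \<epsilon>)) (\<lambda>y. - ereal (of_bool (y < 1))) = of_bool (x < 1)"
  proof (cases "x < 1")
    case True
    then have "\<forall>\<^sub>F \<epsilon> in at_right 0. \<epsilon> \<in> {0<..<1 - x}" by (intro eventually_at_right_real) simp
    then show ?thesis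
    proof eventually_elim
      case (elim \<epsilon>)
      have "esssup (restrict_space lborel (ball x \<epsilon>)) (\<lambda>y. - ereal (of_bool (y < 1))) = - 1"
        by (rule esssup_ball_eq[where a="x - \<epsilon>" and b=x])
           (use elim True in \<open>auto simp: dist_real_def of_bool_def abs_less_iff one_ereal_def\<close>)
      then show ?case using True by simp
    qed
  next
    case False
    then have x: "x = 1" using assms by simp
    show ?thesis using eventually_at_right_less[of 0]
    proof eventually_elim
      case (elim \<epsilon>)
      have "esssup (restrict_space lborel (ball x \<epsilon>)) (\<lambda>y. - ereal (of_bool (y < 1))) = 0"
        by (rule esssup_ball_eq[where a="1" and b="1 + \<epsilon>"])
           (use elim x in \<open>auto simp: dist_real_def of_bool_def\<close>)
      then show ?case using False by simp
    qed
  qed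
  then show "((\<lambda>\<epsilon>. - esssup (restrict_space lborel (ball x \<epsilon>)) (\<lambda>y. - ereal (of_bool (y < 1)))) \<longlongrightarrow> of_bool (x < 1)) (at_right 0)"
    by (rule tendsto_eventually)
qed simp

text \<open>Absence of mass below 0 makes \<open>h\<close> vanish almost everywhere there, so
  integrals over the line reduce to \<open>{0..}\<close> and the law fits
  \<open>service_density\<close>.\<close>

lemma density_on_nonneg:
  fixes h :: "real \<Rightarrow> real"
  assumes H: "real_distribution H" "measure H {..<0} = 0" and h: "h \<in> borel_measurable borel" "\<And>x. 0 \<le> h x"
    and d: "H = density lborel (\<lambda>x. ennreal (h x))"
  shows "service_density h" and "cdf H c = (LBINT v:{0..c}. h v)"
proof -
  interpret real_distribution H by fact
  note [measurable] = h(1)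
  have "emeasure H {..<0} = 0" using H(2) by (simp add: emeasure_eq_measure)
  then have "(\<integral>\<^sup>+x. ennreal (h x) * indicator {..<0} x \<partial>lborel) = 0" by (simp add: d emeasure_density)
  then have "AE x in lborel. ennreal (h x) * indicator {..<0} x = 0"
    by (subst (asm) nn_integral_0_iff_AE) auto
  then have neg: "AE x in lborel. x < 0 \<longrightarrow> h x = 0"
    by eventually_elim (use h(2) in \<open>auto simp: indicator_def ennreal_eq_0_iff antisym\<close>)
  have part: "emeasure H B = (\<integral>\<^sup>+x. ennreal (indicator (B \<inter> {0..}) x *\<^sub>R h x) \<partial>lborel)" if "B \<in> sets borel" for B
  proof -
    have "emeasure H B = (\<integral>\<^sup>+x. ennreal (h x) * indicator B x \<partial>lborel)" using that by (simp add: d emeasure_density)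
    also have "\<dots> = (\<integral>\<^sup>+x. ennreal (indicator (B \<inter> {0..}) x *\<^sub>R h x) \<partial>lborel)"
      by (rule nn_integral_cong_AE, use neg in eventually_elim) (auto simp: indicator_def)
    finally show ?thesis .
  qed
  have int: "integrable lborel (\<lambda>x. indicator (B \<inter> {0..}) x *\<^sub>R h x)" if B: "B \<in> sets borel" for B
  proof (rule integrableI_nonneg)
    have "(\<integral>\<^sup>+x. ennreal (indicator (B \<inter> {0..}) x *\<^sub>R h x) \<partial>lborel) = emeasure H B" by (rule part[OF B, symmetric])
    also have "\<dots> < \<infinity>" by (simp add: emeasure_eq_measure)
    finally show "(\<integral>\<^sup>+x. ennreal (indicator (B \<inter> {0..}) x *\<^sub>R h x) \<partial>lborel) < \<infinity>" .
    show "(\<lambda>x. indicator (B \<inter> {0..}) x *\<^sub>R h x) \<in> borel_measurable lborel" using B by measurable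
  qed (use h(2) in auto)
  have val: "measure H B = (\<integral>x. indicator (B \<inter> {0..}) x *\<^sub>R h x \<partial>lborel)" if B: "B \<in> sets borel" for B
    using part[OF B] nn_integral_eq_integral[OF int[OF B]] h(2)
    by (simp add: measure_def Bochner_Integration.integral_nonneg)
  show "service_density h"
  proof
    show "set_integrable lborel {0..} h" using int[of UNIV] by (simp add: set_integrable_def)
    show "(LBINT x:{0..}. h x) = 1" using val[of UNIV] prob_space by (simp add: set_lebesgue_integral_def)
  qed (use h in auto)
  have "{..c} \<inter> {0..} = {0..c}" by auto
  then show "cdf H c = (LBINT v:{0..c}. h v)" using val[of "{..c}"] by (simp add: cdf_def set_lebesgue_integral_def)
qed

text \<open>Distribution functions lie between 0 and 1, so the supremum is over a bounded set and
  dominates each difference. The limiting one then vanishes at negative arguments, and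
  \<open>{..<0}\<close> is an increasing countable union of the corresponding half-lines.\<close>

lemma uniform_limit_no_mass_below_0:
  assumes F: "real_distribution F" and Fn: "\<And>n. n \<ge> 1 \<Longrightarrow> real_distribution (Fn n)" "\<And>n. n \<ge> 1 \<Longrightarrow> measure (Fn n) {..<0} = 0"
    and conv: "(\<lambda>n. SUP t. \<bar>cdf (Fn n) t - cdf F t\<bar>) \<longlonglongrightarrow> 0"
  shows "(\<lambda>n. cdf (Fn n) t) \<longlonglongrightarrow> cdf F t" and "measure F {..<0} = 0"
proof -
  interpret F: real_distribution F by fact
  have le: "\<bar>cdf (Fn n) t - cdf F t\<bar> \<le> (SUP t. \<bar>cdf (Fn n) t - cdf F t\<bar>)" if "n \<ge> 1" for n t
  proof (rule cSUP_upper)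
    interpret Fn: real_distribution "Fn n" by (rule Fn(1)[OF that])
    show "bdd_above (range (\<lambda>t. \<bar>cdf (Fn n) t - cdf F t\<bar>))"
    proof (rule bdd_aboveI2)
      fix t show "\<bar>cdf (Fn n) t - cdf F t\<bar> \<le> 1"
        using Fn.cdf_nonneg[of t] Fn.cdf_bounded_prob[of t] F.cdf_nonneg[of t] F.cdf_bounded_prob[of t] by linarith
    qed
  qed simp
  have lim: "(\<lambda>n. cdf (Fn n) t) \<longlonglongrightarrow> cdf F t" for t
  proof -
    have "(\<lambda>n. cdf (Fn n) t - cdf F t) \<longlonglongrightarrow> 0"
    proof (rule Lim_null_comparison[OF _ conv])
      show "\<forall>\<^sub>F n in sequentially. norm (cdf (Fn n) t - cdf F t) \<le> (SUP t. \<bar>cdf (Fn n) t - cdf F t\<bar>)"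
        using eventually_ge_at_top[of 1] by eventually_elim (use le in simp)
    qed
    then show ?thesis by (simp add: LIM_zero_iff)
  qed
  then show "(\<lambda>n. cdf (Fn n) t) \<longlonglongrightarrow> cdf F t" .
  have neg: "cdf F t = 0" if "t < 0" for t
  proof (rule LIMSEQ_unique[OF lim])
    have "\<forall>\<^sub>F n in sequentially. cdf (Fn n) t = 0" using eventually_ge_at_top[of 1]
    proof eventually_elim
      case (elim n)
      interpret Fn: real_distribution "Fn n" by (rule Fn(1)[OF elim])
      have "measure (Fn n) {..t} \<le> measure (Fn n) {..<0}" by (rule Fn.finite_measure_mono) (use that in auto)
      then show ?case using Fn(2)[OF elim] measure_nonneg[of "Fn n" "{..t}"] by (simp add: cdf_def)
    qed
    then show "(\<lambda>n. cdf (Fn n) t) \<longlonglongrightarrow> 0" by (rule tendsto_eventually)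
  qed
  have "(\<lambda>i. measure F {..- inverse (real (Suc i))}) \<longlonglongrightarrow> measure F (\<Union>i. {..- inverse (real (Suc i))})"
  proof (rule F.finite_Lim_measure_incseq)
    show "incseq (\<lambda>i. {..- inverse (real (Suc i))})"
    proof (rule incseq_SucI)
      fix n
      have "inverse (real (Suc (Suc n))) \<le> inverse (real (Suc n))" by (rule le_imp_inverse_le) auto
      then show "{..- inverse (real (Suc n))} \<subseteq> {..- inverse (real (Suc (Suc n)))}"
        by (intro subsetI) (unfold atMost_iff, linarith)
    qed
  qed auto
  also have "(\<Union>i. {..- inverse (real (Suc i))}) = {..<0}"
  proof (intro equalityI subsetI)
    fix x :: real assume "x \<in> {..<0}"
    then have "0 < - x" by simp
    then obtain i where "inverse (real (Suc i)) < - x" using reals_Archimedean by blast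
    then have "x \<le> - inverse (real (Suc i))" by linarith
    then show "x \<in> (\<Union>i. {..- inverse (real (Suc i))})" by blast
  next
    fix x :: real assume "x \<in> (\<Union>i. {..- inverse (real (Suc i))})"
    then obtain i where "x \<le> - inverse (real (Suc i))" by blast
    moreover have "0 < inverse (real (Suc i))" by simp
    ultimately show "x \<in> {..<0}" unfolding lessThan_iff by linarith
  qed
  also have "(\<lambda>i. measure F {..- inverse (real (Suc i))}) = (\<lambda>i. 0)"
    using neg unfolding cdf_def by (intro ext) simp
  finally show "measure F {..<0} = 0" using LIMSEQ_unique tendsto_const by blast
qed

text \<open>The exponential bounds are collected over all rational parameters. The second conclusion
  is kept apart from \<open>good_paths\<close>, as it serves to identify the weak limit and not to
  construct it.\<close>

lemma (in prob_space) AE_good_paths: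
  fixes lam g q :: "real \<Rightarrow> real" and \<rho>0 T :: real
    and A :: "nat \<Rightarrow> real \<Rightarrow> 'a \<Rightarrow> nat" and N0 :: "nat \<Rightarrow> 'a \<Rightarrow> nat" and R S :: "nat \<Rightarrow> nat \<Rightarrow> 'a \<Rightarrow> real"
  assumes lq: "\<And>n. n \<ge> 1 \<Longrightarrow> loss_queue M n lam G (Fn n) (A n) (N0 n) (R n) (S n)"
    and rl: "reflected_limit g (\<lambda>t. LBINT u:{0..t}. lam u) q T"
    and G: "\<And>c. measure G {c<..} = service_density.tail g c"
    and Fn: "\<And>p. (\<lambda>n. measure (Fn n) {p<..}) \<longlonglongrightarrow> H p" and q: "\<And>p. q p = \<rho>0 * H p"
    and N0: "AE \<omega> in M. (\<lambda>n. real (N0 n \<omega>) / real n) \<longlonglongrightarrow> \<rho>0"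
  shows "AE \<omega> in M. reflected_limit.good_paths g (\<lambda>t. LBINT u:{0..t}. lam u) q
      (\<lambda>n t. A n t \<omega>) (\<lambda>n. N0 n \<omega>) (\<lambda>n j. R n j \<omega>) (\<lambda>n k. S n k \<omega>)"
    and "AE \<omega> in M. \<forall>p\<in>{p\<in>\<rat>. 0 < p}. (\<lambda>n. accepted_upto n (\<lambda>t. A n t \<omega>) (N0 n \<omega>) (\<lambda>j. R n j \<omega>) (\<lambda>k. S n k \<omega>) p / n
      - (LBINT u:{0..p}. free_before n (\<lambda>t. A n t \<omega>) (N0 n \<omega>) (\<lambda>j. R n j \<omega>) (\<lambda>k. S n k \<omega>) u * lam u)) \<longlonglongrightarrow> 0"
proof -
  interpret rl: reflected_limit g "\<lambda>t. LBINT u:{0..t}. lam u" q T by fact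
  let ?Lam = "\<lambda>t. LBINT u:{0..t}. lam u"
  let ?adm = "\<lambda>n \<omega>. admitted n (N0 n \<omega>) (\<lambda>j. R n j \<omega>) (arrival_time (\<lambda>t. A n t \<omega>)) (\<lambda>k. S n k \<omega>)"
  have Lam0: "loss_queue.Lam lam 0 = ?Lam"
    using loss_queue.Lam_def[OF lq[of 1]] by (simp add: fun_eq_iff)
  have g1: "AE \<omega> in M. \<forall>n\<in>{1..}. counting_path (\<lambda>t. A n t \<omega>) \<and> N0 n \<omega> \<le> n"
  proof (rule AE_ball_countable')
    fix n :: nat assume "n \<in> {1..}"
    then interpret lq: loss_queue M n lam G "Fn n" "A n" "N0 n" "R n" "S n" using lq by simp
    show "AE \<omega> in M. counting_path (\<lambda>t. A n t \<omega>) \<and> N0 n \<omega> \<le> n"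
      using lq.AE_counting_path lq.AE_N0_le by eventually_elim simp
  qed simp
  have cr: "countable {p\<in>\<rat>. (0::real) \<le> p}" "countable {p\<in>\<rat>. (0::real) < p}"
    by (rule countable_subset[OF _ countable_rat]; auto)+
  have g2: "AE \<omega> in M. \<forall>p\<in>{p\<in>\<rat>. 0 \<le> p}. (\<lambda>n. real (A n p \<omega>) / n) \<longlonglongrightarrow> ?Lam p"
  proof (rule AE_ball_countable'[OF _ cr(1)])
    fix p :: real assume p: "p \<in> {p\<in>\<rat>. 0 \<le> p}"
    have "AE \<omega> in M. (\<lambda>n. real (A n p \<omega>) / n - ?Lam p) \<longlonglongrightarrow> 0"
    proof (rule AE_tendsto_zero_of_exp_bounds)
      fix n :: nat and \<theta> :: real assume "1 \<le> n" and \<theta>: "\<bar>\<theta>\<bar> \<le> 1"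
      then interpret lq: loss_queue M n lam G "Fn n" "A n" "N0 n" "R n" "S n" using lq by simp
      show "\<exists>Z\<in>borel_measurable M. (\<integral>\<^sup>+\<omega>. Z \<omega> \<partial>M) \<le> 1 \<and>
        (AE \<omega> in M. ennreal (exp (real n * (\<theta> * (real (A n p \<omega>) / n - ?Lam p) - ?Lam p * \<theta>\<^sup>2))) \<le> Z \<omega>)"
        using lq.arrivals_exp_bound[OF _ \<theta>, of p] p by (simp add: Lam0)
    qed
    then show "AE \<omega> in M. (\<lambda>n. real (A n p \<omega>) / n) \<longlonglongrightarrow> ?Lam p"
      by eventually_elim (simp add: LIM_zero_iff)
  qed
  have g4: "AE \<omega> in M. \<forall>p\<in>\<rat>. (\<lambda>n. real (card {j. j < N0 n \<omega> \<and> p < R n j \<omega>}) / n) \<longlonglongrightarrow> q p"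
  proof (rule AE_ball_countable'[OF _ countable_rat])
    fix p :: real
    have "AE \<omega> in M. (\<lambda>n. (real (card {j. j < N0 n \<omega> \<and> p < R n j \<omega>}) - N0 n \<omega> * measure (Fn n) {p<..}) / n) \<longlonglongrightarrow> 0"
    proof (rule AE_tendsto_zero_of_exp_bounds)
      fix n :: nat and \<theta> :: real assume "1 \<le> n" and \<theta>: "\<bar>\<theta>\<bar> \<le> 1"
      then interpret lq: loss_queue M n lam G "Fn n" "A n" "N0 n" "R n" "S n" using lq by simp
      show "\<exists>Z\<in>borel_measurable M. (\<integral>\<^sup>+\<omega>. Z \<omega> \<partial>M) \<le> 1 \<and>
        (AE \<omega> in M. ennreal (exp (real n * (\<theta> * ((real (card {j. j < N0 n \<omega> \<and> p < R n j \<omega>}) - N0 n \<omega> * measure (Fn n) {p<..}) / n) - 1 * \<theta>\<^sup>2))) \<le> Z \<omega>)"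
        by (rule lq.residuals_exp_bound[OF \<theta>])
    qed
    with N0 show "AE \<omega> in M. (\<lambda>n. real (card {j. j < N0 n \<omega> \<and> p < R n j \<omega>}) / n) \<longlonglongrightarrow> q p"
    proof eventually_elim
      case (elim \<omega>)
      \<comment> \<open>The centred sum is completed by the mean, in which the scaled initial number
        and the survival probability under \<open>Fn n\<close> converge separately.\<close>
      have "(\<lambda>n. (real (card {j. j < N0 n \<omega> \<and> p < R n j \<omega>}) - N0 n \<omega> * measure (Fn n) {p<..}) / n
          + real (N0 n \<omega>) / n * measure (Fn n) {p<..}) \<longlonglongrightarrow> 0 + \<rho>0 * H p"
        by (intro tendsto_add tendsto_mult elim Fn)
      then show ?case by (simp add: q diff_divide_distrib)
    qed
  qed
  have g5: "AE \<omega> in M. \<forall>(p, p', c)\<in>{(p, p', c). p \<in> \<rat> \<and> p' \<in> \<rat> \<and> c \<in> \<rat> \<and> 0 \<le> p \<and> p \<le> p'}.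
      (\<lambda>n. (\<Sum>i\<in>{i\<in>?adm n \<omega> (A n p' \<omega>). A n p \<omega> \<le> i}. of_bool (c < S n i \<omega>) - rl.tail c) / n) \<longlonglongrightarrow> 0"
  proof (rule AE_ball_countable')
    have "countable (\<rat> \<times> \<rat> \<times> (\<rat> :: real set))" by (intro countable_SIGMA countable_rat)
    then show "countable {(p, p', c). p \<in> \<rat> \<and> p' \<in> \<rat> \<and> c \<in> (\<rat> :: real set) \<and> (0::real) \<le> p \<and> p \<le> (p' :: real)}"
      by (rule countable_subset[rotated]) auto
    fix z :: "real \<times> real \<times> real" assume z: "z \<in> {(p, p', c). p \<in> \<rat> \<and> p' \<in> \<rat> \<and> c \<in> \<rat> \<and> 0 \<le> p \<and> p \<le> p'}"
    obtain p p' c where zz: "z = (p, p', c)" by (cases z) auto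
    have p: "0 \<le> p" "p \<le> p'" "p' \<in> {p\<in>\<rat>. 0 \<le> p}" using z by (auto simp: zz)
    \<comment> \<open>The arrivals up to \<open>p'\<close> eventually stay below
      \<open>C * n\<close>, so the cut-off in the service bound disappears in the limit.\<close>
    define C where "C = nat \<lceil>?Lam p' + 1\<rceil>"
    have C: "?Lam p' + 1 \<le> real C" unfolding C_def by linarith
    have "AE \<omega> in M. (\<lambda>n. (\<Sum>i\<in>{i\<in>?adm n \<omega> (A n p' \<omega>). A n p \<omega> \<le> i \<and> i < C * n}. of_bool (c < S n i \<omega>) - measure G {c<..}) / n) \<longlonglongrightarrow> 0"
    proof (rule AE_tendsto_zero_of_exp_bounds)
      fix n :: nat and \<theta> :: real assume "1 \<le> n" and \<theta>: "\<bar>\<theta>\<bar> \<le> 1"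
      then interpret lq: loss_queue M n lam G "Fn n" "A n" "N0 n" "R n" "S n" using lq by simp
      show "\<exists>Z\<in>borel_measurable M. (\<integral>\<^sup>+\<omega>. Z \<omega> \<partial>M) \<le> 1 \<and>
        (AE \<omega> in M. ennreal (exp (real n * (\<theta> * ((\<Sum>i\<in>{i\<in>?adm n \<omega> (A n p' \<omega>). A n p \<omega> \<le> i \<and> i < C * n}.
          of_bool (c < S n i \<omega>) - measure G {c<..}) / n) - real C * \<theta>\<^sup>2))) \<le> Z \<omega>)"
        by (rule lq.services_exp_bound[OF p(1,2) \<theta>])
    qed
    with g2 have "AE \<omega> in M. (\<lambda>n. (\<Sum>i\<in>{i\<in>?adm n \<omega> (A n p' \<omega>). A n p \<omega> \<le> i}. of_bool (c < S n i \<omega>) - rl.tail c) / n) \<longlonglongrightarrow> 0"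
    proof eventually_elim
      case (elim \<omega>)
      have "(\<lambda>n. real (A n p' \<omega>) / n) \<longlonglongrightarrow> ?Lam p'" using elim(1) p(3) by blast
      then have "\<forall>\<^sub>F n in sequentially. real (A n p' \<omega>) / n < ?Lam p' + 1" by (rule order_tendstoD) simp
      with eventually_gt_at_top[of 0]
      have "\<forall>\<^sub>F n in sequentially. (\<Sum>i\<in>{i\<in>?adm n \<omega> (A n p' \<omega>). A n p \<omega> \<le> i \<and> i < C * n}. of_bool (c < S n i \<omega>) - measure G {c<..}) / n
        = (\<Sum>i\<in>{i\<in>?adm n \<omega> (A n p' \<omega>). A n p \<omega> \<le> i}. of_bool (c < S n i \<omega>) - rl.tail c) / n"
      proof eventually_elim
        case (elim n)
        have "real (A n p' \<omega>) / n < real C" using elim(2) C by linarith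
        then have "real (A n p' \<omega>) < real (C * n)" using elim(1) by (simp add: field_simps)
        then have "A n p' \<omega> < C * n" by (simp only: of_nat_less_iff)
        then have "{i\<in>?adm n \<omega> (A n p' \<omega>). A n p \<omega> \<le> i \<and> i < C * n} = {i\<in>?adm n \<omega> (A n p' \<omega>). A n p \<omega> \<le> i}"
          using admitted_subset[of n "N0 n \<omega>" "\<lambda>j. R n j \<omega>" "arrival_time (\<lambda>t. A n t \<omega>)" "\<lambda>k. S n k \<omega>" "A n p' \<omega>"] by force
        then show ?case by (simp add: G)
      qed
      then show ?case by (rule Lim_transform_eventually[OF elim(2)])
    qed
    then show "AE \<omega> in M. case z of (p, p', c) \<Rightarrow> (\<lambda>n. (\<Sum>i\<in>{i\<in>?adm n \<omega> (A n p' \<omega>). A n p \<omega> \<le> i}. of_bool (c < S n i \<omega>) - rl.tail c) / n) \<longlonglongrightarrow> 0"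
      by (simp add: zz)
  qed
  show "AE \<omega> in M. rl.good_paths (\<lambda>n t. A n t \<omega>) (\<lambda>n. N0 n \<omega>) (\<lambda>n j. R n j \<omega>) (\<lambda>n k. S n k \<omega>)"
    using g1 g2 g4 g5
  proof eventually_elim
    case (elim \<omega>)
    show ?case unfolding rl.good_paths_def
    proof (intro conjI ballI impI)
      show "\<forall>n\<ge>1. counting_path (\<lambda>t. A n t \<omega>) \<and> N0 n \<omega> \<le> n" using elim(1) by auto
      show "(\<lambda>n. real (A n p \<omega>) / n) \<longlonglongrightarrow> ?Lam p" if "p \<in> \<rat>" "0 \<le> p" for p using elim(2) that by blast
      show "(\<lambda>n. real (card {j. j < N0 n \<omega> \<and> p < R n j \<omega>}) / n) \<longlonglongrightarrow> q p" if "p \<in> \<rat>" for p using elim(3) that by blast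
      show "(\<lambda>n. (\<Sum>i\<in>{i\<in>?adm n \<omega> (A n p' \<omega>). A n p \<omega> \<le> i}. of_bool (c < S n i \<omega>) - rl.tail c) / n) \<longlonglongrightarrow> 0"
        if "p \<in> \<rat>" "p' \<in> \<rat>" "c \<in> \<rat>" "0 \<le> p" "p \<le> p'" for p p' c
        using elim(4)[rule_format, of "(p, p', c)"] that by simp
    qed
  qed
  show "AE \<omega> in M. \<forall>p\<in>{p\<in>\<rat>. 0 < p}. (\<lambda>n. accepted_upto n (\<lambda>t. A n t \<omega>) (N0 n \<omega>) (\<lambda>j. R n j \<omega>) (\<lambda>k. S n k \<omega>) p / n
      - (LBINT u:{0..p}. free_before n (\<lambda>t. A n t \<omega>) (N0 n \<omega>) (\<lambda>j. R n j \<omega>) (\<lambda>k. S n k \<omega>) u * lam u)) \<longlonglongrightarrow> 0"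
  proof (rule AE_ball_countable'[OF _ cr(2)])
    fix p :: real assume p: "p \<in> {p\<in>\<rat>. 0 < p}"
    show "AE \<omega> in M. (\<lambda>n. accepted_upto n (\<lambda>t. A n t \<omega>) (N0 n \<omega>) (\<lambda>j. R n j \<omega>) (\<lambda>k. S n k \<omega>) p / n
      - (LBINT u:{0..p}. free_before n (\<lambda>t. A n t \<omega>) (N0 n \<omega>) (\<lambda>j. R n j \<omega>) (\<lambda>k. S n k \<omega>) u * lam u)) \<longlonglongrightarrow> 0"
    proof (rule AE_tendsto_zero_of_exp_bounds)
      fix n :: nat and \<theta> :: real assume "1 \<le> n" and \<theta>: "\<bar>\<theta>\<bar> \<le> 1"
      then interpret lq: loss_queue M n lam G "Fn n" "A n" "N0 n" "R n" "S n" using lq by simp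
      show "\<exists>Z\<in>borel_measurable M. (\<integral>\<^sup>+\<omega>. Z \<omega> \<partial>M) \<le> 1 \<and>
        (AE \<omega> in M. ennreal (exp (real n * (\<theta> * (accepted_upto n (\<lambda>t. A n t \<omega>) (N0 n \<omega>) (\<lambda>j. R n j \<omega>) (\<lambda>k. S n k \<omega>) p / n
          - (LBINT u:{0..p}. free_before n (\<lambda>t. A n t \<omega>) (N0 n \<omega>) (\<lambda>j. R n j \<omega>) (\<lambda>k. S n k \<omega>) u * lam u)) - ?Lam p * \<theta>\<^sup>2))) \<le> Z \<omega>)"
        using lq.admissions_exp_bound[OF _ \<theta>, of p] p by (simp add: Lam0 accepted_upto_def)
    qed
  qed
qed

theorem theorem3p3:
  fixes M :: "'a measure"
    and lam f g :: "real \<Rightarrow> real"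
    and F G :: "real measure"
    and Fn :: "nat \<Rightarrow> real measure"
    and A :: "nat \<Rightarrow> real \<Rightarrow> 'a \<Rightarrow> nat"
    and N0 :: "nat \<Rightarrow> 'a \<Rightarrow> nat"
    and R S :: "nat \<Rightarrow> nat \<Rightarrow> 'a \<Rightarrow> real"
    and \<rho>0 T :: real
  assumes "prob_space M"
    and "\<And>t. 0 \<le> t \<Longrightarrow> 0 \<le> lam t" and "locally_integrable lam"
    and "real_distribution G" and "measure G {..<0} = 0"
    and "g \<in> borel_measurable borel" and "\<And>x. 0 \<le> g x" and "G = density lborel (\<lambda>x. ennreal (g x))"
    and "real_distribution F"
    and "f \<in> borel_measurable borel" and "\<And>x. 0 \<le> f x" and "F = density lborel (\<lambda>x. ennreal (f x))"
    and "\<And>n. n \<ge> 1 \<Longrightarrow> real_distribution (Fn n)" and "\<And>n. n \<ge> 1 \<Longrightarrow> measure (Fn n) {..<0} = 0"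
    and "(\<lambda>n. SUP t. \<bar>cdf (Fn n) t - cdf F t\<bar>) \<longlonglongrightarrow> 0"
    and "\<And>n. n \<ge> 1 \<Longrightarrow> loss_queue_data M n lam G (Fn n) (A n) (N0 n) (R n) (S n)"
    and "0 \<le> \<rho>0" and "\<rho>0 \<le> 1"
    and "AE \<omega> in M. (\<lambda>n. real (N0 n \<omega>) / real n) \<longlonglongrightarrow> \<rho>0"
    and "T > 0"
  shows "\<exists>\<rho> :: real \<Rightarrow> real.
    continuous_on {0..T} \<rho> \<and>
    (AE \<omega> in M.
      (\<lambda>n. SUP t\<in>{0..T}. \<bar>scaled_busy n (A n) (N0 n) (R n) (S n) \<omega> t - \<rho> t\<bar>) \<longlonglongrightarrow> 0) \<and>
    (\<exists>w :: real \<Rightarrow> real.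
      w \<in> borel_measurable borel \<and> bounded (range w) \<and>
      (AE \<omega> in M. weak_star_conv_on {t \<in> {0..T}. 0 < lam t}
        (\<lambda>n t. of_bool (left_lim (scaled_busy n (A n) (N0 n) (R n) (S n) \<omega>) t < 1)) w) \<and>
      (AE t in lborel. t \<in> {0..T} \<longrightarrow>
        (\<rho> t < 1 \<longrightarrow> w t * lam t = lam t) \<and>
        (\<rho> t = 1 \<longrightarrow>
          w t * lam t = \<rho>0 * f t + (LBINT u:{0..t}. w u * lam u * g (t - u)))) \<and>
      (AE t in lborel. t \<in> {0..T} \<longrightarrow> of_bool (\<rho> t < 1) \<le> w t \<and> w t \<le> 1) \<and>
      (\<forall>t\<in>{0..T}. \<rho> t = \<rho>0 * (1 - cdf F t)
        + (LBINT u:{0..t}. w u * (1 - cdf G (t - u)) * lam u)) \<and>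
      (AE u in lborel. u \<in> {0..T} \<longrightarrow> of_bool (left_lim \<rho> u < 1) \<le> w u \<and> w u \<le> 1) \<and>
      volterra_solution T (\<lambda>t. \<rho>0 * (1 - cdf F t)) (\<lambda>x. of_bool (x < 1))
        (\<lambda>t. 1 - cdf G t) lam \<rho> w)"
proof -

  \<comment> \<open>Passage to the path-wise setting\<close>
  note lam_nn = assms(2) and lam_loc = assms(3)
  interpret prob_space M by fact
  interpret G: real_distribution G by fact
  interpret F: real_distribution F by fact
  define Lam where "Lam t = (LBINT u:{0..t}. lam u)" for t
  define q where "q t = \<rho>0 * (1 - cdf F t)" for t
  note T = assms(20)
  have lam_int: "set_integrable lborel {0..t} lam" for t
  proof (cases "0 \<le> t")
    case True
    then show ?thesis using lam_loc by (simp add: locally_integrable_def)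
  qed (simp add: set_integrable_def)
  have Fn_lim: "(\<lambda>n. cdf (Fn n) t) \<longlonglongrightarrow> cdf F t" and F0: "measure F {..<0} = 0" for t
    by (rule uniform_limit_no_mass_below_0[OF assms(9,13,14,15)]; simp)+
  have sg: "service_density g" and cG: "cdf G c = (LBINT v:{0..c}. g v)" for c
    by (rule density_on_nonneg[OF assms(4,5,6,7,8)])+
  have sf: "service_density f" and cF: "cdf F c = (LBINT v:{0..c}. f v)" for c
    by (rule density_on_nonneg[OF assms(9) F0 assms(10,11,12)])+
  interpret sg: service_density g by (rule sg)
  interpret sf: service_density f by (rule sf)
  have tail_G: "1 - cdf G c = sg.tail c" for c by (simp add: sg.tail_def cG)
  have tail_F: "1 - cdf F c = sf.tail c" for c by (simp add: sf.tail_def cF)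
  have zero_int: "(LBINT u:{0..t}. h u) = 0" if "t \<le> 0" for h :: "real \<Rightarrow> real" and t
    unfolding set_lebesgue_integral_def
    by (rule integral_eq_zero_AE, rule AE_mp[OF AE_lborel_singleton[of 0]]) (use that in \<open>auto simp: indicator_def\<close>)
  have Lam_mono: "mono Lam"
    unfolding Lam_def mono_def set_lebesgue_integral_def
    using lam_int lam_nn by (intro allI impI integral_mono) (auto simp: set_integrable_def indicator_def)
  interpret rl: reflected_limit g Lam q T
  proof
    show "Lam t = 0" if "t \<le> 0" for t unfolding Lam_def using that by (rule zero_int)
    show "continuous_on {0..} Lam" unfolding Lam_def[abs_def] by (intro continuous_on_atLeast_LBINT_upto lam_int)
    show "continuous_on {0..} q" unfolding q_def[abs_def] tail_F by (intro continuous_intros sf.continuous_on_tail)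
  qed (use Lam_mono T in auto)
  have lq: "loss_queue M n lam G (Fn n) (A n) (N0 n) (R n) (S n)" if "n \<ge> 1" for n
    by unfold_locales (use assms(16)[OF that] that lam_nn lam_loc in auto)
  have Gt: "measure G {c<..} = sg.tail c" for c
  proof -
    have "measure G {c<..} = measure G (space G - {..c})" by (intro arg_cong2[where f=measure]) auto
    also have "\<dots> = 1 - measure G {..c}" by (rule G.prob_compl) simp
    finally show ?thesis by (simp add: tail_G[symmetric] cdf_def)
  qed
  have Fnt: "(\<lambda>n. measure (Fn n) {p<..}) \<longlonglongrightarrow> 1 - cdf F p" for p
  proof (rule Lim_transform_eventually)
    show "(\<lambda>n. 1 - cdf (Fn n) p) \<longlonglongrightarrow> 1 - cdf F p" by (intro tendsto_intros Fn_lim)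
    show "\<forall>\<^sub>F n in sequentially. 1 - cdf (Fn n) p = measure (Fn n) {p<..}"
      using eventually_ge_at_top[of 1]
    proof eventually_elim
      case (elim n)
      interpret Fn: real_distribution "Fn n" by (rule assms(13)[OF elim])
      have "measure (Fn n) {p<..} = measure (Fn n) (space (Fn n) - {..p})" by (intro arg_cong2[where f=measure]) auto
      also have "\<dots> = 1 - measure (Fn n) {..p}" by (rule Fn.prob_compl) simp
      finally show ?case by (simp add: cdf_def)
    qed
  qed
  define good where "good \<omega> \<longleftrightarrow> rl.good_paths (\<lambda>n t. A n t \<omega>) (\<lambda>n. N0 n \<omega>) (\<lambda>n j. R n j \<omega>) (\<lambda>n k. S n k \<omega>)" for \<omega>
  have rl_eq: "(\<lambda>t. LBINT u:{0..t}. lam u) = Lam" by (simp add: fun_eq_iff Lam_def)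
  have rl': "reflected_limit g (\<lambda>t. LBINT u:{0..t}. lam u) q T" unfolding rl_eq by (rule rl.reflected_limit_axioms)
  have AE_good: "AE \<omega> in M. good \<omega>"
    using AE_good_paths(1)[OF lq rl' Gt Fnt q_def assms(19)] unfolding good_def rl_eq by simp
  have AE_acc: "AE \<omega> in M. \<forall>p\<in>{p \<in> \<rat>. 0 < p}.
      (\<lambda>n. accepted_upto n (\<lambda>t. A n t \<omega>) (N0 n \<omega>) (\<lambda>j. R n j \<omega>) (\<lambda>k. S n k \<omega>) p / real n
        - (LBINT u:{0..p}. free_before n (\<lambda>t. A n t \<omega>) (N0 n \<omega>) (\<lambda>j. R n j \<omega>) (\<lambda>k. S n k \<omega>) u * lam u))
      \<longlonglongrightarrow> 0"
    by (rule AE_good_paths(2)[OF lq rl' Gt Fnt q_def assms(19)])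
  \<comment> \<open>A single good sample point provides \<open>L\<close>; the clauses on all good
    families carry it over to almost every other one.\<close>
  obtain \<omega>0 where "good \<omega>0" using eventually_happens'[OF ae_filter_bot AE_good] by blast
  note good0 = this[unfolded good_def]
  obtain L where
    L: "mono L" "\<And>t. t \<le> 0 \<Longrightarrow> L t = 0" "\<And>t. T \<le> t \<Longrightarrow> L t = L T"
    "\<And>u t. 0 \<le> u \<Longrightarrow> u \<le> t \<Longrightarrow> t \<le> T \<Longrightarrow> L t - L u \<le> Lam t - Lam u"
    and rho_cont: "continuous_on {0..T} (rl.rho_of L)" and rho01: "\<And>t. t \<in> {0..T} \<Longrightarrow> 0 \<le> rl.rho_of L t \<and> rl.rho_of L t \<le> 1"
    and flat: "\<And>u t. 0 \<le> u \<Longrightarrow> u \<le> t \<Longrightarrow> t \<le> T \<Longrightarrow> (\<And>v. v \<in> {u..t} \<Longrightarrow> rl.rho_of L v < 1) \<Longrightarrow> L t = L u"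
    and unif: "\<And>a n0 r s e. rl.good_paths a n0 r s \<Longrightarrow> 0 < e \<Longrightarrow> \<forall>\<^sub>F n in sequentially. \<forall>t\<in>{0..T}.
        \<bar>real (busy_servers n (a n) (n0 n) (r n) (s n) t) / n - rl.rho_of L t\<bar> \<le> e"
    and acc: "\<And>a n0 r s p. rl.good_paths a n0 r s \<Longrightarrow> p \<in> \<rat> \<Longrightarrow> p \<in> {0..T} \<Longrightarrow>
        (\<lambda>n. accepted_upto n (a n) (n0 n) (r n) (s n) p / n) \<longlonglongrightarrow> Lam p - L p"
  proof (rule rl.reflected_limit[OF good0], goal_cases)
    case (1 L)
    show ?case by (rule that) (fact 1)+
  qed
  define \<rho> where "\<rho> = rl.rho_of L"
  note rho_cont = rho_cont[folded \<rho>_def] and rho01 = rho01[folded \<rho>_def] and flat = flat[folded \<rho>_def] and unif = unif[folded \<rho>_def]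
  have Lmeas[measurable]: "L \<in> borel_measurable borel" using L(1) by (rule borel_measurable_mono)

  \<comment> \<open>The density of the losses and its support\<close>
  obtain k where k: "k \<in> borel_measurable borel" "\<And>x. 0 \<le> k x" "AE x in lborel. x \<in> {0..T} \<longrightarrow> k x \<le> lam x"
    "set_integrable lborel {0..T} k" "\<And>t. t \<in> {0..T} \<Longrightarrow> L t = (LBINT x:{0..t}. k x)"
    using dominated_increments_density[OF T lam_int lam_nn L(1,2,3)] L(4) unfolding Lam_def by blast
  have k0: "AE t in lborel. t \<in> {0..T} \<longrightarrow> \<rho> t < 1 \<longrightarrow> k t = 0"
  proof -
    \<comment> \<open>Apart from the points 0 and \<open>T\<close>, the set where
      \<open>\<rho>\<close> is below 1 is covered by countably many closed intervals with rational
      ends inside it. On each of them \<open>L\<close> is constant, so its nonnegative density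
      vanishes almost everywhere.\<close>
    define I where "I = {(a, b). a \<in> \<rat> \<and> b \<in> \<rat> \<and> 0 \<le> a \<and> a \<le> b \<and> b \<le> T \<and> (\<forall>v\<in>{a..b}. \<rho> v < 1)}"
    have "countable (\<rat> \<times> (\<rat> :: real set))" by (intro countable_SIGMA countable_rat)
    then have cI: "countable I" by (rule countable_subset[rotated]) (auto simp: I_def)
    have "AE t in lborel. case z of (a, b) \<Rightarrow> t \<in> {a..b} \<longrightarrow> k t = 0" if z: "z \<in> I" for z
    proof -
      obtain a b where ab: "z = (a, b)" "0 \<le> a" "a \<le> b" "b \<le> T" "\<And>v. v \<in> {a..b} \<Longrightarrow> \<rho> v < 1" using z by (auto simp: I_def)
      have ik: "set_integrable lborel {a..b} k" by (rule set_integrable_subset[OF k(4)]) (use ab in auto)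
      have ik0: "set_integrable lborel {0..a} k" by (rule set_integrable_subset[OF k(4)]) (use ab in auto)
      have "L b = (LBINT x:{0..a} \<union> {a..b}. k x)" using k(5)[of b] ab by (simp add: ivl_disj_un_two_touch)
      also have "\<dots> = L a + (LBINT x:{a..b}. k x)"
      proof -
        have "AE u in lborel. \<not> (u \<in> {0..a} \<and> u \<in> {a..b})" using AE_lborel_singleton[of a] by eventually_elim auto
        from set_integral_Un_AE[OF this _ _ ik0 ik] show ?thesis using k(5)[of a] ab by simp
      qed
      finally have "(LBINT x:{a..b}. k x) = 0" using flat[OF ab(2,3,4,5)] by simp
      then have "AE x in lborel. indicator {a..b} x *\<^sub>R k x = 0"
        unfolding set_lebesgue_integral_def using ik k(2)
        by (subst (asm) integral_nonneg_eq_0_iff_AE) (auto simp: set_integrable_def)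
      then show ?thesis unfolding ab(1) by eventually_elim (auto simp: indicator_def split: if_splits)
    qed
    then have "AE t in lborel. \<forall>z\<in>I. case z of (a, b) \<Rightarrow> t \<in> {a..b} \<longrightarrow> k t = 0"
      by (intro AE_ball_countable' cI)
    with AE_lborel_singleton[of 0] AE_lborel_singleton[of T] show ?thesis
    proof eventually_elim
      case (elim t)
      show ?case
      proof (intro impI)
        assume t: "t \<in> {0..T}" and lt: "\<rho> t < 1"
        have "continuous (at t within {0..T}) \<rho>" using rho_cont t by (auto simp: continuous_on_eq_continuous_within)
        then obtain \<delta> where \<delta>: "0 < \<delta>" "\<And>v. v \<in> {0..T} \<Longrightarrow> dist v t < \<delta> \<Longrightarrow> dist (\<rho> v) (\<rho> t) < 1 - \<rho> t"
          using lt unfolding continuous_within_eps_delta by (meson diff_gt_0_iff_gt)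
        have "max 0 (t - \<delta>) < t" "t < min T (t + \<delta>)" using t elim(1,2) \<delta>(1) by auto
        then obtain a b where ab: "a \<in> \<rat>" "max 0 (t - \<delta>) < a" "a < t" "b \<in> \<rat>" "t < b" "b < min T (t + \<delta>)"
          using Rats_dense_in_real[of "max 0 (t - \<delta>)" t] Rats_dense_in_real[of t "min T (t + \<delta>)"] by blast
        have "\<rho> v < 1" if "v \<in> {a..b}" for v
        proof -
          have "v \<in> {0..T}" "dist v t < \<delta>" using that ab by (auto simp: dist_real_def)
          from \<delta>(2)[OF this] show ?thesis by (simp add: dist_real_def)
        qed
        then have "(a, b) \<in> I" using ab by (auto simp: I_def)
        from elim(3)[rule_format, OF this] show "k t = 0" using ab by simp
      qed
    qed
  qed

  \<comment> \<open>The acceptance weight\<close>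
  define l where "l x = indicator {0..T} x * lam x" for x
  have [measurable]: "l \<in> borel_measurable borel"
    using lam_int[of T] by (auto simp: l_def[abs_def] set_integrable_def dest: borel_measurable_integrable)
  define Ks where "Ks = {t \<in> {0..T}. \<rho> t = 1}"
  have "closed Ks" unfolding Ks_def by (rule continuous_closed_preimage_constant[OF rho_cont]) simp
  then have [measurable]: "Ks \<in> sets borel" by (rule borel_closed)
  \<comment> \<open>At full occupancy the accepted fraction is \<open>1 - k / lam\<close>; elsewhere
    it is 1, so that the constraints on \<open>w\<close> hold at every point. The minimum covers the
    null set where \<open>k\<close> may exceed \<open>lam\<close>, and \<open>0 < l t\<close> avoids
    division by zero.\<close>
  define w where "w t = (if t \<in> Ks \<and> 0 < l t then 1 - min 1 (k t / l t) else 1)" for t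
  note [measurable] = k(1)
  have w_meas[measurable]: "w \<in> borel_measurable borel" unfolding w_def[abs_def] by measurable
  have l_nn: "0 \<le> l t" for t using lam_nn by (auto simp: l_def indicator_def)
  have w01: "0 \<le> w t" "w t \<le> 1" for t using k(2)[of t] l_nn[of t] by (auto simp: w_def)
  have wl: "AE t in lborel. t \<in> {0..T} \<longrightarrow> w t * lam t = lam t - k t"
    using k(3) k0
  proof eventually_elim
    case (elim t)
    show ?case
    proof
      assume t: "t \<in> {0..T}"
      have lt: "l t = lam t" using t by (simp add: l_def)
      have kl: "k t \<le> lam t" using elim(1) t by blast
      consider "\<rho> t < 1" | "\<rho> t = 1" "lam t = 0" | "\<rho> t = 1" "0 < lam t" using rho01[OF t] lam_nn[of t] t by fastforce
      then show "w t * lam t = lam t - k t"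
      proof cases
        case 1
        then show ?thesis using elim(2) t by (simp add: w_def Ks_def)
      next
        case 2
        then show ?thesis using kl k(2)[of t] by simp
      next
        case 3
        then have "k t / lam t \<le> 1" using kl by simp
        then show ?thesis using 3 t lt by (simp add: w_def Ks_def min_def field_simps)
      qed
    qed
  qed
  define ell where "ell t = w t * lam t" for t
  have sub: "set_integrable lborel {0..t} h" if "set_integrable lborel {0..T} h" "t \<le> T" for h :: "real \<Rightarrow> real" and t
    by (rule set_integrable_subset[OF that(1)]) (use that in auto)
  have l_int: "set_integrable lborel {0..T} ell"
  proof (rule set_integrable_bound[OF lam_int[of T]])
    have "(\<lambda>t. w t * l t) \<in> borel_measurable borel" by measurable
    also have "(\<lambda>t. w t * l t) = (\<lambda>t. indicator {0..T} t *\<^sub>R ell t)" by (auto simp: l_def ell_def fun_eq_iff)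
    finally show "set_borel_measurable lborel {0..T} ell" by (simp add: set_borel_measurable_def)
  qed (use w01 in \<open>auto simp: ell_def abs_mult intro!: AE_I2 mult_left_le_one_le\<close>)
  have J: "(LBINT u:{0..t}. ell u) = Lam t - L t" if t: "t \<in> {0..T}" for t
  proof -
    have kt: "set_integrable lborel {0..t} k" and lt: "set_integrable lborel {0..t} ell"
      using sub[OF k(4)] sub[OF l_int] t by auto
    have "(LBINT u:{0..t}. ell u) = (LBINT u:{0..t}. lam u - k u)"
      unfolding set_lebesgue_integral_def
    proof (rule integral_cong_AE)
      show "AE u in lborel. indicator {0..t} u *\<^sub>R ell u = indicator {0..t} u *\<^sub>R (lam u - k u)"
        using wl by eventually_elim (use t in \<open>auto simp: ell_def indicator_def\<close>)
      show "(\<lambda>u. indicator {0..t} u *\<^sub>R ell u) \<in> borel_measurable lborel"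
        using lt by (auto simp: set_integrable_def dest: borel_measurable_integrable)
      have "set_integrable lborel {0..t} (\<lambda>u. lam u - k u)" by (rule set_integral_diff(1)[OF lam_int kt])
      then show "(\<lambda>u. indicator {0..t} u *\<^sub>R (lam u - k u)) \<in> borel_measurable lborel"
        by (auto simp: set_integrable_def dest: borel_measurable_integrable)
    qed
    also have "\<dots> = Lam t - L t" using set_integral_diff(2)[OF lam_int kt] k(5)[OF t] by (simp add: Lam_def)
    finally show ?thesis .
  qed
  \<comment> \<open>The equation is rewritten from losses to acceptances: the latter have the
    primitive \<open>Lam t - L t\<close>, and convolution is linear.\<close>
  have rho_eq: "\<rho> t = q t + ((LBINT u:{0..t}. ell u) - conv_upto g (\<lambda>s. LBINT u:{0..s}. ell u) t)" if t: "t \<in> {0..T}" for t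
  proof -
    have "conv_upto g (\<lambda>s. LBINT u:{0..s}. ell u) t = conv_upto g (\<lambda>s. Lam s - L s) t"
      unfolding conv_upto_def by (rule set_lebesgue_integral_cong) (use t J in auto)
    also have "\<dots> = conv_upto g Lam t - conv_upto g L t"
      by (rule sg.conv_diff) (auto intro!: rl.mono_abs_le[OF Lam_mono] rl.mono_abs_le[OF L(1)] borel_measurable_mono Lam_mono L(1))
    finally show ?thesis using J[OF t] by (simp add: \<rho>_def rl.rho_of_def rl.drift_def)
  qed
  have volterra: "\<rho> t = \<rho>0 * (1 - cdf F t) + (LBINT u:{0..t}. w u * (1 - cdf G (t - u)) * lam u)" if t: "t \<in> {0..T}" for t
    using rho_eq[OF t] sg.convolution_Fubini(1)[OF l_int t]
    by (simp add: tail_G ell_def q_def mult_ac)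

  \<comment> \<open>The equation at full occupancy\<close>
  define c where "c s = (LBINT u:{0..s}. ell u * g (s - u))" for s
  have c_int: "set_integrable lborel {0..T} c"
    unfolding c_def[abs_def] by (rule sg.convolution_Fubini(2)[OF l_int, of T]) (use T in simp)
  \<comment> \<open>The density of \<open>\<rho>\<close>: the rate of acceptances, minus departures
    of accepted customers, minus departures of initial ones. Its vanishing where
    \<open>\<rho>\<close> equals 1 is the required equation.\<close>
  define h where "h t = (ell t - c t) - \<rho>0 * f t" for t
  have f_int: "set_integrable lborel {0..T} (\<lambda>t. \<rho>0 * f t)"
    by (intro set_integrable_mult_right sf.g_integrable_upto)
  have lc_int: "set_integrable lborel {0..T} (\<lambda>t. ell t - c t)" by (rule set_integral_diff(1)[OF l_int c_int])
  have h_int: "set_integrable lborel {0..T} h"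
    unfolding h_def[abs_def] by (rule set_integral_diff(1)[OF lc_int f_int])
  have rho_h: "\<rho> t = \<rho>0 + (LBINT u:{0..t}. h u)" if t: "t \<in> {0..T}" for t
  proof -
    have tT: "t \<le> T" using t by simp
    have "(LBINT u:{0..t}. h u) = ((LBINT u:{0..t}. ell u) - (LBINT u:{0..t}. c u)) - (LBINT u:{0..t}. \<rho>0 * f u)"
      unfolding h_def
      by (subst set_integral_diff(2)[OF sub[OF lc_int tT] sub[OF f_int tT]], subst set_integral_diff(2)[OF sub[OF l_int tT] sub[OF c_int tT]]) simp
    moreover have "conv_upto g (\<lambda>s. LBINT u:{0..s}. ell u) t = (LBINT u:{0..t}. c u)"
      unfolding c_def by (rule sg.convolution_Fubini(3)[OF l_int t])
    ultimately show ?thesis using rho_eq[OF t] by (simp add: q_def cF algebra_simps)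
  qed
  have level: "AE t in lborel. t \<in> {0..T} \<longrightarrow> \<rho> t = 1 \<longrightarrow> h t = 0"
    by (rule derivative_zero_on_level_set[OF h_int rho_h rho01])
  have w_rho: "of_bool (\<rho> t < 1) \<le> w t \<and> w t \<le> 1" for t
    using w01[of t] by (auto simp: w_def Ks_def)
  \<comment> \<open>Time 0 is excluded, since a left limit there would involve values at negative
    times.\<close>
  have left: "left_lim \<rho> u = \<rho> u" if u: "u \<in> {0<..T}" for u
    unfolding left_lim_def
  proof (rule tendsto_Lim)
    have "(\<rho> \<longlongrightarrow> \<rho> u) (at u within {0..T})" using rho_cont u by (auto simp: continuous_on_def)
    then have "(\<rho> \<longlongrightarrow> \<rho> u) (at u within {0<..<u})" by (rule tendsto_within_subset) (use u in auto)
    moreover have "at_left u = at u within {0<..<u}" by (rule at_within_nhd[of _ "{0<..}"]) (use u in auto)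
    ultimately show "(\<rho> \<longlongrightarrow> \<rho> u) (at_left u)" by simp
  qed simp

  \<comment> \<open>Verification of the claims\<close>
  have sb: "scaled_busy n (A n) (N0 n) (R n) (S n) \<omega> = (\<lambda>t. real (busy_servers n (\<lambda>u. A n u \<omega>) (N0 n \<omega>) (\<lambda>j. R n j \<omega>) (\<lambda>k. S n k \<omega>) t) / real n)" for n \<omega>
    by (simp add: scaled_busy_def fun_eq_iff)
  show ?thesis
  proof (rule exI[of _ \<rho>], intro conjI exI[of _ w])
    show "continuous_on {0..T} \<rho>" by (rule rho_cont)
    show "AE \<omega> in M. (\<lambda>n. SUP t\<in>{0..T}. \<bar>scaled_busy n (A n) (N0 n) (R n) (S n) \<omega> t - \<rho> t\<bar>) \<longlonglongrightarrow> 0"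
      using AE_good
    proof eventually_elim
      case (elim \<omega>)
      show ?case
      proof (rule LIMSEQ_I)
        fix e :: real assume e: "0 < e"
        then have "0 < e / 2" by simp
        from unif[OF elim[unfolded good_def] this] obtain no where
          no: "\<And>n t. n \<ge> no \<Longrightarrow> t \<in> {0..T} \<Longrightarrow> \<bar>scaled_busy n (A n) (N0 n) (R n) (S n) \<omega> t - \<rho> t\<bar> \<le> e / 2"
          unfolding eventually_sequentially sb by blast
        show "\<exists>no. \<forall>n\<ge>no. norm ((SUP t\<in>{0..T}. \<bar>scaled_busy n (A n) (N0 n) (R n) (S n) \<omega> t - \<rho> t\<bar>) - 0) < e"
        proof (intro exI[of _ no] allI impI)
          fix n assume n: "no \<le> n"
          let ?f = "\<lambda>t. \<bar>scaled_busy n (A n) (N0 n) (R n) (S n) \<omega> t - \<rho> t\<bar>"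
          have "(SUP t\<in>{0..T}. ?f t) \<le> e / 2" by (rule cSUP_least) (use no[OF n] T in auto)
          moreover have "bdd_above (?f ` {0..T})" by (rule bdd_aboveI2[of _ _ "e / 2"]) (use no[OF n] in auto)
          then have "?f 0 \<le> (SUP t\<in>{0..T}. ?f t)" by (rule cSUP_upper[rotated]) (use T in simp)
          then have "0 \<le> (SUP t\<in>{0..T}. ?f t)" by (rule order_trans[rotated]) simp
          ultimately show "norm ((SUP t\<in>{0..T}. ?f t) - 0) < e" using e by simp
        qed
      qed
    qed
    show "w \<in> borel_measurable borel" by (rule w_meas)
    show "bounded (range w)" unfolding bounded_iff using w01 by (intro exI[of _ 1]) auto
    show "AE \<omega> in M. weak_star_conv_on {t \<in> {0..T}. 0 < lam t}
        (\<lambda>n t. of_bool (left_lim (scaled_busy n (A n) (N0 n) (R n) (S n) \<omega>) t < 1)) w"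
      using AE_good AE_acc
    proof eventually_elim
      case (elim \<omega>)
      let ?h = "\<lambda>n. free_before n (\<lambda>t. A n t \<omega>) (N0 n \<omega>) (\<lambda>j. R n j \<omega>) (\<lambda>k. S n k \<omega>)"
      have "weak_star_conv_on {t \<in> {0..T}. 0 < lam t} ?h w"
      proof (rule weak_star_density[OF T lam_int lam_nn])
        fix n :: nat assume n: "1 \<le> n"
        have "counting_path (\<lambda>t. A n t \<omega>)" using elim(1) n unfolding good_def rl.good_paths_def by blast
        then show "set_borel_measurable borel {0..T} (?h n)" by (rule free_before_measurable[OF _ n T])
        show "\<bar>?h n x\<bar> \<le> 1" for x by (simp add: free_before_def)
      next
        show "\<bar>w x\<bar> \<le> 1" for x using w01[of x] by simp
        fix p :: real assume p: "p \<in> \<rat>" "p \<in> {0..T}"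
        show "(\<lambda>n. LBINT u:{0..p}. ?h n u * lam u) \<longlonglongrightarrow> (LBINT u:{0..p}. w u * lam u)"
        proof (cases "p = 0")
          case True
          then have "p \<le> 0" by simp
          then show ?thesis by (simp only: zero_int tendsto_const)
        next
          case False
          then have p0: "p \<in> {p \<in> \<rat>. 0 < p}" using p by auto
          \<comment> \<open>The scaled accepted arrivals tend to \<open>Lam p - L p\<close>, and
            their distance from the integrated acceptance indicator tends to 0.\<close>
          from tendsto_diff[OF acc[OF elim(1)[unfolded good_def] p] elim(2)[rule_format, OF p0]]
          show ?thesis using J[OF p(2)] by (simp add: ell_def)
        qed
      qed (simp_all add: w_meas)
      then show ?case unfolding free_before_def[abs_def] sb .
    qed
    show "AE t in lborel. t \<in> {0..T} \<longrightarrow>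
        (\<rho> t < 1 \<longrightarrow> w t * lam t = lam t) \<and>
        (\<rho> t = 1 \<longrightarrow> w t * lam t = \<rho>0 * f t + (LBINT u:{0..t}. w u * lam u * g (t - u)))"
      using level
    proof eventually_elim
      case (elim t)
      show ?case
      proof (intro impI conjI)
        assume "\<rho> t < 1"
        then show "w t * lam t = lam t" by (simp add: w_def Ks_def)
      next
        assume "t \<in> {0..T}" "\<rho> t = 1"
        then have "h t = 0" using elim by blast
        then show "w t * lam t = \<rho>0 * f t + (LBINT u:{0..t}. w u * lam u * g (t - u))"
          by (simp add: h_def c_def ell_def)
      qed
    qed
    show "AE t in lborel. t \<in> {0..T} \<longrightarrow> of_bool (\<rho> t < 1) \<le> w t \<and> w t \<le> 1"
      using w_rho by (intro AE_I2) blast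
    show "\<forall>t\<in>{0..T}. \<rho> t = \<rho>0 * (1 - cdf F t) + (LBINT u:{0..t}. w u * (1 - cdf G (t - u)) * lam u)"
      using volterra by blast
    show "AE u in lborel. u \<in> {0..T} \<longrightarrow> of_bool (left_lim \<rho> u < 1) \<le> w u \<and> w u \<le> 1"
      using AE_lborel_singleton[of 0]
    proof eventually_elim
      case (elim u)
      then show ?case using left[of u] w_rho[of u] by auto
    qed
    show "volterra_solution T (\<lambda>t. \<rho>0 * (1 - cdf F t)) (\<lambda>x. of_bool (x < 1)) (\<lambda>t. 1 - cdf G t) lam \<rho> w"
      unfolding volterra_solution_def
    proof (intro conjI)
      show "bounded (\<rho> ` {0..T})" by (intro compact_imp_bounded compact_continuous_image rho_cont) simp
      show "bounded (w ` {0..T})" unfolding bounded_iff using w01 by (intro exI[of _ 1]) auto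
      show "set_borel_measurable lborel {0..T} w" unfolding set_borel_measurable_def by measurable
      show "AE t in lborel. t \<in> {0..T} \<longrightarrow>
          lower_env (\<lambda>x. of_bool (x < 1)) (\<rho> t) \<le> ereal (w t) \<and> ereal (w t) \<le> upper_env (\<lambda>x. of_bool (x < 1)) (\<rho> t)"
      proof (intro AE_I2 impI)
        fix t assume "t \<in> {0..T}"
        then have "\<rho> t \<le> 1" using rho01 by blast
        then show "lower_env (\<lambda>x. of_bool (x < 1)) (\<rho> t) \<le> ereal (w t) \<and> ereal (w t) \<le> upper_env (\<lambda>x. of_bool (x < 1)) (\<rho> t)"
          using w_rho[of t] w01[of t] by (cases "\<rho> t < 1") (auto simp: upper_env_threshold lower_env_threshold)
      qed
      show "\<forall>t\<in>{0..T}. \<rho> t = \<rho>0 * (1 - cdf F t) + (LBINT u:{0..t}. w u * (1 - cdf G (t - u)) * lam u)"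
        using volterra by blast
    qed
  qed
qed

end
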